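(* Let $\Lambda$ be a stationary point process in $\mathbb C$ having a finite second moment, with spectral measure $\rho_\Lambda$ satisfying $\int_{\{0<|\xi|\le1\}}|\xi|^{-2}{\rm d}\rho_\Lambda(\xi)<\infty$. Let $V_\Lambda(z)=\zeta_\Lambda(z)-\Psi_1(\infty)-\pi\mathfrak c_\Lambda\bar z$. Then the spectral measure of $V_\Lambda$ is ${\rm d}\rho_{V_\Lambda}(\xi)=\mathbf 1_{\mathbb C\setminus\{0\}}(\xi)\,|\xi|^{-2}\,{\rm d}\rho_\Lambda(\xi)$.
   Context: A point process $\Lambda$ in $\mathbb C$ is stationary if its distribution is translation invariant; finite second moment means $\mathbb E[n_\Lambda(B)^2]<\infty$ for bounded Borel $B$, $n_\Lambda=\sum_{\lambda\in\Lambda}\delta_\lambda$. The spectral measure of a stationary (generalized) random process $X$ with $X(\varphi)\in L^2$ is the non-negative locally finite measure $\rho_X$ with ${\sf Cov}[X(\varphi),X(\psi)]=\int\widehat\varphi\,\overline{\widehat\psi}\,{\rm d}\rho_X$ for compactly supported smooth $\varphi,\psi$ (here $X(\varphi)=\int X\varphi\,{\rm d}m$), with $\widehat\varphi(\xi)=\int e^{-2\pi{\rm i}\,\xi\cdot x}\varphi(x){\rm d}m(x)$; $\rho_\Lambda$ corresponds to $X(\varphi)=\sum_\lambda\varphi(\lambda)$. $\mathfrak c_\Lambda=\pi^{-1}\mathbb E[n_\Lambda(\mathbb D)\mid\mathcal F_{\sf inv}]$, $\mathcal F_{\sf inv}$ the translation-invariant events. $\zeta_\Lambda(z)=\sum_{|\lambda|<1}\frac1{z-\lambda}+\sum_{|\lambda|\ge1}\big(\frac1{z-\lambda}+\frac1\lambda+\frac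 z{\lambda^2}\big)-\Psi_2(\infty)z$, where $\Psi_\ell(\infty)$ denotes the $L^2$-limit as $R\to\infty$ of $\sum_{\lambda\in\Lambda,1\le|\lambda|\le R}\lambda^{-\ell}$, $\ell=1,2$ (both exist under the hypotheses). Under these hypotheses $V_\Lambda$ is stationary. *)

theory Defs
  imports "HOL-Analysis.Analysis" "HOL-Probability.Probability"
begin

definition pdir :: "bool \<Rightarrow> (complex \<Rightarrow> complex) \<Rightarrow> complex \<Rightarrow> complex" where
  "pdir d g z = vector_derivative (\<lambda>t::real. g (z + of_real t * (if d then \<i> else 1))) (at 0)"

fun pderivs :: "bool list \<Rightarrow> (complex \<Rightarrow> complex) \<Rightarrow> complex \<Rightarrow> complex" where
  "pderivs [] f = f"
| "pderivs (d # ds) f = pdir d (pderivs ds f)"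

definition smooth_fun :: "(complex \<Rightarrow> complex) \<Rightarrow> bool" where
  "smooth_fun f \<longleftrightarrow>
     (\<forall>ds. continuous_on UNIV (pderivs ds f) \<and>
       (\<forall>z d. (\<lambda>t::real. pderivs ds f (z + of_real t * (if d then \<i> else 1))) differentiable (at 0)))"

definition test_fun :: "(complex \<Rightarrow> complex) \<Rightarrow> bool" where
  "test_fun f \<longleftrightarrow> smooth_fun f \<and> bounded {z. f z \<noteq> 0}"

definition fourier :: "(complex \<Rightarrow> complex) \<Rightarrow> complex \<Rightarrow> complex" where
  "fourier f \<xi> = (\<integral>x. exp (- 2 * of_real pi * \<i> * of_real (\<xi> \<bullet> x)) * f x \<partial>lborel)"

definition sq_integrable :: "'w measure \<Rightarrow> ('w \<Rightarrow> complex) \<Rightarrow> bool" where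
  "sq_integrable M Y \<longleftrightarrow> Y \<in> borel_measurable M \<and> integrable M (\<lambda>\<omega>. (cmod (Y \<omega>))\<^sup>2)"

definition covar :: "'w measure \<Rightarrow> ('w \<Rightarrow> complex) \<Rightarrow> ('w \<Rightarrow> complex) \<Rightarrow> complex" where
  "covar M Y Z = (\<integral>\<omega>. (Y \<omega> - (\<integral>\<omega>'. Y \<omega>' \<partial>M)) * cnj (Z \<omega> - (\<integral>\<omega>'. Z \<omega>' \<partial>M)) \<partial>M)"

text \<open>\<open>X \<phi> \<omega>\<close> is the value of the generalized random process on the test function \<open>\<phi>\<close>.\<close>
definition spectral_measure ::
    "'w measure \<Rightarrow> ((complex \<Rightarrow> complex) \<Rightarrow> 'w \<Rightarrow> complex) \<Rightarrow> complex measure \<Rightarrow> bool" where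
  "spectral_measure M X \<rho> \<longleftrightarrow>
     sets \<rho> = sets borel \<and>
     (\<forall>K. compact K \<longrightarrow> emeasure \<rho> K < \<infinity>) \<and>
     (\<forall>\<phi> \<psi>. test_fun \<phi> \<longrightarrow> test_fun \<psi> \<longrightarrow>
        sq_integrable M (X \<phi>) \<and> sq_integrable M (X \<psi>) \<and>
        integrable \<rho> (\<lambda>\<xi>. fourier \<phi> \<xi> * cnj (fourier \<psi> \<xi>)) \<and>
        covar M (X \<phi>) (X \<psi>) = (\<integral>\<xi>. fourier \<phi> \<xi> * cnj (fourier \<psi> \<xi>) \<partial>\<rho>))"

text \<open>A configuration is a multiplicity function \<open>\<mu> :: complex \<Rightarrow> nat\<close> with locally finite support.\<close>
definition supp :: "(complex \<Rightarrow> nat) \<Rightarrow> complex set" where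
  "supp \<mu> = {z. \<mu> z \<noteq> 0}"

definition cnt :: "(complex \<Rightarrow> nat) \<Rightarrow> complex set \<Rightarrow> nat" where
  "cnt \<mu> B = (\<Sum>z\<in>supp \<mu> \<inter> B. \<mu> z)"

definition configs :: "(complex \<Rightarrow> nat) set" where
  "configs = {\<mu>. \<forall>B. bounded B \<longrightarrow> finite (supp \<mu> \<inter> B)}"

definition Conf :: "(complex \<Rightarrow> nat) measure" where
  "Conf = sigma configs
     {{\<mu> \<in> configs. cnt \<mu> B = k} | B k. B \<in> sets borel \<and> bounded B}"

definition shift :: "complex \<Rightarrow> (complex \<Rightarrow> nat) \<Rightarrow> (complex \<Rightarrow> nat)" where
  "shift w \<mu> = (\<lambda>z. \<mu> (z - w))"

definition point_process :: "'w measure \<Rightarrow> ('w \<Rightarrow> complex \<Rightarrow> nat) \<Rightarrow> bool" where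
  "point_process M \<Lambda> \<longleftrightarrow> prob_space M \<and> \<Lambda> \<in> measurable M Conf"

definition stationary_pp :: "'w measure \<Rightarrow> ('w \<Rightarrow> complex \<Rightarrow> nat) \<Rightarrow> bool" where
  "stationary_pp M \<Lambda> \<longleftrightarrow>
     (\<forall>w. distr M Conf (\<lambda>\<omega>. shift w (\<Lambda> \<omega>)) = distr M Conf \<Lambda>)"

definition finite_second_moment :: "'w measure \<Rightarrow> ('w \<Rightarrow> complex \<Rightarrow> nat) \<Rightarrow> bool" where
  "finite_second_moment M \<Lambda> \<longleftrightarrow>
     (\<forall>B. B \<in> sets borel \<longrightarrow> bounded B \<longrightarrow>
        integrable M (\<lambda>\<omega>. (real (cnt (\<Lambda> \<omega>) B))\<^sup>2))"

definition lin_stat :: "('w \<Rightarrow> complex \<Rightarrow> nat) \<Rightarrow> (complex \<Rightarrow> complex) \<Rightarrow> 'w \<Rightarrow> complex" where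
  "lin_stat \<Lambda> \<phi> \<omega> = (\<Sum>z\<in>supp (\<Lambda> \<omega>) \<inter> {z. \<phi> z \<noteq> 0}. of_nat (\<Lambda> \<omega> z) * \<phi> z)"

definition F_inv :: "'w measure \<Rightarrow> ('w \<Rightarrow> complex \<Rightarrow> nat) \<Rightarrow> 'w measure" where
  "F_inv M \<Lambda> = sigma (space M)
     {\<Lambda> -` A \<inter> space M | A. A \<in> sets Conf \<and>
        (\<forall>w. \<forall>\<mu>\<in>configs. shift w \<mu> \<in> A \<longleftrightarrow> \<mu> \<in> A)}"

definition cLam :: "'w measure \<Rightarrow> ('w \<Rightarrow> complex \<Rightarrow> nat) \<Rightarrow> 'w \<Rightarrow> real" where
  "cLam M \<Lambda> = (\<lambda>\<omega>. real_cond_exp M (F_inv M \<Lambda>) (\<lambda>\<omega>'. real (cnt (\<Lambda> \<omega>') (ball 0 1))) \<omega> / pi)"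

definition L2_limit :: "'w measure \<Rightarrow> (real \<Rightarrow> 'w \<Rightarrow> complex) \<Rightarrow> ('w \<Rightarrow> complex) \<Rightarrow> bool" where
  "L2_limit M S Y \<longleftrightarrow> Y \<in> borel_measurable M \<and>
     (\<forall>R. integrable M (\<lambda>\<omega>. (cmod (S R \<omega> - Y \<omega>))\<^sup>2)) \<and>
     ((\<lambda>R. \<integral>\<omega>. (cmod (S R \<omega> - Y \<omega>))\<^sup>2 \<partial>M) \<longlongrightarrow> 0) at_top"

definition Psi_partial :: "nat \<Rightarrow> ('w \<Rightarrow> complex \<Rightarrow> nat) \<Rightarrow> real \<Rightarrow> 'w \<Rightarrow> complex" where
  "Psi_partial l \<Lambda> R \<omega> =
     (\<Sum>z\<in>supp (\<Lambda> \<omega>) \<inter> {z. 1 \<le> cmod z \<and> cmod z \<le> R}. of_nat (\<Lambda> \<omega> z) / z ^ l)"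

definition Psi_inf :: "'w measure \<Rightarrow> nat \<Rightarrow> ('w \<Rightarrow> complex \<Rightarrow> nat) \<Rightarrow> 'w \<Rightarrow> complex" where
  "Psi_inf M l \<Lambda> = (SOME Y. L2_limit M (Psi_partial l \<Lambda>) Y)"

definition zeta :: "'w measure \<Rightarrow> ('w \<Rightarrow> complex \<Rightarrow> nat) \<Rightarrow> 'w \<Rightarrow> complex \<Rightarrow> complex" where
  "zeta M \<Lambda> \<omega> z =
     (\<Sum>a\<in>supp (\<Lambda> \<omega>) \<inter> ball 0 1. of_nat (\<Lambda> \<omega> a) / (z - a))
     + (\<Sum>\<^sub>\<infinity>a\<in>supp (\<Lambda> \<omega>) - ball 0 1.
          of_nat (\<Lambda> \<omega> a) * (1 / (z - a) + 1 / a + z / a\<^sup>2))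
     - Psi_inf M 2 \<Lambda> \<omega> * z"

definition V_Lam :: "'w measure \<Rightarrow> ('w \<Rightarrow> complex \<Rightarrow> nat) \<Rightarrow> 'w \<Rightarrow> complex \<Rightarrow> complex" where
  "V_Lam M \<Lambda> \<omega> z = zeta M \<Lambda> \<omega> z - Psi_inf M 1 \<Lambda> \<omega> - of_real (pi * cLam M \<Lambda> \<omega>) * cnj z"

definition gen_proc :: "('w \<Rightarrow> complex \<Rightarrow> complex) \<Rightarrow> (complex \<Rightarrow> complex) \<Rightarrow> 'w \<Rightarrow> complex" where
  "gen_proc F \<phi> \<omega> = (\<integral>z. F \<omega> z * \<phi> z \<partial>lborel)"

end

theory Submission
  imports Defs
begin

text \<open>The Fourier transform of the Cauchy kernel \<open>1 / a\<close> is \<open>- \<i> / \<xi>\<close>, whence the weight \<open>|\<xi>|\<^sup>-\<^sup>2\<close>. To make this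
  rigorous, replace \<open>1 / a\<close> by \<open>k\<^sub>R(a) = 1 / a - cnj a / R\<^sup>2\<close> on \<open>|a| \<le> R\<close>, which has compact support and mean zero, and
  satisfies \<open>F[k\<^sub>R](\<xi>) = - \<i> / \<xi> \<cdot> (1 - J\<^sub>1(2 \<pi> R |\<xi>|) / (\<pi> R |\<xi>|))\<close> for \<open>\<xi> \<noteq> 0\<close>. Stationarity and the finite second moment give
  \<open>\<rho>(|\<xi>| \<le> r) = O(r\<^sup>2)\<close>, so together with the integrability of \<open>|\<xi>|\<^sup>-\<^sup>2\<close> near the origin the Bessel term is negligible in
  \<open>L\<^sup>2(\<rho>)\<close>: the linear statistics of \<open>\<phi> * k\<^sub>R\<close> converge in \<open>L\<^sup>2\<close>, and their covariances converge to
  \<open>\<integral> |\<xi>|\<^sup>-\<^sup>2 F[\<phi>] cnj F[\<psi>] d\<rho>\<close> over \<open>\<xi> \<noteq> 0\<close>; the same estimates give the existence of \<open>\<Psi>\<^sub>1(\<infinity>)\<close> and \<open>\<Psi>\<^sub>2(\<infinity>)\<close>.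
  The limit is \<open>- V(\<phi>)\<close>, because the Taylor polynomial of the Cauchy transform of \<open>\<phi>\<close> at infinity produces \<open>\<Psi>\<^sub>1\<close> and \<open>\<Psi>\<^sub>2\<close>, the
  term \<open>cnj a / R\<^sup>2\<close> produces \<open>n(|a| \<le> R) / R\<^sup>2\<close>, which converges in mean to \<open>\<pi> c\<close>, and the remaining
  errors vanish in \<open>L\<^sup>1\<close>.\<close>

text \<open>The spectral identity concerns compactly supported smooth functions, whereas the
  ingredients of \<open>V_Lam\<close> have sharp cutoffs and infinite range. Two kinds of control
  bridge the gap. Mean square control comes from \<rho>, once the covariance identity is extended to
  bounded, almost everywhere continuous functions of bounded support. Control in mean comes from
  stationarity alone: the mean counting measure is a multiple of Lebesgue measure, so the expected
  modulus of a linear statistic is at most a constant times an L1 norm, whatever the support. The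
  two kinds of limit can be compared because an L1 limit determines its function almost surely. A
  possible atom of \<rho> at 0 and the intensity enter only through transforms at the origin; every
  approximating family has a value there that does not depend on R. Sharp discs are forced by the
  definition of Psi, and they limit the decay of transforms. An exponent below -1 is needed, once
  because a factor R multiplies \<open>disc_p\<close> at R |xi| and once because squares are
  integrated against a measure of quadratic growth; -4/3 has an elementary proof.\<close>

lemma dominated_convergence_at_top_real:
  fixes s :: "real \<Rightarrow> 'a \<Rightarrow> 'b::{banach, second_countable_topology}" and w :: "'a \<Rightarrow> real"
  assumes "f \<in> borel_measurable M" "\<And>t. t \<ge> c \<Longrightarrow> s t \<in> borel_measurable M" "integrable M w"
    and "AE x in M. ((\<lambda>t. s t x) \<longlongrightarrow> f x) at_top"
    and "\<And>t. t \<ge> c \<Longrightarrow> AE x in M. norm (s t x) \<le> w x"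
  shows "((\<lambda>t. integral\<^sup>L M (s t)) \<longlongrightarrow> integral\<^sup>L M f) at_top" "integrable M f"
proof -
  \<comment> \<open>Freezing the parameter at \<open>max c t\<close> makes measurability and
    domination hold for all \<open>t\<close> and leaves the limit at infinity untouched.\<close>
  define s' where "s' t = s (max c t)" for t
  have s': "s' t \<in> borel_measurable M" "AE x in M. norm (s' t x) \<le> w x" for t
    using assms(2,5)[of "max c t"] by (auto simp: s'_def)
  have lim: "AE x in M. ((\<lambda>t. s' t x) \<longlongrightarrow> f x) at_top"
    using assms(4)
  proof eventually_elim
    case (elim x)
    show ?case
      by (rule Lim_transform_eventually[OF elim]) (auto simp: s'_def intro!: eventually_at_top_linorderI[of c])
  qed
  have "((\<lambda>t. integral\<^sup>L M (s' t)) \<longlongrightarrow> integral\<^sup>L M f) at_top"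
    by (rule integral_dominated_convergence_at_top[where w=w])
      (use assms(1,3) lim s' in auto)
  then show "((\<lambda>t. integral\<^sup>L M (s t)) \<longlongrightarrow> integral\<^sup>L M f) at_top"
    by (rule Lim_transform_eventually) (auto simp: s'_def intro!: eventually_at_top_linorderI[of c])
  show "integrable M f"
    by (rule integrable_dominated_convergence_at_top[where w=w])
      (use assms(1,3) lim s' in auto)
qed

text \<open>Writing the derivative as a limit of difference quotients is what lets the limit be
  exchanged with an integral below.\<close>

lemma has_vector_derivative_at_iff_quotient:
  "(f has_vector_derivative D) (at t0) \<longleftrightarrow> ((\<lambda>s. (f s - f t0) /\<^sub>R (s - t0)) \<longlongrightarrow> D) (at t0)"
proof -
  have "(f has_vector_derivative D) (at t0) \<longleftrightarrow>
      ((\<lambda>y. norm (f y - f t0 - (y - t0) *\<^sub>R D) / norm (y - t0)) \<longlongrightarrow> 0) (at t0)"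
    by (simp add: has_vector_derivative_def has_derivative_iff_norm bounded_linear_scaleR_left)
  also have "\<dots> \<longleftrightarrow> ((\<lambda>s. norm ((f s - f t0) /\<^sub>R (s - t0) - D)) \<longlongrightarrow> 0) (at t0)"
  proof (rule Lim_cong_within)
    fix y :: real assume "y \<noteq> t0"
    then have "(f y - f t0) /\<^sub>R (y - t0) - D = (f y - f t0 - (y - t0) *\<^sub>R D) /\<^sub>R (y - t0)"
      by (simp add: scaleR_diff_right)
    then show "norm (f y - f t0 - (y - t0) *\<^sub>R D) / norm (y - t0) = norm ((f y - f t0) /\<^sub>R (y - t0) - D)"
      by (simp add: divide_inverse mult.commute)
  qed simp_all
  finally show ?thesis
    by (simp add: tendsto_norm_zero_iff LIM_zero_iff)
qed

text \<open>The mean value inequality turns the bound \<open>B\<close> on the derivative into the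
  same bound on all difference quotients, so dominated convergence applies to them.\<close>

lemma has_vector_derivative_lebesgue_integral:
  fixes g :: "real \<Rightarrow> 'a \<Rightarrow> complex"
  assumes int: "\<And>t. integrable M (g t)"
    and deriv: "\<And>t w. w \<in> space M \<Longrightarrow> ((\<lambda>t. g t w) has_vector_derivative g' t w) (at t)"
    and bound: "\<And>t w. w \<in> space M \<Longrightarrow> norm (g' t w) \<le> B w"
    and B: "integrable M B" and meas: "\<And>t. g' t \<in> borel_measurable M"
  shows "((\<lambda>t. \<integral>w. g t w \<partial>M) has_vector_derivative (\<integral>w. g' t0 w \<partial>M)) (at t0)"
proof -
  have lip: "norm (g s w - g t0 w) \<le> B w * \<bar>s - t0\<bar>" if w: "w \<in> space M" for s w
  proof -
    have "norm (g s w - g t0 w) \<le> B w * norm (s - t0)"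
      by (rule differentiable_bound[where S=UNIV and f'="\<lambda>t h. h *\<^sub>R g' t w"])
        (use deriv[OF w] bound[OF w] order_trans[OF norm_ge_zero bound[OF w]] in
          \<open>auto simp: has_vector_derivative_def mult.commute[of "B w"]
            intro!: onorm_bound mult_left_mono\<close>)
    then show ?thesis by simp
  qed
  have "((\<lambda>s. \<integral>w. (g s w - g t0 w) /\<^sub>R (s - t0) \<partial>M) \<longlongrightarrow> (\<integral>w. g' t0 w \<partial>M)) (at t0)"
    unfolding tendsto_at_iff_sequentially comp_def
  proof (intro allI impI)
    fix X :: "nat \<Rightarrow> real" assume X: "\<forall>i. X i \<in> UNIV - {t0}" "X \<longlonglongrightarrow> t0"
    show "(\<lambda>n. \<integral>w. (g (X n) w - g t0 w) /\<^sub>R (X n - t0) \<partial>M) \<longlonglongrightarrow> (\<integral>w. g' t0 w \<partial>M)"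
    proof (rule integral_dominated_convergence[where w=B])
      show "AE w in M. (\<lambda>n. (g (X n) w - g t0 w) /\<^sub>R (X n - t0)) \<longlonglongrightarrow> g' t0 w"
      proof (rule AE_I2)
        fix w assume w: "w \<in> space M"
        have "((\<lambda>s. (g s w - g t0 w) /\<^sub>R (s - t0)) \<longlongrightarrow> g' t0 w) (at t0)"
          using deriv[OF w, of t0]
          by (simp add: has_vector_derivative_at_iff_quotient)
        then show "(\<lambda>n. (g (X n) w - g t0 w) /\<^sub>R (X n - t0)) \<longlonglongrightarrow> g' t0 w"
          using X unfolding tendsto_at_iff_sequentially comp_def by blast
      qed
      show "AE w in M. norm ((g (X n) w - g t0 w) /\<^sub>R (X n - t0)) \<le> B w" for n
        using X lip by (intro AE_I2) (auto simp: divide_simps mult.commute)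
    qed (use int meas B in auto)
  qed
  moreover have "(\<integral>w. (g s w - g t0 w) /\<^sub>R (s - t0) \<partial>M) = ((\<integral>w. g s w \<partial>M) - (\<integral>w. g t0 w \<partial>M)) /\<^sub>R (s - t0)" for s
    using int by simp
  ultimately show ?thesis
    by (simp only: has_vector_derivative_at_iff_quotient)
qed


subsection \<open>Lebesgue measure on the complex plane\<close>

lemma measurable_Complex [measurable (raw)]:
  assumes [measurable]: "f \<in> borel_measurable M" "g \<in> borel_measurable M"
  shows "(\<lambda>x. Complex (f x) (g x)) \<in> borel_measurable M"
  unfolding Complex_eq by measurable

text \<open>It is enough to compare the two measures on open boxes. The product form is used later
  to integrate along vertical lines, on which a character with real frequency is constant.\<close>

lemma distr_lborel_Complex: "distr (lborel \<Otimes>\<^sub>M lborel) borel (\<lambda>(x, y). Complex x y) = (lborel :: complex measure)"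
proof (rule lborel_eqI[symmetric])
  fix l u :: complex assume le: "\<And>b. b \<in> Basis \<Longrightarrow> l \<bullet> b \<le> u \<bullet> b"
  have "(\<lambda>(x, y). Complex x y) -` box l u = {Re l<..<Re u} \<times> {Im l<..<Im u}"
    by (auto simp: box_def Basis_complex_def)
  then show "emeasure (distr (lborel \<Otimes>\<^sub>M lborel) borel (\<lambda>(x, y). Complex x y)) (box l u) = ennreal (\<Prod>b\<in>Basis. (u - l) \<bullet> b)"
    using le[of 1] le[of \<i>]
    by (simp add: emeasure_distr space_pair_measure lborel.emeasure_pair_measure_Times
      Basis_complex_def ennreal_mult complex_eq_iff)
qed simp

lemma nn_integral_lborel_complex:
  assumes [measurable]: "f \<in> borel_measurable borel"
  shows "(\<integral>\<^sup>+z. f z \<partial>lborel) = (\<integral>\<^sup>+x. \<integral>\<^sup>+y. f (Complex x y) \<partial>lborel \<partial>lborel)"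
  by (subst distr_lborel_Complex[symmetric])
    (simp add: nn_integral_distr lborel.nn_integral_fst[symmetric] case_prod_unfold)

lemma integral_lborel_complex:
  fixes f :: "complex \<Rightarrow> 'b::{banach, second_countable_topology}"
  assumes "integrable lborel f"
  shows "(\<integral>z. f z \<partial>lborel) = (\<integral>x. \<integral>y. f (Complex x y) \<partial>lborel \<partial>lborel)"
proof -
  have [measurable]: "f \<in> borel_measurable borel" using assms by auto
  have "integrable (lborel \<Otimes>\<^sub>M lborel) (\<lambda>p. f ((\<lambda>(x, y). Complex x y) p))"
    by (subst integrable_distr_eq[symmetric, where N=borel and f=f]) (auto simp: distr_lborel_Complex assms)
  then show ?thesis
    by (subst distr_lborel_Complex[symmetric], subst integral_distr)
      (auto simp: lborel_pair.integral_fst'[symmetric] case_prod_unfold)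
qed

text \<open>The classical Fubini argument: the integral of 1_D(y) 1_B(x + y) against Lebesgue
  measure in y and \<open>\<nu>\<close> in x is evaluated by a shift of x alone, and again by a
  shift of y followed by one of x, giving |D| nu(B) = nu(D) |B|. It serves both for the Jacobian of
  complex multiplication and for mean measures of the point process.\<close>

lemma haar_measure_unique:
  fixes \<nu> :: "complex measure"
  assumes sets: "sets \<nu> = sets borel" and inv: "\<And>w. distr \<nu> borel (\<lambda>z. z + w) = \<nu>"
    and fin: "\<And>r. emeasure \<nu> (ball 0 r) < \<infinity>"
  obtains \<kappa> where "\<kappa> \<ge> 0" "\<nu> = scale_measure (ennreal \<kappa>) lborel"
proof -
  have [measurable_cong]: "sets \<nu> = sets borel" by fact
  have "sigma_finite_measure \<nu>"
  proof
    have "UNIV = (\<Union>n. ball (0::complex) (real n))"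
      by (auto intro: reals_Archimedean2)
    then show "\<exists>A. countable A \<and> A \<subseteq> sets \<nu> \<and> \<Union> A = space \<nu> \<and> (\<forall>a\<in>A. emeasure \<nu> a \<noteq> \<infinity>)"
      using fin by (intro exI[of _ "range (\<lambda>n. ball 0 (real n))"])
        (auto simp: sets sets_eq_imp_space_eq[OF sets] less_top)
  qed
  then interpret sigma_finite_measure \<nu> .
  interpret pair_sigma_finite lborel \<nu> ..
  have shift: "(\<integral>\<^sup>+x. f (x + w) \<partial>\<nu>) = (\<integral>\<^sup>+x. f x \<partial>\<nu>)" if [measurable]: "f \<in> borel_measurable borel" for f w
    by (subst (2) inv[of w, symmetric]) (simp add: nn_integral_distr)
  have shiftL: "(\<integral>\<^sup>+x. f (x + w) \<partial>lborel) = (\<integral>\<^sup>+x. f x \<partial>lborel)" if [measurable]: "f \<in> borel_measurable borel" for f and w :: complex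
    by (subst (2) lborel_distr_plus[of w, symmetric]) (simp add: nn_integral_distr add.commute)
  define D where "D = ball (0::complex) 1"
  have [measurable]: "D \<in> sets borel" by (simp add: D_def)
  \<comment> \<open>The last shift in \<open>x\<close> turns the argument y - x into -x; the
    symmetry of the disc removes the sign.\<close>
  have D_sym: "- x \<in> D \<longleftrightarrow> x \<in> D" for x by (simp add: D_def)
  have pair: "borel_measurable (lborel \<Otimes>\<^sub>M \<nu>) = borel_measurable (borel \<Otimes>\<^sub>M borel)"
    by (intro measurable_cong_sets sets_pair_measure_cong) (simp_all add: sets)
  have eq: "emeasure lborel D * emeasure \<nu> B = emeasure \<nu> D * emeasure lborel B" if B[measurable]: "B \<in> sets borel" for B
  proof -
    have "emeasure lborel D * emeasure \<nu> B = (\<integral>\<^sup>+y. indicator D y * (\<integral>\<^sup>+x. indicator B x \<partial>\<nu>) \<partial>lborel)"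
      by (subst nn_integral_multc) (simp_all add: sets)
    also have "\<dots> = (\<integral>\<^sup>+y. \<integral>\<^sup>+x. indicator D y * indicator B (x + y) \<partial>\<nu> \<partial>lborel)"
      by (simp add: nn_integral_cmult shift[of "indicator B"])
    also have "\<dots> = (\<integral>\<^sup>+x. \<integral>\<^sup>+y. indicator D y * indicator B (x + y) \<partial>lborel \<partial>\<nu>)"
      by (rule Fubini'[symmetric], unfold pair) measurable
    also have "\<dots> = (\<integral>\<^sup>+x. \<integral>\<^sup>+y. indicator D (y - x) * indicator B y \<partial>lborel \<partial>\<nu>)"
    proof (rule nn_integral_cong)
      fix x
      show "(\<integral>\<^sup>+y. indicator D y * indicator B (x + y) \<partial>lborel) = (\<integral>\<^sup>+y. indicator D (y - x) * (indicator B y::ennreal) \<partial>lborel)"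
        using shiftL[of "\<lambda>y. indicator D (y - x) * indicator B y" x] by (simp add: add.commute)
    qed
    also have "\<dots> = (\<integral>\<^sup>+y. \<integral>\<^sup>+x. indicator D (y - x) * indicator B y \<partial>\<nu> \<partial>lborel)"
      by (rule Fubini', unfold pair) measurable
    also have "\<dots> = (\<integral>\<^sup>+y. \<integral>\<^sup>+x. indicator D x * indicator B y \<partial>\<nu> \<partial>lborel)"
    proof (rule nn_integral_cong)
      fix y
      show "(\<integral>\<^sup>+x. indicator D (y - x) * indicator B y \<partial>\<nu>) = (\<integral>\<^sup>+x. indicator D x * (indicator B y::ennreal) \<partial>\<nu>)"
        by (subst shift[of "\<lambda>x. indicator D (y - x) * indicator B y" y, symmetric])
          (auto simp: indicator_def D_sym intro!: nn_integral_cong)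
    qed
    also have "\<dots> = emeasure \<nu> D * emeasure lborel B"
      by (simp add: nn_integral_multc nn_integral_cmult)
    finally show ?thesis .
  qed
  have D: "emeasure lborel D = ennreal (measure lborel D)" "measure lborel D > 0"
    using content_ball_pos[of 1 "0::complex"] emeasure_lborel_ball_finite[of "0::complex" 1]
    unfolding D_def by (auto intro!: emeasure_eq_ennreal_measure)
  show thesis
  proof
    show "0 \<le> measure \<nu> D / measure lborel D" by simp
    show "\<nu> = scale_measure (ennreal (measure \<nu> D / measure lborel D)) lborel"
    proof (rule measure_eqI)
      fix B assume "B \<in> sets \<nu>"
      then have "ennreal (measure lborel D) * emeasure \<nu> B = ennreal (measure \<nu> D) * emeasure lborel B"
        using eq[of B] D fin[of 1] by (simp add: D_def sets emeasure_eq_ennreal_measure)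
      then have "ennreal (1 / measure lborel D) * (ennreal (measure lborel D) * emeasure \<nu> B) =
          ennreal (1 / measure lborel D) * (ennreal (measure \<nu> D) * emeasure lborel B)" by simp
      then show "emeasure \<nu> B = emeasure (scale_measure (ennreal (measure \<nu> D / measure lborel D)) lborel) B"
        using D(2) by (simp add: mult.assoc[symmetric] ennreal_mult'[symmetric])
    qed (simp add: sets)
  qed
qed

lemma emeasure_lborel_ball_complex: "r \<ge> 0 \<Longrightarrow> emeasure lborel (ball (c::complex) r) = ennreal (pi * r\<^sup>2)"
  by (simp add: emeasure_ball unit_ball_vol_2)

lemma emeasure_lborel_cball_complex: "r \<ge> 0 \<Longrightarrow> emeasure lborel (cball (c::complex) r) = ennreal (pi * r\<^sup>2)"
  by (simp add: emeasure_cball unit_ball_vol_2)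

text \<open>The image is again translation invariant, so only its constant is unknown; it is read
  off from the unit disc, whose preimage is the disc of radius 1 / |c|.\<close>

lemma distr_lborel_complex_mult:
  assumes c: "c \<noteq> (0::complex)"
  shows "distr lborel borel (\<lambda>z. c * z) = scale_measure (ennreal (1 / (cmod c)\<^sup>2)) lborel"
proof -
  let ?\<nu> = "distr lborel borel (\<lambda>z. c * z)"
  have ball: "emeasure ?\<nu> (ball 0 r) = ennreal (pi * (r / cmod c)\<^sup>2)" if "r \<ge> 0" for r
  proof -
    have "(\<lambda>z. c * z) -` ball 0 r = ball 0 (r / cmod c)"
      using c by (auto simp: norm_mult field_simps)
    then show ?thesis using that by (simp add: emeasure_distr emeasure_lborel_ball_complex)
  qed
  obtain \<kappa> where \<kappa>: "\<kappa> \<ge> 0" "?\<nu> = scale_measure (ennreal \<kappa>) lborel"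
  proof (rule haar_measure_unique[of ?\<nu>])
    fix w :: complex
    have "distr ?\<nu> borel (\<lambda>z. z + w) = distr (distr lborel borel ((+) (w / c))) borel (\<lambda>z. c * z)"
      using c by (simp add: distr_distr comp_def algebra_simps)
    then show "distr ?\<nu> borel (\<lambda>z. z + w) = ?\<nu>" by (simp add: lborel_distr_plus)
  next
    fix r :: real show "emeasure ?\<nu> (ball 0 r) < \<infinity>"
      using ball[of r] by (cases "r \<ge> 0") (auto simp: ball_empty)
  qed auto
  have "ennreal (\<kappa> * pi) = ennreal (pi * (1 / cmod c)\<^sup>2)"
    using ball[of 1] by (simp add: \<kappa> emeasure_lborel_ball_complex ennreal_mult')
  then have "\<kappa> = 1 / (cmod c)\<^sup>2"
    using \<kappa>(1) by (subst (asm) ennreal_inj) (auto simp: power_divide mult.commute[of \<kappa>] divide_inverse power_inverse)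
  with \<kappa> show ?thesis by simp
qed

lemma scale_measure_eq_density: "scale_measure r M = density M (\<lambda>_. r)"
  by (rule measure_eqI) (auto simp: emeasure_density nn_integral_cmult_indicator)

lemma integral_lborel_complex_mult:
  fixes f :: "complex \<Rightarrow> 'b::{banach, second_countable_topology}"
  assumes [measurable]: "f \<in> borel_measurable borel" and c: "c \<noteq> 0"
  shows "(\<integral>z. f (c * z) \<partial>lborel) = (\<integral>z. f z \<partial>lborel) /\<^sub>R (cmod c)\<^sup>2"
proof -
  have "(\<integral>z. f (c * z) \<partial>lborel) = integral\<^sup>L (distr lborel borel (\<lambda>z. c * z)) f"
    by (simp add: integral_distr)
  also have "\<dots> = (\<integral>z. f z \<partial>lborel) /\<^sub>R (cmod c)\<^sup>2"
    by (simp add: distr_lborel_complex_mult[OF c] scale_measure_eq_density integral_density inverse_eq_divide)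
  finally show ?thesis .
qed

lemma integrable_lborel_complex_mult:
  fixes f :: "complex \<Rightarrow> 'b::{banach, second_countable_topology}"
  assumes f: "integrable lborel f" and c: "c \<noteq> 0"
  shows "integrable lborel (\<lambda>z. f (c * z))"
proof -
  have [measurable]: "f \<in> borel_measurable borel" using f by auto
  have "integrable (distr lborel borel (\<lambda>z. c * z)) f"
    using f by (simp add: distr_lborel_complex_mult[OF c] scale_measure_eq_density integrable_density)
  then show ?thesis by (simp add: integrable_distr_eq)
qed

lemma integral_lborel_shift:
  fixes f :: "complex \<Rightarrow> 'b::{banach, second_countable_topology}"
  assumes [measurable]: "f \<in> borel_measurable borel"
  shows "(\<integral>z. f (z + w) \<partial>lborel) = (\<integral>z. f z \<partial>lborel)"
  by (subst (2) lborel_distr_plus[of w, symmetric]) (simp add: integral_distr add.commute)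

lemma integral_lborel_reflect:
  fixes f :: "complex \<Rightarrow> 'b::{banach, second_countable_topology}"
  assumes [measurable]: "f \<in> borel_measurable borel"
  shows "(\<integral>z. f (w - z) \<partial>lborel) = (\<integral>z. f z \<partial>lborel)"
  using integral_lborel_complex_mult[of "\<lambda>z. f (z + w)" "-1"] integral_lborel_shift[of f w] by simp

lemma integrable_lborel_shift:
  fixes f :: "complex \<Rightarrow> 'b::{banach, second_countable_topology}"
  assumes f: "integrable lborel f"
  shows "integrable lborel (\<lambda>z. f (z + w))"
proof -
  have [measurable]: "f \<in> borel_measurable borel" using f by auto
  have "integrable (distr lborel borel ((+) w)) f" using f by (simp add: lborel_distr_plus)
  then show ?thesis by (simp add: integrable_distr_eq add.commute)
qed

lemma integrable_lborel_reflect: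
  fixes f :: "complex \<Rightarrow> 'b::{banach, second_countable_topology}"
  assumes f: "integrable lborel f"
  shows "integrable lborel (\<lambda>z. f (w - z))"
  using integrable_lborel_complex_mult[OF integrable_lborel_shift[OF f, of w], of "-1"] by simp


subsection \<open>Fourier transform\<close>

definition cis_inner :: "complex \<Rightarrow> complex \<Rightarrow> complex" where
  "cis_inner \<xi> x = exp (- 2 * of_real pi * \<i> * of_real (\<xi> \<bullet> x))"

lemma fourier_eq: "fourier f \<xi> = (\<integral>x. cis_inner \<xi> x * f x \<partial>lborel)"
  by (simp add: fourier_def cis_inner_def)

lemma norm_cis_inner [simp]: "cmod (cis_inner \<xi> x) = 1"
  by (simp add: cis_inner_def)

lemma continuous_cis_inner [continuous_intros]:
  "continuous_on A f \<Longrightarrow> continuous_on A g \<Longrightarrow> continuous_on A (\<lambda>x. cis_inner (f x) (g x))"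
  unfolding cis_inner_def by (intro continuous_intros)

lemma measurable_cis_inner [measurable (raw)]:
  "f \<in> borel_measurable M \<Longrightarrow> g \<in> borel_measurable M \<Longrightarrow> (\<lambda>x. cis_inner (f x) (g x)) \<in> borel_measurable M"
  unfolding cis_inner_def by measurable

lemma cis_inner_add: "cis_inner \<xi> (x + y) = cis_inner \<xi> x * cis_inner \<xi> y"
  by (simp add: cis_inner_def inner_add_right exp_add[symmetric] algebra_simps)

lemma cis_inner_0 [simp]: "cis_inner 0 x = 1" "cis_inner \<xi> 0 = 1"
  by (simp_all add: cis_inner_def)

text \<open>The adjoint of multiplication by \<open>c\<close>, for the real inner product of the
  plane, is multiplication by \<open>cnj c\<close>.\<close>

lemma cis_inner_mult: "cis_inner \<xi> (c * x) = cis_inner (cnj c * \<xi>) x"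
  by (simp add: cis_inner_def inner_complex_def algebra_simps)

lemma integrable_cis_inner_mult:
  "integrable lborel f \<Longrightarrow> integrable lborel (\<lambda>x. cis_inner \<xi> x * f x)"
  by (rule Bochner_Integration.integrable_bound[of _ f]) (auto simp: norm_mult)

lemma norm_fourier_le: "cmod (fourier f \<xi>) \<le> (\<integral>x. cmod (f x) \<partial>lborel)"
proof -
  have "cmod (fourier f \<xi>) \<le> (\<integral>x. cmod (cis_inner \<xi> x * f x) \<partial>lborel)"
    unfolding fourier_eq by (rule integral_norm_bound)
  then show ?thesis by (simp add: norm_mult)
qed

lemma continuous_on_fourier:
  assumes f: "integrable lborel f"
  shows "continuous_on UNIV (fourier f)"
  unfolding continuous_on_sequentially comp_def
proof (intro allI impI ballI, elim conjE)
  fix X :: "nat \<Rightarrow> complex" and a assume X: "X \<longlonglongrightarrow> a"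
  show "(\<lambda>n. fourier f (X n)) \<longlonglongrightarrow> fourier f a"
    unfolding fourier_eq
  proof (rule integral_dominated_convergence[where w="\<lambda>x. cmod (f x)"])
    show "AE x in lborel. (\<lambda>n. cis_inner (X n) x * f x) \<longlonglongrightarrow> cis_inner a x * f x"
      unfolding cis_inner_def by (intro AE_I2 tendsto_intros X)
  qed (use f in \<open>auto simp: norm_mult\<close>)
qed

lemma borel_measurable_fourier [measurable]:
  "integrable lborel f \<Longrightarrow> fourier f \<in> borel_measurable borel"
  by (rule borel_measurable_continuous_onI) (rule continuous_on_fourier)

lemma fourier_add: "integrable lborel f \<Longrightarrow> integrable lborel g \<Longrightarrow>
   fourier (\<lambda>x. f x + g x) \<xi> = fourier f \<xi> + fourier g \<xi>"
  by (simp add: fourier_eq distrib_left integrable_cis_inner_mult)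

lemma fourier_diff: "integrable lborel f \<Longrightarrow> integrable lborel g \<Longrightarrow>
   fourier (\<lambda>x. f x - g x) \<xi> = fourier f \<xi> - fourier g \<xi>"
  by (simp add: fourier_eq right_diff_distrib integrable_cis_inner_mult)

lemma fourier_cmult: "fourier (\<lambda>x. c * f x) \<xi> = c * fourier f \<xi>"
  by (simp add: fourier_eq mult.left_commute[of _ c])

lemma fourier_0: "fourier f 0 = (\<integral>x. f x \<partial>lborel)"
  by (simp add: fourier_eq)

text \<open>Dilations and rotations in one formula; it reduces the transforms of the discs and
  annuli below to radius 1 or to real frequencies.\<close>

lemma fourier_complex_mult:
  assumes [measurable]: "f \<in> borel_measurable borel" and c: "c \<noteq> 0"
  shows "fourier f \<xi> = of_real ((cmod c)\<^sup>2) * fourier (\<lambda>x. f (c * x)) (cnj c * \<xi>)"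
proof -
  have "fourier (\<lambda>x. f (c * x)) (cnj c * \<xi>) = (\<integral>x. cis_inner \<xi> (c * x) * f (c * x) \<partial>lborel)"
    by (simp add: fourier_eq cis_inner_mult)
  also have "\<dots> = fourier f \<xi> /\<^sub>R (cmod c)\<^sup>2"
    unfolding fourier_eq by (rule integral_lborel_complex_mult[OF _ c]) simp
  finally show ?thesis using c by (simp add: scaleR_conv_of_real field_simps)
qed

definition conv :: "(complex \<Rightarrow> complex) \<Rightarrow> (complex \<Rightarrow> complex) \<Rightarrow> complex \<Rightarrow> complex" where
  "conv f g a = (\<integral>z. f z * g (a - z) \<partial>lborel)"

text \<open>All three claims are Fubini for an absolutely integrable function of the pair:
  substituting a + z for a splits the character into a factor in z and a factor in a.\<close>

lemma
  assumes f: "integrable lborel f" and g: "integrable lborel g"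
  shows integrable_conv_pair: "integrable (lborel \<Otimes>\<^sub>M lborel) (\<lambda>(z, a). f z * g (a - z))"
    and integrable_conv: "integrable lborel (conv f g)"
    and fourier_conv: "fourier (conv f g) \<xi> = fourier f \<xi> * fourier g \<xi>"
proof -
  have [measurable]: "f \<in> borel_measurable borel" "g \<in> borel_measurable borel" using f g by auto
  have g': "integrable lborel (\<lambda>a. g (a - z))" for z
    using integrable_lborel_shift[OF g, of "-z"] by simp
  have *: "(\<integral>a. h (a - z) \<partial>lborel) = (\<integral>a. h a \<partial>lborel)" if "h \<in> borel_measurable borel"
    for z and h :: "complex \<Rightarrow> 'b::{banach, second_countable_topology}"
    using integral_lborel_shift[OF that, of "-z"] by simp
  show pair: "integrable (lborel \<Otimes>\<^sub>M lborel) (\<lambda>(z, a). f z * g (a - z))"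
  proof (rule lborel_pair.Fubini_integrable)
    show "integrable lborel (\<lambda>z. \<integral>a. norm (case (z, a) of (z, a) \<Rightarrow> f z * g (a - z)) \<partial>lborel)"
      using f by (simp add: norm_mult *[of "\<lambda>a. cmod (g a)"])
  qed (use g' in auto)
  have "integrable lborel (\<lambda>a. \<integral>z. f z * g (a - z) \<partial>lborel)"
    using lborel_pair.integrable_snd[OF pair] by simp
  then show "integrable lborel (conv f g)" by (simp add: conv_def[abs_def])
  have pair': "integrable (lborel \<Otimes>\<^sub>M lborel) (\<lambda>(z, a). cis_inner \<xi> a * (f z * g (a - z)))"
    by (rule Bochner_Integration.integrable_bound[OF pair]) (auto simp: norm_mult case_prod_unfold)
  have "fourier (conv f g) \<xi> = (\<integral>a. \<integral>z. cis_inner \<xi> a * (f z * g (a - z)) \<partial>lborel \<partial>lborel)"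
    unfolding fourier_eq conv_def by simp
  also have "\<dots> = (\<integral>z. \<integral>a. cis_inner \<xi> a * (f z * g (a - z)) \<partial>lborel \<partial>lborel)"
    using lborel_pair.Fubini_integral[OF pair'] by simp
  also have "\<dots> = (\<integral>z. (cis_inner \<xi> z * f z) * fourier g \<xi> \<partial>lborel)"
  proof (rule Bochner_Integration.integral_cong[OF refl])
    fix z
    have "(\<integral>a. cis_inner \<xi> a * (f z * g (a - z)) \<partial>lborel) = (\<integral>a. cis_inner \<xi> (a + z) * (f z * g a) \<partial>lborel)"
      using *[of "\<lambda>a. cis_inner \<xi> (a + z) * (f z * g a)" z] by simp
    also have "\<dots> = (\<integral>a. (cis_inner \<xi> z * f z) * (cis_inner \<xi> a * g a) \<partial>lborel)"
      by (simp add: cis_inner_add ac_simps)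
    also have "\<dots> = (cis_inner \<xi> z * f z) * fourier g \<xi>"
      by (simp add: fourier_eq)
    finally show "(\<integral>a. cis_inner \<xi> a * (f z * g (a - z)) \<partial>lborel) = (cis_inner \<xi> z * f z) * fourier g \<xi>" .
  qed
  also have "\<dots> = fourier f \<xi> * fourier g \<xi>"
    by (simp add: fourier_eq)
  finally show "fourier (conv f g) \<xi> = fourier f \<xi> * fourier g \<xi>" .
qed

subsection \<open>Mollification\<close>

text \<open>Every derivative of the bump exp (-1 / (1 - x^2)) has this shape, a polynomial over a
  power of 1 - x^2 times the bump; the family is closed under differentiation.\<close>

definition bump_poly :: "nat \<Rightarrow> real poly \<Rightarrow> real \<Rightarrow> real" where
  "bump_poly k p x = (if \<bar>x\<bar> < 1 then poly p x / (1 - x\<^sup>2) ^ k * exp (- 1 / (1 - x\<^sup>2)) else 0)"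

text \<open>One term of the exponential series. With u = 1 / (1 - x^2) it says that the exponential
  beats every power of the singular denominator.\<close>

lemma power_le_fact_exp:
  assumes "(u::real) \<ge> 0"
  shows "u ^ n \<le> fact n * exp u"
proof -
  have "u ^ n /\<^sub>R fact n \<le> (\<Sum>k. u ^ k /\<^sub>R fact k)"
    using assms by (intro sum_le_suminf[of _ "{n}", simplified] summable_exp_generic) auto
  then show ?thesis by (simp add: exp_def field_simps)
qed

text \<open>Inside (-1, 1) this is the quotient rule, the exponent of the denominator growing by 2
  because of the derivative of the exponential. At the end points the function is O(|y - x|^2), so
  the derivative exists and is 0.\<close>

lemma bump_poly_deriv:
  fixes p :: "real poly" and k :: nat
  defines "S \<equiv> [:1, 0, -1:]"
  defines "p' \<equiv> pderiv p * S\<^sup>2 + smult (2 * real k) ([:0, 1:] * S * p) - smult 2 ([:0, 1:] * p)"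
  shows "(bump_poly k p has_real_derivative bump_poly (k + 2) p' x) (at x)"
proof (cases "\<bar>x\<bar> < 1")
  case True
  then have s: "1 - x\<^sup>2 > 0" by (simp add: abs_square_less_1)
  define s where "s = 1 - x\<^sup>2"
  define E where "E = exp (- 1 / s)"
  have s0: "s \<noteq> 0" using s by (simp add: s_def)
  have D1: "((\<lambda>y. poly p y / (1 - y\<^sup>2) ^ k) has_real_derivative
      ((poly (pderiv p) x * s ^ k - poly p x * (real k * s ^ (k - 1) * (- 2 * x))) / (s ^ k * s ^ k))) (at x)"
    unfolding s_def using s by (auto intro!: derivative_eq_intros simp: power2_eq_square)
  have D2: "((\<lambda>y. exp (- 1 / (1 - y\<^sup>2))) has_real_derivative (E * (- (2 * x) / s\<^sup>2))) (at x)"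
    unfolding s_def E_def using s by (auto intro!: derivative_eq_intros simp: power2_eq_square)
  have "((\<lambda>y. poly p y / (1 - y\<^sup>2) ^ k * exp (- 1 / (1 - y\<^sup>2))) has_real_derivative
      ((poly (pderiv p) x * s ^ k - poly p x * (real k * s ^ (k - 1) * (- 2 * x))) / (s ^ k * s ^ k)) * E
       + poly p x / s ^ k * (E * (- (2 * x) / s\<^sup>2))) (at x)"
    using DERIV_mult[OF D1 D2] by (simp add: s_def E_def ac_simps)
  also have "((poly (pderiv p) x * s ^ k - poly p x * (real k * s ^ (k - 1) * (- 2 * x))) / (s ^ k * s ^ k)) * E
       + poly p x / s ^ k * (E * (- (2 * x) / s\<^sup>2)) = poly p' x / s ^ (k + 2) * E"
  proof -
    have 1: "real k * s ^ (k - 1) = real k * s ^ k / s" using s0 by (cases k) auto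
    have "poly S x = s" by (simp add: S_def s_def power2_eq_square)
    then have 2: "poly p' x = poly (pderiv p) x * s\<^sup>2 + 2 * real k * (x * s * poly p x) - 2 * (x * poly p x)"
      by (simp add: p'_def)
    have "s ^ k \<noteq> 0" using s0 by simp
    then show ?thesis
      unfolding 1 2 power_add using s0 by (simp add: field_simps power2_eq_square)
  qed
  also have "\<dots> = bump_poly (k + 2) p' x" using True by (simp add: bump_poly_def s_def E_def)
  finally show ?thesis
    by (rule has_field_derivative_transform_within_open[of _ _ _ "{-1<..<1}"])
      (use True in \<open>auto simp: bump_poly_def\<close>)
next
  case False
  have 0: "bump_poly k p x = 0" "bump_poly (k + 2) p' x = 0" using False by (auto simp: bump_poly_def)
  show ?thesis
  proof (cases "\<bar>x\<bar> = 1")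
    case x1: True
    have "bounded (poly p ` {-1..1})"
      by (intro compact_imp_bounded compact_continuous_image continuous_intros) auto
    then obtain B where B: "B > 0" "\<And>y. y \<in> {-1..1} \<Longrightarrow> \<bar>poly p y\<bar> \<le> B"
      unfolding bounded_pos by auto
    \<comment> \<open>The factorial is that of \<open>power_le_fact_exp\<close> at exponent k + 2,
      which leaves (1 - y^2)^2 after the denominator is cancelled; the 4 comes from 1 - y^2 <= 2 |y
      - x|.\<close>
    define C where "C = 4 * B * fact (k + 2)"
    have bd: "\<bar>bump_poly k p y\<bar> \<le> C * \<bar>y - x\<bar>\<^sup>2" for y
    proof (cases "\<bar>y\<bar> < 1")
      case True
      then have s: "1 - y\<^sup>2 > 0" by (simp add: abs_square_less_1)
      define s where "s = 1 - y\<^sup>2"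
      have spos: "s > 0" using s by (simp add: s_def)
      then have "(1 / s) ^ (k + 2) \<le> fact (k + 2) * exp (1 / s)"
        by (intro power_le_fact_exp) simp
      then have "1 \<le> (fact (k + 2) * exp (1 / s)) * s ^ (k + 2)"
        using spos by (simp only: power_divide power_one divide_le_eq zero_less_power if_True)
      then have "exp (- 1 / s) * 1 \<le> exp (- 1 / s) * ((fact (k + 2) * exp (1 / s)) * s ^ (k + 2))"
        by (intro mult_left_mono) auto
      also have "\<dots> = fact (k + 2) * s ^ (k + 2) * (exp (- 1 / s) * exp (1 / s))" by (simp only: ac_simps)
      also have "exp (- 1 / s) * exp (1 / s) = 1" by (simp add: exp_add[symmetric])
      finally have "exp (- 1 / s) \<le> fact (k + 2) * s ^ (k + 2)" by simp
      then have "exp (- 1 / s) / s ^ k \<le> fact (k + 2) * s\<^sup>2"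
        using spos by (simp only: divide_le_eq zero_less_power if_True) (simp add: power2_eq_square ac_simps del: fact_Suc)
      then have bd1: "\<bar>bump_poly k p y\<bar> \<le> B * (fact (k + 2) * s\<^sup>2)"
        using True B(2)[of y] s B(1) unfolding bump_poly_def s_def
        by (auto simp: abs_mult power_abs intro!: mult_mono)
          (smt (verit) divide_nonneg_pos exp_ge_zero mult_mono' times_divide_eq_left times_divide_eq_right zero_less_power)
      have s2: "s\<^sup>2 \<le> (2 * \<bar>y - x\<bar>)\<^sup>2"
      proof (rule power_mono)
        have "s = (1 - \<bar>y\<bar>) * (1 + \<bar>y\<bar>)" by (simp add: s_def algebra_simps power2_eq_square)
        also have "\<dots> \<le> (1 - \<bar>y\<bar>) * 2" using True by (intro mult_left_mono) auto
        also have "1 - \<bar>y\<bar> \<le> \<bar>y - x\<bar>" using x1 by linarith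
        finally show "s \<le> 2 * \<bar>y - x\<bar>" by simp
      qed (use s in \<open>simp add: s_def\<close>)
      have "B * (fact (k + 2) * s\<^sup>2) \<le> B * (fact (k + 2) * (2 * \<bar>y - x\<bar>)\<^sup>2)"
        using B(1) by (intro mult_left_mono s2) auto
      also have "\<dots> = C * \<bar>y - x\<bar>\<^sup>2" by (simp add: C_def power_mult_distrib ac_simps del: fact_Suc)
      finally show ?thesis using bd1 by linarith
    next
      case False then show ?thesis using B by (auto simp: bump_poly_def C_def)
    qed
    have "((\<lambda>y. (bump_poly k p y - bump_poly k p x) / (y - x)) \<longlongrightarrow> 0) (at x)"
    proof (rule Lim_null_comparison)
      show "\<forall>\<^sub>F y in at x. norm ((bump_poly k p y - bump_poly k p x) / (y - x)) \<le> C * \<bar>y - x\<bar>"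
        unfolding eventually_at_filter
        by (rule always_eventually) (use bd in \<open>auto simp: 0 divide_le_eq power2_eq_square mult.assoc\<close>)
      have "((\<lambda>y. C * \<bar>y - x\<bar>) \<longlongrightarrow> C * \<bar>x - x\<bar>) (at x)" by (intro tendsto_intros)
      then show "((\<lambda>y. C * \<bar>y - x\<bar>) \<longlongrightarrow> 0) (at x)" by simp
    qed
    then show ?thesis unfolding has_field_derivative_iff 0(2) .
  next
    case False
    with \<open>\<not> \<bar>x\<bar> < 1\<close> have "x \<in> - {-1..1}" by auto
    then have "(bump_poly k p has_real_derivative 0) (at x)"
      by (rule has_field_derivative_transform_within_open[OF DERIV_const[of 0], rotated 1])
        (auto simp: bump_poly_def)
    then show ?thesis unfolding 0(2) .
  qed
qed

text \<open>\<open>V k\<close> plays the k-th derivative of a normalised bump supported in [-r, r].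
  Carrying all derivatives as one sequence makes iterated partial derivatives of a mollifier a
  matter of raising indices.\<close>

definition bump_family :: "(nat \<Rightarrow> real \<Rightarrow> real) \<Rightarrow> real \<Rightarrow> bool" where
  "bump_family V r \<longleftrightarrow> (\<forall>k x. (V k has_real_derivative V (Suc k) x) (at x)) \<and>
     (\<forall>k x. \<bar>x\<bar> \<ge> r \<longrightarrow> V k x = 0) \<and> (\<forall>x. V 0 x \<ge> 0) \<and> integrable lborel (V 0) \<and> (\<integral>x. V 0 x \<partial>lborel) = 1"

lemma bump_family_exists:
  assumes r: "r > 0"
  shows "\<exists>V. bump_family V r"
proof -
  define T where "T k p = pderiv p * [:1, 0, -1:]\<^sup>2 + smult (2 * real k) ([:0, 1:] * [:1, 0, -1:] * p) - smult 2 ([:0, 1:] * p)" for k p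
  \<comment> \<open>The numerators of the successive derivatives; each differentiation raises the
    exponent of the denominator by 2, hence 2 n after n steps.\<close>
  define P where "P = rec_nat 1 (\<lambda>n p. T (2 * n) p)"
  define U where "U n = bump_poly (2 * n) (P n)" for n
  have U': "(U n has_real_derivative U (Suc n) x) (at x)" for n x
    unfolding U_def using bump_poly_deriv[of "2 * n" "P n" x] by (simp add: P_def T_def)
  have U0: "U n x = 0" if "\<bar>x\<bar> \<ge> 1" for n x using that by (simp add: U_def bump_poly_def)
  have Uc: "continuous_on A (U n)" for n A
    by (meson U' DERIV_isCont continuous_at_imp_continuous_on)
  have Upos: "U 0 x \<ge> 0" for x by (simp add: U_def P_def bump_poly_def)
  have Uint: "integrable lborel (U 0)"
  proof -
    have "integrable lborel (\<lambda>x. indicator {-1..1} x *\<^sub>R U 0 x)"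
      by (rule borel_integrable_compact) (auto intro: Uc)
    moreover have "(\<lambda>x. indicator {-1..1} x *\<^sub>R U 0 x) = U 0"
    proof
      fix x show "indicator {-1..1} x *\<^sub>R U 0 x = U 0 x"
        using U0[of x 0] by (cases "x \<in> {-1..1}") (auto simp: not_le)
    qed
    ultimately show ?thesis by simp
  qed
  define c where "c = (\<integral>x. U 0 x \<partial>lborel)"
  have "c \<noteq> 0"
  proof
    assume "c = 0"
    then have "AE x in lborel. U 0 x = 0"
      unfolding c_def using integral_nonneg_eq_0_iff_AE[OF Uint] Upos by auto
    moreover have "U 0 x \<noteq> 0" if "x \<in> {0<..<1}" for x
      using that by (auto simp: U_def P_def bump_poly_def)
    ultimately have "AE x in lborel. x \<notin> {0<..<(1::real)}" by (auto elim!: eventually_mono)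
    then have "{0<..<(1::real)} \<in> null_sets lborel" by (subst AE_iff_null_sets) auto
    then have "emeasure lborel {0<..<(1::real)} = 0" by blast
    then show False using emeasure_lborel_Ioo[of 0 "1::real"] by simp
  qed
  moreover have "c \<ge> 0" unfolding c_def by (intro integral_nonneg_AE AE_I2 Upos)
  ultimately have c: "c > 0" by simp
  \<comment> \<open>The k-fold chain rule accounts for \<open>r ^ k\<close>; one more
    \<open>r\<close> and the constant \<open>c\<close> normalise the integral of \<open>V 0\<close>
    to 1.\<close>
  define V where "V k x = U k (x / r) / (c * r ^ (k + 1))" for k x
  have "bump_family V r"
    unfolding bump_family_def
  proof (intro conjI allI impI)
    fix k x
    have "((\<lambda>x. U k (x / r)) has_real_derivative U (Suc k) (x / r) * (1 / r)) (at x)"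
      by (rule DERIV_chain2[OF U']) (use r in \<open>auto intro!: derivative_eq_intros\<close>)
    then have "((\<lambda>x. U k (x / r) / (c * r ^ (k + 1))) has_real_derivative U (Suc k) (x / r) * (1 / r) / (c * r ^ (k + 1))) (at x)"
      by (rule DERIV_cdivide)
    then show "(V k has_real_derivative V (Suc k) x) (at x)"
      by (simp add: V_def[abs_def] field_simps)
  next
    fix k x assume "\<bar>x\<bar> \<ge> r"
    then show "V k x = 0" using r by (simp add: V_def U0)
  next
    fix x show "V 0 x \<ge> 0" using c r Upos by (simp add: V_def)
  next
    have i: "integrable lborel (\<lambda>x. U 0 (0 + (1 / r) * x))"
      using r Uint lborel_integrable_real_affine[of "U 0" "1 / r" 0] by simp
    then show "integrable lborel (V 0)" by (simp add: V_def[abs_def])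
    have "c = (1 / r) * (\<integral>x. U 0 (0 + (1 / r) * x) \<partial>lborel)"
      unfolding c_def using r by (subst lborel_integral_real_affine[of "1 / r" _ 0]) auto
    then have "(\<integral>x. U 0 (x / r) \<partial>lborel) = c * r" using r by (simp add: field_simps)
    then show "(\<integral>x. V 0 x \<partial>lborel) = 1" using c r by (simp add: V_def[abs_def])
  qed
  then show ?thesis by blast
qed


section \<open>Bounded functions of bounded support and their mollification\<close>

definition bdd_supp :: "(complex \<Rightarrow> complex) \<Rightarrow> bool" where
  "bdd_supp f \<longleftrightarrow> f \<in> borel_measurable borel \<and> bounded (range f) \<and> bounded {z. f z \<noteq> 0}"

lemma bdd_suppI:
  assumes "f \<in> borel_measurable borel" "\<And>x. cmod (f x) \<le> C" "\<And>x. cmod x > r \<Longrightarrow> f x = 0"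
  shows "bdd_supp f"
  unfolding bdd_supp_def
proof (intro conjI)
  show "bounded (range f)" using assms(2) by (auto simp: bounded_iff)
  show "bounded {z. f z \<noteq> 0}" using assms(3) by (auto simp: bounded_iff not_less[symmetric])
qed fact

lemma bdd_suppE:
  assumes "bdd_supp f"
  obtains C r where "C > 0" "r > 0" "f \<in> borel_measurable borel" "\<And>x. cmod (f x) \<le> C" "\<And>x. cmod x > r \<Longrightarrow> f x = 0"
proof -
  obtain C where "C > 0" "\<And>x. cmod (f x) \<le> C" using assms by (auto simp: bdd_supp_def bounded_pos)
  moreover obtain r where "r > 0" "\<And>z. f z \<noteq> 0 \<Longrightarrow> cmod z \<le> r" using assms by (auto simp: bdd_supp_def bounded_pos)
  moreover have "f \<in> borel_measurable borel" using assms by (simp add: bdd_supp_def)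
  ultimately show thesis using that[of C r] by (meson not_le)
qed

lemma integrable_bdd_supp:
  assumes "bdd_supp f" shows "integrable lborel f"
proof -
  obtain C r where C: "C > 0" "r > 0" "f \<in> borel_measurable borel" "\<And>x. cmod (f x) \<le> C" "\<And>x. cmod x > r \<Longrightarrow> f x = 0"
    using bdd_suppE[OF assms] by metis
  have "integrable lborel (\<lambda>x. C * indicator (cball (0::complex) r) x)"
    using C by (intro integrable_mult_right integrable_real_indicator)
      (auto simp: emeasure_lborel_cball_complex)
  then show ?thesis
    by (rule Bochner_Integration.integrable_bound) (use C in \<open>auto simp: indicator_def not_le\<close>)
qed

text \<open>A product of one-dimensional bumps; \<open>k\<close> and \<open>l\<close> count the
  derivatives in the real and in the imaginary direction.\<close>

definition mollifier :: "(nat \<Rightarrow> real \<Rightarrow> real) \<Rightarrow> nat \<Rightarrow> nat \<Rightarrow> complex \<Rightarrow> complex" where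
  "mollifier V k l z = of_real (V k (Re z) * V l (Im z))"

context
  fixes V :: "nat \<Rightarrow> real \<Rightarrow> real" and r :: real
  assumes V: "bump_family V r" and r_pos: "r > 0"
begin

lemma bump_family_isCont: "isCont (V k) x"
  using V by (auto simp: bump_family_def intro: DERIV_isCont)

lemma bump_family_continuous_on: "continuous_on A (V k)"
  by (simp add: bump_family_isCont continuous_at_imp_continuous_on)

lemma bump_family_bounded: "\<exists>C>0. \<forall>x. \<bar>V k x\<bar> \<le> C"
proof -
  have "bounded (V k ` {-r..r})"
    by (intro compact_imp_bounded compact_continuous_image bump_family_continuous_on) auto
  then obtain C where C: "C > 0" "\<And>x. x \<in> {-r..r} \<Longrightarrow> \<bar>V k x\<bar> \<le> C" unfolding bounded_pos by auto
  have "\<bar>V k x\<bar> \<le> C" for x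
    using C(1) C(2)[of x] V by (cases "x \<in> {-r..r}") (auto simp: bump_family_def not_le)
  then show ?thesis using C(1) by auto
qed

lemma continuous_mollifier: "continuous_on A (mollifier V k l)"
  unfolding mollifier_def
  by (intro continuous_intros continuous_on_compose2[OF bump_family_continuous_on[of UNIV]]) auto

lemma measurable_mollifier [measurable]: "mollifier V k l \<in> borel_measurable borel"
  by (intro borel_measurable_continuous_onI continuous_mollifier)

lemma mollifier_bounded: "\<exists>C>0. \<forall>z. cmod (mollifier V k l z) \<le> C"
proof -
  obtain C D where "C > 0" "\<And>x. \<bar>V k x\<bar> \<le> C" "D > 0" "\<And>x. \<bar>V l x\<bar> \<le> D"
    using bump_family_bounded by metis
  then show ?thesis
    by (intro exI[of _ "C * D"]) (auto simp: mollifier_def norm_mult intro!: mult_mono)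
qed

text \<open>The square of half side \<open>r\<close> lies in the disc of radius 2 r, by |z| <= |Re
  z| + |Im z|.\<close>

lemma mollifier_supp:
  assumes "cmod z > 2 * r" shows "mollifier V k l z = 0"
proof -
  have "\<bar>Re z\<bar> \<ge> r \<or> \<bar>Im z\<bar> \<ge> r" using cmod_le[of z] assms by linarith
  then show ?thesis using V by (auto simp: mollifier_def bump_family_def)
qed

lemma bdd_supp_mollifier: "bdd_supp (mollifier V k l)"
  using mollifier_bounded[of k l] mollifier_supp by (metis bdd_suppI measurable_mollifier)

lemma integral_mollifier: "(\<integral>z. mollifier V 0 0 z \<partial>lborel) = 1"
proof -
  have "(\<integral>z. mollifier V 0 0 z \<partial>lborel) = (\<integral>x. \<integral>y. of_real (V 0 x * V 0 y) \<partial>lborel \<partial>lborel)"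
    using integral_lborel_complex[OF integrable_bdd_supp[OF bdd_supp_mollifier[of 0 0]]]
    by (simp add: mollifier_def)
  also have "\<dots> = 1" using V by (simp add: bump_family_def)
  finally show ?thesis .
qed

lemma mollifier_norm: "cmod (mollifier V 0 0 z) = Re (mollifier V 0 0 z)"
  using V by (simp add: mollifier_def bump_family_def norm_mult)

lemma integral_norm_mollifier: "(\<integral>z. cmod (mollifier V 0 0 z) \<partial>lborel) = 1"
  using integral_mollifier integral_Re[OF integrable_bdd_supp[OF bdd_supp_mollifier[of 0 0]]]
  by (simp add: mollifier_norm)

lemma integrable_conv_mollifier:
  assumes "bdd_supp f" shows "integrable lborel (\<lambda>w. f w * mollifier V k l (z - w))"
proof -
  obtain C where C: "C > 0" "\<And>z. cmod (mollifier V k l z) \<le> C" using mollifier_bounded by metis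
  have [measurable]: "f \<in> borel_measurable borel" using assms by (simp add: bdd_supp_def)
  have "integrable lborel (\<lambda>w. C * cmod (f w))" using integrable_bdd_supp[OF assms] by auto
  then show ?thesis
    by (rule Bochner_Integration.integrable_bound)
      (use C in \<open>auto simp: norm_mult mult.commute[of C] intro!: mult_left_mono abs_ge_self[THEN order_trans[rotated]]\<close>)
qed

lemma continuous_conv_mollifier:
  assumes f: "bdd_supp f" shows "continuous_on UNIV (conv f (mollifier V k l))"
  unfolding continuous_on_sequentially comp_def
proof (intro allI impI ballI, elim conjE)
  have [measurable]: "f \<in> borel_measurable borel" using f by (simp add: bdd_supp_def)
  obtain C where C: "C > 0" "\<And>z. cmod (mollifier V k l z) \<le> C" using mollifier_bounded by metis
  fix X :: "nat \<Rightarrow> complex" and a assume X: "X \<longlonglongrightarrow> a"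
  show "(\<lambda>n. conv f (mollifier V k l) (X n)) \<longlonglongrightarrow> conv f (mollifier V k l) a"
    unfolding conv_def
  proof (rule integral_dominated_convergence[where w="\<lambda>x. cmod (f x) * C"])
    show "AE x in lborel. (\<lambda>n. f x * mollifier V k l (X n - x)) \<longlonglongrightarrow> f x * mollifier V k l (a - x)"
      by (intro AE_I2 tendsto_intros continuous_on_tendsto_compose[OF continuous_mollifier[of UNIV]] X) auto
  qed (use C integrable_bdd_supp[OF f] in \<open>auto simp: norm_mult intro!: mult_left_mono\<close>)
qed

lemma mollifier_deriv:
  "((\<lambda>t::real. mollifier V k l (z + of_real t * (if d then \<i> else 1))) has_vector_derivative
    mollifier V (if d then k else Suc k) (if d then Suc l else l) (z + of_real t * (if d then \<i> else 1))) (at t)"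
proof -
  have d: "(V k has_vector_derivative V (Suc k) x) (at x)" for k x
    using V by (simp add: bump_family_def has_real_derivative_iff_has_vector_derivative)
  have c: "((\<lambda>t. V k (x + t)) has_vector_derivative V (Suc k) (x + t)) (at t)" for k x t
  proof -
    have "((\<lambda>t. x + t) has_vector_derivative 1) (at t)"
      unfolding has_real_derivative_iff_has_vector_derivative[symmetric] by (auto intro!: derivative_eq_intros)
    from vector_diff_chain_at[OF this d] show ?thesis by (simp add: comp_def)
  qed
  show ?thesis
    by (cases d) (auto simp: mollifier_def simp del: of_real_mult intro!: has_vector_derivative_of_real
       DERIV_cmult DERIV_cmult_right c[unfolded has_real_derivative_iff_has_vector_derivative[symmetric]])
qed

text \<open>The derivative is put on the mollifier, so nothing but boundedness, measurability and
  bounded support is asked of \<open>f\<close>.\<close>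

lemma conv_mollifier_deriv:
  assumes f: "bdd_supp f"
  shows "((\<lambda>t::real. conv f (mollifier V k l) (z + of_real t * (if d then \<i> else 1))) has_vector_derivative
    conv f (mollifier V (if d then k else Suc k) (if d then Suc l else l)) z) (at 0)"
proof -
  have [measurable]: "f \<in> borel_measurable borel" using f by (simp add: bdd_supp_def)
  let ?e = "if d then \<i> else 1" and ?m = "mollifier V (if d then k else Suc k) (if d then Suc l else l)"
  obtain C where C: "C > 0" "\<And>z. cmod (?m z) \<le> C" using mollifier_bounded by metis
  have "((\<lambda>t. \<integral>w. f w * mollifier V k l (z + of_real t * ?e - w) \<partial>lborel) has_vector_derivative
      (\<integral>w. f w * ?m (z + of_real 0 * ?e - w) \<partial>lborel)) (at 0)"
  proof (rule has_vector_derivative_lebesgue_integral[where B="\<lambda>w. cmod (f w) * C"])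
    fix t w
    have "z + of_real t * ?e - w = (z - w) + of_real t * ?e" for t :: real by simp
    then show "((\<lambda>t. f w * mollifier V k l (z + of_real t * ?e - w)) has_vector_derivative
        f w * ?m (z + of_real t * ?e - w)) (at t)"
      by (simp only:) (intro has_vector_derivative_mult_right mollifier_deriv)
  qed (use C integrable_bdd_supp[OF f] integrable_conv_mollifier[OF f] in
      \<open>auto simp: norm_mult intro!: mult_left_mono\<close>)
  then show ?thesis by (simp add: conv_def)
qed

text \<open>Smoothness in the sense of \<open>smooth_fun\<close> reduces to this closure property of
  convolutions with the family.\<close>

lemma pderivs_conv_mollifier:
  assumes f: "bdd_supp f"
  shows "\<exists>k l. pderivs ds (conv f (mollifier V 0 0)) = conv f (mollifier V k l)"
proof (induction ds)
  case (Cons d ds)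
  then obtain k l where "pderivs ds (conv f (mollifier V 0 0)) = conv f (mollifier V k l)" by blast
  then have "pderivs (d # ds) (conv f (mollifier V 0 0)) = pdir d (conv f (mollifier V k l))" by simp
  also have "\<dots> = conv f (mollifier V (if d then k else Suc k) (if d then Suc l else l))"
    unfolding pdir_def using vector_derivative_at[OF conv_mollifier_deriv[OF f]] by auto
  finally show ?case by blast
qed auto

lemma conv_mollifier_supp:
  assumes "\<And>x. cmod x > R \<Longrightarrow> f x = 0" "cmod a > R + 2 * r"
  shows "conv f (mollifier V k l) a = 0"
proof -
  have "f w * mollifier V k l (a - w) = 0" for w
    using assms(1)[of w] mollifier_supp[of "a - w"] norm_triangle_sub[of a w] assms(2)
    by (cases "cmod w > R") auto
  then have "(\<lambda>w. f w * mollifier V k l (a - w)) = (\<lambda>_. 0)" by blast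
  then show ?thesis by (simp only: conv_def) simp
qed

lemma test_fun_conv_mollifier:
  assumes f: "bdd_supp f"
  shows "test_fun (conv f (mollifier V 0 0))"
  unfolding test_fun_def smooth_fun_def
proof (intro conjI allI)
  fix ds show "continuous_on UNIV (pderivs ds (conv f (mollifier V 0 0)))"
    using pderivs_conv_mollifier[OF f, of ds] continuous_conv_mollifier[OF f] by auto
next
  fix ds d z
  show "(\<lambda>t::real. pderivs ds (conv f (mollifier V 0 0)) (z + of_real t * (if d then \<i> else 1))) differentiable at 0"
    using pderivs_conv_mollifier[OF f, of ds] conv_mollifier_deriv[OF f]
    by (metis differentiableI_vector)
next
  obtain R where R: "\<And>x. cmod x > R \<Longrightarrow> f x = 0" using bdd_suppE[OF f] by metis
  show "bounded {z. conv f (mollifier V 0 0) z \<noteq> 0}"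
    using conv_mollifier_supp[OF R] by (auto simp: bounded_iff intro!: exI[of _ "R + 2 * r"] simp flip: not_less)
qed

lemma conv_mollifier_reflect:
  assumes [measurable]: "f \<in> borel_measurable borel"
  shows "conv f (mollifier V k l) a = (\<integral>w. f (a - w) * mollifier V k l w \<partial>lborel)"
  unfolding conv_def by (subst integral_lborel_reflect[of _ a, symmetric]) auto

lemma norm_conv_mollifier_le:
  assumes [measurable]: "f \<in> borel_measurable borel" and C: "\<And>x. cmod (f x) \<le> C"
  shows "cmod (conv f (mollifier V 0 0) a) \<le> C"
proof -
  have i: "integrable lborel (\<lambda>w. cmod (mollifier V 0 0 w))"
    using integrable_bdd_supp[OF bdd_supp_mollifier] by auto
  have "cmod (conv f (mollifier V 0 0) a) \<le> (\<integral>w. C * cmod (mollifier V 0 0 w) \<partial>lborel)"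
    unfolding conv_mollifier_reflect[OF assms(1)]
    by (rule Bochner_Integration.integral_norm_bound_integral)
      (use C i in \<open>auto simp: norm_mult intro!: mult_right_mono AE_I2 order_trans[OF mult_right_mono[OF C norm_ge_zero] abs_ge_self]
         Bochner_Integration.integrable_bound[OF integrable_mult_right[OF i, of C]]\<close>)
  then show ?thesis by (simp add: integral_norm_mollifier)
qed

text \<open>Since the mollifier is nonnegative with integral 1, the convolution is an average of
  values of \<open>f\<close> within distance 2 r of \<open>a\<close>.\<close>

lemma conv_mollifier_near:
  assumes [measurable]: "f \<in> borel_measurable borel" and C: "\<And>x. cmod (f x) \<le> C"
    and e: "\<And>w. cmod w \<le> 2 * r \<Longrightarrow> cmod (f (a - w) - f a) \<le> e"
  shows "cmod (conv f (mollifier V 0 0) a - f a) \<le> e"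
proof -
  have i: "integrable lborel (\<lambda>w. cmod (mollifier V 0 0 w))" "integrable lborel (mollifier V 0 0)"
    using integrable_bdd_supp[OF bdd_supp_mollifier] by auto
  have i2: "integrable lborel (\<lambda>w. f (a - w) * mollifier V 0 0 w)"
    by (rule Bochner_Integration.integrable_bound[OF integrable_mult_right[OF i(1), of C]])
      (auto simp: norm_mult intro!: AE_I2 order_trans[OF mult_right_mono[OF C norm_ge_zero] abs_ge_self])
  have "conv f (mollifier V 0 0) a - f a = (\<integral>w. f (a - w) * mollifier V 0 0 w \<partial>lborel) - (\<integral>w. f a * mollifier V 0 0 w \<partial>lborel)"
    by (simp add: conv_mollifier_reflect integral_mollifier)
  also have "\<dots> = (\<integral>w. (f (a - w) - f a) * mollifier V 0 0 w \<partial>lborel)"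
    using i i2 by (subst Bochner_Integration.integral_diff[symmetric]) (auto simp: left_diff_distrib)
  also have "cmod \<dots> \<le> (\<integral>w. e * cmod (mollifier V 0 0 w) \<partial>lborel)"
  proof (rule Bochner_Integration.integral_norm_bound_integral)
    show "integrable lborel (\<lambda>w. (f (a - w) - f a) * mollifier V 0 0 w)"
      using i i2 by (simp add: left_diff_distrib)
    fix w
    show "cmod ((f (a - w) - f a) * mollifier V 0 0 w) \<le> e * cmod (mollifier V 0 0 w)"
      using e[of w] mollifier_supp[of w 0 0] by (cases "cmod w \<le> 2 * r") (auto simp: norm_mult intro!: mult_right_mono)
  qed (use i in auto)
  also have "\<dots> = e" by (simp add: integral_norm_mollifier)
  finally show ?thesis .
qed

end

text \<open>Bundles what the extension of the covariance identity needs: domination by a common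
  bound on a common disc for the configurations, and transforms bounded by 1 and tending to 1 for
  the frequencies. Convergence is claimed only at points of continuity, since the limits will have
  jumps.\<close>

lemma mollifier_sequence:
  obtains \<eta> :: "nat \<Rightarrow> complex \<Rightarrow> complex" where
    "\<And>n. integrable lborel (\<eta> n)"
    "\<And>n f. bdd_supp f \<Longrightarrow> test_fun (conv f (\<eta> n))"
    "\<And>n f C a. f \<in> borel_measurable borel \<Longrightarrow> (\<And>x. cmod (f x) \<le> C) \<Longrightarrow> cmod (conv f (\<eta> n) a) \<le> C"
    "\<And>n f R a. (\<And>x. cmod x > R \<Longrightarrow> f x = 0) \<Longrightarrow> cmod a > R + 2 \<Longrightarrow> conv f (\<eta> n) a = 0"
    "\<And>f C a. f \<in> borel_measurable borel \<Longrightarrow> (\<And>x. cmod (f x) \<le> C) \<Longrightarrow> isCont f a \<Longrightarrow> (\<lambda>n. conv f (\<eta> n) a) \<longlonglongrightarrow> f a"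
    "\<And>n \<xi>. cmod (fourier (\<eta> n) \<xi>) \<le> 1"
    "\<And>\<xi>. (\<lambda>n. fourier (\<eta> n) \<xi>) \<longlonglongrightarrow> 1"
proof -
  have "\<forall>n. \<exists>V. bump_family V (1 / real (Suc n))" by (intro allI bump_family_exists) simp
  then obtain V where V: "\<And>n. bump_family (V n) (1 / real (Suc n))" by metis
  define \<eta> where "\<eta> n = mollifier (V n) 0 0" for n
  have pos: "1 / real (Suc n) > 0" for n by simp
  have lim: "(\<lambda>n. conv f (\<eta> n) a) \<longlonglongrightarrow> f a"
    if f: "f \<in> borel_measurable borel" and C: "\<And>x. cmod (f x) \<le> C" and cont: "isCont f a" for f C a
  proof (rule LIMSEQ_I)
    fix e :: real assume "e > 0"
    then obtain d where d: "d > 0" "\<And>x. dist x a < d \<Longrightarrow> dist (f x) (f a) < e / 2"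
      using cont unfolding continuous_at_eps_delta by (metis half_gt_zero)
    obtain N where N: "2 / d < real N" using reals_Archimedean2 by blast
    show "\<exists>no. \<forall>n\<ge>no. cmod (conv f (\<eta> n) a - f a) < e"
    proof (intro exI allI impI)
      fix n assume "n \<ge> N"
      have "cmod (conv f (\<eta> n) a - f a) \<le> e / 2"
        unfolding \<eta>_def
      proof (rule conv_mollifier_near[OF V pos f C])
        fix w :: complex assume "cmod w \<le> 2 * (1 / real (Suc n))"
        also have "\<dots> < d" using N \<open>n \<ge> N\<close> d(1) by (simp add: field_simps) (smt (verit) mult_left_mono of_nat_le_iff)
        finally show "cmod (f (a - w) - f a) \<le> e / 2"
          using d(2)[of "a - w"] by (simp add: dist_norm)
      qed
      then show "cmod (conv f (\<eta> n) a - f a) < e" using \<open>e > 0\<close> by simp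
    qed
  qed
  have int: "integrable lborel (\<eta> n)" for n
    unfolding \<eta>_def by (intro integrable_bdd_supp bdd_supp_mollifier[OF V pos])
  \<comment> \<open>The transform is a convolution with a character, evaluated at 0, so the bound
    and the limit for convolutions give those for the transforms.\<close>
  have fourier: "fourier (\<eta> n) \<xi> = conv (\<lambda>z. cis_inner \<xi> (- z)) (\<eta> n) 0" for n \<xi>
    unfolding \<eta>_def by (simp add: conv_mollifier_reflect[OF V pos] fourier_eq)
  show thesis
  proof (rule that[of \<eta>])
    fix n :: nat and f :: "complex \<Rightarrow> complex" and R :: real and a :: complex
    assume *: "\<And>x. cmod x > R \<Longrightarrow> f x = 0" "cmod a > R + 2"
    have "1 / real (Suc n) \<le> 1" by simp
    then have "cmod a > R + 2 * (1 / real (Suc n))" using *(2) by linarith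
    then show "conv f (\<eta> n) a = 0" unfolding \<eta>_def using conv_mollifier_supp[OF V pos, of R f] *(1) by blast
  next
    fix n \<xi> show "cmod (fourier (\<eta> n) \<xi>) \<le> 1"
      unfolding fourier unfolding \<eta>_def by (rule norm_conv_mollifier_le[OF V pos]) auto
  next
    fix \<xi>
    have "isCont (\<lambda>z. cis_inner \<xi> (- z)) 0"
      by (rule continuous_on_interior[of UNIV]) (auto intro!: continuous_intros)
    then show "(\<lambda>n. fourier (\<eta> n) \<xi>) \<longlonglongrightarrow> 1"
      unfolding fourier using lim[of "\<lambda>z. cis_inner \<xi> (- z)" 1 0] by simp
  next
    fix f :: "complex \<Rightarrow> complex" and C :: real and a :: complex
    assume "f \<in> borel_measurable borel" "\<And>x. cmod (f x) \<le> C" "isCont f a"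
    then show "(\<lambda>n. conv f (\<eta> n) a) \<longlonglongrightarrow> f a" by (rule lim)
  qed (use int test_fun_conv_mollifier[OF V pos] norm_conv_mollifier_le[OF V pos] in \<open>auto simp: \<eta>_def\<close>)
qed

subsection \<open>The Fourier transform of a disc\<close>

lemma AE_lborel_cmod_neq: "AE z in lborel. cmod z \<noteq> r"
proof -
  have "sphere (0::complex) r \<in> null_sets lborel"
    using negligible_sphere[of "0::complex" r] by (simp add: negligible_iff_null_sets null_sets_completion_iff)
  from AE_not_in[OF this] show ?thesis by simp
qed

text \<open>The phase sin is stationary at the two ends of the interval: end pieces of length eps
  are estimated trivially, and the rest, where cos >= eps / 2, is integrated by parts. The bounds 2
  and 4 fit the amplitudes that belong to \<open>disc_q\<close> and \<open>disc_p\<close>. The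
  exponent -1/3 is not optimal, but it is enough.\<close>

lemma oscillatory_integral_bound:
  fixes u u' :: "real \<Rightarrow> real"
  assumes deriv: "\<And>x. (u has_real_derivative u' x) (at x)" and cont: "continuous_on UNIV u'"
    and bu: "\<And>x. \<bar>u x\<bar> \<le> 2" and bu': "\<And>x. \<bar>u' x\<bar> \<le> 4" and s: "s \<ge> 1"
  shows "cmod (integral {-pi/2..pi/2} (\<lambda>x. of_real (u x) * exp (- \<i> * of_real (s * sin x)))) \<le> 100 * s powr (-1/3)"
proof -
  define e where "e x = exp (- \<i> * of_real (s * sin x))" for x
  define f where "f x = of_real (u x) * e x" for x
  \<comment> \<open>Balances the two costs: the end pieces contribute O(eps) and the integration by
    parts O(1 / (s eps^2)), which have the same order for this choice.\<close>
  define \<epsilon> where "\<epsilon> = s powr (-1/3)"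
  have \<epsilon>: "0 < \<epsilon>" "\<epsilon> \<le> 1" using s powr_mono[of "-1/3" 0 s] by (auto simp: \<epsilon>_def)
  have s_eps: "s * \<epsilon>\<^sup>2 = s powr (1/3)"
    using s by (simp add: \<epsilon>_def powr_add[symmetric] power2_eq_square powr_mult_base)
  have norm_e [simp]: "cmod (e x) = 1" for x by (simp add: e_def)
  have cont_u: "continuous_on A u" for A
    by (meson deriv DERIV_isCont continuous_at_imp_continuous_on)
  have cont_f: "continuous_on A f" for A
    unfolding f_def e_def by (intro continuous_intros cont_u)
  have f_le: "cmod (f x) \<le> 2" for x using bu[of x] by (simp add: f_def norm_mult)
  have int_f: "f integrable_on {a..b}" for a b
    by (intro integrable_continuous_interval cont_f)
  let ?a = "-pi/2 + \<epsilon>" and ?b = "pi/2 - \<epsilon>"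
  have ab: "-pi/2 \<le> ?a" "?a \<le> ?b" "?b \<le> pi/2" using \<epsilon> pi_gt3 by auto
  have split: "integral {-pi/2..pi/2} f = integral {-pi/2..?a} f + integral {?a..?b} f + integral {?b..pi/2} f"
    using ab by (simp add: Henstock_Kurzweil_Integration.integral_combine int_f)
  have small: "cmod (integral {x..y} f) \<le> 2 * (y - x)" if "x \<le> y" for x y
    using integral_bound[of x y f 2] that cont_f f_le by auto
  have cos_ge: "cos x \<ge> \<epsilon> / 2" if "x \<in> {?a..?b}" for x
  proof -
    have "cos (pi/2 - \<epsilon>) \<le> cos \<bar>x\<bar>"
      using that \<epsilon> pi_gt3 by (intro cos_monotone_0_pi_le) auto
    moreover have "cos (pi/2 - \<epsilon>) = sin \<epsilon>" by (simp add: cos_diff)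
    moreover have "sin 0 - 0 / 2 \<le> sin \<epsilon> - \<epsilon> / 2"
    proof (rule DERIV_nonneg_imp_nondecreasing[where f="\<lambda>x. sin x - x / 2"])
      fix x assume x: "0 \<le> x" "x \<le> \<epsilon>"
      have "cos (pi / 3) \<le> cos x"
        using x \<epsilon> pi_gt3 by (intro cos_monotone_0_pi_le) auto
      then show "\<exists>y. ((\<lambda>x. sin x - x / 2) has_real_derivative y) (at x) \<and> 0 \<le> y"
        by (intro exI[of _ "cos x - 1 / 2"]) (auto intro!: derivative_eq_intros simp: cos_60)
    qed (use \<epsilon> in auto)
    ultimately show ?thesis by (simp add: abs_if split: if_splits)
  qed
  \<comment> \<open>Division by the derivative of the phase: \<open>F\<close> differentiates to the
    integrand \<open>f\<close> plus a term \<open>h\<close> of order 1 / (s eps^2).\<close>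
  define F where "F x = of_real (u x / cos x) * e x * (\<i> / of_real s)" for x
  define h where "h x = of_real ((u' x * cos x + u x * sin x) / (cos x)\<^sup>2) * e x * (\<i> / of_real s)" for x
  have F': "(F has_vector_derivative (f x + h x)) (at x within {?a..?b})" if x: "x \<in> {?a..?b}" for x
  proof -
    have c: "cos x \<noteq> 0" using cos_ge[OF x] \<epsilon> by auto
    have 1: "((\<lambda>x. of_real (u x / cos x) :: complex) has_vector_derivative of_real ((u' x * cos x + u x * sin x) / (cos x)\<^sup>2)) (at x within {?a..?b})"
      by (rule has_vector_derivative_of_real, rule DERIV_subset[where s=UNIV])
        (use c in \<open>auto intro!: derivative_eq_intros deriv simp: power2_eq_square\<close>)
    have 2: "(e has_vector_derivative (- \<i> * of_real (s * cos x) * e x)) (at x within {?a..?b})"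
    proof -
      have "((\<lambda>z. exp (- \<i> * of_real s * sin z)) has_field_derivative (exp (- \<i> * of_real s * sin (of_real x)) * (- \<i> * of_real s * cos (of_real x)))) (at (of_real x))"
        by (auto intro!: derivative_eq_intros)
      from has_vector_derivative_real_field[OF this]
      show ?thesis by (simp add: e_def[abs_def] sin_of_real cos_of_real ac_simps has_vector_derivative_at_within)
    qed
    have "(F has_vector_derivative ((of_real (u x / cos x) * (- \<i> * of_real (s * cos x) * e x) +
        of_real ((u' x * cos x + u x * sin x) / (cos x)\<^sup>2) * e x) * (\<i> / of_real s))) (at x within {?a..?b})"
      unfolding F_def by (intro has_vector_derivative_mult_left has_vector_derivative_mult 1 2)
    also have "((of_real (u x / cos x) * (- \<i> * of_real (s * cos x) * e x) +
        of_real ((u' x * cos x + u x * sin x) / (cos x)\<^sup>2) * e x) * (\<i> / of_real s)) = f x + h x"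
      using c s by (simp add: f_def h_def field_simps)
    finally show ?thesis .
  qed
  have hi: "((\<lambda>x. f x + h x) has_integral (F ?b - F ?a)) {?a..?b}"
    by (rule fundamental_theorem_of_calculus[OF ab(2) F'])
  have "((\<lambda>x. (f x + h x) - f x) has_integral ((F ?b - F ?a) - integral {?a..?b} f)) {?a..?b}"
    by (intro has_integral_diff hi integrable_integral int_f)
  then have hh: "(h has_integral ((F ?b - F ?a) - integral {?a..?b} f)) {?a..?b}" by simp
  have h_le: "cmod (h x) \<le> (8 / \<epsilon> + 8 / \<epsilon>\<^sup>2) / s" if x: "x \<in> {?a..?b}" for x
  proof -
    have c: "cos x \<ge> \<epsilon> / 2" "cos x > 0" using cos_ge[OF x] \<epsilon> by auto
    have "(u' x * cos x + u x * sin x) / (cos x)\<^sup>2 = u' x / cos x + u x * sin x / (cos x)\<^sup>2"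
      using c by (simp add: field_simps power2_eq_square)
    also have "\<bar>\<dots>\<bar> \<le> \<bar>u' x\<bar> / cos x + \<bar>u x\<bar> * \<bar>sin x\<bar> / (cos x)\<^sup>2"
      using c by (intro order_trans[OF abs_triangle_ineq]) (simp add: abs_mult)
    also have "\<dots> \<le> 4 / (\<epsilon> / 2) + 2 * 1 / (\<epsilon> / 2)\<^sup>2"
      using c \<epsilon> bu[of x] bu'[of x] by (intro add_mono frac_le mult_mono power_mono) auto
    also have "\<dots> = 8 / \<epsilon> + 8 / \<epsilon>\<^sup>2" using \<epsilon> by (simp add: field_simps power2_eq_square)
    finally have "\<bar>(u' x * cos x + u x * sin x) / (cos x)\<^sup>2\<bar> / s \<le> (8 / \<epsilon> + 8 / \<epsilon>\<^sup>2) / s"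
      using s by (intro divide_right_mono) auto
    moreover have "cmod (h x) = \<bar>(u' x * cos x + u x * sin x) / (cos x)\<^sup>2\<bar> / s"
      using s unfolding h_def norm_mult norm_of_real norm_e norm_divide by simp
    ultimately show ?thesis by simp
  qed
  have "cmod ((F ?b - F ?a) - integral {?a..?b} f) \<le> (8 / \<epsilon> + 8 / \<epsilon>\<^sup>2) / s * (?b - ?a)"
    using has_integral_bound[OF _ hh[folded cbox_interval], of "(8 / \<epsilon> + 8 / \<epsilon>\<^sup>2) / s"] h_le ab \<epsilon> s by auto
  also have "\<dots> \<le> (16 / \<epsilon>\<^sup>2) / s * 4"
  proof (intro mult_mono divide_right_mono)
    have "8 / \<epsilon> \<le> 8 / \<epsilon>\<^sup>2" using \<epsilon> power_decreasing[of 1 2 \<epsilon>] by (intro divide_left_mono) auto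
    then show "8 / \<epsilon> + 8 / \<epsilon>\<^sup>2 \<le> 16 / \<epsilon>\<^sup>2" by simp
  qed (use s \<epsilon> pi_less_4 ab in auto)
  finally have "cmod (integral {?a..?b} f - (F ?b - F ?a)) \<le> 64 / (s * \<epsilon>\<^sup>2)"
    by (simp add: norm_minus_commute mult.commute)
  have F_le: "cmod (F x) \<le> 4 / (s * \<epsilon>\<^sup>2)" if x: "x \<in> {?a..?b}" for x
  proof -
    have c: "cos x \<ge> \<epsilon> / 2" "cos x > 0" using cos_ge[OF x] \<epsilon> by auto
    have "cmod (F x) = \<bar>u x\<bar> / cos x / s" using c s by (simp add: F_def norm_mult norm_divide)
    also have "\<dots> \<le> 2 / (\<epsilon> / 2) / s" using c \<epsilon> bu[of x] s by (intro divide_right_mono frac_le) auto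
    also have "\<dots> = 4 / (s * \<epsilon>)" by simp
    also have "\<dots> \<le> 4 / (s * \<epsilon>\<^sup>2)"
      using \<epsilon> power_decreasing[of 1 2 \<epsilon>] s by (intro divide_left_mono mult_left_mono) auto
    finally show ?thesis .
  qed
  \<comment> \<open>72 = 64 from the remainder \<open>h\<close> plus 4 from each of the two boundary
    values of \<open>F\<close>.\<close>
  have "cmod (integral {?a..?b} f) \<le> 72 / (s * \<epsilon>\<^sup>2)"
  proof -
    have "?a \<in> {?a..?b}" "?b \<in> {?a..?b}" using ab by auto
    note F_le[OF this(1)] F_le[OF this(2)]
    moreover note \<open>cmod (integral {?a..?b} f - (F ?b - F ?a)) \<le> 64 / (s * \<epsilon>\<^sup>2)\<close>
    moreover have "x \<le> 72 * K" if "x \<le> y + z" "y \<le> v + w" "v \<le> 4 * K" "w \<le> 4 * K" "z \<le> 64 * K" for x y z v w K :: real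
      using that by linarith
    note this[OF norm_triangle_sub[of "integral {?a..?b} f" "F ?b - F ?a"] norm_triangle_ineq4[of "F ?b" "F ?a"], of "1 / (s * \<epsilon>\<^sup>2)"]
    ultimately show ?thesis by simp
  qed
  also have "72 / (s * \<epsilon>\<^sup>2) = 72 * \<epsilon>"
    unfolding s_eps using s by (simp add: \<epsilon>_def powr_minus_divide)
  finally have "cmod (integral {-pi/2..pi/2} f) \<le> 72 * \<epsilon> + 4 * \<epsilon>"
    unfolding split using small[of "-pi/2" ?a] small[of ?b "pi/2"] ab
    by (intro order_trans[OF norm_triangle_ineq] order_trans[OF add_right_mono[OF norm_triangle_ineq]]) auto
  then have "cmod (integral {-pi/2..pi/2} f) \<le> 100 * \<epsilon>" using \<epsilon>(1) by linarith
  then show ?thesis by (simp only: f_def[abs_def] e_def[abs_def] \<epsilon>_def)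
qed

text \<open>The additional factor cos x is the derivative of sin x, so one integration by parts
  gains 1 / s; \<open>w\<close> vanishes at both ends and leaves no boundary term.\<close>

lemma oscillatory_integral_by_parts:
  fixes w u u' :: "real \<Rightarrow> real"
  assumes dw: "\<And>x. (w has_real_derivative u x) (at x)" and w0: "w (- (pi/2)) = 0" "w (pi/2) = 0"
    and du: "\<And>x. (u has_real_derivative u' x) (at x)" and cont: "continuous_on UNIV u'"
    and bu: "\<And>x. \<bar>u x\<bar> \<le> 2" and bu': "\<And>x. \<bar>u' x\<bar> \<le> 4" and s: "s \<ge> 1"
  shows "cmod (integral {-pi/2..pi/2} (\<lambda>x. of_real (w x * cos x) * exp (- \<i> * of_real (s * sin x)))) \<le> 100 * s powr (-4/3)"
proof -
  define e where "e x = exp (- \<i> * of_real (s * sin x))" for x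
  define F where "F x = of_real (w x) * e x * (\<i> / of_real s)" for x
  have cont_u: "continuous_on A u" "continuous_on A w" for A
    by (meson du dw DERIV_isCont continuous_at_imp_continuous_on)+
  have "(F has_vector_derivative (of_real (w x * cos x) * e x + of_real (u x) * e x * (\<i> / of_real s))) (at x within {-pi/2..pi/2})" for x
  proof -
    have 1: "((\<lambda>x. of_real (w x) :: complex) has_vector_derivative of_real (u x)) (at x within {-pi/2..pi/2})"
      by (rule has_vector_derivative_of_real, rule DERIV_subset[where s=UNIV]) (use dw in auto)
    have 2: "(e has_vector_derivative (- \<i> * of_real (s * cos x) * e x)) (at x within {-pi/2..pi/2})"
    proof -
      have "((\<lambda>z. exp (- \<i> * of_real s * sin z)) has_field_derivative (exp (- \<i> * of_real s * sin (of_real x)) * (- \<i> * of_real s * cos (of_real x)))) (at (of_real x))"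
        by (auto intro!: derivative_eq_intros)
      from has_vector_derivative_real_field[OF this]
      show ?thesis by (simp add: e_def[abs_def] sin_of_real cos_of_real ac_simps has_vector_derivative_at_within)
    qed
    have "(F has_vector_derivative ((of_real (w x) * (- \<i> * of_real (s * cos x) * e x) + of_real (u x) * e x) * (\<i> / of_real s))) (at x within {-pi/2..pi/2})"
      unfolding F_def by (intro has_vector_derivative_mult_left has_vector_derivative_mult 1 2)
    also have "((of_real (w x) * (- \<i> * of_real (s * cos x) * e x) + of_real (u x) * e x) * (\<i> / of_real s)) =
        of_real (w x * cos x) * e x + of_real (u x) * e x * (\<i> / of_real s)"
      using s by (simp add: field_simps)
    finally show ?thesis .
  qed
  then have "((\<lambda>x. of_real (w x * cos x) * e x + of_real (u x) * e x * (\<i> / of_real s)) has_integral (F (pi/2) - F (-pi/2))) {-pi/2..pi/2}"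
    by (intro fundamental_theorem_of_calculus) auto
  then have 0: "integral {-pi/2..pi/2} (\<lambda>x. of_real (w x * cos x) * e x + of_real (u x) * e x * (\<i> / of_real s)) = 0"
    by (simp add: integral_unique F_def w0)
  have "integral {-pi/2..pi/2} (\<lambda>x. of_real (w x * cos x) * e x) + integral {-pi/2..pi/2} (\<lambda>x. of_real (u x) * e x * (\<i> / of_real s)) = 0"
    unfolding 0[symmetric] e_def
    by (rule Henstock_Kurzweil_Integration.integral_add[symmetric]; intro integrable_continuous_interval continuous_intros cont_u) (use s in auto)
  then have "integral {-pi/2..pi/2} (\<lambda>x. of_real (w x * cos x) * e x) = - (integral {-pi/2..pi/2} (\<lambda>x. of_real (u x) * e x) * (\<i> / of_real s))"
    by (simp add: eq_neg_iff_add_eq_0)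
  then have "cmod (integral {-pi/2..pi/2} (\<lambda>x. of_real (w x * cos x) * e x)) = cmod (integral {-pi/2..pi/2} (\<lambda>x. of_real (u x) * e x)) / s"
    using s by (simp add: norm_mult norm_divide)
  also have "\<dots> \<le> 100 * s powr (-1/3) / s"
    unfolding e_def using s by (intro divide_right_mono oscillatory_integral_bound[OF du cont bu bu']) auto
  also have "\<dots> = 100 * s powr (-4/3)"
    using s powr_diff[of s "-1/3" 1] by simp
  finally show ?thesis by (simp add: e_def)
qed


section \<open>Transforms of discs and their decay\<close>

definition disc :: "real \<Rightarrow> complex \<Rightarrow> complex" where
  "disc R z = indicator (cball 0 R) z"

text \<open>Up to normalisation, \<open>disc_q\<close> and \<open>disc_p\<close> are the Bessel functions
  \<open>J\<^sub>1(2 \<pi> t) / t\<close> and \<open>J\<^sub>2(2 \<pi> t) / t\<close>.\<close>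
definition disc_q :: "real \<Rightarrow> complex" where
  "disc_q t = fourier (disc 1) (of_real t)"

definition disc_p :: "real \<Rightarrow> complex" where
  "disc_p t = fourier (\<lambda>z. cnj z * disc 1 z) (of_real t)"

lemma measurable_disc [measurable]: "disc R \<in> borel_measurable borel"
  unfolding disc_def[abs_def] by (rule borel_measurable_indicator) simp

lemma measurable_cnj [measurable (raw)]: "f \<in> borel_measurable M \<Longrightarrow> (\<lambda>x. cnj (f x)) \<in> borel_measurable M"
  by (rule borel_measurable_continuous_on[of cnj]) (intro continuous_intros)

lemma bdd_supp_mult_disc:
  assumes [measurable]: "f \<in> borel_measurable borel" and C: "\<And>z. cmod z \<le> R \<Longrightarrow> cmod (f z) \<le> C"
  shows "bdd_supp (\<lambda>z. f z * disc R z)"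
  by (rule bdd_suppI[where C="max C 0" and r=R]) (use C in \<open>auto simp: disc_def indicator_def le_max_iff_disj\<close>)

lemma bdd_supp_disc: "bdd_supp (disc R)"
  using bdd_supp_mult_disc[of "\<lambda>_. 1" R 1] by simp

lemma bdd_supp_cnj_disc: "bdd_supp (\<lambda>z. cnj z * disc R z)"
  by (rule bdd_supp_mult_disc[where C=R]) auto

lemma disc_Complex:
  assumes "R \<ge> 0"
  shows "disc R (Complex x y) = (if \<bar>x\<bar> \<le> R then indicator {- sqrt (R\<^sup>2 - x\<^sup>2)..sqrt (R\<^sup>2 - x\<^sup>2)} y else 0)"
proof -
  have "cmod (Complex x y) \<le> R \<longleftrightarrow> x\<^sup>2 + y\<^sup>2 \<le> R\<^sup>2"
    using assms cmod_power2[of "Complex x y"] abs_le_square_iff[of "cmod (Complex x y)" R] by simp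
  moreover have "x\<^sup>2 + y\<^sup>2 \<le> R\<^sup>2 \<longleftrightarrow> \<bar>x\<bar> \<le> R \<and> \<bar>y\<bar> \<le> sqrt (R\<^sup>2 - x\<^sup>2)"
  proof -
    have "\<bar>x\<bar> \<le> R" if "x\<^sup>2 + y\<^sup>2 \<le> R\<^sup>2"
      using that assms abs_le_square_iff[of x R] by (smt (verit) zero_le_power2)
    moreover have "x\<^sup>2 + y\<^sup>2 \<le> R\<^sup>2 \<longleftrightarrow> \<bar>y\<bar> \<le> sqrt (R\<^sup>2 - x\<^sup>2)"
      using real_sqrt_le_iff[of "y\<^sup>2" "R\<^sup>2 - x\<^sup>2"] by (auto simp: algebra_simps)
    ultimately show ?thesis by blast
  qed
  ultimately show ?thesis by (auto simp: disc_def indicator_def abs_le_iff)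
qed

lemma cis_inner_of_real: "cis_inner (of_real t) (Complex x y) = exp (- \<i> * of_real (2 * pi * t * x))"
  by (simp add: cis_inner_def inner_complex_def mult_ac)

lemma integral_disc_slice:
  assumes "R \<ge> 0"
  shows "(\<integral>y. disc R (Complex x y) \<partial>lborel) = (if \<bar>x\<bar> \<le> R then of_real (2 * sqrt (R\<^sup>2 - x\<^sup>2)) else 0)"
proof (cases "\<bar>x\<bar> \<le> R")
  case True
  then have "0 \<le> R\<^sup>2 - x\<^sup>2" using assms abs_le_square_iff[of x R] by simp
  then have "(\<integral>y. of_real (indicat_real {- sqrt (R\<^sup>2 - x\<^sup>2)..sqrt (R\<^sup>2 - x\<^sup>2)} y) \<partial>lborel) = (of_real (2 * sqrt (R\<^sup>2 - x\<^sup>2)) :: complex)"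
    by (subst integral_complex_of_real) simp
  moreover have "(\<lambda>y. disc R (Complex x y)) = (\<lambda>y. of_real (indicat_real {- sqrt (R\<^sup>2 - x\<^sup>2)..sqrt (R\<^sup>2 - x\<^sup>2)} y))"
    using True assms by (auto simp: disc_Complex indicator_def)
  ultimately show ?thesis using True by simp
qed (use assms in \<open>simp add: disc_Complex\<close>)

lemma integral_odd:
  fixes f :: "real \<Rightarrow> complex"
  assumes "\<And>y. f (- y) = - f y" shows "(\<integral>y. f y \<partial>lborel) = 0"
proof -
  have "(\<integral>y. f y \<partial>lborel) = (\<integral>y. f (- y) \<partial>lborel)"
    using lborel_integral_real_affine[of "-1" f 0] by simp
  also have "\<dots> = - (\<integral>y. f y \<partial>lborel)" by (simp add: assms)
  finally show ?thesis by simp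
qed

lemma integral_Im_disc_slice: "R \<ge> 0 \<Longrightarrow> (\<integral>y. of_real y * disc R (Complex x y) \<partial>lborel) = 0"
  by (rule integral_odd) (auto simp: disc_Complex indicator_def)

lemma integrable_disc_slice: "R \<ge> 0 \<Longrightarrow> integrable lborel (\<lambda>y. disc R (Complex x y))"
  and integrable_Im_disc_slice: "R \<ge> 0 \<Longrightarrow> integrable lborel (\<lambda>y. of_real y * disc R (Complex x y))"
proof -
  assume R: "R \<ge> 0"
  have *: "integrable lborel (\<lambda>y. indicator {a..b} y *\<^sub>R (of_real y ^ k :: complex))" for a b :: real and k
    by (rule borel_integrable_compact) (auto intro!: continuous_intros)
  have "integrable lborel (\<lambda>y. of_real y ^ k * disc R (Complex x y))" for k
  proof (cases "\<bar>x\<bar> \<le> R")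
    case True
    then have "(\<lambda>y. of_real y ^ k * disc R (Complex x y)) =
        (\<lambda>y. indicator {- sqrt (R\<^sup>2 - x\<^sup>2)..sqrt (R\<^sup>2 - x\<^sup>2)} y *\<^sub>R (of_real y ^ k))"
      using R by (auto simp: disc_Complex fun_eq_iff indicator_def)
    then show ?thesis using * by simp
  qed (use R in \<open>simp add: disc_Complex\<close>)
  from this[of 0] this[of 1] show "integrable lborel (\<lambda>y. disc R (Complex x y))"
    "integrable lborel (\<lambda>y. of_real y * disc R (Complex x y))" by simp_all
qed

text \<open>The substitution \<open>x = sin \<theta>\<close> removes the singularity of \<open>sqrt (1 - x\<^sup>2)\<close> at the end points.\<close>
lemma disc_transform_trig:
  fixes h :: "real \<Rightarrow> real"
  assumes cont: "continuous_on UNIV h"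
  shows "(\<integral>x. (of_real (h x) * (if \<bar>x\<bar> \<le> 1 then of_real (2 * sqrt (1 - x\<^sup>2)) else 0)) * exp (- \<i> * of_real (s * x)) \<partial>lborel)
    = integral {-pi/2..pi/2} (\<lambda>x. of_real ((2 * h (sin x) * cos x) * cos x) * exp (- \<i> * of_real (s * sin x)))"
proof -
  define f where "f x = of_real (h x * (2 * sqrt (1 - x\<^sup>2))) * exp (- \<i> * of_real (s * x))" for x
  have cf: "continuous_on {-1..1} f"
    unfolding f_def by (intro continuous_intros continuous_on_subset[OF cont]) auto
  have sub: "((\<lambda>x. cos x *\<^sub>R f (sin x)) has_integral (integral {sin (-pi/2)..sin (pi/2)} f)) {-pi/2..pi/2}"
    by (rule has_integral_substitution[where c="-1" and d=1])
      (use cf in \<open>auto intro!: derivative_eq_intros simp: has_real_derivative_iff_has_vector_derivative[symmetric]\<close>)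
  have "integral {-1..1} f = integral {-pi/2..pi/2} (\<lambda>x. cos x *\<^sub>R f (sin x))"
    using integral_unique[OF sub] by simp
  also have "\<dots> = integral {-pi/2..pi/2} (\<lambda>x. of_real ((2 * h (sin x) * cos x) * cos x) * exp (- \<i> * of_real (s * sin x)))"
  proof (rule integral_cong)
    fix x assume "x \<in> {-pi/2..pi/2}"
    then have "cos x \<ge> 0" by (intro cos_ge_zero) auto
    then have "sqrt (1 - (sin x)\<^sup>2) = cos x" by (simp add: cos_squared_eq[symmetric])
    then show "cos x *\<^sub>R f (sin x) = of_real ((2 * h (sin x) * cos x) * cos x) * exp (- \<i> * of_real (s * sin x))"
      by (simp add: f_def scaleR_conv_of_real)
  qed
  finally have 1: "integral {-1..1} f = \<dots>" .
  have "set_integrable lborel {-1..1} f"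
    unfolding set_integrable_def by (rule borel_integrable_compact) (use cf in auto)
  from set_borel_integral_eq_integral(2)[OF this]
  have "(\<integral>x. indicator {-1..1} x *\<^sub>R f x \<partial>lborel) = integral {-1..1} f"
    by (simp add: set_lebesgue_integral_def)
  moreover have "(of_real (h x) * (if \<bar>x\<bar> \<le> 1 then of_real (2 * sqrt (1 - x\<^sup>2)) else 0)) * exp (- \<i> * of_real (s * x))
      = indicator {-1..1} x *\<^sub>R f x" for x
    by (auto simp: f_def indicator_def)
  ultimately show ?thesis using 1 by simp
qed

text \<open>One cosine is half the length of the slice at abscissa sin x, the other is the Jacobian
  of the substitution.\<close>

lemma disc_q_trig: "disc_q t = integral {-pi/2..pi/2} (\<lambda>x. of_real ((2 * cos x) * cos x) * exp (- \<i> * of_real (2 * pi * t * sin x)))"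
proof -
  have "disc_q t = (\<integral>x. \<integral>y. cis_inner (of_real t) (Complex x y) * disc 1 (Complex x y) \<partial>lborel \<partial>lborel)"
    unfolding disc_q_def fourier_eq
    by (rule integral_lborel_complex) (intro integrable_cis_inner_mult integrable_bdd_supp bdd_supp_disc)
  also have "\<dots> = (\<integral>x. (of_real 1 * (if \<bar>x\<bar> \<le> 1 then of_real (2 * sqrt (1 - x\<^sup>2)) else 0)) * exp (- \<i> * of_real (2 * pi * t * x)) \<partial>lborel)"
    by (simp only: cis_inner_of_real integral_mult_right_zero integral_disc_slice[of 1, simplified]) (simp add: mult.commute cong: if_cong)
  finally show ?thesis using disc_transform_trig[of "\<lambda>_. 1" "2 * pi * t"] by simp
qed

text \<open>On a slice symmetric about the real axis the imaginary part of the weight is odd and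
  integrates to 0, so \<open>cnj\<close> may be replaced by \<open>Re\<close>.\<close>

lemma disc_p_slice:
  "(\<integral>y. cis_inner (of_real t) (Complex x y) * (cnj (Complex x y) * disc 1 (Complex x y)) \<partial>lborel) =
   (\<integral>y. cis_inner (of_real t) (Complex x y) * (of_real x * disc 1 (Complex x y)) \<partial>lborel)"
proof -
  have "(\<integral>y. cnj (Complex x y) * disc 1 (Complex x y) \<partial>lborel) =
     (\<integral>y. of_real x * disc 1 (Complex x y) - \<i> * (of_real y * disc 1 (Complex x y)) \<partial>lborel)"
    by (rule Bochner_Integration.integral_cong) (auto simp: complex_eq_iff)
  also have "\<dots> = (\<integral>y. of_real x * disc 1 (Complex x y) \<partial>lborel)"
    by (subst Bochner_Integration.integral_diff)
      (auto intro!: integrable_mult_right integrable_disc_slice integrable_Im_disc_slice simp: integral_Im_disc_slice)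
  finally show ?thesis by (simp only: cis_inner_of_real integral_mult_right_zero)
qed

lemma disc_p_eq_Re: "disc_p t = fourier (\<lambda>z. of_real (Re z) * disc 1 z) (of_real t)"
proof -
  have "integrable lborel (\<lambda>z. cis_inner (of_real t) z * (cnj z * disc 1 z))"
    by (intro integrable_cis_inner_mult integrable_bdd_supp bdd_supp_cnj_disc)
  moreover have "integrable lborel (\<lambda>z. cis_inner (of_real t) z * (of_real (Re z) * disc 1 z))"
    by (intro integrable_cis_inner_mult integrable_bdd_supp bdd_supp_mult_disc[where C=1])
      (auto intro: order_trans[OF abs_Re_le_cmod])
  ultimately show ?thesis
    unfolding disc_p_def fourier_eq by (simp add: integral_lborel_complex disc_p_slice)
qed

lemma disc_p_trig: "disc_p t = integral {-pi/2..pi/2} (\<lambda>x. of_real ((2 * sin x * cos x) * cos x) * exp (- \<i> * of_real (2 * pi * t * sin x)))"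
proof -
  have "disc_p t = (\<integral>x. \<integral>y. cis_inner (of_real t) (Complex x y) * (cnj (Complex x y) * disc 1 (Complex x y)) \<partial>lborel \<partial>lborel)"
    unfolding disc_p_def fourier_eq
    by (rule integral_lborel_complex) (intro integrable_cis_inner_mult integrable_bdd_supp bdd_supp_cnj_disc)
  also have "\<dots> = (\<integral>x. (of_real x * (if \<bar>x\<bar> \<le> 1 then of_real (2 * sqrt (1 - x\<^sup>2)) else 0)) * exp (- \<i> * of_real (2 * pi * t * x)) \<partial>lborel)"
    unfolding disc_p_slice
    by (simp only: cis_inner_of_real integral_mult_right_zero integral_disc_slice[of 1, simplified]) (simp add: mult.commute cong: if_cong)
  finally show ?thesis using disc_transform_trig[of "\<lambda>x. x" "2 * pi * t"] by (simp add: continuous_on_id)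
qed

text \<open>For t >= 1 the amplitudes 2 cos x and 2 sin x cos x are fed into the oscillatory
  estimate; for t < 1 the trivial bound \<open>C\<close> lies below
  \<open>C * t powr (-4/3)\<close>. The sharp rate is t^(-3/2), but the later arguments ask only for
  an exponent below -1.\<close>

lemma disc_q_p_decay:
  obtains C where "C > 0" "\<And>t. cmod (disc_q t) \<le> C" "\<And>t. cmod (disc_p t) \<le> C"
    "\<And>t. t > 0 \<Longrightarrow> cmod (disc_q t) \<le> C * t powr (-4/3)" "\<And>t. t > 0 \<Longrightarrow> cmod (disc_p t) \<le> C * t powr (-4/3)"
proof -
  define C where "C = max 100 (max (\<integral>z. cmod (disc 1 z) \<partial>lborel) (\<integral>z. cmod (cnj z * disc 1 z) \<partial>lborel))"
  have C: "C \<ge> 100" "cmod (disc_q t) \<le> C" "cmod (disc_p t) \<le> C" for t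
    unfolding C_def disc_q_def disc_p_def
    using norm_fourier_le[of "disc 1" "of_real t"] norm_fourier_le[of "\<lambda>z. cnj z * disc 1 z" "of_real t"] by auto
  have small: "C \<le> C * t powr (-4/3)" if "0 < t" "t < 1" for t
    using C(1) that powr_mono2'[of "-4/3" t 1] by simp
  have large: "100 * (2 * pi * t) powr (-4/3) \<le> C * t powr (-4/3)" if "t \<ge> 1" for t
  proof (rule mult_mono)
    show "(2 * pi * t) powr (-4/3) \<le> t powr (-4/3)"
      by (rule powr_mono2') (use that pi_gt3 in \<open>auto simp: mult_le_cancel_right1\<close>)
  qed (use C in auto)
  have s: "2 * pi * t \<ge> 1" if "t \<ge> 1" for t using that pi_gt3 by (smt (verit) mult_le_cancel_left1)
  have q: "cmod (disc_q t) \<le> C * t powr (-4/3)" if t: "t \<ge> 1" for t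
  proof -
    have "cmod (disc_q t) \<le> 100 * (2 * pi * t) powr (-4/3)"
      unfolding disc_q_trig
      by (rule oscillatory_integral_by_parts[where u="\<lambda>x. - 2 * sin x" and u'="\<lambda>x. - 2 * cos x"])
        (use s[OF t] abs_sin_le_one abs_cos_le_one in \<open>auto intro!: derivative_eq_intros continuous_intros
          intro: order_trans[OF abs_cos_le_one] simp: abs_mult\<close>)
    then show ?thesis using large[OF t] by linarith
  qed
  have p: "cmod (disc_p t) \<le> C * t powr (-4/3)" if t: "t \<ge> 1" for t
  proof -
    have "cmod (disc_p t) \<le> 100 * (2 * pi * t) powr (-4/3)"
      unfolding disc_p_trig
    proof (rule oscillatory_integral_by_parts[where u="\<lambda>x. 2 * cos (2 * x)" and u'="\<lambda>x. - 4 * sin (2 * x)"])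
      show "((\<lambda>x. 2 * sin x * cos x) has_real_derivative 2 * cos (2 * x)) (at x)" for x :: real
        by (auto intro!: derivative_eq_intros simp: cos_double power2_eq_square)
      show "((\<lambda>x. 2 * cos (2 * x)) has_real_derivative - 4 * sin (2 * x)) (at x)" for x :: real
        by (auto intro!: derivative_eq_intros)
    qed (use s[OF t] in \<open>auto intro!: continuous_intros simp: abs_mult\<close>)
    then show ?thesis using large[OF t] by linarith
  qed
  show thesis
  proof (rule that[of C])
    fix t :: real assume "t > 0"
    then show "cmod (disc_q t) \<le> C * t powr (-4/3)" "cmod (disc_p t) \<le> C * t powr (-4/3)"
      using small[of t] C(2,3)[of t] p[of t] q[of t] by (cases "t \<ge> 1"; linarith)+
  qed (use C in auto)
qed

lemma disc_q_0: "disc_q 0 = of_real pi"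
proof -
  have "(\<integral>z. of_real (indicat_real (cball (0::complex) 1) z) \<partial>lborel) = (of_real pi :: complex)"
    by (subst integral_complex_of_real) (simp add: emeasure_lborel_cball_complex measure_def)
  moreover have "disc 1 = (\<lambda>z. of_real (indicat_real (cball 0 1) z))" by (auto simp: disc_def indicator_def)
  ultimately show ?thesis by (simp add: disc_q_def fourier_eq)
qed

lemma disc_p_0: "disc_p 0 = 0"
proof -
  have "disc 1 (- z) = disc 1 z" for z by (simp add: disc_def indicator_def)
  then show ?thesis
    using integral_lborel_complex_mult[of "\<lambda>z. cnj z * disc 1 z" "-1"] by (simp add: disc_p_def fourier_0)
qed

text \<open>Differentiating the character brings down the factor Re z. This makes
  \<open>disc_p\<close> an exact derivative and allows the radial integral for
  \<open>disc_kernel\<close> to be computed.\<close>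

lemma disc_q_deriv: "(disc_q has_vector_derivative (- 2 * of_real pi * \<i> * disc_p t)) (at t)"
proof -
  have "((\<lambda>t. \<integral>z. cis_inner (of_real t) z * disc 1 z \<partial>lborel) has_vector_derivative
      (\<integral>z. - 2 * of_real pi * \<i> * of_real (Re z) * cis_inner (of_real t) z * disc 1 z \<partial>lborel)) (at t)"
  proof (rule has_vector_derivative_lebesgue_integral[where B="\<lambda>z. 2 * pi * cmod (disc 1 z)"])
    fix t :: real and z :: complex
    have "((\<lambda>w. exp (- 2 * of_real pi * \<i> * (w * of_real (Re z))) * disc 1 z) has_field_derivative
       (- 2 * of_real pi * \<i> * of_real (Re z)) * exp (- 2 * of_real pi * \<i> * (of_real t * of_real (Re z))) * disc 1 z) (at (of_real t))"
      by (auto intro!: derivative_eq_intros)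
    from has_vector_derivative_real_field[OF this]
    show "((\<lambda>t. cis_inner (of_real t) z * disc 1 z) has_vector_derivative - 2 * of_real pi * \<i> * of_real (Re z) * cis_inner (of_real t) z * disc 1 z) (at t)"
      by (simp add: cis_inner_def inner_complex_def mult_ac)
    show "cmod (- 2 * of_real pi * \<i> * of_real (Re z) * cis_inner (of_real t) z * disc 1 z) \<le> 2 * pi * cmod (disc 1 z)"
      using abs_Re_le_cmod[of z] by (auto simp: norm_mult disc_def indicator_def)
  qed (use integrable_bdd_supp[OF bdd_supp_disc] in \<open>auto intro: integrable_cis_inner_mult\<close>)
  moreover have "(\<integral>z. - 2 * of_real pi * \<i> * of_real (Re z) * cis_inner (of_real t) z * disc 1 z \<partial>lborel) = - 2 * of_real pi * \<i> * disc_p t"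
    unfolding disc_p_eq_Re fourier_eq integral_mult_right_zero[symmetric] by (simp add: mult_ac)
  ultimately show ?thesis by (simp add: disc_q_def[abs_def] fourier_eq)
qed


text \<open>The direction is existential because it is arbitrary at \<xi> = 0.\<close>

lemma unit_direction:
  obtains u where "cmod u = 1" "\<xi> = of_real (cmod \<xi>) * u"
proof (cases "\<xi> = 0")
  case True then show thesis using that[of 1] by simp
next
  case False
  then have "of_real (cmod \<xi>) * sgn \<xi> = \<xi>" by (simp add: sgn_div_norm scaleR_conv_of_real)
  then show thesis using that[of "sgn \<xi>"] False by (simp add: norm_sgn)
qed

lemma fourier_disc:
  assumes R: "R > 0" shows "fourier (disc R) \<xi> = of_real (R\<^sup>2) * disc_q (R * cmod \<xi>)"
proof -
  obtain u where u: "cmod u = 1" "\<xi> = of_real (cmod \<xi>) * u" by (rule unit_direction)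
  have uu: "cnj u * u = 1" using u(1) complex_norm_square[of u] by (simp add: mult.commute)
  have "disc R (of_real R * u * x) = disc 1 x" for x
    using R u(1) by (simp add: disc_def indicator_def norm_mult)
  moreover have "cnj (of_real R * u) * \<xi> = of_real (R * cmod \<xi>)"
    by (subst u(2)) (use uu in \<open>simp add: algebra_simps\<close>)
  moreover have "fourier (disc R) \<xi> = of_real ((cmod (of_real R * u))\<^sup>2) * fourier (\<lambda>x. disc R (of_real R * u * x)) (cnj (of_real R * u) * \<xi>)"
    by (rule fourier_complex_mult) (use R u(1) in auto)
  ultimately show ?thesis using R u(1) by (simp only: disc_q_def norm_mult) simp
qed

text \<open>The substitution z = R u x scales the area by R^2 and takes cnj z to R cnj u times cnj
  x, whence the third power and the phase.\<close>

lemma fourier_cnj_disc: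
  assumes R: "R > 0" and u: "cmod u = 1" "\<xi> = of_real (cmod \<xi>) * u"
  shows "fourier (\<lambda>z. cnj z * disc R z) \<xi> = of_real (R ^ 3) * cnj u * disc_p (R * cmod \<xi>)"
proof -
  have uu: "cnj u * u = 1" using u(1) complex_norm_square[of u] by (simp add: mult.commute)
  have "cnj (of_real R * u * x) * disc R (of_real R * u * x) = (of_real R * cnj u) * (cnj x * disc 1 x)" for x
    using R u(1) by (simp add: disc_def indicator_def norm_mult)
  moreover have "cnj (of_real R * u) * \<xi> = of_real (R * cmod \<xi>)"
    by (subst u(2)) (use uu in \<open>simp add: algebra_simps\<close>)
  moreover have "fourier (\<lambda>z. cnj z * disc R z) \<xi> = of_real ((cmod (of_real R * u))\<^sup>2) *
      fourier (\<lambda>x. cnj (of_real R * u * x) * disc R (of_real R * u * x)) (cnj (of_real R * u) * \<xi>)"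
    by (rule fourier_complex_mult) (use R u(1) in auto)
  ultimately show ?thesis
    using R u(1) by (simp only: disc_p_def norm_mult fourier_cmult) (simp add: power2_eq_square power3_eq_cube)
qed

text \<open>\<open>disc_kernel R\<close> is \<open>1 / a\<close> minus its average \<open>1 / (\<pi> R\<^sup>2) \<integral>\<^bsub>|w| \<le> R\<^esub> dw / (a - w)\<close>. As a superposition of
  the functions \<open>cnj a * disc t a\<close> its transform reduces to \<open>disc_p\<close>.\<close>
definition disc_kernel :: "real \<Rightarrow> complex \<Rightarrow> complex" where
  "disc_kernel R a = (1 / a - cnj a / of_real (R\<^sup>2)) * disc R a"

text \<open>The integral of 2 / t^3 from |a| to R is 1 / |a|^2 - 1 / R^2, and multiplying by cnj a
  gives 1 / a - cnj a / R^2.\<close>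

lemma disc_kernel_superposition:
  assumes "a \<noteq> 0" "R > 0"
  shows "disc_kernel R a = (\<integral>t. of_real (indicator {0<..R} t * (2 / t ^ 3)) * (cnj a * disc t a) \<partial>lborel)"
proof (cases "cmod a \<le> R")
  case True
  have "(\<integral>t. indicator {cmod a..R} t *\<^sub>R (2 / t ^ 3) \<partial>lborel) = - 1 / R\<^sup>2 - - 1 / (cmod a)\<^sup>2"
  proof (rule integral_FTC_Icc[OF True])
    fix x assume "cmod a \<le> x" "x \<le> R"
    then have "x > 0" using assms by (smt (verit) zero_less_norm_iff)
    then have "((\<lambda>x. - 1 / x\<^sup>2) has_real_derivative (2 / x ^ 3)) (at x)"
      by (auto intro!: derivative_eq_intros simp: field_simps power2_eq_square power3_eq_cube)
    then show "((\<lambda>x. - 1 / x\<^sup>2) has_vector_derivative (2 / x ^ 3)) (at x within {cmod a..R})"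
      by (simp add: has_real_derivative_iff_has_vector_derivative has_vector_derivative_at_within)
  qed (use assms in \<open>auto intro!: continuous_intros\<close>)
  moreover have "of_real (indicator {0<..R} t * (2 / t ^ 3)) * (cnj a * disc t a) =
      cnj a * of_real (indicator {cmod a..R} t *\<^sub>R (2 / t ^ 3))" for t
    using assms by (auto simp: indicator_def disc_def not_le) (smt (verit) zero_less_norm_iff)
  ultimately have "(\<integral>t. of_real (indicator {0<..R} t * (2 / t ^ 3)) * (cnj a * disc t a) \<partial>lborel) =
      cnj a * of_real (1 / (cmod a)\<^sup>2 - 1 / R\<^sup>2)"
    by (simp only: integral_mult_right_zero integral_complex_of_real) simp
  also have "\<dots> = 1 / a - cnj a / of_real (R\<^sup>2)"
    using assms complex_norm_square[of a] by (simp add: field_simps)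
  finally show ?thesis using True by (simp add: disc_kernel_def disc_def)
next
  case False
  then have "(\<lambda>t. of_real (indicator {0<..R} t * (2 / t ^ 3)) * (cnj a * disc t a)) = (\<lambda>_. 0::complex)"
    by (auto simp: indicator_def disc_def fun_eq_iff)
  then show ?thesis using False by (simp only:) (simp add: disc_kernel_def disc_def)
qed

lemma measurable_disc_pair [measurable]: "(\<lambda>(t, a). disc t a) \<in> borel_measurable (borel \<Otimes>\<^sub>M borel)"
proof -
  have "Measurable.pred (borel \<Otimes>\<^sub>M borel) (\<lambda>x::real \<times> complex. cmod (snd x) \<le> fst x)" by measurable
  then have "{x::real \<times> complex. cmod (snd x) \<le> fst x} \<in> sets (borel \<Otimes>\<^sub>M borel)"
    by (simp add: pred_def space_pair_measure)
  moreover have "(\<lambda>(t, a). disc t a) = (indicator {x::real \<times> complex. cmod (snd x) \<le> fst x} :: _ \<Rightarrow> complex)"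
    by (auto simp: disc_def indicator_def)
  ultimately show ?thesis by (simp only: borel_measurable_indicator)
qed

text \<open>The transform is taken layer by layer in t, where \<open>fourier_cnj_disc\<close> leaves
  2 cnj u disc_p (t |xi|); this integrates to \<open>disc_q\<close> by \<open>disc_q_deriv\<close>.
  Multiplying by |xi| instead of dividing keeps the formula true at 0.\<close>

lemma
  assumes R: "R > 0"
  shows integrable_disc_kernel: "integrable lborel (disc_kernel R)"
    and fourier_disc_kernel: "\<And>u \<xi>. cmod u = 1 \<Longrightarrow> \<xi> = of_real (cmod \<xi>) * u \<Longrightarrow>
      of_real (cmod \<xi>) * fourier (disc_kernel R) \<xi> = cnj u * (\<i> / of_real pi) * (disc_q (R * cmod \<xi>) - of_real pi)"
    and integral_disc_kernel: "(\<integral>a. disc_kernel R a \<partial>lborel) = 0"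
proof -
  let ?G = "\<lambda>(t, a). of_real (indicator {0<..R} t * (2 / t ^ 3)) * (cnj a * disc t a) :: complex"
  \<comment> \<open>The layer at radius t has L1 norm at most 2 / t^3 times t times pi t^2 = 2 pi,
    uniformly in t; this is what makes the kernel integrable despite its pole.\<close>
  have int_norm: "(\<integral>a. cmod (?G (t, a)) \<partial>lborel) \<le> indicator {0..R} t * (2 * pi)" for t
  proof (cases "t \<in> {0<..R}")
    case True
    have "(\<integral>a. cmod (?G (t, a)) \<partial>lborel) \<le> (\<integral>a. (2 / t\<^sup>2) * indicator (cball (0::complex) t) a \<partial>lborel)"
    proof (rule integral_mono)
      have "integrable lborel (\<lambda>a. ?G (t, a))"
        using integrable_bdd_supp[OF bdd_supp_cnj_disc] by simp
      then show "integrable lborel (\<lambda>a. cmod (?G (t, a)))" by (rule integrable_norm)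
      show "integrable lborel (\<lambda>a. (2 / t\<^sup>2) * indicat_real (cball (0::complex) t) a)"
        using True by (intro integrable_mult_right integrable_real_indicator) (auto simp: emeasure_lborel_cball_complex)
      show "cmod (?G (t, a)) \<le> (2 / t\<^sup>2) * indicator (cball (0::complex) t) a" for a
        using True by (auto simp: norm_mult norm_divide norm_power disc_def indicator_def field_simps power2_eq_square power3_eq_cube)
    qed
    also have "\<dots> = 2 * pi" using True by (simp add: measure_def emeasure_lborel_cball_complex)
    finally show ?thesis using True by simp
  qed auto
  have pair: "integrable (lborel \<Otimes>\<^sub>M lborel) ?G"
  proof (rule lborel_pair.Fubini_integrable)
    show "?G \<in> borel_measurable (lborel \<Otimes>\<^sub>M lborel)" by measurable
    show "integrable lborel (\<lambda>t. \<integral>a. cmod (?G (t, a)) \<partial>lborel)"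
    proof (rule Bochner_Integration.integrable_bound)
      show "integrable lborel (\<lambda>t. indicator {0..R} t * (2 * pi))" using R by auto
      show "(\<lambda>t. \<integral>a. cmod (?G (t, a)) \<partial>lborel) \<in> borel_measurable lborel"
        by measurable
      show "AE t in lborel. norm (\<integral>a. cmod (?G (t, a)) \<partial>lborel) \<le> norm (indicator {0..R} t * (2 * pi))"
        using int_norm by (intro AE_I2) (auto intro!: order_trans[OF int_norm] simp del: split_conv)
    qed
    show "AE t in lborel. integrable lborel (\<lambda>a. ?G (t, a))"
      using integrable_bdd_supp[OF bdd_supp_cnj_disc] by auto
  qed
  have AE_eq: "AE a in lborel. (\<integral>t. ?G (t, a) \<partial>lborel) = disc_kernel R a"
    using AE_lborel_singleton[of "0::complex"] by eventually_elim (use disc_kernel_superposition R in auto)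
  have m: "disc_kernel R \<in> borel_measurable borel" unfolding disc_kernel_def[abs_def] by measurable
  have "integrable lborel (\<lambda>a. \<integral>t. ?G (t, a) \<partial>lborel)" using lborel_pair.integrable_snd[OF pair] by simp
  then show int: "integrable lborel (disc_kernel R)"
    by (rule integrable_cong_AE_imp) (use m AE_eq in auto)
  have F: "fourier (disc_kernel R) \<xi> = cnj u * (LINT t:{0<..R}|lborel. 2 * disc_p (t * cmod \<xi>))"
    if u: "cmod u = 1" "\<xi> = of_real (cmod \<xi>) * u" for u \<xi>
  proof -
    have pair': "integrable (lborel \<Otimes>\<^sub>M lborel) (\<lambda>(t, a). cis_inner \<xi> a * ?G (t, a))"
      by (rule Bochner_Integration.integrable_bound[OF pair]) (auto simp: norm_mult norm_divide intro!: AE_I2)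
    have "fourier (disc_kernel R) \<xi> = (\<integral>a. cis_inner \<xi> a * (\<integral>t. ?G (t, a) \<partial>lborel) \<partial>lborel)"
      unfolding fourier_eq
      by (rule integral_cong_AE)
        (use m AE_eq borel_measurable_integrable[OF lborel_pair.integrable_snd[OF pair]] in \<open>auto intro!: borel_measurable_times elim!: eventually_mono\<close>)
    also have "\<dots> = (\<integral>a. \<integral>t. cis_inner \<xi> a * ?G (t, a) \<partial>lborel \<partial>lborel)"
      by (simp only: integral_mult_right_zero)
    also have "\<dots> = (\<integral>t. \<integral>a. cis_inner \<xi> a * ?G (t, a) \<partial>lborel \<partial>lborel)"
      using lborel_pair.Fubini_integral[OF pair'] by simp
    also have "\<dots> = (\<integral>t. cnj u * (indicator {0<..R} t *\<^sub>R (2 * disc_p (t * cmod \<xi>))) \<partial>lborel)"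
    proof (rule Bochner_Integration.integral_cong[OF refl])
      fix t
      have "(\<integral>a. cis_inner \<xi> a * ?G (t, a) \<partial>lborel) = of_real (indicator {0<..R} t * (2 / t ^ 3)) * fourier (\<lambda>a. cnj a * disc t a) \<xi>"
        unfolding fourier_eq integral_mult_right_zero[symmetric] by (simp add: mult_ac)
      also have "\<dots> = cnj u * (indicator {0<..R} t *\<^sub>R (2 * disc_p (t * cmod \<xi>)))"
        using fourier_cnj_disc[OF _ u, of t] by (auto simp: indicator_def)
      finally show "(\<integral>a. cis_inner \<xi> a * ?G (t, a) \<partial>lborel) = cnj u * (indicator {0<..R} t *\<^sub>R (2 * disc_p (t * cmod \<xi>)))" .
    qed
    finally show ?thesis by (simp only: set_lebesgue_integral_def integral_mult_right_zero)
  qed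
  have cont_p: "continuous_on UNIV disc_p"
    unfolding disc_p_def[abs_def]
    by (intro continuous_on_compose2[OF continuous_on_fourier[OF integrable_bdd_supp[OF bdd_supp_cnj_disc]]] continuous_intros) auto
  show "of_real (cmod \<xi>) * fourier (disc_kernel R) \<xi> = cnj u * (\<i> / of_real pi) * (disc_q (R * cmod \<xi>) - of_real pi)"
    if u: "cmod u = 1" "\<xi> = of_real (cmod \<xi>) * u" for u \<xi>
  proof -
    define c where "c = cmod \<xi>"
    have "(\<integral>t. indicator {0..R} t *\<^sub>R (of_real c * (2 * disc_p (t * c))) \<partial>lborel) = (\<i> / of_real pi) * disc_q (R * c) - (\<i> / of_real pi) * disc_q (0 * c)"
    proof (rule integral_FTC_Icc)
      fix x
      have "((\<lambda>t. t * c) has_vector_derivative c) (at x)"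
        unfolding has_real_derivative_iff_has_vector_derivative[symmetric] by (auto intro!: derivative_eq_intros)
      from vector_diff_chain_at[OF this disc_q_deriv]
      have "((\<lambda>t. disc_q (t * c)) has_vector_derivative (c *\<^sub>R (- 2 * of_real pi * \<i> * disc_p (x * c)))) (at x)"
        by (simp add: comp_def)
      from has_vector_derivative_mult_right[OF this, of "\<i> / of_real pi"]
      show "((\<lambda>t. (\<i> / of_real pi) * disc_q (t * c)) has_vector_derivative (of_real c * (2 * disc_p (x * c)))) (at x within {0..R})"
        by (simp add: has_vector_derivative_at_within scaleR_conv_of_real field_simps)
    qed (use R in \<open>auto intro!: continuous_intros continuous_on_compose2[OF cont_p]\<close>)
    moreover have "(\<integral>t. indicator {0..R} t *\<^sub>R (of_real c * (2 * disc_p (t * c))) \<partial>lborel) = of_real c * (LINT t:{0<..R}|lborel. 2 * disc_p (t * c))"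
    proof -
      have "(\<integral>t. indicator {0..R} t *\<^sub>R (of_real c * (2 * disc_p (t * c))) \<partial>lborel) = (\<integral>t. of_real c * (indicator {0<..R} t *\<^sub>R (2 * disc_p (t * c))) \<partial>lborel)"
      proof (rule integral_cong_AE)
        have [measurable]: "disc_p \<in> borel_measurable borel" by (rule borel_measurable_continuous_onI[OF cont_p])
        show "(\<lambda>t. indicator {0..R} t *\<^sub>R (of_real c * (2 * disc_p (t * c)))) \<in> borel_measurable lborel"
          "(\<lambda>t. of_real c * (indicator {0<..R} t *\<^sub>R (2 * disc_p (t * c)))) \<in> borel_measurable lborel" by measurable
        show "AE t in lborel. indicator {0..R} t *\<^sub>R (of_real c * (2 * disc_p (t * c))) = of_real c * (indicator {0<..R} t *\<^sub>R (2 * disc_p (t * c)))"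
          using AE_lborel_singleton[of "0::real"] by eventually_elim (auto simp: indicator_def)
      qed
      then show ?thesis by (simp only: set_lebesgue_integral_def integral_mult_right_zero)
    qed
    ultimately have L: "of_real c * (LINT t:{0<..R}|lborel. 2 * disc_p (t * c)) = (\<i> / of_real pi) * disc_q (R * c) - (\<i> / of_real pi) * disc_q (0 * c)"
      by metis
    have "of_real c * fourier (disc_kernel R) \<xi> = cnj u * (of_real c * (LINT t:{0<..R}|lborel. 2 * disc_p (t * c)))"
      unfolding F[OF u] c_def[symmetric] by (rule mult.left_commute)
    also have "\<dots> = cnj u * (\<i> / of_real pi) * (disc_q (R * c) - of_real pi)"
      unfolding L by (simp add: disc_q_0 right_diff_distrib)
    finally show ?thesis by (simp only: c_def)
  qed
  \<comment> \<open>At frequency 0 every layer contributes \<open>disc_p 0\<close>, which is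
    0.\<close>
  show "(\<integral>a. disc_kernel R a \<partial>lborel) = 0"
    using F[of 1 0] by (simp add: fourier_0 disc_p_0)
qed


text \<open>On a vertical line \<open>x = const\<close> the function \<open>1 / a\<^sup>2\<close> has the antiderivative \<open>\<i> / a\<close>, and
  \<open>\<i> / (x + \<i> y) - \<i> / (x - \<i> y) = 2 y / (x\<^sup>2 + y\<^sup>2)\<close> is \<open>1 / R\<^sup>2\<close> times the length of the slice.\<close>
lemma integral_inverse_square_slice:
  assumes "x \<noteq> 0" "R > 0"
  shows "integrable lborel (\<lambda>y. disc R (Complex x y) / (Complex x y)\<^sup>2)"
    and "(\<integral>y. disc R (Complex x y) / (Complex x y)\<^sup>2 \<partial>lborel) = (\<integral>y. disc R (Complex x y) / of_real (R\<^sup>2) \<partial>lborel)"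
proof -
  define Y where "Y = sqrt (R\<^sup>2 - x\<^sup>2)"
  have ne: "Complex x y \<noteq> 0" for y using assms by (simp add: complex_eq_iff)
  have cont: "continuous_on A (\<lambda>y. 1 / (Complex x y)\<^sup>2)" for A
    using ne unfolding Complex_eq by (intro continuous_intros) auto
  have eq: "disc R (Complex x y) / (Complex x y)\<^sup>2 = indicator {-Y..Y} y *\<^sub>R (1 / (Complex x y)\<^sup>2)" if "\<bar>x\<bar> \<le> R" for y
    using that assms by (auto simp: disc_Complex Y_def indicator_def)
  show "integrable lborel (\<lambda>y. disc R (Complex x y) / (Complex x y)\<^sup>2)"
  proof (cases "\<bar>x\<bar> \<le> R")
    case True
    have "integrable lborel (\<lambda>y. indicator {-Y..Y} y *\<^sub>R (1 / (Complex x y)\<^sup>2))"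
      by (rule borel_integrable_compact) (auto intro: cont)
    then show ?thesis using eq[OF True] by simp
  qed (use assms in \<open>simp add: disc_Complex\<close>)
  show "(\<integral>y. disc R (Complex x y) / (Complex x y)\<^sup>2 \<partial>lborel) = (\<integral>y. disc R (Complex x y) / of_real (R\<^sup>2) \<partial>lborel)"
  proof (cases "\<bar>x\<bar> \<le> R")
    case True
    then have Y: "0 \<le> Y" "Y\<^sup>2 = R\<^sup>2 - x\<^sup>2" using assms abs_le_square_iff[of x R] by (auto simp: Y_def)
    have "(\<integral>y. disc R (Complex x y) / (Complex x y)\<^sup>2 \<partial>lborel) = (\<integral>y. indicator {-Y..Y} y *\<^sub>R (1 / (Complex x y)\<^sup>2) \<partial>lborel)"
      using eq[OF True] by simp
    also have "\<dots> = \<i> / Complex x Y - \<i> / Complex x (- Y)"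
    proof (rule integral_FTC_Icc[OF _ _ cont])
      fix y
      have "((\<lambda>w. \<i> / (of_real x + \<i> * w)) has_field_derivative (1 / (Complex x y)\<^sup>2)) (at (of_real y))"
        using ne[of y] unfolding Complex_eq
        by (auto intro!: derivative_eq_intros simp: power2_eq_square)
      from has_vector_derivative_real_field[OF this]
      show "((\<lambda>y. \<i> / Complex x y) has_vector_derivative (1 / (Complex x y)\<^sup>2)) (at y within {-Y..Y})"
        by (simp add: Complex_eq has_vector_derivative_at_within)
    qed (use Y in simp)
    also have "\<dots> = of_real (2 * Y) / of_real (R\<^sup>2)"
    proof -
      have "Complex x Y * Complex x (- Y) = of_real (R\<^sup>2)" using Y by (simp add: complex_eq_iff power2_eq_square)
      moreover have "\<i> / Complex x Y - \<i> / Complex x (- Y) = \<i> * (Complex x (- Y) - Complex x Y) / (Complex x Y * Complex x (- Y))"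
        using ne[of Y] ne[of "-Y"] by (simp add: divide_simps) (simp add: algebra_simps)
      moreover have "\<i> * (Complex x (- Y) - Complex x Y) = of_real (2 * Y)" by (simp add: complex_eq_iff)
      ultimately show ?thesis by simp
    qed
    also have "\<dots> = (\<integral>y. disc R (Complex x y) / of_real (R\<^sup>2) \<partial>lborel)"
      using True assms integral_disc_slice[of R x] by (simp add: Y_def)
    finally show ?thesis .
  qed (use assms in \<open>simp add: disc_Complex\<close>)
qed

section \<open>Transforms of 1 / a and 1 / a^2 on annuli\<close>

lemma bdd_supp_annulus:
  assumes [measurable]: "f \<in> borel_measurable borel" and C: "\<And>z. cmod z > r \<Longrightarrow> cmod z \<le> R \<Longrightarrow> cmod (f z) \<le> C" and "r \<le> R"
  shows "bdd_supp (\<lambda>z. f z * (disc R z - disc r z))"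
  by (rule bdd_suppI[where C="max C 0" and r=R]) (use assms in \<open>auto simp: disc_def indicator_def le_max_iff_disj not_le\<close>)

text \<open>For a real frequency the character is constant on vertical lines, so by
  \<open>integral_inverse_square_slice\<close> the function 1 / a^2 can be traded there for the
  constants 1 / R^2 and 1 / r^2 on the two discs. A rotation, under which 1 / a^2 picks up (cnj
  u)^2, covers the remaining frequencies.\<close>

lemma fourier_inverse_square_annulus:
  assumes r: "0 < r" "r \<le> R" and u: "cmod u = 1" "\<xi> = of_real (cmod \<xi>) * u"
  shows "fourier (\<lambda>a. 1 / a\<^sup>2 * (disc R a - disc r a)) \<xi> = (cnj u)\<^sup>2 * (disc_q (R * cmod \<xi>) - disc_q (r * cmod \<xi>))"
proof -
  let ?f = "\<lambda>a. 1 / a\<^sup>2 * (disc R a - disc r a)"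
  define t where "t = cmod \<xi>"
  have uu: "cnj u * u = 1" using u(1) complex_norm_square[of u] by (simp add: mult.commute)
  have ci: "cnj u * \<xi> = of_real t" by (subst u(2)) (use uu in \<open>simp add: algebra_simps t_def\<close>)
  have u0: "u \<noteq> 0" using u by auto
  have f_u: "?f (u * x) = (cnj u)\<^sup>2 * ?f x" for x
  proof -
    have "disc R (u * x) = disc R x" "disc r (u * x) = disc r x" using u(1) by (simp_all add: disc_def indicator_def norm_mult)
    moreover have "1 / u\<^sup>2 = (cnj u)\<^sup>2" using uu u0 by (simp add: field_simps power_mult_distrib[symmetric] mult.commute)
    ultimately show ?thesis by (simp add: power_mult_distrib divide_divide_eq_left[symmetric] divide_inverse)
  qed
  have int_f: "integrable lborel ?f"
    by (intro integrable_bdd_supp bdd_supp_annulus[where C="1 / r\<^sup>2"])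
      (use r in \<open>auto simp: norm_divide norm_power intro!: frac_le power_mono\<close>)
  have "fourier ?f \<xi> = of_real ((cmod u)\<^sup>2) * fourier (\<lambda>x. ?f (u * x)) (cnj u * \<xi>)"
    by (rule fourier_complex_mult) (use u0 in auto)
  also have "\<dots> = (cnj u)\<^sup>2 * fourier ?f (of_real t)"
    unfolding f_u ci fourier_cmult using u(1) by simp
  also have "fourier ?f (of_real t) = (\<integral>x. \<integral>y. cis_inner (of_real t) (Complex x y) * ?f (Complex x y) \<partial>lborel \<partial>lborel)"
    unfolding fourier_eq by (intro integral_lborel_complex integrable_cis_inner_mult int_f)
  also have "\<dots> = (\<integral>x. \<integral>y. cis_inner (of_real t) (Complex x y) * (disc R (Complex x y) / of_real (R\<^sup>2) - disc r (Complex x y) / of_real (r\<^sup>2)) \<partial>lborel \<partial>lborel)"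
  proof (rule integral_cong_AE)
    \<comment> \<open>Only the line x = 0 through the pole has to be left out.\<close>
    show "AE x in lborel. (\<integral>y. cis_inner (of_real t) (Complex x y) * ?f (Complex x y) \<partial>lborel) =
       (\<integral>y. cis_inner (of_real t) (Complex x y) * (disc R (Complex x y) / of_real (R\<^sup>2) - disc r (Complex x y) / of_real (r\<^sup>2)) \<partial>lborel)"
      using AE_lborel_singleton[of "0::real"]
    proof eventually_elim
      case (elim x)
      have "(\<integral>y. ?f (Complex x y) \<partial>lborel) =
        (\<integral>y. disc R (Complex x y) / (Complex x y)\<^sup>2 - disc r (Complex x y) / (Complex x y)\<^sup>2 \<partial>lborel)"
        by (simp add: diff_divide_distrib)
      also have "\<dots> = (\<integral>y. disc R (Complex x y) / of_real (R\<^sup>2) - disc r (Complex x y) / of_real (r\<^sup>2) \<partial>lborel)"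
        using integral_inverse_square_slice[of x R] integral_inverse_square_slice[of x r] elim r
          integrable_disc_slice[of R x] integrable_disc_slice[of r x]
        by (simp only: Bochner_Integration.integral_diff integrable_divide) simp
      finally show ?case by (simp only: cis_inner_of_real integral_mult_right_zero)
    qed
  qed (simp_all)
  also have "\<dots> = fourier (\<lambda>a. disc R a / of_real (R\<^sup>2) - disc r a / of_real (r\<^sup>2)) (of_real t)"
    unfolding fourier_eq
    by (rule integral_lborel_complex[symmetric])
      (intro integrable_cis_inner_mult Bochner_Integration.integrable_diff integrable_divide integrable_bdd_supp bdd_supp_disc)
  also have "\<dots> = fourier (\<lambda>a. (1 / of_real (R\<^sup>2)) * disc R a) (of_real t) - fourier (\<lambda>a. (1 / of_real (r\<^sup>2)) * disc r a) (of_real t)"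
    using integrable_bdd_supp[OF bdd_supp_disc] by (subst fourier_diff[symmetric]) auto
  also have "\<dots> = disc_q (R * t) - disc_q (r * t)"
    unfolding fourier_cmult using r fourier_disc[of R "of_real t"] fourier_disc[of r "of_real t"] by (simp add: t_def)
  finally show ?thesis by (simp add: t_def)
qed

text \<open>On a disc, 1 / a is \<open>disc_kernel\<close> plus a multiple of cnj a; in the
  difference of the two radii the constant pi of \<open>fourier_disc_kernel\<close> cancels.\<close>

lemma fourier_inverse_annulus:
  assumes r: "0 < r" "r \<le> R" and u: "cmod u = 1" "\<xi> = of_real (cmod \<xi>) * u"
  shows "of_real (cmod \<xi>) * fourier (\<lambda>a. 1 / a * (disc R a - disc r a)) \<xi> =
     cnj u * ((\<i> / of_real pi) * (disc_q (R * cmod \<xi>) - disc_q (r * cmod \<xi>))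
       + of_real (cmod \<xi>) * (of_real R * disc_p (R * cmod \<xi>) - of_real r * disc_p (r * cmod \<xi>)))"
proof -
  let ?g = "\<lambda>R a. disc_kernel R a + (1 / of_real (R\<^sup>2)) * (cnj a * disc R a)"
  have R: "R > 0" using r by simp
  have i: "integrable lborel (disc_kernel R)" "integrable lborel (\<lambda>a. (1 / of_real (R\<^sup>2)) * (cnj a * disc R a))" if "R > 0" for R
    using integrable_disc_kernel[OF that] integrable_bdd_supp[OF bdd_supp_cnj_disc, of R] by simp_all
  have g: "?g R a = 1 / a * disc R a" for R a
    by (simp add: disc_kernel_def left_diff_distrib)
  have g': "(\<lambda>a. 1 / a * (disc R a - disc r a)) = (\<lambda>a. ?g R a - ?g r a)"
    by (simp only: g right_diff_distrib)
  have eq: "fourier (\<lambda>a. 1 / a * (disc R a - disc r a)) \<xi> = (fourier (disc_kernel R) \<xi> + (1 / of_real (R\<^sup>2)) * fourier (\<lambda>a. cnj a * disc R a) \<xi>)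
      - (fourier (disc_kernel r) \<xi> + (1 / of_real (r\<^sup>2)) * fourier (\<lambda>a. cnj a * disc r a) \<xi>)"
    unfolding g'
    by (simp only: fourier_diff[OF Bochner_Integration.integrable_add[OF i[OF R]] Bochner_Integration.integrable_add[OF i[OF r(1)]]]
      fourier_add[OF i[OF R]] fourier_add[OF i[OF r(1)]] fourier_cmult)
  have p: "(1 / of_real (R\<^sup>2)) * fourier (\<lambda>a. cnj a * disc R a) \<xi> = cnj u * (of_real R * disc_p (R * cmod \<xi>))" if "R > 0" for R
  proof -
    have "of_real (R ^ 3) = (of_real (R\<^sup>2) * of_real R :: complex)"
      by (simp add: power2_eq_square power3_eq_cube)
    then have "(1 / of_real (R\<^sup>2)) * fourier (\<lambda>a. cnj a * disc R a) \<xi> =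
        (1 / of_real (R\<^sup>2) * of_real (R\<^sup>2)) * (cnj u * (of_real R * disc_p (R * cmod \<xi>)))"
      unfolding fourier_cnj_disc[OF that u] by (simp only: ac_simps)
    also have "1 / of_real (R\<^sup>2) * of_real (R\<^sup>2) = (1::complex)" using that by simp
    finally show ?thesis by simp
  qed
  have alg: "t * ((A + B) - (C + D)) = c * (k * (x - y) + t * (v - w))"
    if "t * A = c * k * (x - l)" "t * C = c * k * (y - l)" "B = c * v" "D = c * w" for t A B C D c k x y l v w :: complex
  proof -
    have "t * ((A + B) - (C + D)) = t * A - t * C + t * (B - D)" by (simp add: algebra_simps)
    then show ?thesis unfolding that by (simp add: algebra_simps)
  qed
  show ?thesis
    unfolding eq by (rule alg[OF fourier_disc_kernel[OF R u] fourier_disc_kernel[OF r(1) u] p[OF R] p[OF r(1)]])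
qed

subsection \<open>Configurations as counting measures\<close>

text \<open>The sum of point masses as a measure on the Borel sets: sums over a configuration become
  integrals, to which convergence theorems and Fubini apply.\<close>

definition pm :: "(complex \<Rightarrow> nat) \<Rightarrow> complex measure" where
  "pm \<mu> = distr (density (count_space UNIV) (\<lambda>a. of_nat (\<mu> a))) borel (\<lambda>a. a)"

lemma sets_pm [simp, measurable_cong]: "sets (pm \<mu>) = sets borel"
  and space_pm [simp]: "space (pm \<mu>) = UNIV"
  by (simp_all add: pm_def)

lemma measurable_count_space_id: "(\<lambda>a. a) \<in> density (count_space UNIV) h \<rightarrow>\<^sub>M borel"
  by (simp add: measurable_def)

lemma nn_integral_pm:
  assumes "f \<in> borel_measurable borel"
  shows "(\<integral>\<^sup>+a. f a \<partial>pm \<mu>) = (\<integral>\<^sup>+a. of_nat (\<mu> a) * f a \<partial>count_space UNIV)"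
  using assms by (simp add: pm_def nn_integral_distr[OF measurable_count_space_id] nn_integral_density)

lemma space_Conf: "space Conf = configs"
  by (simp add: Conf_def space_measure_of_conv)

lemma emeasure_pm_bounded:
  assumes mu: "\<mu> \<in> configs" and B: "bounded B" "B \<in> sets borel"
  shows "emeasure (pm \<mu>) B = of_nat (cnt \<mu> B)"
proof -
  have fin: "finite (supp \<mu> \<inter> B)" using mu B by (auto simp: configs_def)
  have "emeasure (pm \<mu>) B = (\<integral>\<^sup>+a. indicator B a \<partial>pm \<mu>)" using B by simp
  also have "\<dots> = (\<integral>\<^sup>+a. of_nat (\<mu> a) * indicator B a \<partial>count_space UNIV)"
    using B by (subst nn_integral_pm) auto
  also have "\<dots> = (\<Sum>a\<in>supp \<mu> \<inter> B. of_nat (\<mu> a) * indicator B a)"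
    by (rule nn_integral_count_space'[OF fin]) (auto simp: supp_def indicator_def)
  also have "\<dots> = of_nat (cnt \<mu> B)" by (simp add: cnt_def)
  finally show ?thesis .
qed

lemma sigma_finite_pm: assumes "\<mu> \<in> configs" shows "sigma_finite_measure (pm \<mu>)"
proof
  have "UNIV = (\<Union>n. ball (0::complex) (real n))" by (auto intro: reals_Archimedean2)
  then show "\<exists>A. countable A \<and> A \<subseteq> sets (pm \<mu>) \<and> \<Union> A = space (pm \<mu>) \<and> (\<forall>a\<in>A. emeasure (pm \<mu>) a \<noteq> \<infinity>)"
    using assms by (intro exI[of _ "range (\<lambda>n. ball 0 (real n))"]) (auto simp: emeasure_pm_bounded)
qed

lemma integrable_pm_iff:
  fixes f :: "complex \<Rightarrow> complex"
  assumes [measurable]: "f \<in> borel_measurable borel"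
  shows "integrable (pm \<mu>) f \<longleftrightarrow> integrable (count_space UNIV) (\<lambda>a. of_nat (\<mu> a) * f a)"
proof -
  have *: "integrable (density (count_space UNIV) (\<lambda>a. ennreal (real (\<mu> a)))) f \<longleftrightarrow> integrable (count_space UNIV) (\<lambda>a. real (\<mu> a) *\<^sub>R f a)"
    by (rule integrable_density) auto
  show ?thesis
    using * by (simp add: pm_def integrable_distr_eq[OF measurable_count_space_id] ennreal_of_nat_eq_real_of_nat scaleR_conv_of_real)
qed

lemma integral_pm:
  fixes f :: "complex \<Rightarrow> complex"
  assumes [measurable]: "f \<in> borel_measurable borel"
  shows "(\<integral>a. f a \<partial>pm \<mu>) = (\<integral>a. of_nat (\<mu> a) * f a \<partial>count_space UNIV)"
proof -
  have *: "integral\<^sup>L (density (count_space UNIV) (\<lambda>a. ennreal (real (\<mu> a)))) f = (\<integral>a. real (\<mu> a) *\<^sub>R f a \<partial>count_space UNIV)"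
    by (rule integral_density) auto
  show ?thesis
    using * by (simp add: pm_def integral_distr[OF measurable_count_space_id] ennreal_of_nat_eq_real_of_nat scaleR_conv_of_real)
qed

text \<open>The bridge from the finite sums in \<open>lin_stat\<close>, \<open>Psi_partial\<close>
  and the near part of \<open>zeta\<close> to integrals.\<close>

lemma integral_pm_finite:
  fixes f :: "complex \<Rightarrow> complex"
  assumes [measurable]: "f \<in> borel_measurable borel" and A: "finite (supp \<mu> \<inter> A)" "\<And>a. a \<notin> A \<Longrightarrow> f a = 0"
  shows "integrable (pm \<mu>) f" "(\<integral>a. f a \<partial>pm \<mu>) = (\<Sum>a\<in>supp \<mu> \<inter> A. of_nat (\<mu> a) * f a)"
proof -
  have sub: "of_nat (\<mu> a) * f a \<noteq> 0 \<Longrightarrow> a \<in> supp \<mu> \<inter> A" for a using A(2)[of a] by (auto simp: supp_def)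
  then have fin: "finite {a. of_nat (\<mu> a) * f a \<noteq> 0}" by (intro finite_subset[OF _ A(1)]) auto
  have eq: "(\<lambda>a. of_nat (\<mu> a) * f a) = (\<lambda>a. indicator (supp \<mu> \<inter> A) a *\<^sub>R (of_nat (\<mu> a) * f a))"
  proof
    fix a show "of_nat (\<mu> a) * f a = indicator (supp \<mu> \<inter> A) a *\<^sub>R (of_nat (\<mu> a) * f a)"
    proof (cases "a \<in> supp \<mu> \<inter> A")
      case False
      then have "of_nat (\<mu> a) * f a = 0" using sub by blast
      then show ?thesis by (simp only:) simp
    qed simp
  qed
  have "integrable (count_space (supp \<mu> \<inter> A)) (\<lambda>a. of_nat (\<mu> a) * f a)"
    using A by (intro integrable_count_space)
  then have "integrable (count_space UNIV) (\<lambda>a. of_nat (\<mu> a) * f a)"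
    by (subst eq) (simp add: integrable_restrict_space[of "supp \<mu> \<inter> A" "count_space UNIV", symmetric] restrict_count_space)
  then show "integrable (pm \<mu>) f" by (simp add: integrable_pm_iff)
  have "(\<integral>a. f a \<partial>pm \<mu>) = (\<Sum>a | of_nat (\<mu> a) * f a \<noteq> 0. of_nat (\<mu> a) * f a)"
    unfolding integral_pm[OF assms(1)] using lebesgue_integral_count_space_finite_support[of UNIV "\<lambda>a. of_nat (\<mu> a) * f a"] fin
    by (simp del: mult_eq_0_iff)
  also have "\<dots> = (\<Sum>a\<in>supp \<mu> \<inter> A. of_nat (\<mu> a) * f a)"
    by (rule sum.mono_neutral_left[OF A(1)]) (use sub in auto)
  finally show "(\<integral>a. f a \<partial>pm \<mu>) = (\<Sum>a\<in>supp \<mu> \<inter> A. of_nat (\<mu> a) * f a)" .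
qed

lemma integrable_pm_bdd_supp:
  assumes "\<mu> \<in> configs" "bdd_supp f" shows "integrable (pm \<mu>) f"
  using assms by (intro integral_pm_finite(1)[of f \<mu> "{z. f z \<noteq> 0}"]) (auto simp: bdd_supp_def configs_def)

lemma supp_shift: "supp (shift w \<mu>) = (\<lambda>z. z + w) ` supp \<mu>"
  by (auto simp: supp_def shift_def image_iff) (metis diff_add_cancel)

lemma cnt_shift: "cnt (shift w \<mu>) B = cnt \<mu> ((\<lambda>z. z + w) -` B)"
  unfolding cnt_def
  by (rule sum.reindex_bij_witness[of _ "\<lambda>z. z + w" "\<lambda>z. z - w"]) (auto simp: supp_def shift_def)

lemma shift_configs:
  assumes "\<mu> \<in> configs" shows "shift w \<mu> \<in> configs"
  unfolding configs_def
proof (intro CollectI allI impI)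
  fix B :: "complex set" assume "bounded B"
  then have "bounded ((\<lambda>z. z - w) ` B)"
    using bounded_translation[of B "-w"] by (simp add: add.commute)
  then have "finite (supp \<mu> \<inter> (\<lambda>z. z - w) ` B)" using assms by (auto simp: configs_def)
  then have "finite ((\<lambda>z. z + w) ` (supp \<mu> \<inter> (\<lambda>z. z - w) ` B))" by simp
  moreover have "supp (shift w \<mu>) \<inter> B \<subseteq> (\<lambda>z. z + w) ` (supp \<mu> \<inter> (\<lambda>z. z - w) ` B)"
    by (auto simp: supp_shift image_iff) (metis add_diff_cancel)
  ultimately show "finite (supp (shift w \<mu>) \<inter> B)" by (rule finite_subset[rotated])
qed

lemma cnt_measurable:
  assumes "B \<in> sets borel" "bounded B"
  shows "(\<lambda>\<mu>. cnt \<mu> B) \<in> measurable Conf (count_space UNIV)"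
proof (subst measurable_count_space_eq2_countable, intro conjI ballI)
  fix k :: nat
  have "{\<mu> \<in> configs. cnt \<mu> B = k} \<in> sets Conf"
    unfolding Conf_def using assms by (subst sets_measure_of) (auto intro!: sigma_sets.Basic)
  moreover have "(\<lambda>\<mu>. cnt \<mu> B) -` {k} \<inter> space Conf = {\<mu> \<in> configs. cnt \<mu> B = k}"
    by (auto simp: space_Conf)
  ultimately show "(\<lambda>\<mu>. cnt \<mu> B) -` {k} \<inter> space Conf \<in> sets Conf" by simp
qed auto

lemma shift_measurable: "shift w \<in> measurable Conf Conf"
  unfolding Conf_def
proof (rule measurable_measure_of)
  show "shift w \<in> space (sigma configs {{\<mu> \<in> configs. cnt \<mu> B = k} |B k. B \<in> sets borel \<and> bounded B}) \<rightarrow> configs"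
    by (auto simp: space_measure_of_conv shift_configs)
  fix A assume "A \<in> {{\<mu> \<in> configs. cnt \<mu> B = k} |B k. B \<in> sets borel \<and> bounded B}"
  then obtain B k where B: "A = {\<mu> \<in> configs. cnt \<mu> B = k}" "B \<in> sets borel" "bounded B" by auto
  define B' where "B' = (\<lambda>z. z + w) -` B"
  have "B' = (\<lambda>z. z - w) ` B" by (auto simp: B'_def image_iff) (metis add_diff_cancel)
  then have "bounded B'" using B(3) bounded_translation[of B "-w"] by (simp add: add.commute)
  moreover have "B' \<in> sets borel"
    unfolding B'_def using measurable_sets[of "\<lambda>z. z + w" borel borel B] B(2) by simp
  moreover have "shift w -` A \<inter> space (sigma configs {{\<mu> \<in> configs. cnt \<mu> B = k} |B k. B \<in> sets borel \<and> bounded B}) = {\<mu> \<in> configs. cnt \<mu> B' = k}"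
    by (auto simp: B space_measure_of_conv shift_configs cnt_shift B'_def)
  ultimately show "shift w -` A \<inter> space (sigma configs {{\<mu> \<in> configs. cnt \<mu> B = k} |B k. B \<in> sets borel \<and> bounded B})
      \<in> sets (sigma configs {{\<mu> \<in> configs. cnt \<mu> B = k} |B k. B \<in> sets borel \<and> bounded B})"
    by (subst sets_measure_of) (auto intro!: sigma_sets.Basic)
qed auto

lemma pm_shift: "emeasure (pm (shift w \<mu>)) B = emeasure (pm \<mu>) ((\<lambda>z. z + w) -` B)" if B: "B \<in> sets borel"
proof -
  have B': "(\<lambda>z. z + w) -` B \<in> sets borel" using measurable_sets[of "\<lambda>z. z + w" borel borel B] B by simp
  have "emeasure (pm (shift w \<mu>)) B = (\<integral>\<^sup>+a. of_nat (shift w \<mu> a) * indicator B a \<partial>count_space UNIV)"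
    using B nn_integral_pm[of "indicator B" "shift w \<mu>"] by simp
  also have "\<dots> = (\<integral>\<^sup>+a. of_nat (shift w \<mu> (a + w)) * indicator B (a + w) \<partial>count_space UNIV)"
    by (rule nn_integral_bij_count_space[symmetric, where g="\<lambda>a. a + w"])
      (auto intro!: bij_betwI[where g="\<lambda>a. a - w"])
  also have "\<dots> = (\<integral>\<^sup>+a. of_nat (\<mu> a) * indicator ((\<lambda>z. z + w) -` B) a \<partial>count_space UNIV)"
    by (simp add: shift_def indicator_def)
  also have "\<dots> = emeasure (pm \<mu>) ((\<lambda>z. z + w) -` B)"
    using B' nn_integral_pm[of "indicator ((\<lambda>z. z + w) -` B)" \<mu>] by simp
  finally show ?thesis .
qed

text \<open>Exhaustion by discs, because the generators of \<open>Conf\<close> only count points in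
  bounded sets.\<close>

lemma measurable_emeasure_pm:
  assumes B: "B \<in> sets borel"
  shows "(\<lambda>\<mu>. emeasure (pm \<mu>) B) \<in> borel_measurable Conf"
proof -
  let ?B = "\<lambda>n. B \<inter> ball 0 (real n)"
  have "(\<lambda>\<mu>. SUP n. of_nat (cnt \<mu> (?B n)) :: ennreal) \<in> borel_measurable Conf"
    using B by (intro borel_measurable_SUP measurable_compose[OF cnt_measurable]) auto
  moreover have "emeasure (pm \<mu>) B = (SUP n. of_nat (cnt \<mu> (?B n)))" if "\<mu> \<in> space Conf" for \<mu>
  proof -
    have "(SUP n. of_nat (cnt \<mu> (?B n))) = (SUP n. emeasure (pm \<mu>) (?B n))"
      using that B by (auto simp: emeasure_pm_bounded space_Conf bounded_Int intro!: SUP_cong)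
    also have "\<dots> = emeasure (pm \<mu>) (\<Union>n. ?B n)"
      using B by (intro SUP_emeasure_incseq) (auto simp: incseq_def intro: less_le_trans)
    also have "(\<Union>n. ?B n) = B" by (auto intro: reals_Archimedean2)
    finally show ?thesis by simp
  qed
  ultimately show ?thesis by (subst measurable_cong) auto
qed

lemma measurable_nn_integral_pm:
  assumes "f \<in> borel_measurable borel"
  shows "(\<lambda>\<mu>. \<integral>\<^sup>+a. f a \<partial>pm \<mu>) \<in> borel_measurable Conf"
  using assms
proof (induction rule: borel_measurable_induct)
  case (cong f g)
  then have "f = g" by auto
  with cong show ?case by simp
next
  case (set A) then show ?case by (simp add: measurable_emeasure_pm)
next
  case (mult u c)
  then have "(\<lambda>\<mu>. c * (\<integral>\<^sup>+a. u a \<partial>pm \<mu>)) \<in> borel_measurable Conf" by measurable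
  with mult show ?case by (simp add: nn_integral_cmult)
next
  case (add u v)
  then have "(\<lambda>\<mu>. (\<integral>\<^sup>+a. u a \<partial>pm \<mu>) + (\<integral>\<^sup>+a. v a \<partial>pm \<mu>)) \<in> borel_measurable Conf" by measurable
  with add show ?case by (simp add: nn_integral_add)
next
  case (seq U)
  have "(\<integral>\<^sup>+a. (SUP i. U i) a \<partial>pm \<mu>) = (SUP i. \<integral>\<^sup>+a. U i a \<partial>pm \<mu>)" for \<mu>
    unfolding SUP_apply using seq by (intro nn_integral_monotone_convergence_SUP) auto
  then show ?case using seq by (simp add: borel_measurable_SUP)
qed

lemma measurable_integral_pm:
  fixes f :: "complex \<Rightarrow> complex"
  assumes [measurable]: "f \<in> borel_measurable borel"
  shows "(\<lambda>\<mu>. \<integral>a. f a \<partial>pm \<mu>) \<in> borel_measurable Conf"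
proof -
  note [measurable] = measurable_nn_integral_pm
  let ?r = "\<lambda>g \<mu>. enn2real (\<integral>\<^sup>+a. ennreal (g a) \<partial>pm \<mu>) - enn2real (\<integral>\<^sup>+a. ennreal (- g a) \<partial>pm \<mu>)"
  \<comment> \<open>The else branch matches the convention that a function which is not integrable
    has integral 0.\<close>
  have "(\<lambda>\<mu>. if (\<integral>\<^sup>+a. ennreal (cmod (f a)) \<partial>pm \<mu>) < \<infinity> then Complex (?r (\<lambda>a. Re (f a)) \<mu>) (?r (\<lambda>a. Im (f a)) \<mu>) else 0) \<in> borel_measurable Conf"
    by measurable
  moreover have "(\<integral>a. f a \<partial>pm \<mu>) = (if (\<integral>\<^sup>+a. ennreal (cmod (f a)) \<partial>pm \<mu>) < \<infinity> then Complex (?r (\<lambda>a. Re (f a)) \<mu>) (?r (\<lambda>a. Im (f a)) \<mu>) else 0)" for \<mu>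
  proof (cases "(\<integral>\<^sup>+a. ennreal (cmod (f a)) \<partial>pm \<mu>) < \<infinity>")
    case True
    then have i: "integrable (pm \<mu>) f" by (intro integrableI_bounded) auto
    have "(\<integral>a. f a \<partial>pm \<mu>) = Complex (\<integral>a. Re (f a) \<partial>pm \<mu>) (\<integral>a. Im (f a) \<partial>pm \<mu>)"
      using i by (simp add: complex_eq_iff)
    then show ?thesis
      using True by (simp only: real_lebesgue_integral_def[OF integrable_Re[OF i]] real_lebesgue_integral_def[OF integrable_Im[OF i]] if_True)
  next
    case False
    then have "\<not> integrable (pm \<mu>) f" by (auto simp: integrable_iff_bounded)
    then show ?thesis using False by (simp add: not_integrable_integral_eq)
  qed
  ultimately show ?thesis by simp
qed

subsection \<open>Stationary point processes\<close>

locale stationary_process = prob_space M for M :: "'w measure" +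
  fixes \<Lambda> :: "'w \<Rightarrow> complex \<Rightarrow> nat"
  assumes measurable_Lambda: "\<Lambda> \<in> measurable M Conf"
    and stationary: "stationary_pp M \<Lambda>"
    and second_moment: "finite_second_moment M \<Lambda>"
begin

definition N :: "'w \<Rightarrow> complex measure" where "N \<omega> = pm (\<Lambda> \<omega>)"

definition I :: "(complex \<Rightarrow> complex) \<Rightarrow> 'w \<Rightarrow> complex" where "I f \<omega> = (\<integral>a. f a \<partial>N \<omega>)"

lemma sets_N [simp, measurable_cong]: "sets (N \<omega>) = sets borel"
  and space_N [simp]: "space (N \<omega>) = UNIV"
  by (simp_all add: N_def)

lemma Lambda_configs: "\<omega> \<in> space M \<Longrightarrow> \<Lambda> \<omega> \<in> configs"
  using measurable_space[OF measurable_Lambda] by (simp add: space_Conf)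

lemma measurable_nn_integral_N [measurable (raw)]:
  "f \<in> borel_measurable borel \<Longrightarrow> (\<lambda>\<omega>. \<integral>\<^sup>+a. f a \<partial>N \<omega>) \<in> borel_measurable M"
  unfolding N_def by (rule measurable_compose[OF measurable_Lambda measurable_nn_integral_pm])

lemma measurable_emeasure_N [measurable (raw)]:
  "B \<in> sets borel \<Longrightarrow> (\<lambda>\<omega>. emeasure (N \<omega>) B) \<in> borel_measurable M"
  unfolding N_def by (rule measurable_compose[OF measurable_Lambda measurable_emeasure_pm])

lemma measurable_I [measurable]:
  "f \<in> borel_measurable borel \<Longrightarrow> I f \<in> borel_measurable M"
  unfolding N_def I_def[abs_def] by (rule measurable_compose[OF measurable_Lambda measurable_integral_pm])

text \<open>The mean measure of the process weighted by \<open>g\<close>; it is used with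
  \<open>g\<close> the indicator of an invariant event.\<close>

definition campbell :: "('w \<Rightarrow> ennreal) \<Rightarrow> complex measure" where
  "campbell g = measure_of UNIV (sets borel) (\<lambda>B. \<integral>\<^sup>+\<omega>. g \<omega> * emeasure (N \<omega>) B \<partial>M)"

lemma sets_campbell [simp, measurable_cong]: "sets (campbell g) = sets borel"
  and space_campbell [simp]: "space (campbell g) = UNIV"
  by (auto simp: campbell_def sets.sigma_sets_eq[of borel, simplified])

lemma emeasure_campbell:
  assumes [measurable]: "g \<in> borel_measurable M" and B: "B \<in> sets borel"
  shows "emeasure (campbell g) B = (\<integral>\<^sup>+\<omega>. g \<omega> * emeasure (N \<omega>) B \<partial>M)"
  unfolding campbell_def
proof (rule emeasure_measure_of_sigma[OF _ _ _ B])
  show "sigma_algebra UNIV (sets (borel :: complex measure))"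
    using sets.sigma_algebra_axioms[of "borel :: complex measure"] by simp
  show "positive (sets borel) (\<lambda>B. \<integral>\<^sup>+\<omega>. g \<omega> * emeasure (N \<omega>) B \<partial>M)" by (simp add: positive_def)
  show "countably_additive (sets borel) (\<lambda>B. \<integral>\<^sup>+\<omega>. g \<omega> * emeasure (N \<omega>) B \<partial>M)"
  proof (rule countably_additiveI)
    fix A :: "nat \<Rightarrow> complex set" assume A: "range A \<subseteq> sets borel" "disjoint_family A"
    have "(\<Sum>i. \<integral>\<^sup>+\<omega>. g \<omega> * emeasure (N \<omega>) (A i) \<partial>M) = (\<integral>\<^sup>+\<omega>. (\<Sum>i. g \<omega> * emeasure (N \<omega>) (A i)) \<partial>M)"
      using A by (intro nn_integral_suminf[symmetric]) auto
    also have "\<dots> = (\<integral>\<^sup>+\<omega>. g \<omega> * emeasure (N \<omega>) (\<Union> (range A)) \<partial>M)"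
      using A by (simp add: suminf_emeasure)
    finally show "(\<Sum>i. \<integral>\<^sup>+\<omega>. g \<omega> * emeasure (N \<omega>) (A i) \<partial>M) = (\<integral>\<^sup>+\<omega>. g \<omega> * emeasure (N \<omega>) (\<Union> (range A)) \<partial>M)" .
  qed
qed

lemma nn_integral_campbell:
  assumes g[measurable]: "g \<in> borel_measurable M" and "f \<in> borel_measurable borel"
  shows "(\<integral>\<^sup>+a. f a \<partial>campbell g) = (\<integral>\<^sup>+\<omega>. g \<omega> * (\<integral>\<^sup>+a. f a \<partial>N \<omega>) \<partial>M)"
  using assms(2)
proof (induction rule: borel_measurable_induct)
  case (cong f h)
  then have "f = h" by auto
  with cong show ?case by simp
next
  case (set A) then show ?case by (simp add: emeasure_campbell[OF g])
next
  case (mult u c)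
  then show ?case by (simp add: nn_integral_cmult mult.left_commute[of _ c])
next
  case (add u v)
  then show ?case by (simp add: nn_integral_add distrib_left)
next
  case (seq U)
  have "(\<integral>\<^sup>+a. (SUP i. U i) a \<partial>campbell g) = (SUP i. \<integral>\<^sup>+a. U i a \<partial>campbell g)"
    unfolding SUP_apply using seq by (intro nn_integral_monotone_convergence_SUP) auto
  also have "\<dots> = (SUP i. \<integral>\<^sup>+\<omega>. g \<omega> * (\<integral>\<^sup>+a. U i a \<partial>N \<omega>) \<partial>M)" using seq by simp
  also have "\<dots> = (\<integral>\<^sup>+\<omega>. (SUP i. g \<omega> * (\<integral>\<^sup>+a. U i a \<partial>N \<omega>)) \<partial>M)"
    using seq by (intro nn_integral_monotone_convergence_SUP[symmetric])
      (auto simp: incseq_def le_fun_def intro!: mult_left_mono nn_integral_mono)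
  also have "\<dots> = (\<integral>\<^sup>+\<omega>. g \<omega> * (\<integral>\<^sup>+a. (SUP i. U i) a \<partial>N \<omega>) \<partial>M)"
    unfolding SUP_apply using seq by (subst nn_integral_monotone_convergence_SUP) (auto simp: SUP_mult_left_ennreal)
  finally show ?case .
qed

lemma cnt_square_integrable:
  assumes "B \<in> sets borel" "bounded B" shows "integrable M (\<lambda>\<omega>. (real (cnt (\<Lambda> \<omega>) B))\<^sup>2)"
  using assms second_moment by (auto simp: finite_second_moment_def)

lemma measurable_cnt [measurable]:
  assumes "B \<in> sets borel" "bounded B" shows "(\<lambda>\<omega>. real (cnt (\<Lambda> \<omega>) B)) \<in> borel_measurable M"
  using measurable_compose[OF measurable_compose[OF measurable_Lambda cnt_measurable[OF assms]], of real borel] by simp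

lemma cnt_integrable:
  assumes "B \<in> sets borel" "bounded B" shows "integrable M (\<lambda>\<omega>. real (cnt (\<Lambda> \<omega>) B))"
  using square_integrable_imp_integrable[OF measurable_cnt[OF assms] cnt_square_integrable[OF assms]] .

lemma emeasure_N_bounded:
  "\<omega> \<in> space M \<Longrightarrow> B \<in> sets borel \<Longrightarrow> bounded B \<Longrightarrow> emeasure (N \<omega>) B = ennreal (real (cnt (\<Lambda> \<omega>) B))"
  by (simp add: N_def emeasure_pm_bounded Lambda_configs ennreal_of_nat_eq_real_of_nat)

text \<open>The measure \<open>B \<mapsto> E[1\<^bsub>A\<^esub> n(B)]\<close> of an invariant event is translation invariant, hence
  a multiple of Lebesgue measure.\<close>
lemma invariant_mean_measure:
  assumes A: "A \<in> sets Conf" and inv: "\<And>w \<mu>. \<mu> \<in> configs \<Longrightarrow> shift w \<mu> \<in> A \<longleftrightarrow> \<mu> \<in> A"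
  obtains c where "c \<ge> 0" "\<And>f. f \<in> borel_measurable borel \<Longrightarrow>
    (\<integral>\<^sup>+\<omega>. indicator A (\<Lambda> \<omega>) * (\<integral>\<^sup>+a. f a \<partial>N \<omega>) \<partial>M) = ennreal c * (\<integral>\<^sup>+a. f a \<partial>lborel)"
proof -
  note [measurable] = measurable_Lambda A
  define g :: "'w \<Rightarrow> ennreal" where "g \<omega> = indicator A (\<Lambda> \<omega>)" for \<omega>
  have g[measurable]: "g \<in> borel_measurable M" unfolding g_def by measurable
  let ?\<nu> = "campbell g"
  obtain c where c: "c \<ge> 0" "?\<nu> = scale_measure (ennreal c) lborel"
  proof (rule haar_measure_unique[of ?\<nu>])
    fix w
    show "distr ?\<nu> borel (\<lambda>z. z + w) = ?\<nu>"
    proof (rule measure_eqI)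
      fix B assume "B \<in> sets (distr ?\<nu> borel (\<lambda>z. z + w))"
      then have B: "B \<in> sets borel" by simp
      then have B': "(\<lambda>z. z + w) -` B \<in> sets borel" using measurable_sets[of "\<lambda>z. z + w" borel borel B] by simp
      let ?F = "\<lambda>\<mu>. indicator A \<mu> * emeasure (pm \<mu>) B"
      have F: "?F \<in> borel_measurable Conf" using measurable_emeasure_pm[OF B] by measurable
      have "emeasure (distr ?\<nu> borel (\<lambda>z. z + w)) B = (\<integral>\<^sup>+\<omega>. g \<omega> * emeasure (N \<omega>) ((\<lambda>z. z + w) -` B) \<partial>M)"
        using B B' by (simp add: emeasure_distr emeasure_campbell)
      \<comment> \<open>Shifting the set amounts to shifting the configuration; the indicator
        follows because \<open>A\<close> is invariant, and stationarity then removes the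
        shift.\<close>
      also have "\<dots> = (\<integral>\<^sup>+\<omega>. ?F (shift w (\<Lambda> \<omega>)) \<partial>M)"
        using inv Lambda_configs B by (intro nn_integral_cong) (auto simp: g_def N_def pm_shift indicator_def)
      also have "\<dots> = (\<integral>\<^sup>+\<mu>. ?F \<mu> \<partial>distr M Conf (\<lambda>\<omega>. shift w (\<Lambda> \<omega>)))"
        using F by (subst nn_integral_distr) (auto intro: measurable_compose[OF measurable_Lambda shift_measurable])
      also have "\<dots> = (\<integral>\<^sup>+\<mu>. ?F \<mu> \<partial>distr M Conf \<Lambda>)"
        using stationary by (simp add: stationary_pp_def)
      also have "\<dots> = (\<integral>\<^sup>+\<omega>. g \<omega> * emeasure (N \<omega>) B \<partial>M)"
        using F by (subst nn_integral_distr) (auto simp: g_def N_def intro: measurable_Lambda)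
      finally show "emeasure (distr ?\<nu> borel (\<lambda>z. z + w)) B = emeasure ?\<nu> B"
        using B by (simp add: emeasure_campbell)
    qed simp
  next
    fix r :: real
    have "emeasure ?\<nu> (ball 0 r) \<le> (\<integral>\<^sup>+\<omega>. ennreal (real (cnt (\<Lambda> \<omega>) (ball 0 r))) \<partial>M)"
      by (subst emeasure_campbell) (auto simp: g_def emeasure_N_bounded indicator_def intro!: nn_integral_mono)
    also have "\<dots> < \<infinity>"
      using cnt_integrable[of "ball 0 r"] by (simp add: real_integrable_def less_top)
    finally show "emeasure ?\<nu> (ball 0 r) < \<infinity>" .
  qed simp
  have "(\<integral>\<^sup>+\<omega>. indicator A (\<Lambda> \<omega>) * (\<integral>\<^sup>+a. f a \<partial>N \<omega>) \<partial>M) = ennreal c * (\<integral>\<^sup>+a. f a \<partial>lborel)"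
    if "f \<in> borel_measurable borel" for f
    using nn_integral_campbell[OF g that] that
    by (simp add: g_def[symmetric] c scale_measure_eq_density nn_integral_density nn_integral_cmult)
  with c(1) show thesis by (rule that)
qed

definition intensity :: real where
  "intensity = (SOME c. c \<ge> 0 \<and> (\<forall>f. f \<in> borel_measurable borel \<longrightarrow>
    (\<integral>\<^sup>+\<omega>. (\<integral>\<^sup>+a. f a \<partial>N \<omega>) \<partial>M) = ennreal c * (\<integral>\<^sup>+a. f a \<partial>lborel)))"

lemma intensity_nonneg: "intensity \<ge> 0"
  and nn_integral_N: "f \<in> borel_measurable borel \<Longrightarrow>
    (\<integral>\<^sup>+\<omega>. (\<integral>\<^sup>+a. f a \<partial>N \<omega>) \<partial>M) = ennreal intensity * (\<integral>\<^sup>+a. f a \<partial>lborel)"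
proof -
  have "configs \<in> sets Conf" using sets.top[of Conf] by (simp add: space_Conf)
  then obtain c where c: "c \<ge> 0" "\<And>f. f \<in> borel_measurable borel \<Longrightarrow>
    (\<integral>\<^sup>+\<omega>. indicator configs (\<Lambda> \<omega>) * (\<integral>\<^sup>+a. f a \<partial>N \<omega>) \<partial>M) = ennreal c * (\<integral>\<^sup>+a. f a \<partial>lborel)"
    by (rule invariant_mean_measure) (use shift_configs in auto)
  have "(\<integral>\<^sup>+\<omega>. indicator configs (\<Lambda> \<omega>) * (\<integral>\<^sup>+a. f a \<partial>N \<omega>) \<partial>M) = (\<integral>\<^sup>+\<omega>. (\<integral>\<^sup>+a. f a \<partial>N \<omega>) \<partial>M)" for f :: "complex \<Rightarrow> ennreal"
    by (intro nn_integral_cong) (simp add: Lambda_configs)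
  then have "\<exists>c. c \<ge> 0 \<and> (\<forall>f. f \<in> borel_measurable borel \<longrightarrow>
    (\<integral>\<^sup>+\<omega>. (\<integral>\<^sup>+a. f a \<partial>N \<omega>) \<partial>M) = ennreal c * (\<integral>\<^sup>+a. f a \<partial>lborel))"
    using c by auto
  from someI_ex[OF this, folded intensity_def]
  show "intensity \<ge> 0" "f \<in> borel_measurable borel \<Longrightarrow>
    (\<integral>\<^sup>+\<omega>. (\<integral>\<^sup>+a. f a \<partial>N \<omega>) \<partial>M) = ennreal intensity * (\<integral>\<^sup>+a. f a \<partial>lborel)" by auto
qed

text \<open>A finite mean of the integral of |f| forces finiteness almost surely. This covers
  integrands without bounded support, such as the |a|^-3 tail of zeta.\<close>

lemma AE_N_integrable:
  fixes f :: "complex \<Rightarrow> complex"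
  assumes f: "integrable lborel f"
  shows "AE \<omega> in M. integrable (N \<omega>) f"
proof -
  have [measurable]: "f \<in> borel_measurable borel" using f by auto
  have "(\<integral>\<^sup>+\<omega>. (\<integral>\<^sup>+a. ennreal (cmod (f a)) \<partial>N \<omega>) \<partial>M) < \<infinity>"
    using f by (subst nn_integral_N) (auto simp: integrable_iff_bounded ennreal_mult_less_top)
  then have "AE \<omega> in M. (\<integral>\<^sup>+a. ennreal (cmod (f a)) \<partial>N \<omega>) \<noteq> \<infinity>"
    by (intro nn_integral_PInf_AE) auto
  then show ?thesis by eventually_elim (auto simp: integrable_iff_bounded less_top)
qed

text \<open>The estimate that disposes of deterministic errors: smallness in L1 of the plane gives
  smallness in mean, without reference to a spectral measure.\<close>

lemma
  fixes f :: "complex \<Rightarrow> complex"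
  assumes f: "integrable lborel f"
  shows integrable_I: "integrable M (I f)"
    and integral_norm_I_le: "(\<integral>\<omega>. cmod (I f \<omega>) \<partial>M) \<le> intensity * (\<integral>a. cmod (f a) \<partial>lborel)"
proof -
  have [measurable]: "f \<in> borel_measurable borel" using f by auto
  have "(\<integral>\<^sup>+\<omega>. ennreal (cmod (I f \<omega>)) \<partial>M) \<le> (\<integral>\<^sup>+\<omega>. (\<integral>\<^sup>+a. ennreal (cmod (f a)) \<partial>N \<omega>) \<partial>M)"
    using AE_N_integrable[OF f] unfolding I_def
    by (intro nn_integral_mono_AE) (auto elim!: eventually_mono simp: integral_norm_bound_ennreal)
  also have "\<dots> = ennreal (intensity * (\<integral>a. cmod (f a) \<partial>lborel))"
    using f intensity_nonneg by (simp add: nn_integral_N nn_integral_eq_integral integrable_norm ennreal_mult)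
  finally have *: "(\<integral>\<^sup>+\<omega>. ennreal (cmod (I f \<omega>)) \<partial>M) \<le> ennreal (intensity * (\<integral>a. cmod (f a) \<partial>lborel))" .
  then have "(\<integral>\<^sup>+\<omega>. ennreal (cmod (I f \<omega>)) \<partial>M) < \<infinity>" by (rule order_le_less_trans) simp
  then show i: "integrable M (I f)" by (intro integrableI_bounded) auto
  show "(\<integral>\<omega>. cmod (I f \<omega>) \<partial>M) \<le> intensity * (\<integral>a. cmod (f a) \<partial>lborel)"
    using * i intensity_nonneg by (simp add: nn_integral_eq_integral integrable_norm)
qed

lemma expectation_I:
  fixes f :: "complex \<Rightarrow> complex"
  assumes f: "integrable lborel f"
  shows "(\<integral>\<omega>. I f \<omega> \<partial>M) = of_real intensity * (\<integral>a. f a \<partial>lborel)"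
proof -
  have [measurable]: "f \<in> borel_measurable borel" using f by auto
  \<comment> \<open>Here \<open>h\<close> stands for the real or imaginary part of \<open>f\<close>
    or its negative; \<open>ennreal\<close> truncates at 0, so the identity for nonnegative
    integrals is applied to the positive part.\<close>
  have pos: "(\<integral>\<omega>. enn2real (\<integral>\<^sup>+a. ennreal (h a) \<partial>N \<omega>) \<partial>M) = intensity * enn2real (\<integral>\<^sup>+a. ennreal (h a) \<partial>lborel)"
    and pos_i: "integrable M (\<lambda>\<omega>. enn2real (\<integral>\<^sup>+a. ennreal (h a) \<partial>N \<omega>))"
    if [measurable]: "h \<in> borel_measurable borel" and h: "\<And>a. \<bar>h a\<bar> \<le> cmod (f a)" for h :: "complex \<Rightarrow> real"
  proof -
    have fin: "(\<integral>\<^sup>+a. ennreal (h a) \<partial>lborel) < \<infinity>"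
    proof -
      have "(\<integral>\<^sup>+a. ennreal (h a) \<partial>lborel) \<le> (\<integral>\<^sup>+a. ennreal (cmod (f a)) \<partial>lborel)"
        using h by (intro nn_integral_mono ennreal_leI) (meson abs_le_D1)
      also have "\<dots> < \<infinity>" using f by (simp add: integrable_iff_bounded)
      finally show ?thesis .
    qed
    have eq: "(\<integral>\<^sup>+\<omega>. (\<integral>\<^sup>+a. ennreal (h a) \<partial>N \<omega>) \<partial>M) = ennreal intensity * (\<integral>\<^sup>+a. ennreal (h a) \<partial>lborel)"
      by (simp add: nn_integral_N)
    have "AE \<omega> in M. (\<integral>\<^sup>+a. ennreal (h a) \<partial>N \<omega>) \<noteq> \<infinity>"
      using fin by (intro nn_integral_PInf_AE) (auto simp: eq ennreal_mult_eq_top_iff)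
    then have "(\<integral>\<^sup>+\<omega>. ennreal (enn2real (\<integral>\<^sup>+a. ennreal (h a) \<partial>N \<omega>)) \<partial>M) = (\<integral>\<^sup>+\<omega>. (\<integral>\<^sup>+a. ennreal (h a) \<partial>N \<omega>) \<partial>M)"
      by (intro nn_integral_cong_AE) (auto elim!: eventually_mono simp: ennreal_enn2real less_top)
    also have "\<dots> = ennreal (intensity * enn2real (\<integral>\<^sup>+a. ennreal (h a) \<partial>lborel))"
      using fin intensity_nonneg by (simp add: eq ennreal_mult ennreal_enn2real)
    finally have *: "(\<integral>\<^sup>+\<omega>. ennreal (enn2real (\<integral>\<^sup>+a. ennreal (h a) \<partial>N \<omega>)) \<partial>M) = ennreal (intensity * enn2real (\<integral>\<^sup>+a. ennreal (h a) \<partial>lborel))" .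
    show "integrable M (\<lambda>\<omega>. enn2real (\<integral>\<^sup>+a. ennreal (h a) \<partial>N \<omega>))"
      by (rule integrableI_nonneg) (auto simp: *)
    show "(\<integral>\<omega>. enn2real (\<integral>\<^sup>+a. ennreal (h a) \<partial>N \<omega>) \<partial>M) = intensity * enn2real (\<integral>\<^sup>+a. ennreal (h a) \<partial>lborel)"
      by (rule integral_eq_nn_integral[THEN trans]) (auto simp: * intensity_nonneg)
  qed
  have real: "(\<integral>\<omega>. (\<integral>a. h a \<partial>N \<omega>) \<partial>M) = intensity * (\<integral>a. h a \<partial>lborel)"
    if h[measurable]: "h \<in> borel_measurable borel" and hf: "\<And>a. \<bar>h a\<bar> \<le> cmod (f a)"
      and ih: "\<And>\<omega>. integrable (N \<omega>) f \<Longrightarrow> integrable (N \<omega>) h" "integrable lborel h" and m: "(\<lambda>\<omega>. \<integral>a. h a \<partial>N \<omega>) \<in> borel_measurable M" for h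
  proof -
    have "(\<integral>\<omega>. (\<integral>a. h a \<partial>N \<omega>) \<partial>M) = (\<integral>\<omega>. enn2real (\<integral>\<^sup>+a. ennreal (h a) \<partial>N \<omega>) - enn2real (\<integral>\<^sup>+a. ennreal (- h a) \<partial>N \<omega>) \<partial>M)"
      using AE_N_integrable[OF f] ih(1) by (intro integral_cong_AE m) (auto elim!: eventually_mono simp: real_lebesgue_integral_def)
    also have "\<dots> = intensity * (\<integral>a. h a \<partial>lborel)"
      using pos[of h] pos[of "\<lambda>a. - h a"] pos_i[of h] pos_i[of "\<lambda>a. - h a"] hf ih(2)
      by (simp add: real_lebesgue_integral_def[of lborel h] right_diff_distrib)
    finally show ?thesis .
  qed
  have Re: "Re (I f \<omega>) = (\<integral>a. Re (f a) \<partial>N \<omega>)" and Im: "Im (I f \<omega>) = (\<integral>a. Im (f a) \<partial>N \<omega>)" if "integrable (N \<omega>) f" for \<omega>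
    using that by (simp_all add: I_def)
  have mR: "(\<lambda>\<omega>. \<integral>a. Re (f a) \<partial>N \<omega>) = (\<lambda>\<omega>. Re (I (\<lambda>a. of_real (Re (f a))) \<omega>))"
    "(\<lambda>\<omega>. \<integral>a. Im (f a) \<partial>N \<omega>) = (\<lambda>\<omega>. Re (I (\<lambda>a. of_real (Im (f a))) \<omega>))"
    by (auto simp: I_def fun_eq_iff integral_complex_of_real)
  have "Re (\<integral>\<omega>. I f \<omega> \<partial>M) = (\<integral>\<omega>. (\<integral>a. Re (f a) \<partial>N \<omega>) \<partial>M)"
    using AE_N_integrable[OF f] integrable_I[OF f] Re
    by (simp only: integral_Re[symmetric]) (intro integral_cong_AE, auto elim!: eventually_mono simp: mR)
  also have "\<dots> = intensity * (\<integral>a. Re (f a) \<partial>lborel)"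
    by (rule real) (use f abs_Re_le_cmod in \<open>auto simp: mR\<close>)
  finally have R: "Re (\<integral>\<omega>. I f \<omega> \<partial>M) = intensity * (\<integral>a. Re (f a) \<partial>lborel)" .
  have "Im (\<integral>\<omega>. I f \<omega> \<partial>M) = (\<integral>\<omega>. (\<integral>a. Im (f a) \<partial>N \<omega>) \<partial>M)"
    using AE_N_integrable[OF f] integrable_I[OF f] Im
    by (simp only: integral_Im[symmetric]) (intro integral_cong_AE, auto elim!: eventually_mono simp: mR)
  also have "\<dots> = intensity * (\<integral>a. Im (f a) \<partial>lborel)"
    by (rule real) (use f abs_Im_le_cmod in \<open>auto simp: mR\<close>)
  finally show ?thesis using R f by (simp add: complex_eq_iff)
qed

text \<open>The mean measure is a multiple of Lebesgue measure, so almost surely no point of the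
  process lies in a given Lebesgue null set. It is applied to the unit circle and to the
  discontinuities of cutoffs.\<close>

lemma AE_N_null:
  assumes "AE a in lborel. P a" "Measurable.pred borel P"
  shows "AE \<omega> in M. AE a in N \<omega>. P a"
proof -
  have B: "{a. \<not> P a} \<in> sets borel" using assms(2) by (simp add: pred_def Collect_neg_eq)
  then have "emeasure lborel {a. \<not> P a} = 0" using assms(1) by (subst (asm) AE_iff_measurable[OF _ refl]) auto
  then have "(\<integral>\<^sup>+\<omega>. emeasure (N \<omega>) {a. \<not> P a} \<partial>M) = 0"
    using nn_integral_N[of "indicator {a. \<not> P a}"] B by simp
  then have "AE \<omega> in M. emeasure (N \<omega>) {a. \<not> P a} = 0"
    using B by (subst (asm) nn_integral_0_iff_AE) auto
  then show ?thesis
  proof eventually_elim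
    case (elim \<omega>)
    then show ?case using B by (intro AE_I[of _ _ "{a. \<not> P a}"]) auto
  qed
qed

end

subsection \<open>Covariances\<close>

lemma mult_le_sum_squares: "x \<ge> 0 \<Longrightarrow> y \<ge> 0 \<Longrightarrow> x * y \<le> x\<^sup>2 + (y::real)\<^sup>2"
proof -
  assume "x \<ge> 0" "y \<ge> 0"
  then have "0 \<le> x * y" by simp
  moreover have "2 * (x * y) \<le> x\<^sup>2 + y\<^sup>2" using sum_squares_bound[of x y] by (simp add: mult.assoc)
  ultimately show ?thesis by linarith
qed

lemma (in prob_space) covar_eq:
  assumes Y: "sq_integrable M Y" and Z: "sq_integrable M Z"
  shows "integrable M Y" "integrable M (\<lambda>\<omega>. Y \<omega> * cnj (Z \<omega>))"
    and "covar M Y Z = (\<integral>\<omega>. Y \<omega> * cnj (Z \<omega>) \<partial>M) - (\<integral>\<omega>. Y \<omega> \<partial>M) * cnj (\<integral>\<omega>. Z \<omega> \<partial>M)"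
proof -
  have [measurable]: "Y \<in> borel_measurable M" "Z \<in> borel_measurable M"
    using Y Z by (auto simp: sq_integrable_def)
  have sq: "integrable M (\<lambda>\<omega>. (cmod (Y \<omega>))\<^sup>2)" "integrable M (\<lambda>\<omega>. (cmod (Z \<omega>))\<^sup>2)"
    using Y Z by (auto simp: sq_integrable_def)
  have i: "integrable M X" if [measurable]: "X \<in> borel_measurable M" and "integrable M (\<lambda>\<omega>. (cmod (X \<omega>))\<^sup>2)" for X :: "'a \<Rightarrow> complex"
    using square_integrable_imp_integrable[of "\<lambda>\<omega>. cmod (X \<omega>)"] that(2) by (simp add: integrable_norm_iff)
  show iY: "integrable M Y" by (rule i) (use sq in auto)
  have iZ: "integrable M Z" by (rule i) (use sq in auto)
  show iYZ: "integrable M (\<lambda>\<omega>. Y \<omega> * cnj (Z \<omega>))"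
  proof (rule Bochner_Integration.integrable_bound)
    show "integrable M (\<lambda>\<omega>. (cmod (Y \<omega>))\<^sup>2 + (cmod (Z \<omega>))\<^sup>2)" using sq by simp
    show "AE \<omega> in M. norm (Y \<omega> * cnj (Z \<omega>)) \<le> norm ((cmod (Y \<omega>))\<^sup>2 + (cmod (Z \<omega>))\<^sup>2)"
      by (intro AE_I2) (simp add: norm_mult mult_le_sum_squares)
  qed simp
  have iYc: "integrable M (\<lambda>\<omega>. Y \<omega> * c)" "integrable M (\<lambda>\<omega>. c * cnj (Z \<omega>))" for c
    using iY iZ by auto
  have "covar M Y Z = (\<integral>\<omega>. (Y \<omega> * cnj (Z \<omega>) - Y \<omega> * cnj (\<integral>\<omega>. Z \<omega> \<partial>M)) - ((\<integral>\<omega>. Y \<omega> \<partial>M) * cnj (Z \<omega>) - (\<integral>\<omega>. Y \<omega> \<partial>M) * cnj (\<integral>\<omega>. Z \<omega> \<partial>M)) \<partial>M)"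
    unfolding covar_def by (rule Bochner_Integration.integral_cong) (auto simp: algebra_simps)
  also have "\<dots> = (\<integral>\<omega>. Y \<omega> * cnj (Z \<omega>) \<partial>M) - (\<integral>\<omega>. Y \<omega> \<partial>M) * cnj (\<integral>\<omega>. Z \<omega> \<partial>M)"
    using iYZ iYc by (simp add: prob_space)
  finally show "covar M Y Z = (\<integral>\<omega>. Y \<omega> * cnj (Z \<omega>) \<partial>M) - (\<integral>\<omega>. Y \<omega> \<partial>M) * cnj (\<integral>\<omega>. Z \<omega> \<partial>M)" .
qed

text \<open>The class of test functions to which the defining identity of the spectral measure extends;
  it contains functions with a sharp cutoff.\<close>
definition nice :: "(complex \<Rightarrow> complex) \<Rightarrow> bool" where
  "nice f \<longleftrightarrow> bdd_supp f \<and> (AE x in lborel. isCont f x)"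

lemma test_fun_continuous: "test_fun f \<Longrightarrow> continuous_on UNIV f"
  unfolding test_fun_def smooth_fun_def by (metis pderivs.simps(1))

lemma bdd_supp_continuous:
  assumes c: "continuous_on UNIV f" and b: "bounded {z. f z \<noteq> 0}"
  shows "bdd_supp f"
proof -
  have "compact (closure {z. f z \<noteq> 0})" using b by (simp add: compact_closure)
  then have "bounded (f ` closure {z. f z \<noteq> 0})"
    by (intro compact_imp_bounded compact_continuous_image continuous_on_subset[OF c]) auto
  then have "bounded (insert 0 (f ` closure {z. f z \<noteq> 0}))" by simp
  then have "bounded (range f)"
    by (rule bounded_subset) (use closure_subset in fastforce)
  then show ?thesis using b c by (simp add: bdd_supp_def borel_measurable_continuous_onI)
qed

lemma bdd_supp_test_fun: "test_fun f \<Longrightarrow> bdd_supp f"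
  using bdd_supp_continuous[OF test_fun_continuous] by (auto simp: test_fun_def)

lemma nice_continuous: "continuous_on UNIV f \<Longrightarrow> bdd_supp f \<Longrightarrow> nice f"
  by (auto simp: nice_def continuous_on_eq_continuous_at)

lemma nice_diff: "nice f \<Longrightarrow> nice g \<Longrightarrow> nice (\<lambda>x. f x - g x)"
proof -
  assume fg: "nice f" "nice g"
  obtain C r where f: "C > 0" "r > 0" "f \<in> borel_measurable borel" "\<And>x. cmod (f x) \<le> C" "\<And>x. cmod x > r \<Longrightarrow> f x = 0"
    using fg(1) bdd_suppE unfolding nice_def by metis
  obtain D s where g: "D > 0" "s > 0" "g \<in> borel_measurable borel" "\<And>x. cmod (g x) \<le> D" "\<And>x. cmod x > s \<Longrightarrow> g x = 0"
    using fg(2) bdd_suppE unfolding nice_def by metis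
  have "bdd_supp (\<lambda>x. f x - g x)"
    by (rule bdd_suppI[where C="C + D" and r="max r s"])
      (use f g in \<open>auto intro!: order_trans[OF norm_triangle_ineq4 add_mono]\<close>)
  moreover have "AE x in lborel. isCont f x" "AE x in lborel. isCont g x" using fg by (auto simp: nice_def)
  then have "AE x in lborel. isCont (\<lambda>x. f x - g x) x" by eventually_elim (rule continuous_diff)
  ultimately show ?thesis by (simp add: nice_def)
qed

locale spectral_process = stationary_process +
  fixes \<rho> :: "complex measure"
  assumes spectral: "spectral_measure M (lin_stat \<Lambda>) \<rho>"
begin

lemma sets_rho [simp, measurable_cong]: "sets \<rho> = sets borel"
  using spectral by (simp add: spectral_measure_def)

lemma space_rho [simp]: "space \<rho> = UNIV"
  using sets_eq_imp_space_eq[OF sets_rho] by simp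

lemma lin_stat_eq: "\<omega> \<in> space M \<Longrightarrow> bdd_supp f \<Longrightarrow> lin_stat \<Lambda> f \<omega> = I f \<omega>"
  unfolding lin_stat_def I_def N_def
  by (subst integral_pm_finite(2)[where A="{z. f z \<noteq> 0}"])
    (use Lambda_configs in \<open>auto simp: bdd_supp_def configs_def\<close>)

lemma norm_I_le:
  assumes \<omega>: "\<omega> \<in> space M" and f: "f \<in> borel_measurable borel" "\<And>x. cmod (f x) \<le> C * indicator B x"
    and B: "B \<in> sets borel" "bounded B" and "C \<ge> 0"
  shows "cmod (I f \<omega>) \<le> C * real (cnt (\<Lambda> \<omega>) B)"
proof -
  have [measurable]: "B \<in> sets borel" "f \<in> borel_measurable borel" by fact+
  have iB: "integrable (N \<omega>) (\<lambda>x. C * indicat_real B x)"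
    using emeasure_N_bounded[OF \<omega> B] by (intro integrable_mult_right integrable_real_indicator) (auto simp: B)
  have "cmod (I f \<omega>) \<le> (\<integral>x. C * indicat_real B x \<partial>N \<omega>)"
    unfolding I_def by (rule Bochner_Integration.integral_norm_bound_integral[OF _ iB])
      (use f(2) in \<open>auto intro!: Bochner_Integration.integrable_bound[OF iB] AE_I2 order_trans[OF f(2) abs_ge_self]\<close>)
  also have "\<dots> = C * real (cnt (\<Lambda> \<omega>) B)"
    using emeasure_N_bounded[OF \<omega> B] B by (simp add: measure_def)
  finally show ?thesis .
qed

lemma sq_integrable_I:
  assumes f: "bdd_supp f" shows "sq_integrable M (I f)"
proof -
  obtain C r where C: "C > 0" "r > 0" "f \<in> borel_measurable borel" "\<And>x. cmod (f x) \<le> C" "\<And>x. cmod x > r \<Longrightarrow> f x = 0"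
    using bdd_suppE[OF f] by metis
  note [measurable] = C(3)
  have "cmod (I f \<omega>) \<le> C * real (cnt (\<Lambda> \<omega>) (cball 0 r))" if "\<omega> \<in> space M" for \<omega>
    by (rule norm_I_le[OF that]) (use C in \<open>auto simp: indicator_def not_le\<close>)
  then have "(cmod (I f \<omega>))\<^sup>2 \<le> C\<^sup>2 * (real (cnt (\<Lambda> \<omega>) (cball 0 r)))\<^sup>2" if "\<omega> \<in> space M" for \<omega>
    unfolding power_mult_distrib[symmetric] using that by (intro power_mono) auto
  then have "integrable M (\<lambda>\<omega>. (cmod (I f \<omega>))\<^sup>2)"
    by (intro Bochner_Integration.integrable_bound[OF integrable_mult_right[OF cnt_square_integrable[of "cball 0 r"], of "C\<^sup>2"]])
      (auto intro!: AE_I2)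
  then show ?thesis by (simp add: sq_integrable_def)
qed

text \<open>The mollified functions are bounded by one multiple of a disc indicator and converge at
  continuity points, which almost surely include all points of the process; dominated convergence is
  used first for the counting measure and then for \<open>M\<close>.\<close>

lemma expectation_mollified:
  assumes f: "nice f" "nice g"
    and \<eta>: "\<And>n f C a. f \<in> borel_measurable borel \<Longrightarrow> (\<And>x. cmod (f x) \<le> C) \<Longrightarrow> cmod (conv f (\<eta> n) a) \<le> C"
    "\<And>n f R a. (\<And>x. cmod x > R \<Longrightarrow> f x = 0) \<Longrightarrow> cmod a > R + 2 \<Longrightarrow> conv f (\<eta> n) a = 0"
    "\<And>f C a. f \<in> borel_measurable borel \<Longrightarrow> (\<And>x. cmod (f x) \<le> C) \<Longrightarrow> isCont f a \<Longrightarrow> (\<lambda>n. conv f (\<eta> n) a) \<longlonglongrightarrow> f a"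
    "\<And>n f. bdd_supp f \<Longrightarrow> test_fun (conv f (\<eta> n))"
  shows "(\<lambda>n. covar M (I (conv f (\<eta> n))) (I (conv g (\<eta> n)))) \<longlonglongrightarrow> covar M (I f) (I g)"
proof -
  have main: "\<exists>C r. C \<ge> 0 \<and> (\<forall>n. bdd_supp (conv f (\<eta> n)) \<and> (\<forall>\<omega>\<in>space M. cmod (I (conv f (\<eta> n)) \<omega>) \<le> C * real (cnt (\<Lambda> \<omega>) (cball 0 r))))
     \<and> (AE \<omega> in M. (\<lambda>n. I (conv f (\<eta> n)) \<omega>) \<longlonglongrightarrow> I f \<omega>)" if f: "nice f" for f
  proof -
    have fs: "bdd_supp f" and cont: "AE x in lborel. isCont f x" using f by (auto simp: nice_def)
    obtain C r where C: "C > 0" "r > 0" "f \<in> borel_measurable borel" "\<And>x. cmod (f x) \<le> C" "\<And>x. cmod x > r \<Longrightarrow> f x = 0"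
      using bdd_suppE[OF fs] by metis
    have bs: "bdd_supp (conv f (\<eta> n))" for n using \<eta>(4)[OF fs] by (rule bdd_supp_test_fun)
    then have [measurable]: "conv f (\<eta> n) \<in> borel_measurable borel" for n by (auto simp: bdd_supp_def)
    note [measurable] = C(3)
    have bd: "cmod (conv f (\<eta> n) x) \<le> C * indicator (cball 0 (r + 2)) x" for n x
      using \<eta>(1)[of f C n x] \<eta>(2)[of r f x n] C by (auto simp: indicator_def not_le)
    have "AE \<omega> in M. AE a in N \<omega>. isCont f a" by (rule AE_N_null[OF cont]) measurable
    then have lim: "AE \<omega> in M. (\<lambda>n. I (conv f (\<eta> n)) \<omega>) \<longlonglongrightarrow> I f \<omega>"
      using AE_space
    proof eventually_elim
      case (elim \<omega>)
      show ?case unfolding I_def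
      proof (rule integral_dominated_convergence[where w="\<lambda>x. C * indicator (cball 0 (r + 2)) x"])
        show "integrable (N \<omega>) (\<lambda>x. C * indicat_real (cball 0 (r + 2)) x)"
          using emeasure_N_bounded[OF elim(2), of "cball 0 (r + 2)"] by (intro integrable_mult_right integrable_real_indicator) auto
        show "AE x in N \<omega>. (\<lambda>n. conv f (\<eta> n) x) \<longlonglongrightarrow> f x"
          using elim(1) by eventually_elim (rule \<eta>(3)[OF C(3,4)])
      qed (use bd in auto)
    qed
    have "cmod (I (conv f (\<eta> n)) \<omega>) \<le> C * real (cnt (\<Lambda> \<omega>) (cball 0 (r + 2)))" if "\<omega> \<in> space M" for n \<omega>
      by (rule norm_I_le[OF that _ bd]) (use C(1) in auto)
    then show ?thesis using bs lim C(1) by (intro exI[of _ C] exI[of _ "r + 2"]) auto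
  qed
  obtain C r where F: "C \<ge> 0" "\<And>n. bdd_supp (conv f (\<eta> n))" "\<And>n \<omega>. \<omega> \<in> space M \<Longrightarrow> cmod (I (conv f (\<eta> n)) \<omega>) \<le> C * real (cnt (\<Lambda> \<omega>) (cball 0 r))"
    "AE \<omega> in M. (\<lambda>n. I (conv f (\<eta> n)) \<omega>) \<longlonglongrightarrow> I f \<omega>" using main[OF f(1)] by blast
  obtain D s where G: "D \<ge> 0" "\<And>n. bdd_supp (conv g (\<eta> n))" "\<And>n \<omega>. \<omega> \<in> space M \<Longrightarrow> cmod (I (conv g (\<eta> n)) \<omega>) \<le> D * real (cnt (\<Lambda> \<omega>) (cball 0 s))"
    "AE \<omega> in M. (\<lambda>n. I (conv g (\<eta> n)) \<omega>) \<longlonglongrightarrow> I g \<omega>" using main[OF f(2)] by blast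
  have [measurable]: "conv f (\<eta> n) \<in> borel_measurable borel" "conv g (\<eta> n) \<in> borel_measurable borel" "f \<in> borel_measurable borel" "g \<in> borel_measurable borel" for n
    using F(2) G(2) f by (auto simp: bdd_supp_def nice_def)
  have 1: "(\<lambda>n. \<integral>\<omega>. I (conv f (\<eta> n)) \<omega> \<partial>M) \<longlonglongrightarrow> (\<integral>\<omega>. I f \<omega> \<partial>M)"
    by (rule integral_dominated_convergence[where w="\<lambda>\<omega>. C * real (cnt (\<Lambda> \<omega>) (cball 0 r))"])
      (use F cnt_integrable in auto)
  have 2: "(\<lambda>n. \<integral>\<omega>. I (conv g (\<eta> n)) \<omega> \<partial>M) \<longlonglongrightarrow> (\<integral>\<omega>. I g \<omega> \<partial>M)"
    by (rule integral_dominated_convergence[where w="\<lambda>\<omega>. D * real (cnt (\<Lambda> \<omega>) (cball 0 s))"])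
      (use G cnt_integrable in auto)
  have 3: "(\<lambda>n. \<integral>\<omega>. I (conv f (\<eta> n)) \<omega> * cnj (I (conv g (\<eta> n)) \<omega>) \<partial>M) \<longlonglongrightarrow> (\<integral>\<omega>. I f \<omega> * cnj (I g \<omega>) \<partial>M)"
  \<comment> \<open>The product of two counts is dominated by the sum of their squares, whose
    integrability is the second moment hypothesis.\<close>
  proof (rule integral_dominated_convergence[where w="\<lambda>\<omega>. (C * real (cnt (\<Lambda> \<omega>) (cball 0 r)))\<^sup>2 + (D * real (cnt (\<Lambda> \<omega>) (cball 0 s)))\<^sup>2"])
    show "integrable M (\<lambda>\<omega>. (C * real (cnt (\<Lambda> \<omega>) (cball 0 r)))\<^sup>2 + (D * real (cnt (\<Lambda> \<omega>) (cball 0 s)))\<^sup>2)"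
      unfolding power_mult_distrib by (intro Bochner_Integration.integrable_add integrable_mult_right cnt_square_integrable) auto
    show "AE \<omega> in M. (\<lambda>n. I (conv f (\<eta> n)) \<omega> * cnj (I (conv g (\<eta> n)) \<omega>)) \<longlonglongrightarrow> I f \<omega> * cnj (I g \<omega>)"
      using F(4) G(4) by eventually_elim (intro tendsto_intros)
    show "AE \<omega> in M. cmod (I (conv f (\<eta> n)) \<omega> * cnj (I (conv g (\<eta> n)) \<omega>)) \<le> (C * real (cnt (\<Lambda> \<omega>) (cball 0 r)))\<^sup>2 + (D * real (cnt (\<Lambda> \<omega>) (cball 0 s)))\<^sup>2" for n
    proof (rule AE_I2)
      fix \<omega> assume \<omega>: "\<omega> \<in> space M"
      let ?x = "C * real (cnt (\<Lambda> \<omega>) (cball 0 r))" and ?y = "D * real (cnt (\<Lambda> \<omega>) (cball 0 s))"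
      have "cmod (I (conv f (\<eta> n)) \<omega> * cnj (I (conv g (\<eta> n)) \<omega>)) \<le> ?x * ?y"
        unfolding norm_mult complex_mod_cnj using F(1,3) G(3) \<omega> by (intro mult_mono) auto
      also have "\<dots> \<le> ?x\<^sup>2 + ?y\<^sup>2" using F(1) G(1) by (intro mult_le_sum_squares) auto
      finally show "cmod (I (conv f (\<eta> n)) \<omega> * cnj (I (conv g (\<eta> n)) \<omega>)) \<le> ?x\<^sup>2 + ?y\<^sup>2" .
    qed
  qed auto
  show ?thesis
    using f F(2) G(2) by (simp only: covar_eq(3) sq_integrable_I nice_def) (intro tendsto_intros 1 2 3)
qed

lemma
  assumes "test_fun f" "test_fun g"
  shows covar_test_fun: "covar M (I f) (I g) = (\<integral>\<xi>. fourier f \<xi> * cnj (fourier g \<xi>) \<partial>\<rho>)"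
    and integrable_fourier_test_fun: "integrable \<rho> (\<lambda>\<xi>. fourier f \<xi> * cnj (fourier g \<xi>))"
proof -
  have "covar M (lin_stat \<Lambda> f) (lin_stat \<Lambda> g) = covar M (I f) (I g)"
    unfolding covar_def using assms bdd_supp_test_fun lin_stat_eq
    by (intro Bochner_Integration.integral_cong arg_cong2[where f="(*)"] arg_cong2[where f="(-)"] arg_cong[where f=cnj])
      (auto intro!: Bochner_Integration.integral_cong)
  then show "covar M (I f) (I g) = (\<integral>\<xi>. fourier f \<xi> * cnj (fourier g \<xi>) \<partial>\<rho>)"
    using spectral assms by (auto simp: spectral_measure_def)
  show "integrable \<rho> (\<lambda>\<xi>. fourier f \<xi> * cnj (fourier g \<xi>))"
    using spectral assms by (auto simp: spectral_measure_def)
qed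

text \<open>Both sides of the identity for mollified functions pass to the limit. On the left this
  is \<open>expectation_mollified\<close>; on the right the product of the two limit transforms
  dominates, so that each of them must first be placed in L2(\<rho>).\<close>

lemma
  assumes f: "nice f" and g: "nice g"
  shows integrable_fourier_nice: "integrable \<rho> (\<lambda>\<xi>. fourier f \<xi> * cnj (fourier g \<xi>))"
    and covar_nice: "covar M (I f) (I g) = (\<integral>\<xi>. fourier f \<xi> * cnj (fourier g \<xi>) \<partial>\<rho>)"
proof -
  obtain \<eta> :: "nat \<Rightarrow> complex \<Rightarrow> complex" where \<eta>:
    "\<And>n. integrable lborel (\<eta> n)"
    "\<And>n f. bdd_supp f \<Longrightarrow> test_fun (conv f (\<eta> n))"
    "\<And>n f C a. f \<in> borel_measurable borel \<Longrightarrow> (\<And>x. cmod (f x) \<le> C) \<Longrightarrow> cmod (conv f (\<eta> n) a) \<le> C"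
    "\<And>n f R a. (\<And>x. cmod x > R \<Longrightarrow> f x = 0) \<Longrightarrow> cmod a > R + 2 \<Longrightarrow> conv f (\<eta> n) a = 0"
    "\<And>f C a. f \<in> borel_measurable borel \<Longrightarrow> (\<And>x. cmod (f x) \<le> C) \<Longrightarrow> isCont f a \<Longrightarrow> (\<lambda>n. conv f (\<eta> n) a) \<longlonglongrightarrow> f a"
    "\<And>n \<xi>. cmod (fourier (\<eta> n) \<xi>) \<le> 1"
    "\<And>\<xi>. (\<lambda>n. fourier (\<eta> n) \<xi>) \<longlonglongrightarrow> 1"
    using mollifier_sequence by blast
  have cvg: "(\<lambda>n. covar M (I (conv f (\<eta> n))) (I (conv g (\<eta> n)))) \<longlonglongrightarrow> covar M (I f) (I g)"
    if "nice f" "nice g" for f g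
    by (rule expectation_mollified[OF that]) (fact \<eta>(3) \<eta>(4) \<eta>(5) \<eta>(2))+
  have m: "fourier f \<in> borel_measurable \<rho>" if "nice f" for f
    using borel_measurable_fourier[of f] integrable_bdd_supp that by (simp add: nice_def measurable_cong_sets[OF sets_rho refl])
  have ft: "fourier (conv f (\<eta> n)) \<xi> = fourier f \<xi> * fourier (\<eta> n) \<xi>" if "nice f" for f n \<xi>
    using that by (intro fourier_conv integrable_bdd_supp \<eta>(1)) (simp add: nice_def)
  \<comment> \<open>Fatou: the variances of the mollified statistics converge, hence are bounded,
    and they are the squared L2(\<rho>) norms of functions tending pointwise to the transform of
    \<open>f\<close>.\<close>
  have L2: "integrable \<rho> (\<lambda>\<xi>. (cmod (fourier f \<xi>))\<^sup>2)" if f: "nice f" for f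
  proof -
    have bs: "bdd_supp f" using f by (simp add: nice_def)
    let ?v = "\<lambda>n. \<integral>\<xi>. (cmod (fourier (conv f (\<eta> n)) \<xi>))\<^sup>2 \<partial>\<rho>"
    have sq: "z * cnj z = of_real ((cmod z)\<^sup>2)" for z by (rule complex_norm_square[symmetric])
    have v: "covar M (I (conv f (\<eta> n))) (I (conv f (\<eta> n))) = of_real (?v n)" for n
      unfolding covar_test_fun[OF \<eta>(2)[OF bs] \<eta>(2)[OF bs]] sq by (rule integral_complex_of_real)
    have vi: "integrable \<rho> (\<lambda>\<xi>. (cmod (fourier (conv f (\<eta> n)) \<xi>))\<^sup>2)" for n
      using integrable_Re[OF integrable_fourier_test_fun[OF \<eta>(2)[OF bs] \<eta>(2)[OF bs]], of n n] unfolding sq by simp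
    have "(\<lambda>n. Re (of_real (?v n))) \<longlonglongrightarrow> Re (covar M (I f) (I f))"
      using tendsto_Re[OF cvg[OF f f]] unfolding v .
    then have "?v \<longlonglongrightarrow> Re (covar M (I f) (I f))" by (simp only: Re_complex_of_real)
    then have "convergent ?v" by (auto simp: convergent_def)
    then have "Bseq ?v" by (rule convergent_imp_Bseq)
    then obtain B where "\<And>n. norm (?v n) \<le> B" unfolding Bseq_def by auto
    then have B: "?v n \<le> B" for n using abs_le_D1[of "?v n" B] by (simp only: real_norm_def)
    have "(\<integral>\<^sup>+\<xi>. ennreal ((cmod (fourier f \<xi>))\<^sup>2) \<partial>\<rho>) \<le> (\<integral>\<^sup>+\<xi>. liminf (\<lambda>n. ennreal ((cmod (fourier (conv f (\<eta> n)) \<xi>))\<^sup>2)) \<partial>\<rho>)"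
    proof (rule nn_integral_mono)
      fix \<xi>
      have "(\<lambda>n. ennreal ((cmod (fourier (conv f (\<eta> n)) \<xi>))\<^sup>2)) \<longlonglongrightarrow> ennreal ((cmod (fourier f \<xi> * 1))\<^sup>2)"
        unfolding ft[OF f] by (intro tendsto_intros \<eta>(7))
      then have "liminf (\<lambda>n. ennreal ((cmod (fourier (conv f (\<eta> n)) \<xi>))\<^sup>2)) = ennreal ((cmod (fourier f \<xi> * 1))\<^sup>2)"
        by (intro lim_imp_Liminf) auto
      then show "ennreal ((cmod (fourier f \<xi>))\<^sup>2) \<le> liminf (\<lambda>n. ennreal ((cmod (fourier (conv f (\<eta> n)) \<xi>))\<^sup>2))" by simp
    qed
    also have "\<dots> \<le> liminf (\<lambda>n. \<integral>\<^sup>+\<xi>. ennreal ((cmod (fourier (conv f (\<eta> n)) \<xi>))\<^sup>2) \<partial>\<rho>)"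
      using vi by (intro nn_integral_liminf) auto
    also have "\<dots> = liminf (\<lambda>n. ennreal (?v n))"
      using vi by (simp add: nn_integral_eq_integral)
    also have "\<dots> \<le> ennreal B"
      by (intro Liminf_le always_eventually allI ennreal_leI B) simp
    also have "\<dots> < \<infinity>" by simp
    finally show ?thesis using m[OF f] by (intro integrableI_bounded) auto
  qed
  note [measurable] = m[OF f] m[OF g]
  have dom: "integrable \<rho> (\<lambda>\<xi>. (cmod (fourier f \<xi>))\<^sup>2 + (cmod (fourier g \<xi>))\<^sup>2)"
    using L2[OF f] L2[OF g] by simp
  have le: "cmod x * cmod y \<le> (cmod x)\<^sup>2 + (cmod y)\<^sup>2" for x y :: complex
    by (simp add: mult_le_sum_squares)
  show int: "integrable \<rho> (\<lambda>\<xi>. fourier f \<xi> * cnj (fourier g \<xi>))"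
    by (rule Bochner_Integration.integrable_bound[OF dom]) (use le in \<open>auto simp: norm_mult\<close>)
  have eq: "covar M (I (conv f (\<eta> n))) (I (conv g (\<eta> n))) = (\<integral>\<xi>. fourier (conv f (\<eta> n)) \<xi> * cnj (fourier (conv g (\<eta> n)) \<xi>) \<partial>\<rho>)" for n
    by (rule covar_test_fun) (use f g \<eta>(2) in \<open>auto simp: nice_def\<close>)
  have "(\<lambda>n. \<integral>\<xi>. fourier (conv f (\<eta> n)) \<xi> * cnj (fourier (conv g (\<eta> n)) \<xi>) \<partial>\<rho>) \<longlonglongrightarrow> (\<integral>\<xi>. fourier f \<xi> * cnj (fourier g \<xi>) \<partial>\<rho>)"
  proof (rule integral_dominated_convergence[OF _ _ dom])
    have [measurable]: "fourier (\<eta> n) \<in> borel_measurable \<rho>" for n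
      using borel_measurable_fourier[OF \<eta>(1)] by (simp add: measurable_cong_sets[OF sets_rho refl])
    show "(\<lambda>\<xi>. fourier (conv f (\<eta> n)) \<xi> * cnj (fourier (conv g (\<eta> n)) \<xi>)) \<in> borel_measurable \<rho>" for n
      unfolding ft[OF f] ft[OF g] by measurable
    have "(\<lambda>n. fourier (conv f (\<eta> n)) \<xi> * cnj (fourier (conv g (\<eta> n)) \<xi>)) \<longlonglongrightarrow> (fourier f \<xi> * 1) * cnj (fourier g \<xi> * 1)" for \<xi>
      unfolding ft[OF f] ft[OF g] by (intro tendsto_intros \<eta>(7))
    then show "AE \<xi> in \<rho>. (\<lambda>n. fourier (conv f (\<eta> n)) \<xi> * cnj (fourier (conv g (\<eta> n)) \<xi>)) \<longlonglongrightarrow> fourier f \<xi> * cnj (fourier g \<xi>)"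
      by simp
    show "AE \<xi> in \<rho>. cmod (fourier (conv f (\<eta> n)) \<xi> * cnj (fourier (conv g (\<eta> n)) \<xi>)) \<le> (cmod (fourier f \<xi>))\<^sup>2 + (cmod (fourier g \<xi>))\<^sup>2" for n
    proof (rule AE_I2)
      fix \<xi>
      have "cmod (fourier (conv f (\<eta> n)) \<xi> * cnj (fourier (conv g (\<eta> n)) \<xi>)) \<le> cmod (fourier f \<xi>) * cmod (fourier g \<xi>)"
        unfolding ft[OF f] ft[OF g] norm_mult complex_mod_cnj using \<eta>(6)[of n \<xi>] by (intro mult_mono) (auto simp: mult_left_le)
      also note le
      finally show "cmod (fourier (conv f (\<eta> n)) \<xi> * cnj (fourier (conv g (\<eta> n)) \<xi>)) \<le> (cmod (fourier f \<xi>))\<^sup>2 + (cmod (fourier g \<xi>))\<^sup>2" .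
    qed
  qed measurable
  then show "covar M (I f) (I g) = (\<integral>\<xi>. fourier f \<xi> * cnj (fourier g \<xi>) \<partial>\<rho>)"
    using cvg[OF f g] unfolding eq by (rule LIMSEQ_unique[rotated])
qed

text \<open>Variance plus squared mean; the mean enters only through the transform at 0.\<close>

lemma
  assumes f: "nice f"
  shows integrable_norm_fourier: "integrable \<rho> (\<lambda>\<xi>. (cmod (fourier f \<xi>))\<^sup>2)"
    and second_moment_I: "(\<integral>\<omega>. (cmod (I f \<omega>))\<^sup>2 \<partial>M) = intensity\<^sup>2 * (cmod (fourier f 0))\<^sup>2 + (\<integral>\<xi>. (cmod (fourier f \<xi>))\<^sup>2 \<partial>\<rho>)"
proof -
  have sq: "z * cnj z = of_real ((cmod z)\<^sup>2)" for z by (rule complex_norm_square[symmetric])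
  have bs: "bdd_supp f" using f by (simp add: nice_def)
  show i: "integrable \<rho> (\<lambda>\<xi>. (cmod (fourier f \<xi>))\<^sup>2)"
    using integrable_Re[OF integrable_fourier_nice[OF f f]] unfolding sq by simp
  have "of_real (\<integral>\<omega>. (cmod (I f \<omega>))\<^sup>2 \<partial>M) = (\<integral>\<omega>. I f \<omega> * cnj (I f \<omega>) \<partial>M)"
    unfolding sq by (rule integral_complex_of_real[symmetric])
  also have "\<dots> = covar M (I f) (I f) + (\<integral>\<omega>. I f \<omega> \<partial>M) * cnj (\<integral>\<omega>. I f \<omega> \<partial>M)"
    by (simp add: covar_eq(3) sq_integrable_I bs)
  also have "\<dots> = of_real (\<integral>\<xi>. (cmod (fourier f \<xi>))\<^sup>2 \<partial>\<rho>) + of_real (intensity\<^sup>2 * (cmod (fourier f 0))\<^sup>2)"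
    unfolding sq covar_nice[OF f f] integral_complex_of_real
    by (simp add: expectation_I integrable_bdd_supp[OF bs] fourier_0 norm_mult power_mult_distrib)
  finally show "(\<integral>\<omega>. (cmod (I f \<omega>))\<^sup>2 \<partial>M) = intensity\<^sup>2 * (cmod (fourier f 0))\<^sup>2 + (\<integral>\<xi>. (cmod (fourier f \<xi>))\<^sup>2 \<partial>\<rho>)"
    unfolding of_real_add[symmetric] of_real_eq_iff by simp
qed

end

subsection \<open>Growth of the spectral measure\<close>

text \<open>Dyadic shells: for 2^j <= |xi| < 2^(j+1) the integrand is at most 2^(-p j) and the mass
  at most 4 C 4^j, so the series is geometric with ratio 2^(2-p) < 1. It is used for the spectral
  measure and for Lebesgue measure alike.\<close>

lemma quadratic_growth_tail:
  fixes \<nu> :: "complex measure"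
  assumes sets [measurable_cong]: "sets \<nu> = sets borel" and p: "p > 2"
    and growth: "\<And>k::nat. k \<ge> 1 \<Longrightarrow> emeasure \<nu> (cball 0 (real k)) \<le> ennreal (C * (real k)\<^sup>2)"
  shows "(\<integral>\<^sup>+\<xi>. indicator {\<xi>. 1 \<le> cmod \<xi>} \<xi> * ennreal (cmod \<xi> powr (-p)) \<partial>\<nu>) < \<infinity>"
proof -
  have C: "C \<ge> 0 \<or> ennreal C = 0" by (cases "C \<ge> 0") (auto simp: ennreal_neg)
  define D where "D = max C 0"
  have D: "D \<ge> 0" "\<And>k::nat. k \<ge> 1 \<Longrightarrow> emeasure \<nu> (cball 0 (real k)) \<le> ennreal (D * (real k)\<^sup>2)"
    by (auto simp: D_def intro!: order_trans[OF growth] ennreal_leI mult_right_mono)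
  define x where "x = 2 powr (2 - p)"
  have x: "0 < x" "x < 1" using p powr_less_mono[of "2 - p" 0 2] by (auto simp: x_def)
  let ?h = "\<lambda>j \<xi>. ennreal ((2 powr (-p)) ^ j) * indicator (cball (0::complex) (real (2 ^ Suc j))) \<xi>"
  have pointwise: "indicator {\<xi>. 1 \<le> cmod \<xi>} \<xi> * ennreal (cmod \<xi> powr (-p)) \<le> (\<Sum>j. ?h j \<xi>)" for \<xi>
  proof (cases "1 \<le> cmod \<xi>")
    case True
    define j where "j = nat \<lfloor>log 2 (cmod \<xi>)\<rfloor>"
    have pos: "0 < cmod \<xi>" using True by linarith
    then have l0: "0 \<le> log 2 (cmod \<xi>)" using True by simp
    have lj: "real j \<le> log 2 (cmod \<xi>)" "log 2 (cmod \<xi>) < real j + 1"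
      using l0 by (auto simp: j_def of_nat_nat)
    have 1: "2 powr (real j) \<le> cmod \<xi>" using lj(1) pos by (simp add: le_log_iff)
    have 2: "cmod \<xi> < 2 powr (real j + 1)" using lj(2) pos by (simp add: log_less_iff)
    have "cmod \<xi> powr (-p) \<le> (2 powr (real j)) powr (-p)"
      using 1 p by (intro powr_mono2') auto
    also have "\<dots> = (2 powr (-p)) ^ j" by (simp add: powr_powr powr_realpow[symmetric] mult.commute)
    finally have a: "cmod \<xi> powr (-p) \<le> (2 powr (-p)) ^ j" .
    have b: "\<xi> \<in> cball 0 (real (2 ^ Suc j))" using 2 by (simp add: powr_add powr_realpow)
    have "indicator {\<xi>. 1 \<le> cmod \<xi>} \<xi> * ennreal (cmod \<xi> powr (-p)) \<le> ?h j \<xi>"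
      using a b True by (auto intro!: ennreal_leI simp del: of_nat_power power_Suc)
    also have "?h j \<xi> = sum (\<lambda>j. ?h j \<xi>) {j}"
      by (simp only: sum.insert finite.emptyI empty_iff not_False_eq_True sum.empty add_0_right)
    also have "\<dots> \<le> (\<Sum>j. ?h j \<xi>)"
      by (rule sum_le_suminf) auto
    finally show ?thesis .
  qed simp
  have "(\<integral>\<^sup>+\<xi>. indicator {\<xi>. 1 \<le> cmod \<xi>} \<xi> * ennreal (cmod \<xi> powr (-p)) \<partial>\<nu>) \<le> (\<integral>\<^sup>+\<xi>. (\<Sum>j. ?h j \<xi>) \<partial>\<nu>)"
    by (intro nn_integral_mono pointwise)
  also have "\<dots> = (\<Sum>j. \<integral>\<^sup>+\<xi>. ?h j \<xi> \<partial>\<nu>)"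
    by (intro nn_integral_suminf borel_measurable_times_ennreal borel_measurable_const borel_measurable_indicator) (simp add: sets)
  also have "\<dots> \<le> (\<Sum>j. ennreal (4 * D * x ^ j))"
  proof (rule suminf_le)
    fix j
    have "(\<integral>\<^sup>+\<xi>. ?h j \<xi> \<partial>\<nu>) = ennreal ((2 powr (-p)) ^ j) * emeasure \<nu> (cball 0 (real (2 ^ Suc j)))"
      by (subst nn_integral_cmult_indicator) (auto simp: sets)
    also have "\<dots> \<le> ennreal ((2 powr (-p)) ^ j) * ennreal (D * (real (2 ^ Suc j))\<^sup>2)"
      by (intro mult_left_mono D(2)) auto
    also have "\<dots> = ennreal (4 * D * x ^ j)"
    proof -
      have "x = 2 powr (-p) * 4" by (simp add: x_def powr_diff powr_minus_divide)
      then have "x ^ j = (2 powr (-p)) ^ j * 4 ^ j" by (simp add: power_mult_distrib)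
      moreover have "(real (2 ^ Suc j))\<^sup>2 = 4 * 4 ^ j"
        by (simp add: power_mult_distrib power_mult[symmetric] mult.commute[of j]) (simp add: power_mult)
      ultimately show ?thesis using D(1) by (simp add: ennreal_mult[symmetric] ac_simps)
    qed
    finally show "(\<integral>\<^sup>+\<xi>. ?h j \<xi> \<partial>\<nu>) \<le> ennreal (4 * D * x ^ j)" .
  qed auto
  also have "\<dots> = ennreal (\<Sum>j. 4 * D * x ^ j)"
    using x D(1) by (intro suminf_ennreal2) (auto intro!: summable_mult summable_geometric)
  also have "\<dots> < \<infinity>" by simp
  finally show ?thesis .
qed

text \<open>Discontinuities are confined to the circle of radius \<open>R\<close> and the origin,
  which are null sets.\<close>

lemma nice_mult_disc:
  assumes f: "f \<in> borel_measurable borel" "\<And>z. cmod z \<le> R \<Longrightarrow> cmod (f z) \<le> C" and cont: "\<And>z. z \<noteq> 0 \<Longrightarrow> isCont f z"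
  shows "nice (\<lambda>z. f z * disc R z)"
  unfolding nice_def
proof (intro conjI bdd_supp_mult_disc[where C=C] f)
  show "AE x in lborel. isCont (\<lambda>z. f z * disc R z) x"
    using AE_lborel_cmod_neq[of R] AE_lborel_singleton[of "0::complex"]
  proof eventually_elim
    case (elim x)
    have "isCont (disc R) x"
    proof (cases "cmod x < R")
      case True
      have "\<forall>\<^sub>F y in nhds x. disc R y = 1"
        unfolding eventually_nhds using True by (intro exI[of _ "ball 0 R"]) (auto simp: disc_def indicator_def)
      then show ?thesis by (subst isCont_cong) (auto elim: eventually_mono)
    next
      case False
      have "\<forall>\<^sub>F y in nhds x. disc R y = 0"
        unfolding eventually_nhds using False elim by (intro exI[of _ "- cball 0 R"]) (auto simp: disc_def indicator_def)
      then show ?thesis by (subst isCont_cong) (auto elim: eventually_mono)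
    qed
    with cont elim show ?case by (intro continuous_mult) auto
  qed
qed

lemma nice_disc: "nice (disc R)" and nice_cnj_disc: "nice (\<lambda>z. cnj z * disc R z)"
  using nice_mult_disc[of "\<lambda>_. 1" R 1] nice_mult_disc[of cnj R R]
  by (auto intro!: continuous_intros)

lemma nice_annulus:
  assumes f: "f \<in> borel_measurable borel" "\<And>z. cmod z > r \<Longrightarrow> cmod z \<le> R \<Longrightarrow> cmod (f z) \<le> C"
    and cont: "\<And>z. z \<noteq> 0 \<Longrightarrow> isCont f z" and r: "0 < r" "r \<le> R"
  shows "nice (\<lambda>z. f z * (disc R z - disc r z))"
  unfolding nice_def
proof (intro conjI bdd_supp_annulus[where C=C] f r)
  have "AE x in lborel. isCont (disc R) x" "AE x in lborel. isCont (disc r) x"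
    using nice_disc by (auto simp: nice_def)
  then show "AE x in lborel. isCont (\<lambda>z. f z * (disc R z - disc r z)) x"
    using AE_lborel_singleton[of "0::complex"]
    by eventually_elim (intro continuous_intros cont)
qed

context spectral_process
begin

lemma cnt_shift_square:
  assumes B: "B \<in> sets borel" "bounded B"
  shows "(\<integral>\<omega>. (real (cnt (\<Lambda> \<omega>) ((\<lambda>z. z + w) -` B)))\<^sup>2 \<partial>M) = (\<integral>\<omega>. (real (cnt (\<Lambda> \<omega>) B))\<^sup>2 \<partial>M)"
proof -
  let ?F = "\<lambda>\<mu>. (real (cnt \<mu> B))\<^sup>2"
  have F: "?F \<in> borel_measurable Conf"
    using measurable_compose[OF cnt_measurable[OF B], of "\<lambda>k. (real k)\<^sup>2" borel] by simp
  have "(\<integral>\<omega>. (real (cnt (\<Lambda> \<omega>) ((\<lambda>z. z + w) -` B)))\<^sup>2 \<partial>M) = (\<integral>\<omega>. ?F (shift w (\<Lambda> \<omega>)) \<partial>M)"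
    by (simp add: cnt_shift)
  also have "\<dots> = (\<integral>\<mu>. ?F \<mu> \<partial>distr M Conf (\<lambda>\<omega>. shift w (\<Lambda> \<omega>)))"
    by (rule integral_distr[symmetric]) (use F measurable_compose[OF measurable_Lambda shift_measurable] in auto)
  also have "\<dots> = (\<integral>\<mu>. ?F \<mu> \<partial>distr M Conf \<Lambda>)"
    using stationary by (simp add: stationary_pp_def)
  also have "\<dots> = (\<integral>\<omega>. ?F (\<Lambda> \<omega>) \<partial>M)"
    by (rule integral_distr) (use F measurable_Lambda in auto)
  finally show ?thesis .
qed

text \<open>Superadditivity of \<open>n\<^sup>2\<close> over \<open>k\<^sup>2\<close> disjoint translates of a disc of radius \<open>t / k\<close>.\<close>
lemma small_disc_second_moment:
  assumes t: "t > 0"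
  obtains C where "C \<ge> 0" "\<And>k::nat. k \<ge> 1 \<Longrightarrow> (\<integral>\<omega>. (real (cnt (\<Lambda> \<omega>) (cball 0 (t / real k))))\<^sup>2 \<partial>M) * (real k)\<^sup>2 \<le> C"
proof -
  \<comment> \<open>The lattice centres lie within 3 r times 2 k = 6 t of the origin and the small
    discs have radius at most t, hence 7 t.\<close>
  define B where "B = cball (0::complex) (7 * t)"
  have B: "B \<in> sets borel" "bounded B" by (auto simp: B_def)
  have main: "(\<integral>\<omega>. (real (cnt (\<Lambda> \<omega>) (cball 0 (t / real k))))\<^sup>2 \<partial>M) * (real k)\<^sup>2 \<le> (\<integral>\<omega>. (real (cnt (\<Lambda> \<omega>) B))\<^sup>2 \<partial>M)"
    if k: "k \<ge> 1" for k :: nat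
  proof -
    define r where "r = t / real k"
    have r: "r > 0" "r \<le> t" using t k by (auto simp: r_def field_simps mult_le_cancel_right1)
    define J where "J = {..<k} \<times> {..<k}"
    \<comment> \<open>The spacing 3 r exceeds the diameter 2 r, so the small discs are
      disjoint.\<close>
    define c where "c p = of_real (3 * r) * Complex (real (fst p)) (real (snd p))" for p :: "nat \<times> nat"
    define Q where "Q p = (\<lambda>z. z + - c p) -` cball 0 r" for p
    have Q: "Q p \<in> sets borel" "bounded (Q p)" for p
    proof -
      have "Q p = cball (c p) r" by (auto simp: Q_def dist_norm norm_minus_commute)
      then show "Q p \<in> sets borel" "bounded (Q p)" by auto
    qed
    have disj: "Q p \<inter> Q q = {}" if "p \<noteq> q" for p q
    proof -
      have "1 \<le> cmod (Complex (real (fst p)) (real (snd p)) - Complex (real (fst q)) (real (snd q)))" (is "_ \<le> cmod ?z")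
      proof -
        have "1 \<le> \<bar>Re ?z\<bar> \<or> 1 \<le> \<bar>Im ?z\<bar>" using that by (auto simp: prod_eq_iff)
        then show ?thesis using abs_Re_le_cmod[of ?z] abs_Im_le_cmod[of ?z] by linarith
      qed
      then have "3 * r * 1 \<le> 3 * r * cmod ?z" using r by (intro mult_left_mono) auto
      also have "\<dots> = cmod (c p - c q)" using r by (simp add: c_def right_diff_distrib[symmetric] norm_mult)
      finally have far: "3 * r \<le> cmod (c p - c q)" by simp
      have "False" if "cmod (z - c p) \<le> r" "cmod (z - c q) \<le> r" for z
        using norm_triangle_ineq4[of "z - c q" "z - c p"] that far r by simp
      then show ?thesis by (auto simp: Q_def)
    qed
    have sub: "Q p \<subseteq> B" if "p \<in> J" for p
    proof
      fix z assume "z \<in> Q p"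
      then have 1: "cmod (z - c p) \<le> r" by (simp add: Q_def)
      have "cmod (Complex (real (fst p)) (real (snd p))) \<le> real (fst p) + real (snd p)"
        using cmod_le[of "Complex (real (fst p)) (real (snd p))"] by simp
      also have "\<dots> \<le> 2 * real k" using that by (auto simp: J_def)
      finally have "cmod (c p) \<le> 3 * r * (2 * real k)"
        unfolding c_def norm_mult using r by (intro mult_mono) auto
      also have "\<dots> = 6 * t" using k by (simp add: r_def)
      finally show "z \<in> B" using 1 r norm_triangle_sub[of z "c p"] by (simp add: B_def)
    qed
    have point: "(\<Sum>p\<in>J. (real (cnt (\<Lambda> \<omega>) (Q p)))\<^sup>2) \<le> (real (cnt (\<Lambda> \<omega>) B))\<^sup>2" if \<omega>: "\<omega> \<in> space M" for \<omega>
    proof -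
      have fin: "finite (supp (\<Lambda> \<omega>) \<inter> S)" if "bounded S" for S
        using Lambda_configs[OF \<omega>] that by (auto simp: configs_def)
      have "(\<Sum>p\<in>J. cnt (\<Lambda> \<omega>) (Q p)) = (\<Sum>z\<in>(\<Union>p\<in>J. supp (\<Lambda> \<omega>) \<inter> Q p). \<Lambda> \<omega> z)"
        unfolding cnt_def
      proof (rule sum.UNION_disjoint[symmetric])
        show "\<forall>p\<in>J. \<forall>q\<in>J. p \<noteq> q \<longrightarrow> supp (\<Lambda> \<omega>) \<inter> Q p \<inter> (supp (\<Lambda> \<omega>) \<inter> Q q) = {}"
          using disj by blast
      qed (use fin Q in \<open>auto simp: J_def\<close>)
      also have "\<dots> \<le> cnt (\<Lambda> \<omega>) B"
        unfolding cnt_def by (rule sum_mono2) (use fin B sub in auto)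
      finally have le: "(\<Sum>p\<in>J. cnt (\<Lambda> \<omega>) (Q p)) \<le> cnt (\<Lambda> \<omega>) B" .
      have "(\<Sum>p\<in>J. (cnt (\<Lambda> \<omega>) (Q p))\<^sup>2) \<le> (\<Sum>p\<in>J. cnt (\<Lambda> \<omega>) (Q p) * (\<Sum>p\<in>J. cnt (\<Lambda> \<omega>) (Q p)))"
        unfolding power2_eq_square by (intro sum_mono mult_left_mono member_le_sum) (auto simp: J_def)
      also have "\<dots> = (\<Sum>p\<in>J. cnt (\<Lambda> \<omega>) (Q p))\<^sup>2" by (simp add: sum_distrib_right power2_eq_square)
      also have "\<dots> \<le> (cnt (\<Lambda> \<omega>) B)\<^sup>2" using le by (intro power_mono) auto
      finally have "real (\<Sum>p\<in>J. (cnt (\<Lambda> \<omega>) (Q p))\<^sup>2) \<le> real ((cnt (\<Lambda> \<omega>) B)\<^sup>2)" by (rule of_nat_mono)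
      then show ?thesis by simp
    qed
    have "(\<integral>\<omega>. (real (cnt (\<Lambda> \<omega>) (cball 0 r)))\<^sup>2 \<partial>M) * (real k)\<^sup>2 = (\<Sum>p\<in>J. \<integral>\<omega>. (real (cnt (\<Lambda> \<omega>) (Q p)))\<^sup>2 \<partial>M)"
      unfolding Q_def by (subst cnt_shift_square) (auto simp: J_def power2_eq_square)
    also have "\<dots> = (\<integral>\<omega>. (\<Sum>p\<in>J. (real (cnt (\<Lambda> \<omega>) (Q p)))\<^sup>2) \<partial>M)"
      by (rule Bochner_Integration.integral_sum[symmetric]) (intro cnt_square_integrable Q)
    also have "\<dots> \<le> (\<integral>\<omega>. (real (cnt (\<Lambda> \<omega>) B))\<^sup>2 \<partial>M)"
      by (intro integral_mono Bochner_Integration.integrable_sum cnt_square_integrable Q B point)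
    finally show ?thesis by (simp add: r_def)
  qed
  show thesis by (rule that[OF _ main]) (auto intro: integral_nonneg_AE)
qed

lemma I_disc: "\<omega> \<in> space M \<Longrightarrow> I (disc R) \<omega> = of_real (real (cnt (\<Lambda> \<omega>) (cball 0 R)))"
proof -
  assume \<omega>: "\<omega> \<in> space M"
  have "I (disc R) \<omega> = (\<integral>a. of_real (indicat_real (cball 0 R) a) \<partial>N \<omega>)"
    unfolding I_def by (rule Bochner_Integration.integral_cong) (auto simp: disc_def indicator_def)
  also have "\<dots> = of_real (measure (N \<omega>) (cball 0 R))"
    by (subst integral_complex_of_real) simp
  finally show ?thesis using emeasure_N_bounded[OF \<omega>, of "cball 0 R"] by (simp add: measure_def)
qed

text \<open>Discs as narrow as t / k have transforms of modulus at least (t / k)^2 on |xi| <= k, so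
  the second moment of their counts, which is O(k^-2), controls (t / k)^4 times the mass of |xi| <=
  k.\<close>

lemma rho_growth:
  obtains C where "C \<ge> 0" "\<And>k::nat. k \<ge> 1 \<Longrightarrow> emeasure \<rho> (cball 0 (real k)) \<le> ennreal (C * (real k)\<^sup>2)"
proof -
  \<comment> \<open>Near 0 the value of \<open>disc_q\<close> is close to pi, so its modulus stays
    above 1 on some interval [-t, t].\<close>
  have "isCont disc_q 0" using disc_q_deriv has_vector_derivative_continuous by blast
  then obtain d where d: "d > 0" "\<And>s. \<bar>s\<bar> < d \<Longrightarrow> cmod (disc_q s - of_real pi) < 1"
    using zero_less_one unfolding continuous_at_eps_delta dist_norm disc_q_0 by (metis diff_zero real_norm_def)
  define t where "t = d / 2"
  have t: "t > 0" using d by (simp add: t_def)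
  have q: "1 \<le> cmod (disc_q s)" if "\<bar>s\<bar> \<le> t" for s
  proof -
    have "cmod (disc_q s - of_real pi) < 1" using that d by (intro d(2)) (auto simp: t_def)
    then show ?thesis using norm_triangle_ineq2[of "of_real pi" "disc_q s"] pi_gt3 by (simp add: norm_minus_commute)
  qed
  obtain C where C: "C \<ge> 0" "\<And>k::nat. k \<ge> 1 \<Longrightarrow> (\<integral>\<omega>. (real (cnt (\<Lambda> \<omega>) (cball 0 (t / real k))))\<^sup>2 \<partial>M) * (real k)\<^sup>2 \<le> C"
    using small_disc_second_moment[OF t] by blast
  have "emeasure \<rho> (cball 0 (real k)) \<le> ennreal ((C / t ^ 4) * (real k)\<^sup>2)" if k: "k \<ge> 1" for k :: nat
  proof -
    define r where "r = t / real k"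
    have r: "r > 0" using t k by (simp add: r_def)
    have low: "r ^ 4 \<le> (cmod (fourier (disc r) \<xi>))\<^sup>2" if "\<xi> \<in> cball 0 (real k)" for \<xi>
    proof -
      have "r * cmod \<xi> \<le> t / real k * real k" unfolding r_def using that t k by (intro mult_left_mono) auto
      then have "1 \<le> cmod (disc_q (r * cmod \<xi>))" using k r by (intro q) auto
      then have "1\<^sup>2 \<le> (cmod (disc_q (r * cmod \<xi>)))\<^sup>2" by (intro power_mono) auto
      then have "r ^ 4 * 1 \<le> r ^ 4 * (cmod (disc_q (r * cmod \<xi>)))\<^sup>2" using r by (intro mult_left_mono) auto
      then show ?thesis unfolding fourier_disc[OF r] using r by (simp add: norm_mult norm_power power_mult_distrib)
    qed
    have "ennreal (r ^ 4) * emeasure \<rho> (cball 0 (real k)) = (\<integral>\<^sup>+\<xi>. ennreal (r ^ 4) * indicator (cball 0 (real k)) \<xi> \<partial>\<rho>)"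
      by (simp add: nn_integral_cmult_indicator)
    also have "\<dots> \<le> (\<integral>\<^sup>+\<xi>. ennreal ((cmod (fourier (disc r) \<xi>))\<^sup>2) \<partial>\<rho>)"
      using low by (intro nn_integral_mono) (auto simp: indicator_def intro!: ennreal_leI)
    also have "\<dots> = ennreal (\<integral>\<xi>. (cmod (fourier (disc r) \<xi>))\<^sup>2 \<partial>\<rho>)"
      by (intro nn_integral_eq_integral integrable_norm_fourier nice_disc) auto
    also have "\<dots> \<le> ennreal (\<integral>\<omega>. (cmod (I (disc r) \<omega>))\<^sup>2 \<partial>M)"
      by (intro ennreal_leI) (simp add: second_moment_I[OF nice_disc])
    also have "(\<integral>\<omega>. (cmod (I (disc r) \<omega>))\<^sup>2 \<partial>M) = (\<integral>\<omega>. (real (cnt (\<Lambda> \<omega>) (cball 0 r)))\<^sup>2 \<partial>M)"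
      by (rule Bochner_Integration.integral_cong) (auto simp: I_disc)
    also have "ennreal \<dots> \<le> ennreal (C / (real k)\<^sup>2)"
      using C(2)[OF k] k by (intro ennreal_leI) (simp add: r_def pos_le_divide_eq)
    finally have "ennreal (1 / r ^ 4) * (ennreal (r ^ 4) * emeasure \<rho> (cball 0 (real k))) \<le> ennreal (1 / r ^ 4) * ennreal (C / (real k)\<^sup>2)"
      by (intro mult_left_mono) auto
    moreover have "ennreal (1 / r ^ 4) * (ennreal (r ^ 4) * emeasure \<rho> (cball 0 (real k))) = emeasure \<rho> (cball 0 (real k))"
      using r by (simp add: mult.assoc[symmetric] ennreal_mult'[symmetric])
    moreover have "ennreal (1 / r ^ 4) * ennreal (C / (real k)\<^sup>2) = ennreal ((C / t ^ 4) * (real k)\<^sup>2)"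
    proof -
      have "1 / r ^ 4 * (C / (real k)\<^sup>2) = (C / t ^ 4) * (real k)\<^sup>2"
        using t k by (simp add: r_def field_simps power4_eq_xxxx power2_eq_square)
      moreover have "ennreal (1 / r ^ 4) * ennreal (C / (real k)\<^sup>2) = ennreal (1 / r ^ 4 * (C / (real k)\<^sup>2))"
        using C(1) r by (intro ennreal_mult[symmetric]) auto
      ultimately show ?thesis by simp
    qed
    ultimately show ?thesis by simp
  qed
  then show thesis using C(1) t by (intro that[of "C / t ^ 4"]) auto
qed

end

subsection \<open>Mean square limits\<close>

lemma (in prob_space) L1_le_L2:
  fixes Z :: "'a \<Rightarrow> complex"
  assumes [measurable]: "Z \<in> borel_measurable M" and i: "integrable M (\<lambda>\<omega>. (cmod (Z \<omega>))\<^sup>2)"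
  shows "integrable M Z" "(\<integral>\<omega>. cmod (Z \<omega>) \<partial>M) \<le> sqrt (\<integral>\<omega>. (cmod (Z \<omega>))\<^sup>2 \<partial>M)"
proof -
  have n: "integrable M (\<lambda>\<omega>. cmod (Z \<omega>))"
    by (rule square_integrable_imp_integrable) (use i in auto)
  then show "integrable M Z" by (simp add: integrable_norm_iff)
  have "0 \<le> variance (\<lambda>\<omega>. cmod (Z \<omega>))" by (rule variance_positive)
  also have "\<dots> = expectation (\<lambda>\<omega>. (cmod (Z \<omega>))\<^sup>2) - (expectation (\<lambda>\<omega>. cmod (Z \<omega>)))\<^sup>2"
    by (rule variance_eq[OF n i])
  finally show "(\<integral>\<omega>. cmod (Z \<omega>) \<partial>M) \<le> sqrt (\<integral>\<omega>. (cmod (Z \<omega>))\<^sup>2 \<partial>M)"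
    by (intro real_le_rsqrt) simp
qed

lemma (in prob_space) sq_integrable_diff:
  assumes U: "sq_integrable M U" and V: "sq_integrable M V"
  shows "sq_integrable M (\<lambda>\<omega>. U \<omega> - V \<omega>)"
proof -
  have [measurable]: "U \<in> borel_measurable M" "V \<in> borel_measurable M" using U V by (auto simp: sq_integrable_def)
  have "integrable M (\<lambda>\<omega>. (cmod (U \<omega> - V \<omega>))\<^sup>2)"
  proof (rule Bochner_Integration.integrable_bound)
    show "integrable M (\<lambda>\<omega>. 2 * (cmod (U \<omega>))\<^sup>2 + 2 * (cmod (V \<omega>))\<^sup>2)" using U V by (auto simp: sq_integrable_def)
    have "(cmod (x - y))\<^sup>2 \<le> 2 * (cmod x)\<^sup>2 + 2 * (cmod y)\<^sup>2" for x y
    proof -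
      have "(cmod (x - y))\<^sup>2 \<le> (cmod x + cmod y)\<^sup>2" by (intro power_mono norm_triangle_ineq4) auto
      also have "\<dots> \<le> 2 * (cmod x)\<^sup>2 + 2 * (cmod y)\<^sup>2" using sum_squares_bound[of "cmod x" "cmod y"] by (simp add: power2_sum)
      finally show ?thesis .
    qed
    then show "AE \<omega> in M. norm ((cmod (U \<omega> - V \<omega>))\<^sup>2) \<le> norm (2 * (cmod (U \<omega>))\<^sup>2 + 2 * (cmod (V \<omega>))\<^sup>2)"
      by (intro AE_I2) simp
  qed measurable
  then show ?thesis by (simp add: sq_integrable_def)
qed

text \<open>Riesz-Fischer along R = n + 1: an L1 Cauchy sequence has an almost surely convergent
  subsequence, and Fatou transfers the bound to the limit. The shape 2 (a R + a S) is the one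
  produced by |x - y|^2 <= 2 |x|^2 + 2 |y|^2.\<close>

lemma (in prob_space) L2_complete:
  fixes X :: "real \<Rightarrow> 'a \<Rightarrow> complex"
  assumes X: "\<And>R. R \<ge> 1 \<Longrightarrow> sq_integrable M (X R)"
    and cauchy: "\<And>R S. R \<ge> 1 \<Longrightarrow> S \<ge> 1 \<Longrightarrow> (\<integral>\<omega>. (cmod (X R \<omega> - X S \<omega>))\<^sup>2 \<partial>M) \<le> 2 * (a R + a S)"
    and a: "(a \<longlongrightarrow> 0) at_top"
  obtains Y where "sq_integrable M Y" "\<And>R. R \<ge> 1 \<Longrightarrow> integrable M (\<lambda>\<omega>. (cmod (X R \<omega> - Y \<omega>))\<^sup>2)"
    "((\<lambda>R. \<integral>\<omega>. (cmod (X R \<omega> - Y \<omega>))\<^sup>2 \<partial>M) \<longlongrightarrow> 0) at_top"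
proof -
  have Xm[measurable]: "X R \<in> borel_measurable M" if "R \<ge> 1" for R
    using X[OF that] by (auto simp: sq_integrable_def)
  define s where "s n = X (real n + 1)" for n
  have s[measurable]: "s n \<in> borel_measurable M" and s2: "sq_integrable M (s n)" for n
    unfolding s_def by (auto intro!: Xm X)
  have diff2: "integrable M (\<lambda>\<omega>. (cmod (U \<omega> - V \<omega>))\<^sup>2)" if "sq_integrable M U" "sq_integrable M V" for U V
    using sq_integrable_diff[OF that] by (simp add: sq_integrable_def)
  have an: "(\<lambda>n. a (real n + 1)) \<longlonglongrightarrow> 0"
    by (rule filterlim_compose[OF a]) (auto intro!: filterlim_tendsto_add_at_top filterlim_real_sequentially simp: add.commute[of _ 1])
  have L1: "\<exists>N. \<forall>i\<ge>N. \<forall>j\<ge>N. (\<integral>\<omega>. cmod (s i \<omega> - s j \<omega>) \<partial>M) < e" if e: "e > 0" for e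
  proof -
    have "e\<^sup>2 / 8 > 0" using e by simp
    then obtain N where N: "\<And>n. n \<ge> N \<Longrightarrow> \<bar>a (real n + 1)\<bar> < e\<^sup>2 / 8"
      using LIMSEQ_D[OF an, of "e\<^sup>2 / 8"] by auto
    show ?thesis
    proof (intro exI allI impI)
      fix i j assume ij: "i \<ge> N" "j \<ge> N"
      have "(\<integral>\<omega>. cmod (s i \<omega> - s j \<omega>) \<partial>M) \<le> sqrt (\<integral>\<omega>. (cmod (s i \<omega> - s j \<omega>))\<^sup>2 \<partial>M)"
        by (rule L1_le_L2(2)) (auto intro!: diff2 s2)
      also have "\<dots> \<le> sqrt (2 * (a (real i + 1) + a (real j + 1)))"
        unfolding s_def by (intro real_sqrt_le_mono cauchy) auto
      also have "\<dots> \<le> sqrt (e\<^sup>2 / 2)"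
        using N[OF ij(1)] N[OF ij(2)] by (intro real_sqrt_le_mono) (auto simp: abs_less_iff)
      also have "\<dots> < sqrt (e\<^sup>2)" using e by (intro real_sqrt_less_mono) auto
      finally show "(\<integral>\<omega>. cmod (s i \<omega> - s j \<omega>) \<partial>M) < e" using e by simp
    qed
  qed
  have s_int: "integrable M (s n)" for n by (rule L1_le_L2(1)) (use s2 in \<open>auto simp: sq_integrable_def\<close>)
  obtain r where r: "strict_mono r" "AE \<omega> in M. Cauchy (\<lambda>i. s (r i) \<omega>)"
    by (rule cauchy_L1_AE_cauchy_subseq[of M s]) (use s_int L1 in auto)
  define Y where "Y \<omega> = lim (\<lambda>i. s (r i) \<omega>)" for \<omega>
  have [measurable]: "Y \<in> borel_measurable M" unfolding Y_def[abs_def] by measurable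
  have lim: "AE \<omega> in M. (\<lambda>i. s (r i) \<omega>) \<longlonglongrightarrow> Y \<omega>"
    using r(2) by eventually_elim (auto simp: Y_def Cauchy_convergent_iff convergent_LIMSEQ_iff)
  have bound: "(\<integral>\<^sup>+\<omega>. ennreal ((cmod (X R \<omega> - Y \<omega>))\<^sup>2) \<partial>M) \<le> ennreal (2 * a R)" if R: "R \<ge> 1" for R
  proof -
    note [measurable] = Xm[OF R]
    have "(\<integral>\<^sup>+\<omega>. ennreal ((cmod (X R \<omega> - Y \<omega>))\<^sup>2) \<partial>M) \<le> (\<integral>\<^sup>+\<omega>. liminf (\<lambda>i. ennreal ((cmod (X R \<omega> - s (r i) \<omega>))\<^sup>2)) \<partial>M)"
    proof (rule nn_integral_mono_AE)
      show "AE \<omega> in M. ennreal ((cmod (X R \<omega> - Y \<omega>))\<^sup>2) \<le> liminf (\<lambda>i. ennreal ((cmod (X R \<omega> - s (r i) \<omega>))\<^sup>2))"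
        using lim
      proof eventually_elim
        case (elim \<omega>)
        then have "(\<lambda>i. ennreal ((cmod (X R \<omega> - s (r i) \<omega>))\<^sup>2)) \<longlonglongrightarrow> ennreal ((cmod (X R \<omega> - Y \<omega>))\<^sup>2)"
          by (intro tendsto_intros)
        then have "liminf (\<lambda>i. ennreal ((cmod (X R \<omega> - s (r i) \<omega>))\<^sup>2)) = ennreal ((cmod (X R \<omega> - Y \<omega>))\<^sup>2)"
          by (intro lim_imp_Liminf) auto
        then show ?case by simp
      qed
    qed
    also have "\<dots> \<le> liminf (\<lambda>i. \<integral>\<^sup>+\<omega>. ennreal ((cmod (X R \<omega> - s (r i) \<omega>))\<^sup>2) \<partial>M)"
      by (intro nn_integral_liminf) measurable
    also have "\<dots> \<le> liminf (\<lambda>i. ennreal (2 * (a R + a (real (r i) + 1))))"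
    proof (intro Liminf_mono always_eventually allI)
      fix i
      have "(\<integral>\<^sup>+\<omega>. ennreal ((cmod (X R \<omega> - s (r i) \<omega>))\<^sup>2) \<partial>M) = ennreal (\<integral>\<omega>. (cmod (X R \<omega> - s (r i) \<omega>))\<^sup>2 \<partial>M)"
        by (intro nn_integral_eq_integral diff2 s2 X R) auto
      also have "\<dots> \<le> ennreal (2 * (a R + a (real (r i) + 1)))"
        unfolding s_def by (intro ennreal_leI cauchy R) simp
      finally show "(\<integral>\<^sup>+\<omega>. ennreal ((cmod (X R \<omega> - s (r i) \<omega>))\<^sup>2) \<partial>M) \<le> ennreal (2 * (a R + a (real (r i) + 1)))" .
    qed
    \<comment> \<open>Only the term \<open>a R\<close> survives, since the second index runs to
      infinity.\<close>
    also have "(\<lambda>i. ennreal (2 * (a R + a (real (r i) + 1)))) \<longlonglongrightarrow> ennreal (2 * (a R + 0))"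
      using LIMSEQ_subseq_LIMSEQ[OF an r(1)] by (intro tendsto_intros) (simp add: comp_def)
    then have "liminf (\<lambda>i. ennreal (2 * (a R + a (real (r i) + 1)))) = ennreal (2 * a R)"
      by (intro lim_imp_Liminf) auto
    finally show ?thesis .
  qed
  have int: "integrable M (\<lambda>\<omega>. (cmod (X R \<omega> - Y \<omega>))\<^sup>2)" if "R \<ge> 1" for R
    using bound[OF that] Xm[OF that] by (intro integrableI_bounded) (auto intro: order_le_less_trans)
  have le: "(\<integral>\<omega>. (cmod (X R \<omega> - Y \<omega>))\<^sup>2 \<partial>M) \<le> max 0 (2 * a R)" if "R \<ge> 1" for R
    using bound[OF that] int[OF that] by (simp add: nn_integral_eq_integral ennreal_le_iff2) linarith
  have "((\<lambda>R. \<integral>\<omega>. (cmod (X R \<omega> - Y \<omega>))\<^sup>2 \<partial>M) \<longlongrightarrow> 0) at_top"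
  proof (rule Lim_null_comparison)
    show "\<forall>\<^sub>F R in at_top. norm (\<integral>\<omega>. (cmod (X R \<omega> - Y \<omega>))\<^sup>2 \<partial>M) \<le> max 0 (2 * a R)"
      using le by (intro eventually_at_top_linorderI[of 1]) auto
    have "((\<lambda>R. max 0 (2 * a R)) \<longlongrightarrow> max 0 (2 * 0)) at_top" by (intro tendsto_intros a)
    then show "((\<lambda>R. max 0 (2 * a R)) \<longlongrightarrow> 0) at_top" by simp
  qed
  moreover have "sq_integrable M Y"
  proof -
    have "sq_integrable M (\<lambda>\<omega>. X 1 \<omega> - Y \<omega>)" using int[of 1] Xm[of 1] by (simp add: sq_integrable_def)
    from sq_integrable_diff[OF X[of 1] this] show ?thesis by simp
  qed
  ultimately show thesis using int that by blast
qed

locale integrable_spectral_process = spectral_process +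
  assumes low_frequency: "(\<integral>\<^sup>+\<xi>. indicator {\<xi>. 0 < cmod \<xi> \<and> cmod \<xi> \<le> 1} \<xi> * ennreal (1 / (cmod \<xi>)\<^sup>2) \<partial>\<rho>) < \<infinity>"
begin

text \<open>The common majorant of squared errors: near 0 it is integrable by the hypothesis on
  \<rho>, and beyond 1 the exponent -8/3 comes from squaring the decay -4/3 and lies below -2, as
  quadratic growth requires.\<close>

definition dom :: "complex \<Rightarrow> real" where
  "dom \<xi> = indicator {\<xi>. 0 < cmod \<xi> \<and> cmod \<xi> \<le> 1} \<xi> / (cmod \<xi>)\<^sup>2 + indicator {\<xi>. 1 \<le> cmod \<xi>} \<xi> * cmod \<xi> powr (-8/3)"

lemma dom_nonneg: "dom \<xi> \<ge> 0"
  by (simp add: dom_def)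

lemma integrable_low: "integrable \<rho> (\<lambda>\<xi>. indicator {\<xi>. 0 < cmod \<xi> \<and> cmod \<xi> \<le> 1} \<xi> / (cmod \<xi>)\<^sup>2)"
proof (rule integrableI_nonneg)
  have "(\<integral>\<^sup>+\<xi>. ennreal (indicator {\<xi>. 0 < cmod \<xi> \<and> cmod \<xi> \<le> 1} \<xi> / (cmod \<xi>)\<^sup>2) \<partial>\<rho>) =
      (\<integral>\<^sup>+\<xi>. indicator {\<xi>. 0 < cmod \<xi> \<and> cmod \<xi> \<le> 1} \<xi> * ennreal (1 / (cmod \<xi>)\<^sup>2) \<partial>\<rho>)"
    by (intro nn_integral_cong) (auto simp: indicator_def)
  then show "(\<integral>\<^sup>+\<xi>. ennreal (indicator {\<xi>. 0 < cmod \<xi> \<and> cmod \<xi> \<le> 1} \<xi> / (cmod \<xi>)\<^sup>2) \<partial>\<rho>) < \<infinity>"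
    using low_frequency by simp
qed auto

lemma integrable_dom: "integrable \<rho> dom"
proof -
  obtain C where C: "\<And>k::nat. k \<ge> 1 \<Longrightarrow> emeasure \<rho> (cball 0 (real k)) \<le> ennreal (C * (real k)\<^sup>2)"
    using rho_growth by blast
  have "(\<integral>\<^sup>+\<xi>. indicator {\<xi>. 1 \<le> cmod \<xi>} \<xi> * ennreal (cmod \<xi> powr (- (8/3))) \<partial>\<rho>) < \<infinity>"
    by (rule quadratic_growth_tail[OF sets_rho _ C]) auto
  moreover have "(\<integral>\<^sup>+\<xi>. ennreal (indicator {\<xi>. 1 \<le> cmod \<xi>} \<xi> * cmod \<xi> powr (-8/3)) \<partial>\<rho>) =
      (\<integral>\<^sup>+\<xi>. indicator {\<xi>. 1 \<le> cmod \<xi>} \<xi> * ennreal (cmod \<xi> powr (- (8/3))) \<partial>\<rho>)"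
    by (intro nn_integral_cong) (auto simp: indicator_def)
  ultimately have "integrable \<rho> (\<lambda>\<xi>. indicator {\<xi>. 1 \<le> cmod \<xi>} \<xi> * cmod \<xi> powr (-8/3))"
    by (intro integrableI_nonneg) auto
  with integrable_low show ?thesis unfolding dom_def[abs_def] by (rule Bochner_Integration.integrable_add)
qed

text \<open>The origin is excluded: in the uses below the transforms there do not depend on
  \<open>R\<close>, so a possible atom of \<rho> at 0 needs no estimate.\<close>

definition negligible_error :: "(real \<Rightarrow> complex \<Rightarrow> complex) \<Rightarrow> bool" where
  "negligible_error g \<longleftrightarrow> (\<forall>R\<ge>1. g R \<in> borel_measurable borel) \<and> (\<exists>C\<ge>0. \<forall>R\<ge>1. \<forall>\<xi>. \<xi> \<noteq> 0 \<longrightarrow> (cmod (g R \<xi>))\<^sup>2 \<le> C * dom \<xi>) \<and>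
     (\<forall>\<xi>. \<xi> \<noteq> 0 \<longrightarrow> ((\<lambda>R. g R \<xi>) \<longlongrightarrow> 0) at_top)"

lemma negligible_error_L2:
  assumes g: "negligible_error g"
  defines "a \<equiv> \<lambda>R. \<integral>\<xi>. indicator (UNIV - {0}) \<xi> * (cmod (g R \<xi>))\<^sup>2 \<partial>\<rho>"
  shows "(a \<longlongrightarrow> 0) at_top" "\<And>R. R \<ge> 1 \<Longrightarrow> integrable \<rho> (\<lambda>\<xi>. indicator (UNIV - {0}) \<xi> * (cmod (g R \<xi>))\<^sup>2)"
proof -
  obtain C where C: "C \<ge> 0" "\<And>R \<xi>. R \<ge> 1 \<Longrightarrow> \<xi> \<noteq> 0 \<Longrightarrow> (cmod (g R \<xi>))\<^sup>2 \<le> C * dom \<xi>"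
    using g by (auto simp: negligible_error_def)
  have m: "g R \<in> borel_measurable \<rho>" if "R \<ge> 1" for R
    using g that by (simp add: negligible_error_def measurable_cong_sets[OF sets_rho refl])
  have bd: "norm (indicator (UNIV - {0}) \<xi> * (cmod (g R \<xi>))\<^sup>2) \<le> C * dom \<xi>" if "R \<ge> 1" for R \<xi>
    using C(2)[OF that, of \<xi>] C(1) dom_nonneg[of \<xi>] by (auto simp: indicator_def)
  have "((\<lambda>R. \<integral>\<xi>. indicator (UNIV - {0}) \<xi> * (cmod (g R \<xi>))\<^sup>2 \<partial>\<rho>) \<longlongrightarrow> (\<integral>\<xi>. 0 \<partial>\<rho>)) at_top"
  proof (rule dominated_convergence_at_top_real(1)[where c=1 and w="\<lambda>\<xi>. C * dom \<xi>"])
    show "integrable \<rho> (\<lambda>\<xi>. C * dom \<xi>)" using integrable_dom by simp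
    show "AE \<xi> in \<rho>. ((\<lambda>R. indicator (UNIV - {0}) \<xi> * (cmod (g R \<xi>))\<^sup>2) \<longlongrightarrow> 0) at_top"
    proof (rule AE_I2)
      fix \<xi>
      show "((\<lambda>R. indicator (UNIV - {0}) \<xi> * (cmod (g R \<xi>))\<^sup>2) \<longlongrightarrow> 0) at_top"
      proof (cases "\<xi> = 0")
        case False
        then have "((\<lambda>R. g R \<xi>) \<longlongrightarrow> 0) at_top" using g by (simp add: negligible_error_def)
        then have "((\<lambda>R. (cmod (g R \<xi>))\<^sup>2) \<longlongrightarrow> (cmod 0)\<^sup>2) at_top" by (intro tendsto_intros)
        then show ?thesis using False by simp
      qed simp
    qed
  qed (use m bd in auto)
  then show "(a \<longlongrightarrow> 0) at_top" by (simp add: a_def)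
  show "integrable \<rho> (\<lambda>\<xi>. indicator (UNIV - {0}) \<xi> * (cmod (g R \<xi>))\<^sup>2)" if "R \<ge> 1" for R
  proof (rule Bochner_Integration.integrable_bound)
    show "integrable \<rho> (\<lambda>\<xi>. C * dom \<xi>)" using integrable_dom by simp
  qed (use m[OF that] bd[OF that] C(1) dom_nonneg in \<open>auto\<close>)
qed

text \<open>In a difference F R - F S the part \<open>h\<close> and the value \<open>c0\<close> at
  the origin cancel, and with them the squared mean and the contribution of an atom of \<rho> at 0.
  What remains is the L2(\<rho>) norm of g R - g S.\<close>

lemma L2_limit_of_fourier:
  assumes nice: "\<And>R. R \<ge> 1 \<Longrightarrow> nice (F R)" and zero: "\<And>R. R \<ge> 1 \<Longrightarrow> fourier (F R) 0 = c0"
    and split: "\<And>R \<xi>. R \<ge> 1 \<Longrightarrow> \<xi> \<noteq> 0 \<Longrightarrow> fourier (F R) \<xi> = h \<xi> + g R \<xi>"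
    and g: "negligible_error g"
  obtains Y where "sq_integrable M Y" "\<And>R. R \<ge> 1 \<Longrightarrow> integrable M (\<lambda>\<omega>. (cmod (I (F R) \<omega> - Y \<omega>))\<^sup>2)"
    "((\<lambda>R. \<integral>\<omega>. (cmod (I (F R) \<omega> - Y \<omega>))\<^sup>2 \<partial>M) \<longlongrightarrow> 0) at_top"
proof (rule L2_complete[where X="\<lambda>R. I (F R)"])
  define a where "a R = (\<integral>\<xi>. indicator (UNIV - {0}) \<xi> * (cmod (g R \<xi>))\<^sup>2 \<partial>\<rho>)" for R
  show "(a \<longlongrightarrow> 0) at_top" unfolding a_def by (rule negligible_error_L2(1)[OF g])
  show "sq_integrable M (I (F R))" if "R \<ge> 1" for R
    using nice[OF that] by (simp add: sq_integrable_I nice_def)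
  show "(\<integral>\<omega>. (cmod (I (F R) \<omega> - I (F S) \<omega>))\<^sup>2 \<partial>M) \<le> 2 * (a R + a S)" if R: "R \<ge> 1" and S: "S \<ge> 1" for R S
  proof -
    have bs: "bdd_supp (F R)" "bdd_supp (F S)" using nice R S by (auto simp: nice_def)
    have n: "nice (\<lambda>x. F R x - F S x)" by (intro nice_diff nice R S)
    have ft: "fourier (\<lambda>x. F R x - F S x) \<xi> = fourier (F R) \<xi> - fourier (F S) \<xi>" for \<xi>
      by (intro fourier_diff integrable_bdd_supp bs)
    have "(\<integral>\<omega>. (cmod (I (F R) \<omega> - I (F S) \<omega>))\<^sup>2 \<partial>M) = (\<integral>\<omega>. (cmod (I (\<lambda>x. F R x - F S x) \<omega>))\<^sup>2 \<partial>M)"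
    proof (rule Bochner_Integration.integral_cong[OF refl])
      fix \<omega> assume "\<omega> \<in> space M"
      then have "integrable (N \<omega>) (F R)" "integrable (N \<omega>) (F S)"
        unfolding N_def using bs by (auto intro!: integrable_pm_bdd_supp Lambda_configs)
      then show "(cmod (I (F R) \<omega> - I (F S) \<omega>))\<^sup>2 = (cmod (I (\<lambda>x. F R x - F S x) \<omega>))\<^sup>2"
        by (simp add: I_def)
    qed
    also have "\<dots> = (\<integral>\<xi>. (cmod (fourier (F R) \<xi> - fourier (F S) \<xi>))\<^sup>2 \<partial>\<rho>)"
      using second_moment_I[OF n] by (simp add: ft zero R S)
    also have "\<dots> \<le> (\<integral>\<xi>. 2 * (indicator (UNIV - {0}) \<xi> * (cmod (g R \<xi>))\<^sup>2) + 2 * (indicator (UNIV - {0}) \<xi> * (cmod (g S \<xi>))\<^sup>2) \<partial>\<rho>)"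
    proof (rule integral_mono)
      show "integrable \<rho> (\<lambda>\<xi>. (cmod (fourier (F R) \<xi> - fourier (F S) \<xi>))\<^sup>2)"
        using integrable_norm_fourier[OF n] by (simp add: ft)
      show "integrable \<rho> (\<lambda>\<xi>. 2 * (indicator (UNIV - {0}) \<xi> * (cmod (g R \<xi>))\<^sup>2) + 2 * (indicator (UNIV - {0}) \<xi> * (cmod (g S \<xi>))\<^sup>2))"
        by (intro Bochner_Integration.integrable_add integrable_mult_right negligible_error_L2(2)[OF g] R S)
      fix \<xi>
      show "(cmod (fourier (F R) \<xi> - fourier (F S) \<xi>))\<^sup>2 \<le> 2 * (indicator (UNIV - {0}) \<xi> * (cmod (g R \<xi>))\<^sup>2) + 2 * (indicator (UNIV - {0}) \<xi> * (cmod (g S \<xi>))\<^sup>2)"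
      proof (cases "\<xi> = 0")
        case False
        have "(cmod (g R \<xi> - g S \<xi>))\<^sup>2 \<le> (cmod (g R \<xi>) + cmod (g S \<xi>))\<^sup>2" by (intro power_mono norm_triangle_ineq4) auto
        also have "\<dots> \<le> 2 * (cmod (g R \<xi>))\<^sup>2 + 2 * (cmod (g S \<xi>))\<^sup>2"
          using sum_squares_bound[of "cmod (g R \<xi>)" "cmod (g S \<xi>)"] by (simp add: power2_sum)
        finally show ?thesis using False by (simp add: split R S)
      qed (simp add: zero R S)
    qed
    also have "\<dots> = 2 * (a R + a S)"
      unfolding a_def using negligible_error_L2(2)[OF g R] negligible_error_L2(2)[OF g S] by simp
    finally show ?thesis .
  qed
qed (rule that)

lemma L2_null_of_fourier:
  assumes nice: "\<And>R. R \<ge> 1 \<Longrightarrow> nice (F R)" and zero: "\<And>R. R \<ge> 1 \<Longrightarrow> fourier (F R) 0 = 0"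
    and g: "negligible_error (\<lambda>R. fourier (F R))"
  shows "((\<lambda>R. \<integral>\<omega>. (cmod (I (F R) \<omega>))\<^sup>2 \<partial>M) \<longlongrightarrow> 0) at_top"
proof (rule Lim_transform_eventually[OF negligible_error_L2(1)[OF g]])
  have "(\<integral>\<xi>. indicator (UNIV - {0}) \<xi> * (cmod (fourier (F R) \<xi>))\<^sup>2 \<partial>\<rho>) = (\<integral>\<omega>. (cmod (I (F R) \<omega>))\<^sup>2 \<partial>M)" if R: "R \<ge> 1" for R
    unfolding second_moment_I[OF nice[OF R]] zero[OF R]
    by (simp, rule Bochner_Integration.integral_cong) (auto simp: indicator_def zero[OF R])
  then show "\<forall>\<^sub>F R in at_top. (\<integral>\<xi>. indicator (UNIV - {0}) \<xi> * (cmod (fourier (F R) \<xi>))\<^sup>2 \<partial>\<rho>) = (\<integral>\<omega>. (cmod (I (F R) \<omega>))\<^sup>2 \<partial>M)"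
    by (intro eventually_at_top_linorderI[of 1]) auto
qed

end

section \<open>Negligible Bessel terms and the mean square limits Psi\<close>

lemma powr_neg_four_thirds_square: "(x powr (-4/3))\<^sup>2 = (x::real) powr (-8/3)"
  by (simp add: power2_eq_square powr_add[symmetric])

lemma sgn_direction:
  assumes "\<xi> \<noteq> (0::complex)" shows "cmod (sgn \<xi>) = 1" "\<xi> = of_real (cmod \<xi>) * sgn \<xi>"
proof -
  show "cmod (sgn \<xi>) = 1" using assms by (simp add: norm_sgn)
  show "\<xi> = of_real (cmod \<xi>) * sgn \<xi>" using assms by (simp add: sgn_div_norm scaleR_conv_of_real)
qed

lemma continuous_disc_q: "continuous_on UNIV disc_q" and continuous_disc_p: "continuous_on UNIV disc_p"
  unfolding disc_q_def[abs_def] disc_p_def[abs_def]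
  by (intro continuous_on_compose2[OF continuous_on_fourier[OF integrable_bdd_supp[OF bdd_supp_disc]]]
    continuous_on_compose2[OF continuous_on_fourier[OF integrable_bdd_supp[OF bdd_supp_cnj_disc]]] continuous_intros; simp)+

lemma measurable_disc_q [measurable]: "disc_q \<in> borel_measurable borel"
  and measurable_disc_p [measurable]: "disc_p \<in> borel_measurable borel"
  by (intro borel_measurable_continuous_onI continuous_disc_q continuous_disc_p)+

context integrable_spectral_process
begin

lemma dom_low: "0 < cmod \<xi> \<Longrightarrow> cmod \<xi> \<le> 1 \<Longrightarrow> 1 / (cmod \<xi>)\<^sup>2 \<le> dom \<xi>"
  and dom_high: "1 \<le> cmod \<xi> \<Longrightarrow> cmod \<xi> powr (-8/3) \<le> dom \<xi>"
  by (auto simp: dom_def indicator_def)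

lemma negligible_errorI:
  assumes "\<And>R. R \<ge> 1 \<Longrightarrow> g R \<in> borel_measurable borel" "C \<ge> 0"
    "\<And>R \<xi>. R \<ge> 1 \<Longrightarrow> 0 < cmod \<xi> \<Longrightarrow> cmod \<xi> \<le> 1 \<Longrightarrow> cmod (g R \<xi>) \<le> C / cmod \<xi>"
    "\<And>R \<xi>. R \<ge> 1 \<Longrightarrow> 1 \<le> cmod \<xi> \<Longrightarrow> cmod (g R \<xi>) \<le> C * cmod \<xi> powr (-4/3)"
    "\<And>\<xi>. \<xi> \<noteq> 0 \<Longrightarrow> ((\<lambda>R. g R \<xi>) \<longlongrightarrow> 0) at_top"
  shows "negligible_error g"
proof -
  have "(cmod (g R \<xi>))\<^sup>2 \<le> C\<^sup>2 * dom \<xi>" if R: "R \<ge> 1" and \<xi>: "\<xi> \<noteq> 0" for R \<xi>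
  proof (cases "cmod \<xi> \<le> 1")
    case True
    have "(cmod (g R \<xi>))\<^sup>2 \<le> (C / cmod \<xi>)\<^sup>2" using assms(3)[OF R _ True] \<xi> by (intro power_mono) auto
    also have "\<dots> = C\<^sup>2 * (1 / (cmod \<xi>)\<^sup>2)" by (simp add: power_divide)
    also have "\<dots> \<le> C\<^sup>2 * dom \<xi>" using dom_low[of \<xi>] True \<xi> by (intro mult_left_mono) auto
    finally show ?thesis .
  next
    case False
    have "(cmod (g R \<xi>))\<^sup>2 \<le> (C * cmod \<xi> powr (-4/3))\<^sup>2" using assms(4)[OF R, of \<xi>] False by (intro power_mono) auto
    also have "\<dots> = C\<^sup>2 * cmod \<xi> powr (-8/3)" by (simp only: power_mult_distrib powr_neg_four_thirds_square)
    also have "\<dots> \<le> C\<^sup>2 * dom \<xi>" using dom_high[of \<xi>] False by (intro mult_left_mono) auto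
    finally show ?thesis .
  qed
  then show ?thesis
    using assms(1,5) unfolding negligible_error_def by (intro conjI exI[of _ "C\<^sup>2"]) auto
qed

lemma negligible_error_add:
  assumes g: "negligible_error g" and h: "negligible_error h"
  shows "negligible_error (\<lambda>R \<xi>. g R \<xi> + h R \<xi>)"
proof -
  obtain C D where C: "C \<ge> 0" "\<And>R \<xi>. R \<ge> 1 \<Longrightarrow> \<xi> \<noteq> 0 \<Longrightarrow> (cmod (g R \<xi>))\<^sup>2 \<le> C * dom \<xi>"
    and D: "D \<ge> 0" "\<And>R \<xi>. R \<ge> 1 \<Longrightarrow> \<xi> \<noteq> 0 \<Longrightarrow> (cmod (h R \<xi>))\<^sup>2 \<le> D * dom \<xi>"
    using g h by (auto simp: negligible_error_def)
  have "(cmod (g R \<xi> + h R \<xi>))\<^sup>2 \<le> (2 * C + 2 * D) * dom \<xi>" if "R \<ge> 1" "\<xi> \<noteq> 0" for R \<xi>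
  proof -
    have "(cmod (g R \<xi> + h R \<xi>))\<^sup>2 \<le> (cmod (g R \<xi>) + cmod (h R \<xi>))\<^sup>2" by (intro power_mono norm_triangle_ineq) auto
    also have "\<dots> \<le> 2 * (cmod (g R \<xi>))\<^sup>2 + 2 * (cmod (h R \<xi>))\<^sup>2"
      using sum_squares_bound[of "cmod (g R \<xi>)" "cmod (h R \<xi>)"] by (simp add: power2_sum)
    finally show ?thesis using C(2)[OF that] D(2)[OF that] by (simp add: algebra_simps)
  qed
  moreover have "((\<lambda>R. g R \<xi> + h R \<xi>) \<longlongrightarrow> 0) at_top" if "\<xi> \<noteq> 0" for \<xi>
    using g h that unfolding negligible_error_def by (intro tendsto_add_zero) auto
  moreover have "\<forall>R\<ge>1. (\<lambda>\<xi>. g R \<xi> + h R \<xi>) \<in> borel_measurable borel"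
    using g h unfolding negligible_error_def by (auto intro!: borel_measurable_add)
  ultimately show ?thesis
    unfolding negligible_error_def using C(1) D(1) by (intro conjI exI[of _ "2 * C + 2 * D"]) auto
qed

lemma powr_tendsto_0:
  assumes "(d::real) > 0" "e < 0" shows "((\<lambda>R. (R * d) powr e) \<longlongrightarrow> 0) at_top"
  by (rule filterlim_compose[OF tendsto_neg_powr[OF assms(2) filterlim_ident]])
    (use assms in \<open>auto intro!: filterlim_at_top_mult_tendsto_pos[OF tendsto_const _ filterlim_ident]\<close>)

text \<open>A coefficient as singular as 1 / |xi| is admissible because \<open>dom\<close> is
  |xi|^-2 near 0; at high frequency the bound for R = 1 serves all R >= 1 by monotonicity of the
  power.\<close>

lemma negligible_disc_q:
  assumes [measurable]: "c \<in> borel_measurable borel" and c: "\<And>\<xi>. \<xi> \<noteq> 0 \<Longrightarrow> cmod (c \<xi>) \<le> K * (1 + 1 / cmod \<xi>)" and K: "K \<ge> 0"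
  shows "negligible_error (\<lambda>R \<xi>. c \<xi> * disc_q (R * cmod \<xi>))"
proof -
  obtain C where C: "C > 0" "\<And>t. cmod (disc_q t) \<le> C" "\<And>t. t > 0 \<Longrightarrow> cmod (disc_q t) \<le> C * t powr (-4/3)"
    using disc_q_p_decay by metis
  show ?thesis
  proof (rule negligible_errorI[where C="2 * K * C"])
    fix R \<xi> assume R: "(R::real) \<ge> 1" and \<xi>: "0 < cmod \<xi>" "cmod \<xi> \<le> 1"
    have k1: "K * (1 + 1 / cmod \<xi>) \<le> K * (2 / cmod \<xi>)" using K \<xi> by (intro mult_left_mono) (auto simp: field_simps)
    have "cmod (c \<xi>) * cmod (disc_q (R * cmod \<xi>)) \<le> (K * (2 / cmod \<xi>)) * C"
      by (rule mult_mono) (use k1 c[of \<xi>] \<xi> K C C(1) in auto)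
    then show "cmod (c \<xi> * disc_q (R * cmod \<xi>)) \<le> 2 * K * C / cmod \<xi>" by (simp add: norm_mult mult_ac)
  next
    fix R \<xi> assume R: "(R::real) \<ge> 1" and \<xi>: "1 \<le> cmod \<xi>"
    have x: "cmod \<xi> > 0" using \<xi> by linarith
    have k1: "K * (1 + 1 / cmod \<xi>) \<le> K * 2" using K \<xi> x by (intro mult_left_mono) (auto simp: field_simps)
    have "(R * cmod \<xi>) powr (-4/3) \<le> cmod \<xi> powr (-4/3)"
      using R x by (intro powr_mono2') auto
    then have q1: "cmod (disc_q (R * cmod \<xi>)) \<le> C * cmod \<xi> powr (-4/3)"
      using C(1) C(3)[of "R * cmod \<xi>"] R x by (smt (verit) mult_left_mono mult_pos_pos)
    have "cmod (c \<xi>) * cmod (disc_q (R * cmod \<xi>)) \<le> (K * 2) * (C * cmod \<xi> powr (-4/3))"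
      by (rule mult_mono) (use k1 q1 c[of \<xi>] x K C(1) in auto)
    then show "cmod (c \<xi> * disc_q (R * cmod \<xi>)) \<le> 2 * K * C * cmod \<xi> powr (-4/3)" by (simp add: norm_mult mult_ac)
  next
    fix \<xi> :: complex assume \<xi>: "\<xi> \<noteq> 0"
    have "((\<lambda>R. disc_q (R * cmod \<xi>)) \<longlongrightarrow> 0) at_top"
    proof (rule Lim_null_comparison)
      show "\<forall>\<^sub>F R in at_top. norm (disc_q (R * cmod \<xi>)) \<le> C * (R * cmod \<xi>) powr (-4/3)"
        using C(3) \<xi> by (intro eventually_at_top_linorderI[of 1]) auto
      show "((\<lambda>R. C * (R * cmod \<xi>) powr (-4/3)) \<longlongrightarrow> 0) at_top"
        using \<xi> by (intro tendsto_mult_right_zero powr_tendsto_0) auto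
    qed
    then show "((\<lambda>R. c \<xi> * disc_q (R * cmod \<xi>)) \<longlongrightarrow> 0) at_top" by (rule tendsto_mult_right_zero)
  qed (use K C in auto)
qed

text \<open>The extra factor \<open>R\<close> is paid for near 0 by the bound C on t |disc_p t| and
  elsewhere by R (R x)^(-4/3) = R^(-1/3) x^(-4/3). The latter tends to 0 because the exponent of
  decay is below -1.\<close>

lemma negligible_disc_p:
  assumes [measurable]: "c \<in> borel_measurable borel" and c: "\<And>\<xi>. \<xi> \<noteq> 0 \<Longrightarrow> cmod (c \<xi>) \<le> K" and K: "K \<ge> 0"
  shows "negligible_error (\<lambda>R \<xi>. c \<xi> * (of_real R * disc_p (R * cmod \<xi>)))"
proof -
  obtain C where C: "C > 0" "\<And>t. cmod (disc_p t) \<le> C" "\<And>t. t > 0 \<Longrightarrow> cmod (disc_p t) \<le> C * t powr (-4/3)"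
    using disc_q_p_decay by metis
  have inv: "cmod (disc_p t) \<le> C / t" if t: "t > 0" for t
  proof (cases "t \<le> 1")
    case True
    then have "C \<le> C / t" using C(1) t by (simp add: field_simps)
    then show ?thesis using C(2)[of t] by linarith
  next
    case False
    have "t powr (-4/3) \<le> t powr (-1)" using False by (intro powr_mono) auto
    then have "C * t powr (-4/3) \<le> C * (1 / t)" using C(1) t by (intro mult_left_mono) (auto simp: powr_minus_divide)
    then show ?thesis using C(3)[OF t] by simp
  qed
  have scale: "R * (R * x) powr (-4/3) = (R powr (-1/3)) * x powr (-4/3)" if "R > 0" "x > 0" for R x :: real
    using that powr_add[of R 1 "-4/3"] by (simp add: powr_mult)
  show ?thesis
  proof (rule negligible_errorI[where C="K * C"])
    fix R \<xi> assume R: "(R::real) \<ge> 1" and \<xi>: "0 < cmod \<xi>" "cmod \<xi> \<le> 1"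
    have "R * cmod (disc_p (R * cmod \<xi>)) \<le> R * (C / (R * cmod \<xi>))"
      using R \<xi> by (intro mult_left_mono inv) auto
    also have "\<dots> = C / cmod \<xi>" using R by simp
    finally have p1: "R * cmod (disc_p (R * cmod \<xi>)) \<le> C / cmod \<xi>" .
    have "cmod (c \<xi>) * (R * cmod (disc_p (R * cmod \<xi>))) \<le> K * (C / cmod \<xi>)"
      by (rule mult_mono) (use p1 c[of \<xi>] \<xi> R K C(1) in auto)
    then show "cmod (c \<xi> * (of_real R * disc_p (R * cmod \<xi>))) \<le> K * C / cmod \<xi>" using R by (simp add: norm_mult)
  next
    fix R \<xi> assume R: "(R::real) \<ge> 1" and \<xi>: "1 \<le> cmod \<xi>"
    have x: "cmod \<xi> > 0" using \<xi> by linarith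
    have "R * cmod (disc_p (R * cmod \<xi>)) \<le> R * (C * (R * cmod \<xi>) powr (-4/3))"
      using R x by (intro mult_left_mono C(3)) auto
    also have "\<dots> = C * (R powr (-1/3) * cmod \<xi> powr (-4/3))" using scale[of R "cmod \<xi>"] R x by simp
    also have "\<dots> \<le> C * (1 * cmod \<xi> powr (-4/3))"
      using C(1) R powr_mono[of "-1/3" 0 R] by (intro mult_left_mono mult_right_mono) auto
    finally have p1: "R * cmod (disc_p (R * cmod \<xi>)) \<le> C * cmod \<xi> powr (-4/3)" by simp
    have "cmod (c \<xi>) * (R * cmod (disc_p (R * cmod \<xi>))) \<le> K * (C * cmod \<xi> powr (-4/3))"
      by (rule mult_mono) (use p1 c[of \<xi>] x R K C(1) in auto)
    then show "cmod (c \<xi> * (of_real R * disc_p (R * cmod \<xi>))) \<le> K * C * cmod \<xi> powr (-4/3)" using R by (simp add: norm_mult mult.assoc)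
  next
    fix \<xi> :: complex assume \<xi>: "\<xi> \<noteq> 0"
    have "((\<lambda>R. of_real R * disc_p (R * cmod \<xi>)) \<longlongrightarrow> 0) at_top"
    proof (rule Lim_null_comparison)
      have "norm (of_real R * disc_p (R * cmod \<xi>)) \<le> (C * cmod \<xi> powr (-4/3)) * (R * 1) powr (-1/3)" if R: "R \<ge> 1" for R
      proof -
        have "R * cmod (disc_p (R * cmod \<xi>)) \<le> R * (C * (R * cmod \<xi>) powr (-4/3))"
          using R \<xi> by (intro mult_left_mono C(3)) auto
        also have "\<dots> = C * (R powr (-1/3) * cmod \<xi> powr (-4/3))" using scale[of R "cmod \<xi>"] R \<xi> by simp
        finally show ?thesis using R by (simp add: norm_mult mult_ac)
      qed
      then show "\<forall>\<^sub>F R in at_top. norm (of_real R * disc_p (R * cmod \<xi>)) \<le> (C * cmod \<xi> powr (-4/3)) * (R * 1) powr (-1/3)"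
        by (rule eventually_at_top_linorderI)
      show "((\<lambda>R. (C * cmod \<xi> powr (-4/3)) * (R * 1) powr (-1/3)) \<longlongrightarrow> 0) at_top"
        by (intro tendsto_mult_right_zero powr_tendsto_0) auto
    qed
    then show "((\<lambda>R. c \<xi> * (of_real R * disc_p (R * cmod \<xi>))) \<longlongrightarrow> 0) at_top" by (rule tendsto_mult_right_zero)
  qed (use K C in auto)
qed

text \<open>\<open>Psi_partial\<close> includes the unit circle and the difference of discs does
  not; almost surely no point lies there.\<close>

lemma Psi_partial_eq:
  assumes R: "R \<ge> 1"
  shows "AE \<omega> in M. Psi_partial l \<Lambda> R \<omega> = I (\<lambda>a. 1 / a ^ l * (disc R a - disc 1 a)) \<omega>"
proof -
  have "AE \<omega> in M. AE a in N \<omega>. cmod a \<noteq> 1" by (rule AE_N_null[OF AE_lborel_cmod_neq]) measurable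
  then show ?thesis
    using AE_space
  proof eventually_elim
    case (elim \<omega>)
    let ?A = "{z. 1 \<le> cmod z \<and> cmod z \<le> R}"
    have m: "(\<lambda>a. 1 / a ^ l * indicator ?A a) \<in> borel_measurable borel"
      by (intro borel_measurable_times borel_measurable_indicator) measurable
    have "bounded ?A" by (auto simp: bounded_iff)
    then have fin: "finite (supp (\<Lambda> \<omega>) \<inter> ?A)" using Lambda_configs[OF elim(2)] by (auto simp: configs_def)
    have "Psi_partial l \<Lambda> R \<omega> = (\<integral>a. 1 / a ^ l * indicator ?A a \<partial>N \<omega>)"
      unfolding N_def using integral_pm_finite(2)[OF m fin] by (simp add: Psi_partial_def)
    also have "\<dots> = I (\<lambda>a. 1 / a ^ l * (disc R a - disc 1 a)) \<omega>"
      unfolding I_def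
    proof (rule integral_cong_AE)
      show "AE a in N \<omega>. 1 / a ^ l * indicator ?A a = 1 / a ^ l * (disc R a - disc 1 a)"
        using elim(1) by eventually_elim (use R in \<open>auto simp: disc_def indicator_def\<close>)
    qed (use m in auto)
    finally show ?case .
  qed
qed

lemma measurable_Psi_partial: "Psi_partial l \<Lambda> R \<in> borel_measurable M"
proof -
  let ?A = "{z. 1 \<le> cmod z \<and> cmod z \<le> R}"
  have m: "(\<lambda>a. 1 / a ^ l * indicator ?A a) \<in> borel_measurable borel"
    by (intro borel_measurable_times borel_measurable_indicator) measurable
  have "bounded ?A" by (auto simp: bounded_iff)
  then have fin: "finite (supp (\<Lambda> \<omega>) \<inter> ?A)" if "\<omega> \<in> space M" for \<omega>
    using Lambda_configs[OF that] by (auto simp: configs_def)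
  have "Psi_partial l \<Lambda> R \<omega> = I (\<lambda>a. 1 / a ^ l * indicator ?A a) \<omega>" if "\<omega> \<in> space M" for \<omega>
    unfolding N_def I_def using integral_pm_finite(2)[OF m fin[OF that]] by (simp add: Psi_partial_def)
  with measurable_I[OF m] show ?thesis by (subst measurable_cong) auto
qed

text \<open>Besides convergence this justifies the choice in \<open>Psi_inf\<close>: a limit exists,
  so the chosen function satisfies \<open>L2_limit\<close>, and that is all that is used of it
  afterwards.\<close>

lemma Psi_limit:
  assumes l: "l \<in> {1, 2}"
  shows "Psi_inf M l \<Lambda> \<in> borel_measurable M"
    and "((\<lambda>R. \<integral>\<omega>. (cmod (I (\<lambda>a. 1 / a ^ l * (disc R a - disc 1 a)) \<omega> - Psi_inf M l \<Lambda> \<omega>))\<^sup>2 \<partial>M) \<longlongrightarrow> 0) at_top"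
    and "\<And>R. R \<ge> 1 \<Longrightarrow> integrable M (\<lambda>\<omega>. (cmod (I (\<lambda>a. 1 / a ^ l * (disc R a - disc 1 a)) \<omega> - Psi_inf M l \<Lambda> \<omega>))\<^sup>2)"
proof -
  let ?F = "\<lambda>R a. 1 / a ^ l * (disc R a - disc 1 a)"
  have nice: "nice (?F R)" if R: "R \<ge> 1" for R
    by (rule nice_annulus[where C=1])
      (use R in \<open>auto simp: norm_divide norm_power divide_le_eq one_le_power less_imp_le intro!: continuous_intros\<close>)
  \<comment> \<open>Rotation by -1 for l = 1 and by \<i> for l = 2 preserves the annulus and changes
    the sign of the kernel, so its integral is 0.\<close>
  have zero: "fourier (?F R) 0 = 0" for R
  proof -
    have ex: "\<exists>c. cmod c = 1 \<and> (1 / c) ^ l = - 1"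
      using l by (auto intro: exI[of _ "-1"] exI[of _ \<i>])
    then obtain c where c: "cmod c = 1" "(1 / c) ^ l = - 1" by auto
    have "?F R (c * z) = - ?F R z" for z
    proof -
      have "disc R (c * z) = disc R z" "disc 1 (c * z) = disc 1 z" using c(1) by (simp_all add: disc_def indicator_def norm_mult)
      moreover have "1 / (c * z) ^ l = (1 / c) ^ l * (1 / z ^ l)" by (simp add: power_mult_distrib power_divide)
      ultimately show ?thesis using c(2) by simp
    qed
    then show ?thesis
      using integral_lborel_complex_mult[of "?F R" c] c(1) norm_zero[where 'a=complex] by (cases "c = 0") (auto simp: fourier_0)
  qed
  \<comment> \<open>\<open>h\<close> collects the terms of the inner radius 1 and \<open>g\<close>
    those of the outer radius R.\<close>
  have "\<exists>h g. negligible_error g \<and> (\<forall>R\<ge>1. \<forall>\<xi>. \<xi> \<noteq> 0 \<longrightarrow> fourier (?F R) \<xi> = h \<xi> + g R \<xi>)"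
  proof (cases "l = 1")
    case True
    define g where "g R \<xi> = (cnj (sgn \<xi>) * (\<i> / of_real pi) / of_real (cmod \<xi>)) * disc_q (R * cmod \<xi>) + cnj (sgn \<xi>) * (of_real R * disc_p (R * cmod \<xi>))" for R \<xi>
    define h where "h \<xi> = - ((cnj (sgn \<xi>) * (\<i> / of_real pi) / of_real (cmod \<xi>)) * disc_q (1 * cmod \<xi>) + cnj (sgn \<xi>) * (of_real 1 * disc_p (1 * cmod \<xi>)))" for \<xi>
    have "negligible_error g"
      unfolding g_def
      by (intro negligible_error_add negligible_disc_q[where K=1] negligible_disc_p[where K=1])
        (use pi_gt3 in \<open>auto simp: norm_mult norm_divide norm_sgn field_simps intro: add_increasing2\<close>)
    moreover have "fourier (?F R) \<xi> = h \<xi> + g R \<xi>" if R: "R \<ge> 1" and \<xi>: "\<xi> \<noteq> 0" for R \<xi>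
    proof -
      have alg: "k * (- ((u * c / k) * x + u * y) + ((u * c / k) * v + u * w)) = u * (c * (v - x) + k * (w - y))"
        if "k \<noteq> 0" for k u c x y v w :: complex
      proof -
        have e: "k * ((u * c / k) * x) = u * c * x" for x using that by simp
        have "k * (- (A + u * y) + (B + u * w)) = k * B - k * A + k * (u * (w - y))" for A B
          by (simp add: algebra_simps)
        then show ?thesis using that unfolding e by (simp add: algebra_simps)
      qed
      have "of_real (cmod \<xi>) * (h \<xi> + g R \<xi>) = of_real (cmod \<xi>) * fourier (?F R) \<xi>"
        unfolding h_def g_def True power_one_right fourier_inverse_annulus[OF zero_less_one R sgn_direction[OF \<xi>]]
        by (rule alg) (use \<xi> in simp)
      then show ?thesis using \<xi> by simp
    qed
    ultimately show ?thesis by blast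
  next
    case False
    with l have l2: "l = 2" by auto
    define g where "g R \<xi> = (cnj (sgn \<xi>))\<^sup>2 * disc_q (R * cmod \<xi>)" for R \<xi>
    define h where "h \<xi> = - ((cnj (sgn \<xi>))\<^sup>2 * disc_q (1 * cmod \<xi>))" for \<xi>
    have "negligible_error g"
      unfolding g_def by (intro negligible_disc_q[where K=1]) (auto simp: norm_power norm_sgn)
    moreover have "fourier (?F R) \<xi> = h \<xi> + g R \<xi>" if R: "R \<ge> 1" and \<xi>: "\<xi> \<noteq> 0" for R \<xi>
      using fourier_inverse_square_annulus[OF zero_less_one R sgn_direction[OF \<xi>]]
      by (simp add: l2 g_def h_def algebra_simps)
    ultimately show ?thesis by blast
  qed
  then obtain h g where g: "negligible_error g" "\<And>R \<xi>. R \<ge> 1 \<Longrightarrow> \<xi> \<noteq> 0 \<Longrightarrow> fourier (?F R) \<xi> = h \<xi> + g R \<xi>" by blast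
  obtain Y where Y: "sq_integrable M Y" "\<And>R. R \<ge> 1 \<Longrightarrow> integrable M (\<lambda>\<omega>. (cmod (I (?F R) \<omega> - Y \<omega>))\<^sup>2)"
    "((\<lambda>R. \<integral>\<omega>. (cmod (I (?F R) \<omega> - Y \<omega>))\<^sup>2 \<partial>M) \<longlongrightarrow> 0) at_top"
    using L2_limit_of_fourier[where F="?F" and h=h and g=g and ?c0.0=0, OF nice zero g(2) g(1)] by blast
  have mF: "I (?F R) \<in> borel_measurable M" for R by (rule measurable_I) measurable
  have cong: "(\<integral>\<omega>. (cmod (Psi_partial l \<Lambda> R \<omega> - Z \<omega>))\<^sup>2 \<partial>M) = (\<integral>\<omega>. (cmod (I (?F R) \<omega> - Z \<omega>))\<^sup>2 \<partial>M)"
    and cong_i: "integrable M (\<lambda>\<omega>. (cmod (Psi_partial l \<Lambda> R \<omega> - Z \<omega>))\<^sup>2) \<longleftrightarrow> integrable M (\<lambda>\<omega>. (cmod (I (?F R) \<omega> - Z \<omega>))\<^sup>2)"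
    if [measurable]: "Z \<in> borel_measurable M" and R: "R \<ge> 1" for Z R
  proof -
    note [measurable] = measurable_Psi_partial mF
    have ae: "AE \<omega> in M. (cmod (Psi_partial l \<Lambda> R \<omega> - Z \<omega>))\<^sup>2 = (cmod (I (?F R) \<omega> - Z \<omega>))\<^sup>2"
      using Psi_partial_eq[OF R, of l] by eventually_elim simp
    show "(\<integral>\<omega>. (cmod (Psi_partial l \<Lambda> R \<omega> - Z \<omega>))\<^sup>2 \<partial>M) = (\<integral>\<omega>. (cmod (I (?F R) \<omega> - Z \<omega>))\<^sup>2 \<partial>M)"
      by (rule integral_cong_AE) (use ae in auto)
    show "integrable M (\<lambda>\<omega>. (cmod (Psi_partial l \<Lambda> R \<omega> - Z \<omega>))\<^sup>2) \<longleftrightarrow> integrable M (\<lambda>\<omega>. (cmod (I (?F R) \<omega> - Z \<omega>))\<^sup>2)"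
      by (rule integrable_cong_AE) (use ae in auto)
  qed
  have tend: "((\<lambda>R. \<integral>\<omega>. (cmod (Psi_partial l \<Lambda> R \<omega> - Z \<omega>))\<^sup>2 \<partial>M) \<longlongrightarrow> 0) at_top \<longleftrightarrow>
      ((\<lambda>R. \<integral>\<omega>. (cmod (I (?F R) \<omega> - Z \<omega>))\<^sup>2 \<partial>M) \<longlongrightarrow> 0) at_top" if "Z \<in> borel_measurable M" for Z
    by (rule tendsto_cong) (use cong[OF that] in \<open>auto intro!: eventually_at_top_linorderI[of 1]\<close>)
  have Ym: "Y \<in> borel_measurable M" using Y(1) by (simp add: sq_integrable_def)
  have "L2_limit M (Psi_partial l \<Lambda>) Y"
    unfolding L2_limit_def
  proof (intro conjI allI Ym)
    show "integrable M (\<lambda>\<omega>. (cmod (Psi_partial l \<Lambda> R \<omega> - Y \<omega>))\<^sup>2)" for R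
    proof (cases "R \<ge> 1")
      case True then show ?thesis using cong_i[OF Ym True] Y(2) by simp
    next
      \<comment> \<open>For R < 1 the annulus is empty and the partial sum is 0, so the claim is
        square integrability of \<open>Y\<close>.\<close>
      case False
      then have "{z. 1 \<le> cmod z \<and> cmod z \<le> R} = {}" by auto
      then have "Psi_partial l \<Lambda> R \<omega> = 0" for \<omega> unfolding Psi_partial_def by (simp only: Int_empty_right sum.empty)
      then show ?thesis using Y(1) by (simp add: sq_integrable_def)
    qed
  qed (use tend[OF Ym] Y(3) in auto)
  then have P: "L2_limit M (Psi_partial l \<Lambda>) (Psi_inf M l \<Lambda>)"
    unfolding Psi_inf_def using someI[of "L2_limit M (Psi_partial l \<Lambda>)" Y] by simp
  then show Pm: "Psi_inf M l \<Lambda> \<in> borel_measurable M" by (simp add: L2_limit_def)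
  show "((\<lambda>R. \<integral>\<omega>. (cmod (I (?F R) \<omega> - Psi_inf M l \<Lambda> \<omega>))\<^sup>2 \<partial>M) \<longlongrightarrow> 0) at_top"
    using P tend[OF Pm] by (simp add: L2_limit_def)
  show "\<And>R. R \<ge> 1 \<Longrightarrow> integrable M (\<lambda>\<omega>. (cmod (I (?F R) \<omega> - Psi_inf M l \<Lambda> \<omega>))\<^sup>2)"
    using P cong_i[OF Pm] by (simp add: L2_limit_def)
qed

end

subsection \<open>The invariant \<open>\<sigma>\<close>-algebra and the mean density\<close>

definition shift_invariant :: "(complex \<Rightarrow> nat) set \<Rightarrow> bool" where
  "shift_invariant A \<longleftrightarrow> A \<in> sets Conf \<and> (\<forall>w. \<forall>\<mu>\<in>configs. shift w \<mu> \<in> A \<longleftrightarrow> \<mu> \<in> A)"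

context stationary_process
begin

lemma F_inv_eq: "F_inv M \<Lambda> = sigma (space M) {\<Lambda> -` A \<inter> space M | A. shift_invariant A}"
  by (simp add: F_inv_def shift_invariant_def)

lemma space_F_inv: "space (F_inv M \<Lambda>) = space M"
  by (auto simp: F_inv_eq space_measure_of_conv)

text \<open>Preimages of invariant events are already closed under complements and countable unions,
  so generating adds nothing and every event of \<open>F_inv\<close> has an invariant
  representative.\<close>

lemma sets_F_inv: "sets (F_inv M \<Lambda>) = {\<Lambda> -` A \<inter> space M | A. shift_invariant A}"
proof -
  have sub: "{\<Lambda> -` A \<inter> space M | A. shift_invariant A} \<subseteq> Pow (space M)" by auto
  have "\<exists>A. shift_invariant A \<and> B = \<Lambda> -` A \<inter> space M" if "B \<in> sigma_sets (space M) {\<Lambda> -` A \<inter> space M | A. shift_invariant A}" for B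
    using that
  proof induction
    case Empty
    show ?case by (intro exI[of _ "{}"]) (auto simp: shift_invariant_def)
  next
    case (Compl B)
    then obtain A where A: "shift_invariant A" "B = \<Lambda> -` A \<inter> space M" by auto
    then have "shift_invariant (space Conf - A)"
      using sets.compl_sets[of A Conf] by (auto simp: shift_invariant_def space_Conf shift_configs)
    moreover have "space M - B = \<Lambda> -` (space Conf - A) \<inter> space M"
      using A Lambda_configs by (auto simp: space_Conf)
    ultimately show ?case by blast
  next
    case (Union B)
    then obtain A where A: "\<And>i. shift_invariant (A i)" "\<And>i. B i = \<Lambda> -` A i \<inter> space M" by metis
    then have "shift_invariant (\<Union>i. A i)" by (auto simp: shift_invariant_def)
    moreover have "(\<Union>i. B i) = \<Lambda> -` (\<Union>i. A i) \<inter> space M" using A by auto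
    ultimately show ?case by blast
  qed auto
  then show ?thesis
    unfolding F_inv_eq sets_measure_of[OF sub] by (auto intro: sigma_sets.Basic)
qed

lemma subalgebra_F_inv: "subalgebra M (F_inv M \<Lambda>)"
  unfolding subalgebra_def sets_F_inv space_F_inv
  using measurable_sets[OF measurable_Lambda] by (auto simp: shift_invariant_def)

sublocale inv: finite_measure_subalgebra M "F_inv M \<Lambda>"
  by unfold_locales (rule subalgebra_F_inv)

lemma measurable_F_invI:
  fixes Z :: "(complex \<Rightarrow> nat) \<Rightarrow> 'b::topological_space"
  assumes Z: "Z \<in> borel_measurable Conf" and inv: "\<And>w \<mu>. \<mu> \<in> configs \<Longrightarrow> Z (shift w \<mu>) = Z \<mu>"
  shows "(\<lambda>\<omega>. Z (\<Lambda> \<omega>)) \<in> borel_measurable (F_inv M \<Lambda>)"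
proof (rule measurableI)
  fix B :: "'b set" assume B: "B \<in> sets borel"
  have "shift_invariant (Z -` B \<inter> space Conf)"
    unfolding shift_invariant_def using measurable_sets[OF Z B] inv shift_configs by (auto simp: space_Conf)
  moreover have "(\<lambda>\<omega>. Z (\<Lambda> \<omega>)) -` B \<inter> space (F_inv M \<Lambda>) = \<Lambda> -` (Z -` B \<inter> space Conf) \<inter> space M"
    using Lambda_configs by (auto simp: space_F_inv space_Conf)
  ultimately show "(\<lambda>\<omega>. Z (\<Lambda> \<omega>)) -` B \<inter> space (F_inv M \<Lambda>) \<in> sets (F_inv M \<Lambda>)"
    unfolding sets_F_inv by blast
qed simp

end

context integrable_spectral_process
begin

text \<open>Normalised by R^2 and not by the area, so that the limit is pi times
  \<open>cLam\<close>.\<close>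

definition density_avg :: "real \<Rightarrow> 'a \<Rightarrow> real" where
  "density_avg R \<omega> = real (cnt (\<Lambda> \<omega>) (cball 0 R)) / R\<^sup>2"

lemma measurable_density_avg [measurable]: "density_avg R \<in> borel_measurable M"
  unfolding density_avg_def[abs_def] by measurable

lemma integrable_density_avg: "integrable M (density_avg R)"
  unfolding density_avg_def[abs_def] by (intro integrable_divide cnt_integrable) auto

text \<open>A mean ergodic theorem read off the spectrum: the normalised disc has transform disc_q
  (R |xi|), equal to pi at 0 for every R and negligible elsewhere.\<close>

lemma density_avg_L1_limit:
  obtains y where "integrable M y" "((\<lambda>R. \<integral>\<omega>. \<bar>density_avg R \<omega> - y \<omega>\<bar> \<partial>M) \<longlongrightarrow> 0) at_top"
proof -
  let ?F = "\<lambda>R a. of_real (1 / R\<^sup>2) * disc R a"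
  have ft: "fourier (?F R) \<xi> = disc_q (R * cmod \<xi>)" if "R \<ge> 1" for R \<xi>
    unfolding fourier_cmult using that by (simp add: fourier_disc)
  have nice: "nice (?F R)" for R
    by (rule nice_mult_disc[where C="cmod (of_real (1 / R\<^sup>2))"]) auto
  have neg: "negligible_error (\<lambda>R \<xi>. 1 * disc_q (R * cmod \<xi>))"
    by (rule negligible_disc_q[where K=1]) auto
  have z: "fourier (?F R) 0 = disc_q 0" "\<xi> \<noteq> 0 \<Longrightarrow> fourier (?F R) \<xi> = 0 + 1 * disc_q (R * cmod \<xi>)" if "R \<ge> 1" for R \<xi>
    using ft[OF that] by simp_all
  obtain Y where Y: "sq_integrable M Y" "\<And>R. R \<ge> 1 \<Longrightarrow> integrable M (\<lambda>\<omega>. (cmod (I (?F R) \<omega> - Y \<omega>))\<^sup>2)"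
    "((\<lambda>R. \<integral>\<omega>. (cmod (I (?F R) \<omega> - Y \<omega>))\<^sup>2 \<partial>M) \<longlongrightarrow> 0) at_top"
    using L2_limit_of_fourier[where F="?F" and h="\<lambda>_. 0" and ?c0.0="disc_q 0" and g="\<lambda>R \<xi>. 1 * disc_q (R * cmod \<xi>)", OF nice z neg] by blast
  have Ym[measurable]: "Y \<in> borel_measurable M" using Y(1) by (simp add: sq_integrable_def)
  have Yi: "integrable M Y" by (rule L1_le_L2(1)) (use Y(1) in \<open>auto simp: sq_integrable_def\<close>)
  have I_eq: "I (?F R) \<omega> = of_real (density_avg R \<omega>)" if "\<omega> \<in> space M" for R \<omega>
  proof -
    have "I (?F R) \<omega> = of_real (1 / R\<^sup>2) * I (disc R) \<omega>"
      unfolding I_def by (rule integral_mult_right_zero)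
    then show ?thesis using I_disc[OF that, of R] by (simp add: density_avg_def)
  qed
  have [measurable]: "I (?F R) \<in> borel_measurable M" for R by (rule measurable_I) measurable
  have "((\<lambda>R. \<integral>\<omega>. \<bar>density_avg R \<omega> - Re (Y \<omega>)\<bar> \<partial>M) \<longlongrightarrow> 0) at_top"
  proof (rule Lim_null_comparison)
    have "norm (\<integral>\<omega>. \<bar>density_avg R \<omega> - Re (Y \<omega>)\<bar> \<partial>M) \<le> sqrt (\<integral>\<omega>. (cmod (I (?F R) \<omega> - Y \<omega>))\<^sup>2 \<partial>M)" if R: "R \<ge> 1" for R
    proof -
      note L1 = L1_le_L2[of "\<lambda>\<omega>. I (?F R) \<omega> - Y \<omega>", OF _ Y(2)[OF R]]
      have "(\<integral>\<omega>. \<bar>density_avg R \<omega> - Re (Y \<omega>)\<bar> \<partial>M) \<le> (\<integral>\<omega>. cmod (I (?F R) \<omega> - Y \<omega>) \<partial>M)"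
      proof (rule integral_mono)
        show "integrable M (\<lambda>\<omega>. \<bar>density_avg R \<omega> - Re (Y \<omega>)\<bar>)"
          using integrable_density_avg[of R] Yi by auto
        show "integrable M (\<lambda>\<omega>. cmod (I (?F R) \<omega> - Y \<omega>))" using L1(1) by auto
        show "\<bar>density_avg R \<omega> - Re (Y \<omega>)\<bar> \<le> cmod (I (?F R) \<omega> - Y \<omega>)" if "\<omega> \<in> space M" for \<omega>
          using abs_Re_le_cmod[of "I (?F R) \<omega> - Y \<omega>"] I_eq[OF that, of R] by simp
      qed
      also have "\<dots> \<le> sqrt (\<integral>\<omega>. (cmod (I (?F R) \<omega> - Y \<omega>))\<^sup>2 \<partial>M)" by (rule L1(2)) measurable
      finally show ?thesis by (simp add: integral_nonneg_AE)
    qed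
    then show "\<forall>\<^sub>F R in at_top. norm (\<integral>\<omega>. \<bar>density_avg R \<omega> - Re (Y \<omega>)\<bar> \<partial>M) \<le> sqrt (\<integral>\<omega>. (cmod (I (?F R) \<omega> - Y \<omega>))\<^sup>2 \<partial>M)"
      by (rule eventually_at_top_linorderI)
    show "((\<lambda>R. sqrt (\<integral>\<omega>. (cmod (I (?F R) \<omega> - Y \<omega>))\<^sup>2 \<partial>M)) \<longlongrightarrow> 0) at_top"
      using tendsto_real_sqrt[OF Y(3)] by simp
  qed
  moreover have "integrable M (\<lambda>\<omega>. Re (Y \<omega>))" using Yi by auto
  ultimately show thesis by (rule that[rotated])
qed

text \<open>The L1 limit \<open>y\<close> is recognised as a conditional expectation by its two
  characteristic properties: it agrees almost everywhere with an invariant function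
  \<open>W\<close>, and over an invariant event the mean of \<open>density_avg R\<close> does not
  depend on R, by \<open>invariant_mean_measure\<close>.\<close>

lemma density_avg_limit:
  shows "((\<lambda>R. \<integral>\<omega>. \<bar>density_avg R \<omega> - pi * cLam M \<Lambda> \<omega>\<bar> \<partial>M) \<longlongrightarrow> 0) at_top"
proof -
  obtain y where y: "integrable M y" "((\<lambda>R. \<integral>\<omega>. \<bar>density_avg R \<omega> - y \<omega>\<bar> \<partial>M) \<longlongrightarrow> 0) at_top"
    by (rule density_avg_L1_limit)
  have [measurable]: "y \<in> borel_measurable M" using y by auto
  have diff_int: "integrable M (\<lambda>\<omega>. \<bar>density_avg R \<omega> - y \<omega>\<bar>)" for R
    using integrable_density_avg[of R] y(1) by auto
  have "\<exists>S. S \<ge> real n + 1 \<and> (\<forall>R\<ge>S. (\<integral>\<omega>. \<bar>density_avg R \<omega> - y \<omega>\<bar> \<partial>M) \<le> 1 / (real n + 1)\<^sup>2)" for n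
  proof -
    have "\<forall>\<^sub>F R in at_top. (\<integral>\<omega>. \<bar>density_avg R \<omega> - y \<omega>\<bar> \<partial>M) < 1 / (real n + 1)\<^sup>2"
      by (rule order_tendstoD(2)[OF y(2)]) (auto intro!: divide_pos_pos zero_less_power)
    then obtain S where "\<And>R. R \<ge> S \<Longrightarrow> (\<integral>\<omega>. \<bar>density_avg R \<omega> - y \<omega>\<bar> \<partial>M) < 1 / (real n + 1)\<^sup>2"
      unfolding eventually_at_top_linorder by auto
    then show ?thesis by (intro exI[of _ "max S (real n + 1)"]) (auto intro: less_imp_le)
  qed
  then obtain S where S: "\<And>n. S n \<ge> real n + 1" "\<And>n R. R \<ge> S n \<Longrightarrow> (\<integral>\<omega>. \<bar>density_avg R \<omega> - y \<omega>\<bar> \<partial>M) \<le> 1 / (real n + 1)\<^sup>2"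
    by metis
  \<comment> \<open>Controls all enlargements S n + m with m <= n at once, so that a single
    subsequence serves every integer \<open>m\<close>.\<close>
  define u where "u n \<omega> = (\<Sum>m\<le>n. \<bar>density_avg (S n + real m) \<omega> - y \<omega>\<bar>)" for n \<omega>
  have u_int: "integrable M (u n)" for n
    unfolding u_def by (intro Bochner_Integration.integrable_sum diff_int)
  have "(\<lambda>n. \<integral>\<omega>. norm (u n \<omega>) \<partial>M) \<longlonglongrightarrow> 0"
  proof (rule tendsto_sandwich[OF _ _ tendsto_const LIMSEQ_inverse_real_of_nat])
    have "(\<integral>\<omega>. norm (u n \<omega>) \<partial>M) \<le> inverse (real (Suc n))" for n
    proof -
      have "(\<integral>\<omega>. norm (u n \<omega>) \<partial>M) = (\<integral>\<omega>. u n \<omega> \<partial>M)"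
        unfolding u_def by (intro Bochner_Integration.integral_cong) (auto simp: sum_nonneg)
      also have "\<dots> = (\<Sum>m\<le>n. \<integral>\<omega>. \<bar>density_avg (S n + real m) \<omega> - y \<omega>\<bar> \<partial>M)"
        unfolding u_def by (intro Bochner_Integration.integral_sum diff_int)
      also have "\<dots> \<le> (\<Sum>m\<le>n. 1 / (real n + 1)\<^sup>2)" by (intro sum_mono S(2)) auto
      also have "\<dots> = inverse (real (Suc n))"
      proof -
        have "x * (1 / x\<^sup>2) = inverse x" if "x \<noteq> 0" for x :: real
          using that by (simp add: field_simps power2_eq_square)
        from this[of "real (Suc n)"] show ?thesis by (simp add: add.commute)
      qed
      finally show ?thesis .
    qed
    then show "\<forall>\<^sub>F n in sequentially. (\<integral>\<omega>. norm (u n \<omega>) \<partial>M) \<le> inverse (real (Suc n))" by simp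
    show "\<forall>\<^sub>F n in sequentially. 0 \<le> (\<integral>\<omega>. norm (u n \<omega>) \<partial>M)" by (simp add: integral_nonneg_AE)
  qed
  from tendsto_L1_AE_subseq[OF u_int this]
  obtain r where r: "strict_mono r" "AE \<omega> in M. (\<lambda>k. u (r k) \<omega>) \<longlonglongrightarrow> 0" by blast
  define s where "s k = S (r k)" for k
  have s_ge: "s k \<ge> real k + 1" for k
    using S(1)[of "r k"] seq_suble[OF r(1), of k] unfolding s_def by linarith
  have s_pos: "s k > 0" for k using s_ge[of k] by linarith
  have s_inf: "filterlim s at_top sequentially"
    by (rule filterlim_at_top_mono[OF filterlim_real_sequentially]) (use s_ge in \<open>auto intro!: always_eventually order_trans[OF _ s_ge]\<close>)
  \<comment> \<open>A translation by \<open>w\<close> enlarges the disc by at most |w|, which the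
    supremum over integer margins absorbs. This makes \<open>Z\<close> invariant on every
    configuration and not merely almost surely, as \<open>measurable_F_invI\<close> demands.\<close>
  define Z where "Z \<mu> = (SUP m. limsup (\<lambda>k. ennreal (real (cnt \<mu> (cball 0 (s k + real m))) / (s k)\<^sup>2)))" for \<mu>
  have Z_meas: "Z \<in> borel_measurable Conf"
  proof -
    have [measurable]: "(\<lambda>\<mu>. ennreal (real (cnt \<mu> (cball 0 (s k + real m))) / (s k)\<^sup>2)) \<in> borel_measurable Conf" for k m
      using measurable_compose[OF cnt_measurable[of "cball 0 (s k + real m)"], of "\<lambda>n. ennreal (real n / (s k)\<^sup>2)" borel] by simp
    show ?thesis unfolding Z_def[abs_def] by measurable
  qed
  have Z_le: "Z (shift w \<mu>) \<le> Z \<mu>" if \<mu>: "\<mu> \<in> configs" for w \<mu>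
    unfolding Z_def
  proof (rule SUP_least)
    fix m
    obtain l :: nat where l: "cmod w \<le> real l" using real_arch_simple by blast
    have "limsup (\<lambda>k. ennreal (real (cnt (shift w \<mu>) (cball 0 (s k + real m))) / (s k)\<^sup>2)) \<le> limsup (\<lambda>k. ennreal (real (cnt \<mu> (cball 0 (s k + real (m + l)))) / (s k)\<^sup>2))"
    proof (intro Limsup_mono always_eventually allI ennreal_leI divide_right_mono of_nat_mono)
      fix k
      have "finite (supp \<mu> \<inter> cball 0 (s k + real (m + l)))" using \<mu> by (auto simp: configs_def)
      moreover have "(\<lambda>z. z + w) -` cball 0 (s k + real m) \<subseteq> cball 0 (s k + real (m + l))"
      proof
        fix z assume "z \<in> (\<lambda>z. z + w) -` cball 0 (s k + real m)"
        then show "z \<in> cball 0 (s k + real (m + l))"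
          using l norm_triangle_ineq4[of "z + w" w] by simp
      qed
      ultimately show "cnt (shift w \<mu>) (cball 0 (s k + real m)) \<le> cnt \<mu> (cball 0 (s k + real (m + l)))"
        unfolding cnt_shift unfolding cnt_def by (intro sum_mono2) auto
    qed simp
    also have "\<dots> \<le> (SUP m. limsup (\<lambda>k. ennreal (real (cnt \<mu> (cball 0 (s k + real m))) / (s k)\<^sup>2)))"
      by (rule SUP_upper) simp
    finally show "limsup (\<lambda>k. ennreal (real (cnt (shift w \<mu>) (cball 0 (s k + real m))) / (s k)\<^sup>2)) \<le> \<dots>" .
  qed
  have Z_inv: "Z (shift w \<mu>) = Z \<mu>" if \<mu>: "\<mu> \<in> configs" for w \<mu>
  proof (rule antisym[OF Z_le[OF \<mu>]])
    have "shift (- w) (shift w \<mu>) = \<mu>" by (simp add: shift_def)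
    then show "Z \<mu> \<le> Z (shift w \<mu>)" using Z_le[OF shift_configs[OF \<mu>, of w], of "- w"] by simp
  qed
  define W where "W \<omega> = enn2real (Z (\<Lambda> \<omega>))" for \<omega>
  have W_meas: "W \<in> borel_measurable (F_inv M \<Lambda>)"
    unfolding W_def using measurable_F_invI[OF Z_meas Z_inv] by measurable
  have W_y: "AE \<omega> in M. W \<omega> = y \<omega>"
    using r(2)
  proof eventually_elim
    case (elim \<omega>)
    have conv: "(\<lambda>k. density_avg (s k + real m) \<omega>) \<longlonglongrightarrow> y \<omega>" for m
    proof (rule LIM_zero_cancel, rule Lim_null_comparison[OF _ elim])
      have "norm (density_avg (s k + real m) \<omega> - y \<omega>) \<le> u (r k) \<omega>" if "k \<ge> m" for k
        unfolding u_def s_def real_norm_def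
        by (rule member_le_sum[of m "{..r k}" "\<lambda>m. \<bar>density_avg (S (r k) + real m) \<omega> - y \<omega>\<bar>"])
          (use that seq_suble[OF r(1), of k] in auto)
      then show "\<forall>\<^sub>F k in sequentially. norm (density_avg (s k + real m) \<omega> - y \<omega>) \<le> u (r k) \<omega>"
        by (rule eventually_sequentiallyI)
    qed
    have "y \<omega> \<ge> 0"
      by (rule LIMSEQ_le_const[OF conv[of 0]]) (auto simp: density_avg_def)
    \<comment> \<open>All margins give the same limit because (s + m)^2 / s^2 tends to 1.\<close>
    have "limsup (\<lambda>k. ennreal (real (cnt (\<Lambda> \<omega>) (cball 0 (s k + real m))) / (s k)\<^sup>2)) = ennreal (y \<omega>)" for m
    proof (rule lim_imp_Limsup)
      have "(\<lambda>k. real m / s k) \<longlonglongrightarrow> 0"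
        by (rule tendsto_divide_0[OF tendsto_const filterlim_at_top_imp_at_infinity[OF s_inf]])
      then have "(\<lambda>k. density_avg (s k + real m) \<omega> * (1 + real m / s k)\<^sup>2) \<longlonglongrightarrow> y \<omega> * (1 + 0)\<^sup>2"
        by (intro tendsto_intros conv)
      moreover have "density_avg (s k + real m) \<omega> * (1 + real m / s k)\<^sup>2 = real (cnt (\<Lambda> \<omega>) (cball 0 (s k + real m))) / (s k)\<^sup>2" for k
      proof -
        have "1 + real m / s k = (s k + real m) / s k" using s_pos[of k] by (simp add: field_simps)
        moreover have "s k + real m \<noteq> 0" using s_pos[of k] by linarith
        ultimately show ?thesis by (simp add: density_avg_def power_divide)
      qed
      ultimately show "(\<lambda>k. ennreal (real (cnt (\<Lambda> \<omega>) (cball 0 (s k + real m))) / (s k)\<^sup>2)) \<longlonglongrightarrow> ennreal (y \<omega>)"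
        by (intro tendsto_ennrealI) simp
    qed simp
    then have "Z (\<Lambda> \<omega>) = ennreal (y \<omega>)" by (simp add: Z_def)
    then show ?case using \<open>y \<omega> \<ge> 0\<close> by (simp add: W_def)
  qed
  have W_int: "integrable M W"
    by (rule integrable_cong_AE_imp[OF y(1)])
      (use W_y measurable_from_subalg[OF subalgebra_F_inv W_meas] in \<open>auto elim: eventually_mono\<close>)
  have "AE \<omega> in M. real_cond_exp M (F_inv M \<Lambda>) (\<lambda>\<omega>'. real (cnt (\<Lambda> \<omega>') (ball 0 1))) \<omega> = W \<omega>"
  proof (rule inv.real_cond_exp_charact[OF _ cnt_integrable W_int W_meas])
    fix A assume "A \<in> sets (F_inv M \<Lambda>)"
    then obtain A' where A': "shift_invariant A'" "A = \<Lambda> -` A' \<inter> space M" unfolding sets_F_inv by auto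
    have A[measurable]: "A \<in> sets M" using A' measurable_sets[OF measurable_Lambda] by (auto simp: shift_invariant_def)
    obtain c where c: "c \<ge> 0" "\<And>f. f \<in> borel_measurable borel \<Longrightarrow>
        (\<integral>\<^sup>+\<omega>. indicator A' (\<Lambda> \<omega>) * (\<integral>\<^sup>+a. f a \<partial>N \<omega>) \<partial>M) = ennreal c * (\<integral>\<^sup>+a. f a \<partial>lborel)"
      using A'(1) invariant_mean_measure[of A'] by (auto simp: shift_invariant_def)
    have key: "(\<integral>\<omega>. indicator A \<omega> * real (cnt (\<Lambda> \<omega>) B) \<partial>M) = c * measure lborel B"
      if B: "B \<in> sets borel" "bounded B" for B
    proof -
      have "(\<integral>\<^sup>+\<omega>. ennreal (indicator A \<omega> * real (cnt (\<Lambda> \<omega>) B)) \<partial>M) = (\<integral>\<^sup>+\<omega>. indicator A' (\<Lambda> \<omega>) * (\<integral>\<^sup>+a. indicator B a \<partial>N \<omega>) \<partial>M)"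
      proof (rule nn_integral_cong)
        fix \<omega> assume "\<omega> \<in> space M"
        then show "ennreal (indicator A \<omega> * real (cnt (\<Lambda> \<omega>) B)) = indicator A' (\<Lambda> \<omega>) * (\<integral>\<^sup>+a. indicator B a \<partial>N \<omega>)"
          using emeasure_N_bounded[OF _ B, of \<omega>] B by (cases "\<Lambda> \<omega> \<in> A'") (simp_all add: A'(2))
      qed
      also have "\<dots> = ennreal c * emeasure lborel B" using c(2)[of "indicator B"] B by simp
      finally have *: "(\<integral>\<^sup>+\<omega>. ennreal (indicator A \<omega> * real (cnt (\<Lambda> \<omega>) B)) \<partial>M) = ennreal c * emeasure lborel B" .
      have "(\<integral>\<omega>. indicator A \<omega> * real (cnt (\<Lambda> \<omega>) B) \<partial>M) = enn2real (ennreal c * emeasure lborel B)"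
        unfolding *[symmetric] using measurable_cnt[OF B] by (intro integral_eq_nn_integral) auto
      then show ?thesis using c(1) by (simp add: enn2real_mult measure_def)
    qed
    \<comment> \<open>Over a fixed invariant event the mean count is \<open>c\<close> times the
      area, so dividing by R^2 gives a value free of R.\<close>
    have avg: "(\<integral>\<omega>. indicator A \<omega> * density_avg R \<omega> \<partial>M) = c * pi" if "R > 0" for R
    proof -
      have "(\<integral>\<omega>. indicator A \<omega> * density_avg R \<omega> \<partial>M) = (\<integral>\<omega>. indicator A \<omega> * real (cnt (\<Lambda> \<omega>) (cball 0 R)) / R\<^sup>2 \<partial>M)"
        by (simp add: density_avg_def)
      also have "\<dots> = c * measure lborel (cball (0::complex) R) / R\<^sup>2"
        using key[of "cball 0 R"] by simp
      also have "\<dots> = c * pi" using that by (simp add: measure_def emeasure_lborel_cball_complex)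
      finally show ?thesis .
    qed
    have ind_int: "integrable M (\<lambda>\<omega>. indicator A \<omega> * f \<omega>)" if "integrable M f" for f :: "'a \<Rightarrow> real"
      using integrable_mult_indicator[OF A that] by simp
    \<comment> \<open>A constant dominated by a family tending to 0 must be 0; this moves the
      identity from \<open>density_avg\<close> to its limit \<open>y\<close>.\<close>
    have "((\<lambda>R. c * pi - (\<integral>\<omega>. indicator A \<omega> * y \<omega> \<partial>M)) \<longlongrightarrow> 0) (at_top :: real filter)"
    proof (rule Lim_null_comparison[OF _ y(2)])
      have "norm (c * pi - (\<integral>\<omega>. indicator A \<omega> * y \<omega> \<partial>M)) \<le> (\<integral>\<omega>. \<bar>density_avg R \<omega> - y \<omega>\<bar> \<partial>M)" if "R \<ge> 1" for R
      proof -
        have "c * pi - (\<integral>\<omega>. indicator A \<omega> * y \<omega> \<partial>M) = (\<integral>\<omega>. indicator A \<omega> * density_avg R \<omega> - indicator A \<omega> * y \<omega> \<partial>M)"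
          using avg[of R] that ind_int[OF integrable_density_avg] ind_int[OF y(1)] by simp
        also have "norm \<dots> \<le> (\<integral>\<omega>. \<bar>density_avg R \<omega> - y \<omega>\<bar> \<partial>M)"
        proof (rule order_trans[OF integral_norm_bound], rule integral_mono)
          show "integrable M (\<lambda>\<omega>. norm (indicator A \<omega> * density_avg R \<omega> - indicator A \<omega> * y \<omega>))"
            using ind_int[OF integrable_density_avg] ind_int[OF y(1)] by auto
        qed (use diff_int in \<open>auto simp: indicator_def\<close>)
        finally show ?thesis .
      qed
      then show "\<forall>\<^sub>F R in at_top. norm (c * pi - (\<integral>\<omega>. indicator A \<omega> * y \<omega> \<partial>M)) \<le> (\<integral>\<omega>. \<bar>density_avg R \<omega> - y \<omega>\<bar> \<partial>M)"
        by (rule eventually_at_top_linorderI)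
    qed
    then have y_A: "c * pi = (\<integral>\<omega>. indicator A \<omega> * y \<omega> \<partial>M)"
      using tendsto_unique[OF _ _ tendsto_const] trivial_limit_at_top_linorder by fastforce
    have "(\<integral>\<omega>. indicator A \<omega> * W \<omega> \<partial>M) = (\<integral>\<omega>. indicator A \<omega> * y \<omega> \<partial>M)"
      using W_y W_int by (intro integral_cong_AE) (auto elim: eventually_mono)
    moreover have "measure lborel (ball (0::complex) 1) = pi" by (simp add: measure_def emeasure_lborel_ball_complex)
    ultimately show "(\<integral>\<omega>\<in>A. real (cnt (\<Lambda> \<omega>) (ball 0 1)) \<partial>M) = (\<integral>\<omega>\<in>A. W \<omega> \<partial>M)"
      using key[of "ball 0 1"] y_A by (simp add: set_lebesgue_integral_def)
  qed auto
  then have pc: "AE \<omega> in M. pi * cLam M \<Lambda> \<omega> = y \<omega>"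
    using W_y by eventually_elim (simp add: cLam_def)
  have [measurable]: "cLam M \<Lambda> \<in> borel_measurable M" unfolding cLam_def by measurable
  have "(\<integral>\<omega>. \<bar>density_avg R \<omega> - pi * cLam M \<Lambda> \<omega>\<bar> \<partial>M) = (\<integral>\<omega>. \<bar>density_avg R \<omega> - y \<omega>\<bar> \<partial>M)" for R
    using pc by (intro integral_cong_AE) (auto elim: eventually_mono)
  then show ?thesis using y(2) by simp
qed

lemma measurable_cLam [measurable]: "cLam M \<Lambda> \<in> borel_measurable M"
  unfolding cLam_def by measurable

end

subsection \<open>Cauchy transforms\<close>

text \<open>The pole is already handled in \<open>integrable_disc_kernel\<close>; what has to be
  added to it is bounded.\<close>

lemma integrable_inverse_disc: "R > 0 \<Longrightarrow> integrable lborel (\<lambda>w. 1 / w * disc R w)"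
proof -
  assume R: "R > 0"
  have "integrable lborel (\<lambda>w. disc_kernel R w + (1 / of_real (R\<^sup>2)) * (cnj w * disc R w))"
    by (intro Bochner_Integration.integrable_add integrable_disc_kernel R integrable_mult_right integrable_bdd_supp bdd_supp_cnj_disc)
  moreover have "disc_kernel R w + (1 / of_real (R\<^sup>2)) * (cnj w * disc R w) = 1 / w * disc R w" for w
    by (simp add: disc_kernel_def left_diff_distrib)
  ultimately show ?thesis by (simp only:)
qed

definition near_kernel :: "complex \<Rightarrow> complex \<Rightarrow> complex" where
  "near_kernel z a = indicator (ball 0 1) a * (1 / (z - a))"

text \<open>The far summand of zeta with its Weierstrass corrections, as a function of both
  variables in preparation for Fubini.\<close>

definition far_kernel :: "complex \<Rightarrow> complex \<Rightarrow> complex" where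
  "far_kernel z a = indicator (- ball 0 1) a * (1 / (z - a) + 1 / a + z / a\<^sup>2)"

lemma measurable_near_kernel: "(\<lambda>p. near_kernel (fst p) (snd p)) \<in> borel_measurable (borel \<Otimes>\<^sub>M borel)"
  and measurable_far_kernel: "(\<lambda>p. far_kernel (fst p) (snd p)) \<in> borel_measurable (borel \<Otimes>\<^sub>M borel)"
  unfolding near_kernel_def far_kernel_def
  by (intro borel_measurable_times measurable_compose[OF measurable_snd borel_measurable_indicator]; measurable)+

text \<open>The corrections cancel the first two terms of the expansion in 1 / a and leave decay of
  order |a|^-3.\<close>

lemma far_kernel_identity:
  fixes a z :: complex
  assumes "a \<noteq> 0" "z \<noteq> a"
  shows "1 / (z - a) + 1 / a + z / a\<^sup>2 = z\<^sup>2 / (a\<^sup>2 * (z - a))"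
proof -
  define d where "d = z - a"
  have d: "d \<noteq> 0" "z = a + d" using assms by (auto simp: d_def)
  have "1 / d + 1 / a + (a + d) / a\<^sup>2 = (a + d)\<^sup>2 / (a\<^sup>2 * d)"
    using assms(1) d(1) by (simp add: field_simps power2_eq_square)
  then show ?thesis unfolding d(2) by simp
qed

locale cauchy_transform =
  fixes \<phi> :: "complex \<Rightarrow> complex" and A C :: real
  assumes phi_cont: "continuous_on UNIV \<phi>" and A: "A > 0" and C: "C > 0"
    and phi_bound: "\<And>z. cmod (\<phi> z) \<le> C" and phi_supp: "\<And>z. cmod z > A \<Longrightarrow> \<phi> z = 0"
begin

lemma phi_measurable [measurable]: "\<phi> \<in> borel_measurable borel"
  by (rule borel_measurable_continuous_onI[OF phi_cont])

lemma bdd_supp_phi: "bdd_supp \<phi>"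
  by (rule bdd_suppI[OF phi_measurable phi_bound phi_supp])

lemma integrable_phi_mult:
  assumes [measurable]: "g \<in> borel_measurable borel" and g: "\<And>z. cmod z \<le> A \<Longrightarrow> cmod (g z) \<le> B"
  shows "integrable lborel (\<lambda>z. \<phi> z * g z)"
proof (rule integrable_bdd_supp, rule bdd_suppI)
  show "cmod (\<phi> z * g z) \<le> C * max B 0" for z
    using phi_bound[of z] g[of z] phi_supp[of z] C
    by (cases "cmod z \<le> A") (auto simp: norm_mult not_le le_max_iff_disj intro!: mult_mono)
  show "cmod z > A \<Longrightarrow> \<phi> z * g z = 0" for z by (simp add: phi_supp)
qed measurable

definition mom0 :: complex where "mom0 = (\<integral>z. \<phi> z \<partial>lborel)"
definition mom1 :: complex where "mom1 = (\<integral>z. \<phi> z * z \<partial>lborel)"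
definition momc :: complex where "momc = (\<integral>z. \<phi> z * cnj z \<partial>lborel)"
definition K :: "complex \<Rightarrow> complex" where "K a = (\<integral>z. \<phi> z * (1 / (z - a)) \<partial>lborel)"
text \<open>At infinity \<open>K\<close> has the expansion -mom0 / a - mom1 / a^2 + O(|a|^-3);
  \<open>h\<close> is the remainder.\<close>

definition h :: "complex \<Rightarrow> complex" where "h a = K a + mom0 / a + mom1 / a\<^sup>2"

lemma integrable_phi: "integrable lborel \<phi>" "integrable lborel (\<lambda>z. \<phi> z * z)" "integrable lborel (\<lambda>z. \<phi> z * cnj z)"
  using integrable_phi_mult[of "\<lambda>_. 1" 1] integrable_phi_mult[of "\<lambda>z. z" A] integrable_phi_mult[of cnj A] by auto

text \<open>Splits at |z - a| = 1: inside, the bound C on \<phi> meets the integrable pole; outside,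
  the kernel is at most 1.\<close>

definition cauchy_bound :: real where
  "cauchy_bound = C * (\<integral>w. cmod (1 / w * disc 1 w) \<partial>lborel) + (\<integral>z. cmod (\<phi> z) \<partial>lborel)"

lemma cauchy_bound_nonneg: "cauchy_bound \<ge> 0"
  using C by (simp add: cauchy_bound_def integral_nonneg_AE)

lemma
  shows integrable_cauchy: "integrable lborel (\<lambda>z. \<phi> z * (1 / (z - a)))"
    and cauchy_abs_bound: "(\<integral>z. cmod (\<phi> z * (1 / (z - a))) \<partial>lborel) \<le> cauchy_bound"
proof -
  have i1: "integrable lborel (\<lambda>w. cmod (1 / w * disc 1 w))"
    by (intro integrable_norm integrable_inverse_disc) simp
  have i1': "integrable lborel (\<lambda>z. cmod (1 / (z - a) * disc 1 (z - a)))"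
    using integrable_norm[OF integrable_lborel_shift[OF integrable_inverse_disc[of 1], of "- a"]] by simp
  have i2: "integrable lborel (\<lambda>z. C * cmod (1 / (z - a) * disc 1 (z - a)) + cmod (\<phi> z))"
    using i1' integrable_phi(1) by auto
  have le: "cmod (\<phi> z * (1 / (z - a))) \<le> C * cmod (1 / (z - a) * disc 1 (z - a)) + cmod (\<phi> z)" for z
  proof (cases "cmod (z - a) \<le> 1")
    case True
    then have "cmod (\<phi> z) * cmod (1 / (z - a)) \<le> C * cmod (1 / (z - a))"
      by (intro mult_right_mono phi_bound) auto
    moreover have "disc 1 (z - a) = 1" using True by (simp add: disc_def)
    ultimately show ?thesis by (simp only: norm_mult mult_1_right) (rule add_increasing2, auto)
  next
    case False
    then have "cmod (\<phi> z) * cmod (1 / (z - a)) \<le> cmod (\<phi> z) * 1"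
      by (intro mult_left_mono) (auto simp: norm_divide divide_le_eq)
    moreover have "disc 1 (z - a) = 0" using False by (simp add: disc_def)
    ultimately show ?thesis by (simp only: norm_mult mult_1_right) simp
  qed
  show i: "integrable lborel (\<lambda>z. \<phi> z * (1 / (z - a)))"
  proof (rule Bochner_Integration.integrable_bound[OF i2])
    show "AE z in lborel. cmod (\<phi> z * (1 / (z - a))) \<le> norm (C * cmod (1 / (z - a) * disc 1 (z - a)) + cmod (\<phi> z))"
      unfolding real_norm_def by (intro AE_I2 order_trans[OF le abs_ge_self])
  qed measurable
  have "(\<integral>z. cmod (\<phi> z * (1 / (z - a))) \<partial>lborel) \<le> (\<integral>z. C * cmod (1 / (z - a) * disc 1 (z - a)) + cmod (\<phi> z) \<partial>lborel)"
    by (rule integral_mono[OF integrable_norm[OF i] i2 le])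
  also have "\<dots> = C * (\<integral>z. cmod (1 / (z - a) * disc 1 (z - a)) \<partial>lborel) + (\<integral>z. cmod (\<phi> z) \<partial>lborel)"
    using i1' integrable_phi(1) by simp
  also have "(\<integral>z. cmod (1 / (z - a) * disc 1 (z - a)) \<partial>lborel) = (\<integral>w. cmod (1 / w * disc 1 w) \<partial>lborel)"
    using integral_lborel_shift[of "\<lambda>w. cmod (1 / w * disc 1 w)" "- a"] by simp
  finally show "(\<integral>z. cmod (\<phi> z * (1 / (z - a))) \<partial>lborel) \<le> cauchy_bound" by (simp add: cauchy_bound_def)
qed

lemma norm_K_le: "cmod (K a) \<le> cauchy_bound"
  unfolding K_def by (rule order_trans[OF integral_norm_bound cauchy_abs_bound])

lemma measurable_K [measurable]: "K \<in> borel_measurable borel"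
  unfolding K_def[abs_def] by measurable

lemma measurable_h [measurable]: "h \<in> borel_measurable borel"
  unfolding h_def[abs_def] by measurable

text \<open>The first summand covers 1 <= |a| <= 2 A, where a crude bound is multiplied by 8 A^3 /
  |a|^3 >= 1; the second covers |a| > 2 A, where |z - a| >= |a| / 2 on the support of
  \<phi>.\<close>

definition far_bound :: real where
  "far_bound = 8 * A ^ 3 * (cauchy_bound + (\<integral>z. cmod (\<phi> z) \<partial>lborel) + A * (\<integral>z. cmod (\<phi> z) \<partial>lborel))
     + 2 * A\<^sup>2 * (\<integral>z. cmod (\<phi> z) \<partial>lborel)"

lemma
  assumes a: "cmod a \<ge> 1"
  shows integrable_far: "integrable lborel (\<lambda>z. \<phi> z * (1 / (z - a) + 1 / a + z / a\<^sup>2))"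
    and far_abs_bound: "(\<integral>z. cmod (\<phi> z * (1 / (z - a) + 1 / a + z / a\<^sup>2)) \<partial>lborel) \<le> far_bound / cmod a ^ 3"
    and h_eq: "h a = (\<integral>z. \<phi> z * (1 / (z - a) + 1 / a + z / a\<^sup>2) \<partial>lborel)"
proof -
  let ?n = "\<integral>z. cmod (\<phi> z) \<partial>lborel"
  have n0: "?n \<ge> 0" by (simp add: integral_nonneg_AE)
  have eq: "\<phi> z * (1 / (z - a) + 1 / a + z / a\<^sup>2) = \<phi> z * (1 / (z - a)) + \<phi> z * (1 / a) + (\<phi> z * z) * (1 / a\<^sup>2)" for z
    by (simp add: algebra_simps)
  have i: "integrable lborel (\<lambda>z. \<phi> z * (1 / a))" "integrable lborel (\<lambda>z. (\<phi> z * z) * (1 / a\<^sup>2))"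
    using integrable_phi by auto
  show int: "integrable lborel (\<lambda>z. \<phi> z * (1 / (z - a) + 1 / a + z / a\<^sup>2))"
    unfolding eq by (intro Bochner_Integration.integrable_add integrable_cauchy i)
  show "h a = (\<integral>z. \<phi> z * (1 / (z - a) + 1 / a + z / a\<^sup>2) \<partial>lborel)"
    unfolding eq using integrable_cauchy i
    by (simp only: Bochner_Integration.integral_add Bochner_Integration.integrable_add h_def K_def mom0_def mom1_def integral_mult_left_zero) simp
  show "(\<integral>z. cmod (\<phi> z * (1 / (z - a) + 1 / a + z / a\<^sup>2)) \<partial>lborel) \<le> far_bound / cmod a ^ 3"
  proof (cases "cmod a \<le> 2 * A")
    case True
    have "(\<integral>z. cmod (\<phi> z * (1 / (z - a) + 1 / a + z / a\<^sup>2)) \<partial>lborel) \<le> (\<integral>z. cmod (\<phi> z * (1 / (z - a))) + cmod (\<phi> z) + A * cmod (\<phi> z) \<partial>lborel)"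
    proof (rule integral_mono)
      show "integrable lborel (\<lambda>z. cmod (\<phi> z * (1 / (z - a) + 1 / a + z / a\<^sup>2)))" by (rule integrable_norm[OF int])
      show "integrable lborel (\<lambda>z. cmod (\<phi> z * (1 / (z - a))) + cmod (\<phi> z) + A * cmod (\<phi> z))"
        by (intro Bochner_Integration.integrable_add integrable_norm integrable_cauchy integrable_mult_right integrable_phi)
      fix z
      have "cmod (\<phi> z * (1 / a)) \<le> cmod (\<phi> z) * 1"
        unfolding norm_mult using a by (intro mult_left_mono) (auto simp: norm_divide divide_le_eq)
      moreover have "cmod ((\<phi> z * z) * (1 / a\<^sup>2)) \<le> (A * cmod (\<phi> z)) * 1"
      proof -
        have "cmod (\<phi> z * z) \<le> A * cmod (\<phi> z)"
          using phi_supp[of z] by (cases "cmod z \<le> A") (auto simp: norm_mult mult.commute[of A] not_le intro!: mult_left_mono)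
        moreover have "cmod (1 / a\<^sup>2) \<le> 1" using a by (simp add: norm_divide norm_power divide_le_eq one_le_power)
        ultimately show ?thesis unfolding norm_mult[of "\<phi> z * z"] using A by (intro mult_mono) auto
      qed
      ultimately show "cmod (\<phi> z * (1 / (z - a) + 1 / a + z / a\<^sup>2)) \<le> cmod (\<phi> z * (1 / (z - a))) + cmod (\<phi> z) + A * cmod (\<phi> z)"
        unfolding eq using norm_triangle_ineq[of "\<phi> z * (1 / (z - a)) + \<phi> z * (1 / a)" "(\<phi> z * z) * (1 / a\<^sup>2)"]
          norm_triangle_ineq[of "\<phi> z * (1 / (z - a))" "\<phi> z * (1 / a)"] by linarith
    qed
    also have "\<dots> = (\<integral>z. cmod (\<phi> z * (1 / (z - a))) \<partial>lborel) + ?n + A * ?n"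
      using integrable_norm[OF integrable_cauchy[of a]] integrable_norm[OF integrable_phi(1)]
      by (simp only: Bochner_Integration.integral_add Bochner_Integration.integrable_add integrable_mult_right integral_mult_right_zero)
    also have "\<dots> \<le> (cauchy_bound + ?n + A * ?n) * 1" using cauchy_abs_bound[of a] by simp
    also have "\<dots> \<le> (cauchy_bound + ?n + A * ?n) * (8 * A ^ 3 / cmod a ^ 3)"
    proof (rule mult_left_mono)
      have "cmod a ^ 3 \<le> (2 * A) ^ 3" using True by (intro power_mono) auto
      moreover have "cmod a ^ 3 > 0" using a by (intro zero_less_power) linarith
      ultimately show "1 \<le> 8 * A ^ 3 / cmod a ^ 3" by (simp add: power_mult_distrib)
    qed (use cauchy_bound_nonneg n0 A in auto)
    also have "\<dots> = 8 * A ^ 3 * (cauchy_bound + ?n + A * ?n) / cmod a ^ 3" by simp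
    also have "\<dots> \<le> far_bound / cmod a ^ 3"
      unfolding far_bound_def using n0 by (intro divide_right_mono) auto
    finally show ?thesis .
  next
    case False
    have "(\<integral>z. cmod (\<phi> z * (1 / (z - a) + 1 / a + z / a\<^sup>2)) \<partial>lborel) \<le> (\<integral>z. (2 * A\<^sup>2 / cmod a ^ 3) * cmod (\<phi> z) \<partial>lborel)"
    proof (rule integral_mono)
      show "integrable lborel (\<lambda>z. cmod (\<phi> z * (1 / (z - a) + 1 / a + z / a\<^sup>2)))" by (rule integrable_norm[OF int])
      show "integrable lborel (\<lambda>z. (2 * A\<^sup>2 / cmod a ^ 3) * cmod (\<phi> z))" using integrable_phi(1) by auto
      fix z
      show "cmod (\<phi> z * (1 / (z - a) + 1 / a + z / a\<^sup>2)) \<le> (2 * A\<^sup>2 / cmod a ^ 3) * cmod (\<phi> z)"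
      proof (cases "cmod z \<le> A")
        case True
        have a0: "a \<noteq> 0" using a by auto
        have far: "cmod a / 2 \<le> cmod (z - a)" using True False norm_triangle_ineq3[of z a] by linarith
        then have za: "z \<noteq> a" using a by auto
        have "cmod (1 / (z - a) + 1 / a + z / a\<^sup>2) = (cmod z)\<^sup>2 / ((cmod a)\<^sup>2 * cmod (z - a))"
          unfolding far_kernel_identity[OF a0 za] by (simp add: norm_divide norm_mult norm_power)
        also have "\<dots> \<le> A\<^sup>2 / ((cmod a)\<^sup>2 * (cmod a / 2))"
          using True far a0 by (intro frac_le power_mono mult_left_mono) auto
        also have "\<dots> = 2 * A\<^sup>2 / cmod a ^ 3" by (simp add: power2_eq_square power3_eq_cube)
        finally show ?thesis unfolding norm_mult by (subst mult.commute) (intro mult_right_mono, auto)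
      qed (simp add: phi_supp)
    qed
    also have "\<dots> = 2 * A\<^sup>2 * ?n / cmod a ^ 3" by simp
    also have "\<dots> \<le> far_bound / cmod a ^ 3"
      unfolding far_bound_def using n0 A cauchy_bound_nonneg by (intro divide_right_mono) auto
    finally show ?thesis .
  qed
qed

lemma norm_h_le: "cmod a \<ge> 1 \<Longrightarrow> cmod (h a) \<le> far_bound / cmod a ^ 3"
  unfolding h_eq by (rule order_trans[OF integral_norm_bound far_abs_bound])

lemma far_bound_nonneg: "far_bound \<ge> 0"
  unfolding far_bound_def using A cauchy_bound_nonneg by (auto intro!: add_nonneg_nonneg mult_nonneg_nonneg integral_nonneg_AE)

lemma continuous_conv_kernel: "continuous_on UNIV (conv \<phi> (disc_kernel R))" if R: "R > 0"
proof -
  have i: "integrable lborel (disc_kernel R)" by (rule integrable_disc_kernel[OF R])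
  then have [measurable]: "disc_kernel R \<in> borel_measurable borel" by auto
  \<comment> \<open>The translation is moved to the continuous factor \<phi>, since the kernel has a
    pole.\<close>
  have eq: "conv \<phi> (disc_kernel R) a = (\<integral>w. \<phi> (a - w) * disc_kernel R w \<partial>lborel)" for a
    unfolding conv_def by (subst integral_lborel_reflect[of _ a, symmetric]) auto
  show ?thesis
    unfolding continuous_on_sequentially comp_def
  proof (intro allI impI ballI, elim conjE)
    fix X :: "nat \<Rightarrow> complex" and a assume X: "X \<longlonglongrightarrow> a"
    show "(\<lambda>n. conv \<phi> (disc_kernel R) (X n)) \<longlonglongrightarrow> conv \<phi> (disc_kernel R) a"
      unfolding eq
    proof (rule integral_dominated_convergence[where w="\<lambda>w. C * cmod (disc_kernel R w)"])
      show "AE w in lborel. (\<lambda>n. \<phi> (X n - w) * disc_kernel R w) \<longlonglongrightarrow> \<phi> (a - w) * disc_kernel R w"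
        by (intro AE_I2 tendsto_intros continuous_on_tendsto_compose[OF phi_cont] X) auto
    qed (use i phi_bound in \<open>auto simp: norm_mult intro!: mult_right_mono\<close>)
  qed
qed

lemma conv_kernel_supp:
  assumes "cmod a > R + A" shows "conv \<phi> (disc_kernel R) a = 0"
proof -
  have "\<phi> z * disc_kernel R (a - z) = 0" for z
    using phi_supp[of z] norm_triangle_ineq2[of a z] assms by (cases "cmod z \<le> A") (auto simp: disc_kernel_def disc_def)
  then have "(\<lambda>z. \<phi> z * disc_kernel R (a - z)) = (\<lambda>_. 0)" by blast
  then show ?thesis by (simp only: conv_def) simp
qed

lemma nice_conv_kernel: "nice (conv \<phi> (disc_kernel R))" if R: "R > 0"
proof (rule nice_continuous[OF continuous_conv_kernel[OF R] bdd_supp_continuous[OF continuous_conv_kernel[OF R]]])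
  show "bounded {a. conv \<phi> (disc_kernel R) a \<noteq> 0}"
    using conv_kernel_supp[of R] by (auto simp: bounded_iff intro!: exI[of _ "R + A"] simp flip: not_less)
qed

text \<open>With the cutoff |a - z| <= R replaced by |a| <= R the convolution would be exactly the
  negative of the second term; \<open>err\<close> is the cost of that replacement.\<close>

definition err :: "real \<Rightarrow> complex \<Rightarrow> complex" where
  "err R a = conv \<phi> (disc_kernel R) a + (K a + (cnj a * mom0 - momc) / of_real (R\<^sup>2)) * disc R a"

text \<open>Moving the cutoff from \<open>|a - z| \<le> R\<close> to \<open>|a| \<le> R\<close> costs only \<open>O(R\<^sup>-\<^sup>2)\<close> on an annulus
  of bounded width, because \<open>disc_kernel R\<close> is continuous and vanishes on the circle \<open>|a| = R\<close>.\<close>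
lemma norm_err_le:
  assumes R: "R \<ge> 2 * A"
  shows "cmod (err R a) \<le> (6 * A * (\<integral>z. cmod (\<phi> z) \<partial>lborel) / R\<^sup>2) * indicator (cball 0 (R + A) - ball 0 (R - A)) a"
proof -
  have R0: "R > 0" using R A by linarith
  define e where "e w = 1 / w - cnj w / of_real (R\<^sup>2)" for w :: complex
  have kernel: "disc_kernel R w = e w * disc R w" for w by (simp add: disc_kernel_def e_def)
  have i0: "integrable lborel (\<lambda>z. \<phi> z * disc_kernel R (a - z))"
  proof (rule Bochner_Integration.integrable_bound)
    show "integrable lborel (\<lambda>z. C * cmod (disc_kernel R (a - z)))"
      by (intro integrable_mult_right integrable_norm integrable_lborel_reflect integrable_disc_kernel R0)
    have [measurable]: "disc_kernel R \<in> borel_measurable borel" using integrable_disc_kernel[OF R0] by auto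
    show "(\<lambda>z. \<phi> z * disc_kernel R (a - z)) \<in> borel_measurable lborel" by measurable
    show "AE z in lborel. cmod (\<phi> z * disc_kernel R (a - z)) \<le> norm (C * cmod (disc_kernel R (a - z)))"
      using phi_bound C by (auto simp: norm_mult intro!: AE_I2 mult_right_mono)
  qed
  have ee: "\<phi> z * e (a - z) = - (\<phi> z * (1 / (z - a))) - (cnj a / of_real (R\<^sup>2)) * \<phi> z + (1 / of_real (R\<^sup>2)) * (\<phi> z * cnj z)" for z
  proof -
    have "1 / (a - z) = - (1 / (z - a))" by (metis minus_diff_eq minus_divide_right)
    then show ?thesis by (simp add: e_def algebra_simps diff_divide_distrib)
  qed
  have ie: "integrable lborel (\<lambda>z. \<phi> z * e (a - z))"
    unfolding ee by (intro Bochner_Integration.integrable_add Bochner_Integration.integrable_diff integrable_minus integrable_cauchy integrable_mult_right integrable_phi)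
  have int_e: "(\<integral>z. \<phi> z * e (a - z) \<partial>lborel) = - (K a + (cnj a * mom0 - momc) / of_real (R\<^sup>2))"
  proof -
    have "(\<integral>z. \<phi> z * e (a - z) \<partial>lborel) = - K a - (cnj a / of_real (R\<^sup>2)) * mom0 + (1 / of_real (R\<^sup>2)) * momc"
      unfolding ee K_def mom0_def momc_def
      using integrable_cauchy[of a] integrable_phi
      by (simp only: Bochner_Integration.integral_add Bochner_Integration.integral_diff integral_minus integral_mult_right_zero
          Bochner_Integration.integrable_diff integrable_minus integrable_mult_right)
    then show ?thesis by (simp add: diff_divide_distrib)
  qed
  have i2: "integrable lborel (\<lambda>z. \<phi> z * e (a - z) * disc R a)" using ie by (rule integrable_mult_left)
  have "err R a = (\<integral>z. \<phi> z * disc_kernel R (a - z) \<partial>lborel) - (\<integral>z. \<phi> z * e (a - z) * disc R a \<partial>lborel)"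
    by (simp only: err_def conv_def integral_mult_left_zero int_e) (simp add: algebra_simps)
  also have "\<dots> = (\<integral>z. \<phi> z * disc_kernel R (a - z) - \<phi> z * e (a - z) * disc R a \<partial>lborel)"
    using i0 i2 by simp
  also have "cmod \<dots> \<le> (\<integral>z. cmod (\<phi> z) * (6 * A / R\<^sup>2 * indicator (cball 0 (R + A) - ball 0 (R - A)) a) \<partial>lborel)"
  proof (rule order_trans[OF integral_norm_bound], rule integral_mono)
    show "integrable lborel (\<lambda>z. cmod (\<phi> z * disc_kernel R (a - z) - \<phi> z * e (a - z) * disc R a))"
      using i0 i2 by (intro integrable_norm Bochner_Integration.integrable_diff)
    show "integrable lborel (\<lambda>z. cmod (\<phi> z) * (6 * A / R\<^sup>2 * indicator (cball 0 (R + A) - ball 0 (R - A)) a))"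
      by (intro integrable_mult_left integrable_norm integrable_phi)
    fix z
    have eq: "\<phi> z * disc_kernel R (a - z) - \<phi> z * e (a - z) * disc R a = \<phi> z * (e (a - z) * (disc R (a - z) - disc R a))"
      by (simp add: kernel algebra_simps)
    show "cmod (\<phi> z * disc_kernel R (a - z) - \<phi> z * e (a - z) * disc R a) \<le> cmod (\<phi> z) * (6 * A / R\<^sup>2 * indicator (cball 0 (R + A) - ball 0 (R - A)) a)"
      unfolding eq norm_mult[of "\<phi> z"]
    proof (cases "cmod z \<le> A \<and> (cmod (a - z) \<le> R) \<noteq> (cmod a \<le> R)")
      case True
      define w where "w = a - z"
      have wa: "cmod w \<le> cmod a + A" "cmod a \<le> cmod w + A"
        using True norm_triangle_ineq4[of a z] norm_triangle_ineq[of w z] by (auto simp: w_def)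
      have ws: "R - A \<le> cmod w" "cmod w \<le> R + A" and as: "R - A \<le> cmod a" "cmod a \<le> R + A"
        using True wa A unfolding w_def[symmetric] by linarith+
      have w2: "R / 2 \<le> cmod w" using ws R by linarith
      have w0: "w \<noteq> 0" using w2 R0 by auto
      \<comment> \<open>From this form the constant follows: |R - |w|| <= A, R + |w| <= 3 R and |w|
        >= R / 2 give 3 A R / (R^3 / 2) = 6 A / R^2.\<close>
      have "e w = (of_real (R\<^sup>2) - w * cnj w) / (w * of_real (R\<^sup>2))"
        using w0 R0 by (simp add: e_def divide_simps)
      also have "\<dots> = of_real (R\<^sup>2 - (cmod w)\<^sup>2) / (w * of_real (R\<^sup>2))" by (simp add: complex_norm_square[symmetric])
      finally have "cmod (e w) = \<bar>R\<^sup>2 - (cmod w)\<^sup>2\<bar> / (cmod w * R\<^sup>2)"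
        by (simp add: norm_divide norm_mult del: of_real_diff of_real_power)
      also have "\<dots> \<le> (A * (3 * R)) / (R / 2 * R\<^sup>2)"
      proof (rule frac_le)
        have "R\<^sup>2 - (cmod w)\<^sup>2 = (R - cmod w) * (R + cmod w)" by (simp add: power2_eq_square algebra_simps)
        then have "\<bar>R\<^sup>2 - (cmod w)\<^sup>2\<bar> = \<bar>R - cmod w\<bar> * (R + cmod w)" using R0 by (simp add: abs_mult)
        also have "\<dots> \<le> A * (3 * R)" using ws R R0 A by (intro mult_mono) auto
        finally show "\<bar>R\<^sup>2 - (cmod w)\<^sup>2\<bar> \<le> A * (3 * R)" .
      qed (use w2 R0 A in auto)
      also have "\<dots> = 6 * A / R\<^sup>2" using R0 by (simp add: field_simps power2_eq_square)
      finally have ew: "cmod (e w) \<le> 6 * A / R\<^sup>2" .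
      have "cmod (e w * (disc R w - disc R a)) = cmod (e w)"
        using True by (auto simp: w_def[symmetric] norm_mult disc_def indicator_def)
      then show "cmod (\<phi> z) * cmod (e (a - z) * (disc R (a - z) - disc R a)) \<le> cmod (\<phi> z) * (6 * A / R\<^sup>2 * indicator (cball 0 (R + A) - ball 0 (R - A)) a)"
        using ew as by (intro mult_left_mono) (auto simp: w_def[symmetric] indicator_def)
    next
      case False
      then have "cmod (\<phi> z) * cmod (e (a - z) * (disc R (a - z) - disc R a)) = 0"
        using phi_supp[of z] by (auto simp: disc_def indicator_def not_le)
      then show "cmod (\<phi> z) * cmod (e (a - z) * (disc R (a - z) - disc R a)) \<le> cmod (\<phi> z) * (6 * A / R\<^sup>2 * indicator (cball 0 (R + A) - ball 0 (R - A)) a)"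
        using A by (auto simp: indicator_def)
    qed
  qed
  finally show ?thesis by (simp add: mult.commute)
qed

text \<open>Written as limit plus negligible error, as \<open>L2_limit_of_fourier\<close> wants it;
  the coefficient of the limit has modulus 1 / |xi|.\<close>

lemma fourier_conv_kernel:
  assumes R: "R > 0" and \<xi>: "\<xi> \<noteq> 0"
  shows "fourier (conv \<phi> (disc_kernel R)) \<xi> =
    (- \<i> * cnj (sgn \<xi>) / of_real (cmod \<xi>)) * fourier \<phi> \<xi> + (\<i> * cnj (sgn \<xi>) / of_real (pi * cmod \<xi>)) * fourier \<phi> \<xi> * disc_q (R * cmod \<xi>)"
proof -
  have ne: "of_real (cmod \<xi>) \<noteq> (0::complex)" "of_real pi \<noteq> (0::complex)" using \<xi> by auto
  have "fourier (disc_kernel R) \<xi> = cnj (sgn \<xi>) * (\<i> / of_real pi) * (disc_q (R * cmod \<xi>) - of_real pi) / of_real (cmod \<xi>)"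
    using fourier_disc_kernel[OF R sgn_direction[OF \<xi>]] ne by (simp add: nonzero_eq_divide_eq mult_ac)
  also have "\<dots> = (- \<i> * cnj (sgn \<xi>) / of_real (cmod \<xi>)) + (\<i> * cnj (sgn \<xi>) / of_real (pi * cmod \<xi>)) * disc_q (R * cmod \<xi>)"
    using ne by (simp add: divide_simps) (simp add: algebra_simps)
  finally have F: "fourier (disc_kernel R) \<xi> = \<dots>" .
  show ?thesis
    unfolding fourier_conv[OF integrable_phi(1) integrable_disc_kernel[OF R]] F by (simp add: algebra_simps)
qed

lemma fourier_conv_kernel_0: "R > 0 \<Longrightarrow> fourier (conv \<phi> (disc_kernel R)) 0 = 0"
  unfolding fourier_conv[OF integrable_phi(1) integrable_disc_kernel] by (simp add: fourier_0[of "disc_kernel R"] integral_disc_kernel)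

end

subsection \<open>The field \<open>V\<close>\<close>

context integrable_spectral_process
begin

text \<open>The decay of the far kernel, made complex valued so that it can serve as a linear
  statistic.\<close>

definition far_weight :: "complex \<Rightarrow> complex" where
  "far_weight a = of_real (indicator (- ball 0 1) a / cmod a ^ 3)"

text \<open>Absolute convergence of the far sum, as one condition that does not depend on
  \<open>z\<close>.\<close>

definition good :: "'a \<Rightarrow> bool" where
  "good \<omega> \<longleftrightarrow> integrable (N \<omega>) far_weight"

lemma measurable_far_weight [measurable]: "far_weight \<in> borel_measurable borel"
  unfolding far_weight_def[abs_def] by measurable

lemma norm_far_weight: "cmod a \<ge> 1 \<Longrightarrow> cmod (far_weight a) = 1 / cmod a ^ 3" "cmod a < 1 \<Longrightarrow> far_weight a = 0"
  by (auto simp: far_weight_def norm_divide norm_power)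

lemma integrable_far_weight: "integrable lborel far_weight"
proof (rule integrableI_bounded)
  have growth: "emeasure lborel (cball (0::complex) (real k)) \<le> ennreal (pi * (real k)\<^sup>2)" for k :: nat
    by (simp add: emeasure_lborel_cball_complex)
  have "(\<integral>\<^sup>+a. ennreal (cmod (far_weight a)) \<partial>lborel) = (\<integral>\<^sup>+a. indicator {\<xi>. 1 \<le> cmod \<xi>} a * ennreal (cmod a powr (-3)) \<partial>lborel)"
  proof (rule nn_integral_cong)
    fix a :: complex
    show "ennreal (cmod (far_weight a)) = indicator {\<xi>. 1 \<le> cmod \<xi>} a * ennreal (cmod a powr (-3))"
    proof (cases "1 \<le> cmod a")
      case True
      then have "0 < cmod a" by linarith
      then show ?thesis using True by (simp add: norm_far_weight powr_minus_divide)
    qed (simp add: norm_far_weight)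
  qed
  also have "\<dots> < \<infinity>" by (rule quadratic_growth_tail[OF _ _ growth]) auto
  finally show "(\<integral>\<^sup>+a. ennreal (cmod (far_weight a)) \<partial>lborel) < \<infinity>" .
qed simp

lemma AE_good: "AE \<omega> in M. good \<omega>"
  unfolding good_def by (rule AE_N_integrable[OF integrable_far_weight])

lemma good_measurable: "Measurable.pred M good"
proof -
  have eq: "good = (\<lambda>\<omega>. (\<integral>\<^sup>+a. ennreal (cmod (far_weight a)) \<partial>N \<omega>) < \<infinity>)"
    by (auto simp: good_def integrable_iff_bounded fun_eq_iff)
  show ?thesis unfolding eq by measurable
qed

lemma measurable_far_kernel_section [measurable]: "far_kernel z \<in> borel_measurable borel"
  "near_kernel z \<in> borel_measurable borel"
  unfolding far_kernel_def[abs_def] near_kernel_def[abs_def]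
  by (intro borel_measurable_times borel_measurable_indicator; measurable)+

text \<open>Finitely many points lie in |a| <= 2 |z|; beyond, the kernel is at most a multiple of
  |a|^-3, and a lower bound of the same order gives the converse. An equivalence is wanted because V
  is evaluated at every outcome, also where the sum diverges. At z = 0 the kernel vanishes
  identically, hence the restriction.\<close>

lemma integrable_far_kernel_iff:
  assumes \<omega>: "\<omega> \<in> space M" and z: "z \<noteq> 0"
  shows "integrable (N \<omega>) (far_kernel z) \<longleftrightarrow> good \<omega>"
proof
  assume g: "good \<omega>"
  let ?B = "cball (0::complex) (2 * cmod z)"
  have m1: "(\<lambda>a. indicator ?B a * far_kernel z a) \<in> borel_measurable borel"
    by (intro borel_measurable_times borel_measurable_indicator) auto
  have i1: "integrable (N \<omega>) (\<lambda>a. indicator ?B a * far_kernel z a)"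
    unfolding N_def by (rule integral_pm_finite(1)[OF m1, of _ ?B]) (use Lambda_configs[OF \<omega>] in \<open>auto simp: configs_def\<close>)
  have m2: "(\<lambda>a. indicator (- ?B) a * far_kernel z a) \<in> borel_measurable borel"
    by (intro borel_measurable_times borel_measurable_indicator) auto
  have i2: "integrable (N \<omega>) (\<lambda>a. indicator (- ?B) a * far_kernel z a)"
  proof (rule Bochner_Integration.integrable_bound)
    show "integrable (N \<omega>) (\<lambda>a. of_real (2 * (cmod z)\<^sup>2) * far_weight a)"
      using g by (simp add: good_def)
    show "AE a in N \<omega>. cmod (indicator (- ?B) a * far_kernel z a) \<le> cmod (of_real (2 * (cmod z)\<^sup>2) * far_weight a)"
    proof (rule AE_I2)
      fix a
      show "cmod (indicator (- ?B) a * far_kernel z a) \<le> cmod (of_real (2 * (cmod z)\<^sup>2) * far_weight a)"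
      proof (cases "cmod a > 2 * cmod z \<and> cmod a \<ge> 1")
        case True
        then have far1: "cmod a / 2 \<le> cmod (z - a)" using norm_triangle_ineq3[of z a] by linarith
        have far2: "a \<noteq> 0" using True by auto
        moreover have "z \<noteq> a" using far1 far2 by auto
        ultimately have far: "cmod a / 2 \<le> cmod (z - a)" "a \<noteq> 0" "z \<noteq> a" using far1 by auto
        have "cmod (far_kernel z a) = (cmod z)\<^sup>2 / ((cmod a)\<^sup>2 * cmod (z - a))"
          using True by (simp add: far_kernel_def far_kernel_identity[OF far(2,3)] norm_divide norm_mult norm_power)
        also have "\<dots> \<le> (cmod z)\<^sup>2 / ((cmod a)\<^sup>2 * (cmod a / 2))"
          using far z by (intro frac_le mult_left_mono) auto
        also have "\<dots> = 2 * (cmod z)\<^sup>2 * (1 / cmod a ^ 3)" by (simp add: power2_eq_square power3_eq_cube)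
        finally show ?thesis using True by (simp add: norm_mult norm_power norm_far_weight indicator_def)
      next
        case False
        then have "indicator (- ?B) a * far_kernel z a = 0" by (auto simp: far_kernel_def indicator_def)
        then show ?thesis by (simp only: norm_zero norm_ge_zero)
      qed
    qed
  qed (use m2 in auto)
  have "far_kernel z a = indicator ?B a * far_kernel z a + indicator (- ?B) a * far_kernel z a" for a
    by (simp add: indicator_def)
  then show "integrable (N \<omega>) (far_kernel z)"
    using Bochner_Integration.integrable_add[OF i1 i2] by simp
next
  assume i: "integrable (N \<omega>) (far_kernel z)"
  \<comment> \<open>Chosen from |z - a| <= (|z| + 1) |a| for |a| >= 1.\<close>
  define c where "c = (cmod z)\<^sup>2 / (cmod z + 1)"
  have zp: "cmod z > 0" using z by simp
  then have c: "c > 0" by (simp add: c_def add_pos_pos)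
  have low: "c * cmod (far_weight a) \<le> cmod (far_kernel z a)" for a
  proof (cases "cmod a \<ge> 1")
    case True
    then have a0: "a \<noteq> 0" "cmod a > 0" by auto
    show ?thesis
    proof (cases "z = a")
      \<comment> \<open>At a = z the term 1 / (z - a) is 0 by the convention for division, so the
        kernel is 2 / a, still above the required bound.\<close>
      case True
      have "c * (1 / cmod a ^ 3) = 1 / (cmod a * (cmod a + 1))"
        using a0 True by (simp add: c_def power2_eq_square power3_eq_cube)
      also have "\<dots> \<le> 2 / cmod a" using a0 by (intro frac_le) (auto simp: mult_le_cancel_left1)
      also have "\<dots> = cmod (far_kernel z a)"
        using \<open>cmod a \<ge> 1\<close> a0 True by (simp add: far_kernel_def power2_eq_square norm_divide flip: add_divide_distrib)
      finally show ?thesis using \<open>cmod a \<ge> 1\<close> by (simp add: norm_far_weight)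
    next
      case False
      have "cmod (z - a) \<le> cmod z + cmod a" by (rule norm_triangle_ineq4)
      also have "\<dots> \<le> (cmod z + 1) * cmod a"
        using \<open>cmod a \<ge> 1\<close> zp by (simp add: distrib_right mult_le_cancel_left1)
      finally have d: "cmod (z - a) \<le> (cmod z + 1) * cmod a" .
      have "c * (1 / cmod a ^ 3) = (cmod z)\<^sup>2 / ((cmod a)\<^sup>2 * ((cmod z + 1) * cmod a))"
        by (simp add: c_def power2_eq_square power3_eq_cube mult_ac)
      also have "\<dots> \<le> (cmod z)\<^sup>2 / ((cmod a)\<^sup>2 * cmod (z - a))"
        using d a0 False by (intro frac_le mult_left_mono) auto
      also have "\<dots> = cmod (far_kernel z a)"
        using \<open>cmod a \<ge> 1\<close> by (simp add: far_kernel_def far_kernel_identity[OF a0(1) False] norm_divide norm_mult norm_power)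
      finally show ?thesis using \<open>cmod a \<ge> 1\<close> by (simp add: norm_far_weight)
    qed
  qed (simp add: norm_far_weight)
  show "good \<omega>"
    unfolding good_def
  proof (rule Bochner_Integration.integrable_bound)
    show "integrable (N \<omega>) (\<lambda>a. of_real (1 / c) * far_kernel z a)" using i by simp
    show "AE a in N \<omega>. cmod (far_weight a) \<le> cmod (of_real (1 / c) * far_kernel z a)"
      using low c by (intro AE_I2) (simp add: norm_divide pos_le_divide_eq mult.commute)
  qed simp
qed

text \<open>Complex families are summable exactly when absolutely summable, and a divergent infinite
  sum is 0 by convention, which is the else branch.\<close>

lemma infsum_far_kernel:
  assumes \<omega>: "\<omega> \<in> space M" and z: "z \<noteq> 0"
  shows "(\<Sum>\<^sub>\<infinity>a\<in>supp (\<Lambda> \<omega>) - ball 0 1. of_nat (\<Lambda> \<omega> a) * (1 / (z - a) + 1 / a + z / a\<^sup>2)) =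
    (if good \<omega> then \<integral>a. far_kernel z a \<partial>N \<omega> else 0)"
proof -
  let ?S = "supp (\<Lambda> \<omega>) - ball 0 1" and ?f = "\<lambda>a. of_nat (\<Lambda> \<omega> a) * (1 / (z - a) + 1 / a + z / a\<^sup>2) :: complex"
  have eq: "(\<lambda>a. of_nat (\<Lambda> \<omega> a) * far_kernel z a) = (\<lambda>a. indicator ?S a *\<^sub>R ?f a)"
    by (auto simp: far_kernel_def indicator_def supp_def fun_eq_iff)
  have S: "restrict_space (count_space UNIV) ?S = count_space ?S" by (simp add: restrict_count_space)
  have "integrable (N \<omega>) (far_kernel z) \<longleftrightarrow> integrable (count_space UNIV) (\<lambda>a. indicator ?S a *\<^sub>R ?f a)"
    unfolding N_def by (subst integrable_pm_iff) (auto simp: eq)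
  also have "\<dots> \<longleftrightarrow> integrable (count_space ?S) ?f"
    unfolding S[symmetric] by (subst integrable_restrict_space) auto
  finally have i: "Infinite_Set_Sum.abs_summable_on ?f ?S \<longleftrightarrow> good \<omega>"
    unfolding Infinite_Set_Sum.abs_summable_on_def using integrable_far_kernel_iff[OF \<omega> z] by blast
  have sm: "?f summable_on ?S \<longleftrightarrow> good \<omega>"
    using i abs_summable_equivalent[of ?f ?S] summable_on_iff_abs_summable_on_complex[of ?f ?S] by blast
  show ?thesis
  proof (cases "good \<omega>")
    case True
    have "infsum ?f ?S = infsetsum ?f ?S"
      by (rule infsetsum_infsum[symmetric]) (use i True in blast)
    also have "\<dots> = (\<integral>a. ?f a \<partial>count_space ?S)" by (rule infsetsum_def)
    also have "\<dots> = (\<integral>a. indicator ?S a *\<^sub>R ?f a \<partial>count_space UNIV)"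
      unfolding S[symmetric] by (subst integral_restrict_space) auto
    also have "\<dots> = (\<integral>a. far_kernel z a \<partial>N \<omega>)"
      unfolding eq[symmetric] N_def by (subst integral_pm) auto
    finally show ?thesis using True by simp
  next
    case False
    then show ?thesis using sm by (simp add: infsum_not_exists)
  qed
qed

lemma V_Lam_eq:
  assumes \<omega>: "\<omega> \<in> space M" and z: "z \<noteq> 0"
  shows "V_Lam M \<Lambda> \<omega> z = (\<integral>a. near_kernel z a \<partial>N \<omega>) + (if good \<omega> then \<integral>a. far_kernel z a \<partial>N \<omega> else 0)
    - Psi_inf M 2 \<Lambda> \<omega> * z - Psi_inf M 1 \<Lambda> \<omega> - of_real (pi * cLam M \<Lambda> \<omega>) * cnj z"
proof -
  have fin: "finite (supp (\<Lambda> \<omega>) \<inter> ball 0 1)" using Lambda_configs[OF \<omega>] by (auto simp: configs_def)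
  have "(\<integral>a. near_kernel z a \<partial>N \<omega>) = (\<Sum>a\<in>supp (\<Lambda> \<omega>) \<inter> ball 0 1. of_nat (\<Lambda> \<omega> a) * near_kernel z a)"
    unfolding N_def
    by (rule integral_pm_finite(2)[OF measurable_far_kernel_section(2) fin]) (simp add: near_kernel_def)
  also have "\<dots> = (\<Sum>a\<in>supp (\<Lambda> \<omega>) \<inter> ball 0 1. of_nat (\<Lambda> \<omega> a) / (z - a))"
    by (rule sum.cong) (auto simp: near_kernel_def)
  finally show ?thesis
    unfolding V_Lam_def zeta_def infsum_far_kernel[OF \<omega> z] by simp
qed

end

locale process_test = integrable_spectral_process M \<Lambda> \<rho> + cauchy_transform \<phi> A C
  for M :: "'w measure" and \<Lambda> \<rho> \<phi> A C
begin

text \<open>Absolute integrability on the product comes from integrating the majorant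
  \<open>B\<close> over the configuration, whose counting measure is sigma-finite.\<close>

lemma fubini_N:
  assumes \<omega>: "\<omega> \<in> space M"
    and k: "(\<lambda>p. k (fst p) (snd p)) \<in> borel_measurable (borel \<Otimes>\<^sub>M borel)"
    and i: "\<And>a. integrable lborel (\<lambda>z. \<phi> z * k z a)"
    and b: "\<And>a. (\<integral>z. cmod (\<phi> z * k z a) \<partial>lborel) \<le> B a" and B: "integrable (N \<omega>) B"
  shows "integrable lborel (\<lambda>z. \<phi> z * (\<integral>a. k z a \<partial>N \<omega>))"
    and "(\<integral>z. \<phi> z * (\<integral>a. k z a \<partial>N \<omega>) \<partial>lborel) = (\<integral>a. (\<integral>z. \<phi> z * k z a \<partial>lborel) \<partial>N \<omega>)"
proof -
  interpret S: sigma_finite_measure "N \<omega>" unfolding N_def by (rule sigma_finite_pm[OF Lambda_configs[OF \<omega>]])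
  interpret P: pair_sigma_finite "N \<omega>" lborel ..
  have m0: "(\<lambda>p. \<phi> (snd p) * k (snd p) (fst p)) \<in> borel_measurable (borel \<Otimes>\<^sub>M borel)"
    using measurable_compose[OF measurable_Pair[OF measurable_snd measurable_fst] k] by (simp add: comp_def)
  have sets: "sets (N \<omega> \<Otimes>\<^sub>M lborel) = sets (borel \<Otimes>\<^sub>M borel)" by (intro sets_pair_measure_cong) simp_all
  have m: "(\<lambda>(a, z). \<phi> z * k z a) \<in> borel_measurable (N \<omega> \<Otimes>\<^sub>M lborel)"
    using m0 by (simp add: measurable_cong_sets[OF sets refl] case_prod_unfold)
  have pair: "integrable (N \<omega> \<Otimes>\<^sub>M lborel) (\<lambda>(a, z). \<phi> z * k z a)"
  proof (rule P.Fubini_integrable[OF m])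
    show "integrable (N \<omega>) (\<lambda>a. \<integral>z. cmod (case (a, z) of (a, z) \<Rightarrow> \<phi> z * k z a) \<partial>lborel)"
    proof (rule Bochner_Integration.integrable_bound[OF B])
      have "(\<lambda>(a, z). cmod (\<phi> z * k z a)) \<in> borel_measurable (N \<omega> \<Otimes>\<^sub>M lborel)"
        using measurable_compose[OF m borel_measurable_norm] by (simp add: case_prod_unfold)
      from lborel.borel_measurable_lebesgue_integral[OF this]
      show "(\<lambda>a. \<integral>z. cmod (case (a, z) of (a, z) \<Rightarrow> \<phi> z * k z a) \<partial>lborel) \<in> borel_measurable (N \<omega>)" by simp
      show "AE a in N \<omega>. norm (\<integral>z. cmod (case (a, z) of (a, z) \<Rightarrow> \<phi> z * k z a) \<partial>lborel) \<le> norm (B a)"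
      proof (rule AE_I2)
        fix a
        have "0 \<le> (\<integral>z. cmod (\<phi> z * k z a) \<partial>lborel)" by (intro integral_nonneg_AE AE_I2 norm_ge_zero)
        with b[of a] show "norm (\<integral>z. cmod (case (a, z) of (a, z) \<Rightarrow> \<phi> z * k z a) \<partial>lborel) \<le> norm (B a)"
          unfolding prod.case real_norm_def by linarith
      qed
    qed
    show "AE a in N \<omega>. integrable lborel (\<lambda>z. case (a, z) of (a, z) \<Rightarrow> \<phi> z * k z a)" using i by simp
  qed
  have "integrable lborel (\<lambda>z. \<integral>a. \<phi> z * k z a \<partial>N \<omega>)" using P.integrable_snd[OF pair] by simp
  then show "integrable lborel (\<lambda>z. \<phi> z * (\<integral>a. k z a \<partial>N \<omega>))" by (simp only: integral_mult_right_zero)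
  have "(\<integral>z. (\<integral>a. \<phi> z * k z a \<partial>N \<omega>) \<partial>lborel) = (\<integral>a. (\<integral>z. \<phi> z * k z a \<partial>lborel) \<partial>N \<omega>)"
    using P.Fubini_integral[OF pair] by simp
  then show "(\<integral>z. \<phi> z * (\<integral>a. k z a \<partial>N \<omega>) \<partial>lborel) = (\<integral>a. (\<integral>z. \<phi> z * k z a \<partial>lborel) \<partial>N \<omega>)"
    by (simp only: integral_mult_right_zero)
qed

definition K_near :: "complex \<Rightarrow> complex" where "K_near a = indicator (ball 0 1) a * K a"
definition h_far :: "complex \<Rightarrow> complex" where "h_far a = indicator (- ball 0 1) a * h a"

lemma measurable_K_near [measurable]: "K_near \<in> borel_measurable borel"
  and measurable_h_far [measurable]: "h_far \<in> borel_measurable borel"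
  unfolding K_near_def[abs_def] h_far_def[abs_def]
  by (intro borel_measurable_times borel_measurable_indicator; simp)+

lemma norm_h_far_le: "cmod (h_far a) \<le> far_bound * cmod (far_weight a)"
  using norm_h_le[of a] by (cases "cmod a \<ge> 1") (auto simp: h_far_def norm_far_weight indicator_def)

text \<open>Integrating 1, z and cnj z against \<phi> produces the moments, and Fubini turns the
  sums over points into linear statistics of \<open>K\<close> and \<open>h\<close>. The formula
  holds at every outcome, which gives measurability of the field without completeness of
  \<open>M\<close>.\<close>

lemma gen_proc_V_eq:
  assumes \<omega>: "\<omega> \<in> space M"
  shows "gen_proc (V_Lam M \<Lambda>) \<phi> \<omega> = I K_near \<omega> + (if good \<omega> then I h_far \<omega> else 0)
    - Psi_inf M 2 \<Lambda> \<omega> * mom1 - Psi_inf M 1 \<Lambda> \<omega> * mom0 - of_real (pi * cLam M \<Lambda> \<omega>) * momc"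
proof -
  let ?n = "\<lambda>z. \<integral>a. near_kernel z a \<partial>N \<omega>" and ?f = "\<lambda>z. \<integral>a. far_kernel z a \<partial>N \<omega>"
  have near: "integrable lborel (\<lambda>z. \<phi> z * ?n z)" "(\<integral>z. \<phi> z * ?n z \<partial>lborel) = I K_near \<omega>"
  proof -
    have eq: "\<phi> z * near_kernel z a = indicator (ball 0 1) a * (\<phi> z * (1 / (z - a)))" for z a
      by (simp add: near_kernel_def)
    have i: "integrable lborel (\<lambda>z. \<phi> z * near_kernel z a)" for a
      unfolding eq by (intro integrable_mult_right integrable_cauchy)
    have b: "(\<integral>z. cmod (\<phi> z * near_kernel z a) \<partial>lborel) \<le> cauchy_bound * indicator (ball 0 1) a" for a
      unfolding eq using cauchy_abs_bound[of a] by (cases "a \<in> ball 0 1") auto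
    have B: "integrable (N \<omega>) (\<lambda>a. cauchy_bound * indicator (ball 0 1) a)"
      using emeasure_N_bounded[OF \<omega>, of "ball 0 1"] by (intro integrable_mult_right integrable_real_indicator) auto
    note F = fubini_N[OF \<omega> measurable_near_kernel i b B]
    show "integrable lborel (\<lambda>z. \<phi> z * ?n z)" by (rule F(1))
    have "(\<integral>z. \<phi> z * near_kernel z a \<partial>lborel) = K_near a" for a
      unfolding eq by (simp only: integral_mult_right_zero K_near_def K_def)
    then show "(\<integral>z. \<phi> z * ?n z \<partial>lborel) = I K_near \<omega>" using F(2) by (simp add: I_def)
  qed
  have far: "integrable lborel (\<lambda>z. \<phi> z * ?f z)" "(\<integral>z. \<phi> z * ?f z \<partial>lborel) = I h_far \<omega>" if g: "good \<omega>"
  proof -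
    have eq: "\<phi> z * far_kernel z a = indicator (- ball 0 1) a * (\<phi> z * (1 / (z - a) + 1 / a + z / a\<^sup>2))" for z a
      by (simp add: far_kernel_def)
    have i: "integrable lborel (\<lambda>z. \<phi> z * far_kernel z a)" for a
      unfolding eq using integrable_far[of a] by (cases "cmod a \<ge> 1") auto
    have b: "(\<integral>z. cmod (\<phi> z * far_kernel z a) \<partial>lborel) \<le> far_bound * cmod (far_weight a)" for a
      unfolding eq using far_abs_bound[of a] by (cases "cmod a \<ge> 1") (auto simp: norm_far_weight)
    have B: "integrable (N \<omega>) (\<lambda>a. far_bound * cmod (far_weight a))"
      using g unfolding good_def by (intro integrable_mult_right integrable_norm)
    note F = fubini_N[OF \<omega> measurable_far_kernel i b B]
    show "integrable lborel (\<lambda>z. \<phi> z * ?f z)" by (rule F(1))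
    have "(\<integral>z. \<phi> z * far_kernel z a \<partial>lborel) = h_far a" for a
      unfolding eq using h_eq[of a] by (cases "cmod a \<ge> 1") (auto simp: h_far_def)
    then show "(\<integral>z. \<phi> z * ?f z \<partial>lborel) = I h_far \<omega>" using F(2) by (simp add: I_def)
  qed
  \<comment> \<open>A factor 0 or 1 treats divergent and convergent outcomes in one linear
    formula.\<close>
  define g :: complex where "g = (if good \<omega> then 1 else 0)"
  have gf: "integrable lborel (\<lambda>z. g * (\<phi> z * ?f z))" "(\<integral>z. g * (\<phi> z * ?f z) \<partial>lborel) = (if good \<omega> then I h_far \<omega> else 0)"
    using far by (auto simp: g_def)
  have V_eq: "gen_proc (V_Lam M \<Lambda>) \<phi> \<omega> = (\<integral>z. \<phi> z * ?n z + g * (\<phi> z * ?f z) - Psi_inf M 2 \<Lambda> \<omega> * (\<phi> z * z) - Psi_inf M 1 \<Lambda> \<omega> * \<phi> z - of_real (pi * cLam M \<Lambda> \<omega>) * (\<phi> z * cnj z) \<partial>lborel)"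
  proof -
    let ?r = "\<lambda>z. \<phi> z * ?n z + g * (\<phi> z * ?f z) - Psi_inf M 2 \<Lambda> \<omega> * (\<phi> z * z) - Psi_inf M 1 \<Lambda> \<omega> * \<phi> z - of_real (pi * cLam M \<Lambda> \<omega>) * (\<phi> z * cnj z)"
    have r: "?r \<in> borel_measurable borel"
    proof -
      have n: "(\<lambda>z. \<phi> z * ?n z) \<in> borel_measurable borel" "(\<lambda>z. g * (\<phi> z * ?f z)) \<in> borel_measurable borel"
        using near(1) gf(1) by auto
      show ?thesis by (intro borel_measurable_diff borel_measurable_add n; measurable)
    qed
    \<comment> \<open>The formula for V is available only off the origin; one point does not affect
      the integral.\<close>
    have eq: "V_Lam M \<Lambda> \<omega> z * \<phi> z = ?r z" if "z \<noteq> 0" for z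
      unfolding V_Lam_eq[OF \<omega> that] g_def by (simp add: algebra_simps)
    have eq': "(\<lambda>z. V_Lam M \<Lambda> \<omega> z * \<phi> z) = (\<lambda>z. if z = 0 then V_Lam M \<Lambda> \<omega> 0 * \<phi> 0 else ?r z)"
      using eq by (intro ext) simp
    have "(\<lambda>z. V_Lam M \<Lambda> \<omega> z * \<phi> z) \<in> borel_measurable borel"
      unfolding eq' using r by (intro measurable_If) auto
    then show ?thesis
      unfolding gen_proc_def using r AE_lborel_singleton[of "0::complex"] eq
      by (intro integral_cong_AE) (auto elim!: eventually_mono)
  qed
  have "gen_proc (V_Lam M \<Lambda>) \<phi> \<omega> = (\<integral>z. \<phi> z * ?n z \<partial>lborel) + (\<integral>z. g * (\<phi> z * ?f z) \<partial>lborel) - Psi_inf M 2 \<Lambda> \<omega> * mom1 - Psi_inf M 1 \<Lambda> \<omega> * mom0 - of_real (pi * cLam M \<Lambda> \<omega>) * momc"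
    unfolding V_eq mom0_def mom1_def momc_def
    using near(1) gf(1) integrable_phi
    by (simp only: Bochner_Integration.integral_add Bochner_Integration.integral_diff Bochner_Integration.integrable_add
        Bochner_Integration.integrable_diff integrable_mult_right integral_mult_right_zero)
  then show ?thesis by (simp only: near(2) gf(2))
qed

lemma measurable_gen_proc_V: "gen_proc (V_Lam M \<Lambda>) \<phi> \<in> borel_measurable M"
proof -
  note [measurable] = good_measurable Psi_limit(1)[of 1] Psi_limit(1)[of 2]
  have "(\<lambda>\<omega>. I K_near \<omega> + (if good \<omega> then I h_far \<omega> else 0)
    - Psi_inf M 2 \<Lambda> \<omega> * mom1 - Psi_inf M 1 \<Lambda> \<omega> * mom0 - of_real (pi * cLam M \<Lambda> \<omega>) * momc) \<in> borel_measurable M"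
    using Psi_limit(1)[of 1] Psi_limit(1)[of 2] by measurable
  then show ?thesis by (subst measurable_cong[OF gen_proc_V_eq]) auto
qed

end

section \<open>Families vanishing in mean, and inner products of mean square limits\<close>

context prob_space
begin

text \<open>Integrability is demanded separately, since the integral of a function that is not
  integrable is 0 and would hide divergence.\<close>

definition L1_null :: "(real \<Rightarrow> 'a \<Rightarrow> complex) \<Rightarrow> bool" where
  "L1_null S \<longleftrightarrow> (\<forall>\<^sub>F R in at_top. integrable M (S R)) \<and> ((\<lambda>R. \<integral>\<omega>. cmod (S R \<omega>) \<partial>M) \<longlongrightarrow> 0) at_top"

lemma L1_null_add:
  assumes S: "L1_null S" and T: "L1_null T" shows "L1_null (\<lambda>R \<omega>. S R \<omega> + T R \<omega>)"
  unfolding L1_null_def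
proof
  have e: "\<forall>\<^sub>F R in at_top. integrable M (S R) \<and> integrable M (T R)"
    using S T by (auto simp: L1_null_def intro: eventually_conj)
  then show "\<forall>\<^sub>F R in at_top. integrable M (\<lambda>\<omega>. S R \<omega> + T R \<omega>)" by (auto elim: eventually_mono)
  show "((\<lambda>R. \<integral>\<omega>. cmod (S R \<omega> + T R \<omega>) \<partial>M) \<longlongrightarrow> 0) at_top"
  proof (rule Lim_null_comparison)
    show "\<forall>\<^sub>F R in at_top. norm (\<integral>\<omega>. cmod (S R \<omega> + T R \<omega>) \<partial>M) \<le> (\<integral>\<omega>. cmod (S R \<omega>) \<partial>M) + (\<integral>\<omega>. cmod (T R \<omega>) \<partial>M)"
      using e
    proof eventually_elim
      case (elim R)
      have "(\<integral>\<omega>. cmod (S R \<omega> + T R \<omega>) \<partial>M) \<le> (\<integral>\<omega>. cmod (S R \<omega>) + cmod (T R \<omega>) \<partial>M)"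
        using elim by (intro integral_mono norm_triangle_ineq) auto
      also have "\<dots> = (\<integral>\<omega>. cmod (S R \<omega>) \<partial>M) + (\<integral>\<omega>. cmod (T R \<omega>) \<partial>M)" using elim by simp
      finally show ?case by (simp add: integral_nonneg_AE)
    qed
    have "((\<lambda>R. (\<integral>\<omega>. cmod (S R \<omega>) \<partial>M) + (\<integral>\<omega>. cmod (T R \<omega>) \<partial>M)) \<longlongrightarrow> 0 + 0) at_top"
      using S T unfolding L1_null_def by (intro tendsto_add) auto
    then show "((\<lambda>R. (\<integral>\<omega>. cmod (S R \<omega>) \<partial>M) + (\<integral>\<omega>. cmod (T R \<omega>) \<partial>M)) \<longlongrightarrow> 0) at_top" by simp
  qed
qed

lemma L1_null_cmult:
  assumes S: "L1_null S" shows "L1_null (\<lambda>R \<omega>. c * S R \<omega>)"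
  unfolding L1_null_def
proof
  show "\<forall>\<^sub>F R in at_top. integrable M (\<lambda>\<omega>. c * S R \<omega>)" using S by (auto simp: L1_null_def elim: eventually_mono)
  have "((\<lambda>R. cmod c * (\<integral>\<omega>. cmod (S R \<omega>) \<partial>M)) \<longlongrightarrow> 0) at_top"
    using S by (intro tendsto_mult_right_zero) (simp add: L1_null_def)
  then show "((\<lambda>R. \<integral>\<omega>. cmod (c * S R \<omega>) \<partial>M) \<longlongrightarrow> 0) at_top" by (simp add: norm_mult)
qed

lemma L1_null_cong:
  assumes S: "L1_null S" and m: "\<forall>\<^sub>F R in at_top. T R \<in> borel_measurable M"
    and ae: "\<forall>\<^sub>F R in at_top. AE \<omega> in M. S R \<omega> = T R \<omega>"
  shows "L1_null T"
  unfolding L1_null_def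
proof
  have i: "\<forall>\<^sub>F R in at_top. integrable M (S R)" using S by (simp add: L1_null_def)
  from i m ae show "\<forall>\<^sub>F R in at_top. integrable M (T R)"
    by eventually_elim (rule integrable_cong_AE_imp)
  have "\<forall>\<^sub>F R in at_top. (\<integral>\<omega>. cmod (S R \<omega>) \<partial>M) = (\<integral>\<omega>. cmod (T R \<omega>) \<partial>M)"
    using i m ae
  proof eventually_elim
    case (elim R)
    then show ?case by (intro integral_cong_AE) (auto elim: eventually_mono)
  qed
  then show "((\<lambda>R. \<integral>\<omega>. cmod (T R \<omega>) \<partial>M) \<longlongrightarrow> 0) at_top"
    using S unfolding L1_null_def by (auto intro: Lim_transform_eventually)
qed

lemma L1_null_of_L2:
  assumes m: "\<And>R. R \<ge> 1 \<Longrightarrow> S R \<in> borel_measurable M" and i: "\<And>R. R \<ge> 1 \<Longrightarrow> integrable M (\<lambda>\<omega>. (cmod (S R \<omega>))\<^sup>2)"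
    and lim: "((\<lambda>R. \<integral>\<omega>. (cmod (S R \<omega>))\<^sup>2 \<partial>M) \<longlongrightarrow> 0) at_top"
  shows "L1_null S"
  unfolding L1_null_def
proof
  note L = L1_le_L2[OF m i]
  show "\<forall>\<^sub>F R in at_top. integrable M (S R)" by (rule eventually_at_top_linorderI[of 1]) (rule L(1))
  show "((\<lambda>R. \<integral>\<omega>. cmod (S R \<omega>) \<partial>M) \<longlongrightarrow> 0) at_top"
  proof (rule Lim_null_comparison)
    show "\<forall>\<^sub>F R in at_top. norm (\<integral>\<omega>. cmod (S R \<omega>) \<partial>M) \<le> sqrt (\<integral>\<omega>. (cmod (S R \<omega>))\<^sup>2 \<partial>M)"
      using L(2) by (intro eventually_at_top_linorderI[of 1]) (simp add: integral_nonneg_AE)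
    show "((\<lambda>R. sqrt (\<integral>\<omega>. (cmod (S R \<omega>))\<^sup>2 \<partial>M)) \<longlongrightarrow> 0) at_top"
      using tendsto_real_sqrt[OF lim] by simp
  qed
qed

text \<open>How an almost sure identity is extracted from limits: a null family that does not depend
  on \<open>R\<close> vanishes.\<close>

lemma L1_null_const:
  assumes "L1_null (\<lambda>R. Z)" shows "AE \<omega> in M. Z \<omega> = 0"
proof -
  have i: "integrable M Z" using assms by (simp add: L1_null_def)
  have "(\<integral>\<omega>. cmod (Z \<omega>) \<partial>M) = 0"
    using assms by (simp add: L1_null_def tendsto_const_iff)
  then have "AE \<omega> in M. cmod (Z \<omega>) = 0"
    using i by (subst (asm) integral_nonneg_eq_0_iff_AE) auto
  then show ?thesis by simp
qed

lemma L2_cauchy_schwarz: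
  assumes U: "sq_integrable M U" and V: "sq_integrable M V"
  shows "cmod (\<integral>\<omega>. U \<omega> * cnj (V \<omega>) \<partial>M) \<le> sqrt (\<integral>\<omega>. (cmod (U \<omega>))\<^sup>2 \<partial>M) * sqrt (\<integral>\<omega>. (cmod (V \<omega>))\<^sup>2 \<partial>M)"
proof -
  have [measurable]: "U \<in> borel_measurable M" "V \<in> borel_measurable M" and sq: "integrable M (\<lambda>\<omega>. (cmod (U \<omega>))\<^sup>2)" "integrable M (\<lambda>\<omega>. (cmod (V \<omega>))\<^sup>2)"
    using U V by (auto simp: sq_integrable_def)
  have i: "integrable M (\<lambda>\<omega>. cmod (U \<omega>) * cmod (V \<omega>))"
    using integrable_norm[OF covar_eq(2)[OF U V]] by (simp add: norm_mult)
  have "(\<integral>\<^sup>+\<omega>. ennreal (cmod (U \<omega>)) * ennreal (cmod (V \<omega>)) \<partial>M)\<^sup>2 \<le> (\<integral>\<^sup>+\<omega>. (ennreal (cmod (U \<omega>)))\<^sup>2 \<partial>M) * (\<integral>\<^sup>+\<omega>. (ennreal (cmod (V \<omega>)))\<^sup>2 \<partial>M)"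
    by (rule Cauchy_Schwarz_nn_integral) auto
  then have "ennreal ((\<integral>\<omega>. cmod (U \<omega>) * cmod (V \<omega>) \<partial>M)\<^sup>2) \<le> ennreal ((\<integral>\<omega>. (cmod (U \<omega>))\<^sup>2 \<partial>M) * (\<integral>\<omega>. (cmod (V \<omega>))\<^sup>2 \<partial>M))"
    using i sq by (simp add: ennreal_mult[symmetric] ennreal_power nn_integral_eq_integral integral_nonneg_AE)
  then have "(\<integral>\<omega>. cmod (U \<omega>) * cmod (V \<omega>) \<partial>M)\<^sup>2 \<le> (\<integral>\<omega>. (cmod (U \<omega>))\<^sup>2 \<partial>M) * (\<integral>\<omega>. (cmod (V \<omega>))\<^sup>2 \<partial>M)"
    by (subst (asm) ennreal_le_iff) (auto intro!: mult_nonneg_nonneg integral_nonneg_AE)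
  then have "(\<integral>\<omega>. cmod (U \<omega>) * cmod (V \<omega>) \<partial>M) \<le> sqrt ((\<integral>\<omega>. (cmod (U \<omega>))\<^sup>2 \<partial>M) * (\<integral>\<omega>. (cmod (V \<omega>))\<^sup>2 \<partial>M))"
    by (rule real_le_rsqrt)
  moreover have "cmod (\<integral>\<omega>. U \<omega> * cnj (V \<omega>) \<partial>M) \<le> (\<integral>\<omega>. cmod (U \<omega>) * cmod (V \<omega>) \<partial>M)"
    by (rule order_trans[OF integral_norm_bound]) (simp add: norm_mult)
  ultimately show ?thesis by (simp add: real_sqrt_mult)
qed

text \<open>Up to conjugation the difference expands into (X - U)(Y - V), (X - U) V and U (Y - V),
  each estimated by Cauchy-Schwarz.\<close>

lemma L2_limit_inner:
  fixes X Y :: "real \<Rightarrow> 'a \<Rightarrow> complex"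
  assumes X: "\<And>R. R \<ge> 1 \<Longrightarrow> sq_integrable M (X R)" "sq_integrable M U" "((\<lambda>R. \<integral>\<omega>. (cmod (X R \<omega> - U \<omega>))\<^sup>2 \<partial>M) \<longlongrightarrow> 0) at_top"
    and Y: "\<And>R. R \<ge> 1 \<Longrightarrow> sq_integrable M (Y R)" "sq_integrable M V" "((\<lambda>R. \<integral>\<omega>. (cmod (Y R \<omega> - V \<omega>))\<^sup>2 \<partial>M) \<longlongrightarrow> 0) at_top"
  shows "((\<lambda>R. \<integral>\<omega>. X R \<omega> * cnj (Y R \<omega>) \<partial>M) \<longlongrightarrow> (\<integral>\<omega>. U \<omega> * cnj (V \<omega>) \<partial>M)) at_top"
proof (rule LIM_zero_cancel, rule Lim_null_comparison)
  let ?d = "\<lambda>R. sqrt (\<integral>\<omega>. (cmod (X R \<omega> - U \<omega>))\<^sup>2 \<partial>M)" and ?e = "\<lambda>R. sqrt (\<integral>\<omega>. (cmod (Y R \<omega> - V \<omega>))\<^sup>2 \<partial>M)"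
  let ?u = "sqrt (\<integral>\<omega>. (cmod (U \<omega>))\<^sup>2 \<partial>M)" and ?v = "sqrt (\<integral>\<omega>. (cmod (V \<omega>))\<^sup>2 \<partial>M)"
  have "norm ((\<integral>\<omega>. X R \<omega> * cnj (Y R \<omega>) \<partial>M) - (\<integral>\<omega>. U \<omega> * cnj (V \<omega>) \<partial>M)) \<le> ?d R * ?e R + ?d R * ?v + ?u * ?e R" if R: "R \<ge> 1" for R
  proof -
    have dX: "sq_integrable M (\<lambda>\<omega>. X R \<omega> - U \<omega>)" and dY: "sq_integrable M (\<lambda>\<omega>. Y R \<omega> - V \<omega>)"
      using X Y R by (auto intro: sq_integrable_diff)
    note i = covar_eq(2)[OF dX dY] covar_eq(2)[OF dX Y(2)] covar_eq(2)[OF X(2) dY]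
    have "(\<integral>\<omega>. X R \<omega> * cnj (Y R \<omega>) \<partial>M) - (\<integral>\<omega>. U \<omega> * cnj (V \<omega>) \<partial>M) = (\<integral>\<omega>. X R \<omega> * cnj (Y R \<omega>) - U \<omega> * cnj (V \<omega>) \<partial>M)"
      using covar_eq(2)[OF X(1)[OF R] Y(1)[OF R]] covar_eq(2)[OF X(2) Y(2)] by (rule Bochner_Integration.integral_diff[symmetric])
    also have "\<dots> = (\<integral>\<omega>. (X R \<omega> - U \<omega>) * cnj (Y R \<omega> - V \<omega>) + (X R \<omega> - U \<omega>) * cnj (V \<omega>) + U \<omega> * cnj (Y R \<omega> - V \<omega>) \<partial>M)"
      by (rule Bochner_Integration.integral_cong) (auto simp: algebra_simps)
    also have "\<dots> = (\<integral>\<omega>. (X R \<omega> - U \<omega>) * cnj (Y R \<omega> - V \<omega>) \<partial>M) + (\<integral>\<omega>. (X R \<omega> - U \<omega>) * cnj (V \<omega>) \<partial>M) + (\<integral>\<omega>. U \<omega> * cnj (Y R \<omega> - V \<omega>) \<partial>M)"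
      using i by (simp only: Bochner_Integration.integral_add Bochner_Integration.integrable_add)
    finally show ?thesis
      by (simp only:) (intro order_trans[OF norm_triangle_ineq] add_mono L2_cauchy_schwarz dX dY X(2) Y(2))
  qed
  then show "\<forall>\<^sub>F R in at_top. norm ((\<integral>\<omega>. X R \<omega> * cnj (Y R \<omega>) \<partial>M) - (\<integral>\<omega>. U \<omega> * cnj (V \<omega>) \<partial>M)) \<le> ?d R * ?e R + ?d R * ?v + ?u * ?e R"
    by (intro eventually_at_top_linorderI[of 1]) blast
  have "((\<lambda>R. ?d R * ?e R + ?d R * ?v + ?u * ?e R) \<longlongrightarrow> sqrt 0 * sqrt 0 + sqrt 0 * ?v + ?u * sqrt 0) at_top"
    by (intro tendsto_intros X(3) Y(3))
  then show "((\<lambda>R. ?d R * ?e R + ?d R * ?v + ?u * ?e R) \<longlongrightarrow> 0) at_top" by simp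
qed

end

section \<open>Identification of the field with a mean square limit\<close>

context process_test
begin

lemma I_linear:
  assumes "\<omega> \<in> space M" "integrable (N \<omega>) f" "integrable (N \<omega>) g"
  shows "I (\<lambda>a. f a + g a) \<omega> = I f \<omega> + I g \<omega>" "I (\<lambda>a. f a - g a) \<omega> = I f \<omega> - I g \<omega>"
  using assms by (simp_all add: I_def)

lemma I_cmult: "I (\<lambda>a. c * f a) \<omega> = c * I f \<omega>"
  unfolding I_def by (rule integral_mult_right_zero)

lemma integrable_N: "\<omega> \<in> space M \<Longrightarrow> bdd_supp f \<Longrightarrow> integrable (N \<omega>) f"
  unfolding N_def by (intro integrable_pm_bdd_supp Lambda_configs)

lemma L1_null_I:
  assumes f: "\<And>R. R \<ge> R0 \<Longrightarrow> integrable lborel (f R)" and lim: "((\<lambda>R. \<integral>a. cmod (f R a) \<partial>lborel) \<longlongrightarrow> 0) at_top"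
  shows "L1_null (\<lambda>R. I (f R))"
  unfolding L1_null_def
proof
  show "\<forall>\<^sub>F R in at_top. integrable M (I (f R))"
    by (rule eventually_at_top_linorderI[of R0]) (intro integrable_I f)
  show "((\<lambda>R. \<integral>\<omega>. cmod (I (f R) \<omega>) \<partial>M) \<longlongrightarrow> 0) at_top"
  proof (rule Lim_null_comparison)
    show "\<forall>\<^sub>F R in at_top. norm (\<integral>\<omega>. cmod (I (f R) \<omega>) \<partial>M) \<le> intensity * (\<integral>a. cmod (f R a) \<partial>lborel)"
      by (rule eventually_at_top_linorderI[of R0]) (simp add: integral_norm_I_le f integral_nonneg_AE)
    show "((\<lambda>R. intensity * (\<integral>a. cmod (f R a) \<partial>lborel)) \<longlongrightarrow> 0) at_top"
      by (rule tendsto_mult_right_zero[OF lim])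
  qed
qed

definition far_tail :: "real \<Rightarrow> complex \<Rightarrow> complex" where
  "far_tail R a = h_far a * (1 - disc R a)"

lemma integrable_h_far: "integrable lborel h_far"
proof (rule Bochner_Integration.integrable_bound)
  show "integrable lborel (\<lambda>a. of_real far_bound * far_weight a)" using integrable_far_weight by simp
  show "AE a in lborel. cmod (h_far a) \<le> cmod (of_real far_bound * far_weight a)"
    using norm_h_far_le far_bound_nonneg by (auto simp: norm_mult)
qed simp

lemma integrable_far_tail: "integrable lborel (far_tail R)"
proof (rule Bochner_Integration.integrable_bound[OF integrable_h_far])
  show "far_tail R \<in> borel_measurable lborel" unfolding far_tail_def[abs_def] by measurable
qed (auto simp: far_tail_def disc_def indicator_def)

lemma L1_null_far_tail: "L1_null (\<lambda>R. I (far_tail R))"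
proof (rule L1_null_I[where ?R0.0=1, OF integrable_far_tail])
  have "((\<lambda>R. \<integral>a. cmod (far_tail R a) \<partial>lborel) \<longlongrightarrow> (\<integral>a. 0 \<partial>(lborel :: complex measure))) at_top"
  proof (rule dominated_convergence_at_top_real(1)[where c=1 and w="\<lambda>a. cmod (h_far a)"])
    show "AE a in lborel. ((\<lambda>R. cmod (far_tail R a)) \<longlongrightarrow> 0) at_top"
    proof (rule AE_I2)
      fix a
      have "\<forall>\<^sub>F R in at_top. 0 = cmod (far_tail R a)"
        by (rule eventually_at_top_linorderI[of "cmod a"]) (auto simp: far_tail_def disc_def)
      then show "((\<lambda>R. cmod (far_tail R a)) \<longlongrightarrow> 0) at_top" by (rule Lim_transform_eventually[OF tendsto_const])
    qed
  qed (use integrable_far_tail integrable_h_far in \<open>auto simp: far_tail_def disc_def indicator_def norm_mult\<close>)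
  then show "((\<lambda>R. \<integral>a. cmod (far_tail R a) \<partial>lborel) \<longlongrightarrow> 0) at_top" by simp
qed

lemma integrable_conv_kernel: "R > 0 \<Longrightarrow> integrable lborel (conv \<phi> (disc_kernel R))"
  using nice_conv_kernel by (auto simp: nice_def intro: integrable_bdd_supp)

lemma bdd_supp_K_disc: "bdd_supp (\<lambda>a. K a * disc R a)"
  by (rule bdd_supp_mult_disc[where C=cauchy_bound]) (auto simp: norm_K_le)

lemma err_eq: "err R a = conv \<phi> (disc_kernel R) a + (K a * disc R a + ((mom0 / of_real (R\<^sup>2)) * (cnj a * disc R a) - (momc / of_real (R\<^sup>2)) * disc R a))"
  by (simp add: err_def algebra_simps diff_divide_distrib)

lemma integrable_err: "R > 0 \<Longrightarrow> integrable lborel (err R)"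
  unfolding err_eq[abs_def]
  by (intro Bochner_Integration.integrable_add Bochner_Integration.integrable_diff integrable_mult_right integrable_conv_kernel
    integrable_bdd_supp bdd_supp_K_disc bdd_supp_disc bdd_supp_cnj_disc)

text \<open>The annulus has area 4 pi R A and \<open>err\<close> is O(R^-2) on it and 0 elsewhere,
  so the L1 norm is O(1 / R).\<close>

lemma L1_null_err: "L1_null (\<lambda>R. I (err R))"
proof (rule L1_null_I[where ?R0.0="2 * A"])
  let ?n = "\<integral>z. cmod (\<phi> z) \<partial>lborel"
  have n0: "?n \<ge> 0" by (simp add: integral_nonneg_AE)
  show "integrable lborel (err R)" if "R \<ge> 2 * A" for R using that A by (intro integrable_err) linarith
  show "((\<lambda>R. \<integral>a. cmod (err R a) \<partial>lborel) \<longlongrightarrow> 0) at_top"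
  proof (rule Lim_null_comparison)
    have "norm (\<integral>a. cmod (err R a) \<partial>lborel) \<le> (24 * A\<^sup>2 * ?n * pi) / R" if R: "R \<ge> 2 * A" for R
    proof -
      have R0: "R > 0" using R A by linarith
      let ?D = "cball 0 (R + A) - ball (0::complex) (R - A)"
      have "emeasure lborel ?D = emeasure lborel (cball (0::complex) (R + A)) - emeasure lborel (ball (0::complex) (R - A))"
        by (rule emeasure_Diff) (use R A in \<open>auto simp: emeasure_lborel_ball_complex\<close>)
      also have "\<dots> = ennreal (pi * (R + A)\<^sup>2 - pi * (R - A)\<^sup>2)"
        using R A by (simp add: emeasure_lborel_cball_complex emeasure_lborel_ball_complex ennreal_minus)
      also have "pi * (R + A)\<^sup>2 - pi * (R - A)\<^sup>2 = 4 * pi * R * A" by (simp add: power2_eq_square algebra_simps)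
      finally have D: "emeasure lborel ?D = ennreal (4 * pi * R * A)" .
      have iD: "integrable lborel (\<lambda>a. (6 * A * ?n / R\<^sup>2) * indicat_real ?D a)"
        using D by (intro integrable_mult_right integrable_real_indicator) auto
      have "(\<integral>a. cmod (err R a) \<partial>lborel) \<le> (\<integral>a. (6 * A * ?n / R\<^sup>2) * indicator ?D a \<partial>lborel)"
        by (rule integral_mono[OF integrable_norm[OF integrable_err[OF R0]] iD]) (rule norm_err_le[OF R])
      also have "\<dots> = (6 * A * ?n / R\<^sup>2) * (4 * pi * R * A)" using D R0 A by (simp add: measure_def)
      also have "\<dots> = (24 * A\<^sup>2 * ?n * pi) / R" using R0 by (simp add: field_simps power2_eq_square)
      finally show ?thesis by (simp add: integral_nonneg_AE)
    qed
    then show "\<forall>\<^sub>F R in at_top. norm (\<integral>a. cmod (err R a) \<partial>lborel) \<le> (24 * A\<^sup>2 * ?n * pi) / R"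
      by (rule eventually_at_top_linorderI)
    show "((\<lambda>R. (24 * A\<^sup>2 * ?n * pi) / R) \<longlongrightarrow> 0) at_top"
      by (intro tendsto_divide_0[OF tendsto_const] filterlim_at_top_imp_at_infinity filterlim_ident)
  qed
qed

definition cnj_avg :: "real \<Rightarrow> complex \<Rightarrow> complex" where
  "cnj_avg R a = (1 / of_real (R\<^sup>2)) * (cnj a * disc R a)"

lemma nice_cnj_avg: "R \<ge> 1 \<Longrightarrow> nice (cnj_avg R)"
proof -
  assume R: "R \<ge> 1"
  have "nice (\<lambda>a. ((1 / of_real (R\<^sup>2)) * cnj a) * disc R a)"
  proof (rule nice_mult_disc[where C="(1 / R\<^sup>2) * R"])
    fix a :: complex assume "cmod a \<le> R"
    then show "cmod (1 / of_real (R\<^sup>2) * cnj a) \<le> (1 / R\<^sup>2) * R"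
      unfolding norm_mult by (intro mult_mono) (auto simp: norm_divide norm_power)
  qed (use R in \<open>auto intro!: continuous_intros\<close>)
  then show ?thesis by (simp add: cnj_avg_def[abs_def] mult.assoc)
qed

lemma fourier_cnj_avg:
  assumes R: "R \<ge> 1" shows "\<xi> \<noteq> 0 \<Longrightarrow> fourier (cnj_avg R) \<xi> = cnj (sgn \<xi>) * (of_real R * disc_p (R * cmod \<xi>))" "fourier (cnj_avg R) 0 = 0"
proof -
  have R0: "R > 0" using R by linarith
  have p: "(1 / of_real (R\<^sup>2)) * (of_real (R ^ 3) * u * x) = u * (of_real R * x)" for u x :: complex
    using R0 by (simp add: power2_eq_square power3_eq_cube)
  show "fourier (cnj_avg R) \<xi> = cnj (sgn \<xi>) * (of_real R * disc_p (R * cmod \<xi>))" if "\<xi> \<noteq> 0"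
    unfolding cnj_avg_def[abs_def] fourier_cmult fourier_cnj_disc[OF R0 sgn_direction[OF that]] by (rule p)
  show "fourier (cnj_avg R) 0 = 0"
    unfolding cnj_avg_def[abs_def] fourier_cmult using fourier_cnj_disc[OF R0, of 1 0] by (simp add: disc_p_0)
qed

text \<open>The transform vanishes at 0, and elsewhere it is R disc_p (R |xi|) up to a phase, the
  case treated in \<open>negligible_disc_p\<close>.\<close>

lemma L1_null_cnj_avg: "L1_null (\<lambda>R. I (cnj_avg R))"
proof (rule L1_null_of_L2)
  have g: "negligible_error (\<lambda>R \<xi>. cnj (sgn \<xi>) * (of_real R * disc_p (R * cmod \<xi>)))"
    by (rule negligible_disc_p[where K=1]) (auto simp: norm_sgn)
  have bs: "bdd_supp (cnj_avg R)" if "R \<ge> 1" for R using nice_cnj_avg[OF that] by (simp add: nice_def)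
  have "negligible_error (\<lambda>R. fourier (cnj_avg R))"
    unfolding negligible_error_def
  proof (intro conjI allI impI)
    show "fourier (cnj_avg R) \<in> borel_measurable borel" if "R \<ge> 1" for R
      by (intro borel_measurable_fourier integrable_bdd_supp bs that)
    show "\<exists>C\<ge>0. \<forall>R\<ge>1. \<forall>\<xi>. \<xi> \<noteq> 0 \<longrightarrow> (cmod (fourier (cnj_avg R) \<xi>))\<^sup>2 \<le> C * dom \<xi>"
      using g fourier_cnj_avg unfolding negligible_error_def by auto
    show "((\<lambda>R. fourier (cnj_avg R) \<xi>) \<longlongrightarrow> 0) at_top" if \<xi>: "\<xi> \<noteq> 0" for \<xi>
    proof (rule Lim_transform_eventually)
      show "((\<lambda>R. cnj (sgn \<xi>) * (of_real R * disc_p (R * cmod \<xi>))) \<longlongrightarrow> 0) at_top"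
        using g \<xi> unfolding negligible_error_def by blast
      show "\<forall>\<^sub>F R in at_top. cnj (sgn \<xi>) * (of_real R * disc_p (R * cmod \<xi>)) = fourier (cnj_avg R) \<xi>"
        using fourier_cnj_avg(1)[OF _ \<xi>] by (intro eventually_at_top_linorderI[of 1]) simp
    qed
  qed
  then show "((\<lambda>R. \<integral>\<omega>. (cmod (I (cnj_avg R) \<omega>))\<^sup>2 \<partial>M) \<longlongrightarrow> 0) at_top"
    by (intro L2_null_of_fourier nice_cnj_avg fourier_cnj_avg)
  show "I (cnj_avg R) \<in> borel_measurable M" "integrable M (\<lambda>\<omega>. (cmod (I (cnj_avg R) \<omega>))\<^sup>2)" if "R \<ge> 1" for R
    using sq_integrable_I[OF bs[OF that]] by (auto simp: sq_integrable_def)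
qed

abbreviation inv_annulus :: "nat \<Rightarrow> real \<Rightarrow> complex \<Rightarrow> complex" where
  "inv_annulus l R \<equiv> \<lambda>a. 1 / a ^ l * (disc R a - disc 1 a)"

lemma L1_null_Psi:
  assumes l: "l \<in> {1, 2}" shows "L1_null (\<lambda>R \<omega>. I (inv_annulus l R) \<omega> - Psi_inf M l \<Lambda> \<omega>)"
proof (rule L1_null_of_L2[OF _ Psi_limit(3)[OF l] Psi_limit(2)[OF l]])
  have "I (inv_annulus l R) \<in> borel_measurable M" for R by (rule measurable_I) measurable
  then show "(\<lambda>\<omega>. I (inv_annulus l R) \<omega> - Psi_inf M l \<Lambda> \<omega>) \<in> borel_measurable M" for R
    using Psi_limit(1)[OF l] by (intro borel_measurable_diff)
qed

lemma L1_null_density: "L1_null (\<lambda>R \<omega>. of_real (density_avg R \<omega> - pi * cLam M \<Lambda> \<omega>))"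
proof -
  have "integrable M (cLam M \<Lambda>)"
    unfolding cLam_def using cnt_integrable[of "ball 0 1"] by (intro integrable_divide inv.real_cond_exp_int(1)) auto
  then have "integrable M (\<lambda>\<omega>. of_real (density_avg R \<omega> - pi * cLam M \<Lambda> \<omega>) :: complex)" for R
    using integrable_density_avg[of R] by (intro integrable_of_real Bochner_Integration.integrable_diff integrable_mult_right)
  then show ?thesis using density_avg_limit by (simp add: L1_null_def del: of_real_diff of_real_mult)
qed

text \<open>\<open>err\<close> expresses the convolution through \<open>K\<close> on the disc of
  radius R; \<open>K\<close> is then split at |a| = 1 and its outer part rewritten through
  \<open>h\<close>, so that mom0 and mom1 appear in front of partial sums of Psi. The identity needs
  an outcome that is \<open>good\<close> and has no point on the unit circle.\<close>

lemma V_decomposition: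
  assumes R: "R \<ge> 1"
  shows "AE \<omega> in M. gen_proc (V_Lam M \<Lambda>) \<phi> \<omega> + I (conv \<phi> (disc_kernel R)) \<omega> =
    I (far_tail R) \<omega> + mom0 * (I (inv_annulus 1 R) \<omega> - Psi_inf M 1 \<Lambda> \<omega>) + mom1 * (I (inv_annulus 2 R) \<omega> - Psi_inf M 2 \<Lambda> \<omega>)
      + momc * of_real (density_avg R \<omega> - pi * cLam M \<Lambda> \<omega>) + (- mom0) * I (cnj_avg R) \<omega> + I (err R) \<omega>"
proof -
  have R0: "R > 0" using R by linarith
  have "AE \<omega> in M. AE a in N \<omega>. cmod a \<noteq> 1" by (rule AE_N_null[OF AE_lborel_cmod_neq]) measurable
  then show ?thesis
    using AE_good AE_space
  proof eventually_elim
    case (elim \<omega>)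
    note \<omega> = elim(3)
    note int = integrable_N[OF \<omega>]
    have bs: "bdd_supp (inv_annulus l R)" for l
      by (rule bdd_supp_annulus[where C=1]) (use R in \<open>auto simp: norm_divide norm_power divide_le_eq one_le_power less_imp_le\<close>)
    have bh: "bdd_supp (\<lambda>a. h a * (disc R a - disc 1 a))"
    proof (rule bdd_supp_annulus[where C=far_bound])
      fix z :: complex assume z: "1 < cmod z"
      have "cmod (h z) \<le> far_bound / cmod z ^ 3" using z by (intro norm_h_le) simp
      also have "\<dots> \<le> far_bound / 1" using z far_bound_nonneg by (intro divide_left_mono) (auto simp: one_le_power less_imp_le)
      finally show "cmod (h z) \<le> far_bound" by simp
    qed (use R in auto)
    have bc: "bdd_supp (conv \<phi> (disc_kernel R))" using nice_conv_kernel[OF R0] by (simp add: nice_def)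
    have ihf: "integrable (N \<omega>) h_far"
    proof (rule Bochner_Integration.integrable_bound)
      show "integrable (N \<omega>) (\<lambda>a. of_real far_bound * far_weight a)" using elim(2) by (simp add: good_def)
      show "AE a in N \<omega>. cmod (h_far a) \<le> cmod (of_real far_bound * far_weight a)"
        using norm_h_far_le far_bound_nonneg by (auto simp: norm_mult)
    qed simp
    have near: "I K_near \<omega> = I (\<lambda>a. K a * disc 1 a) \<omega>"
      unfolding I_def
    proof (rule integral_cong_AE)
      show "AE a in N \<omega>. K_near a = K a * disc 1 a"
        using elim(1) by eventually_elim (auto simp: K_near_def disc_def indicator_def)
    qed auto
    have tail: "I (far_tail R) \<omega> = I h_far \<omega> - I (\<lambda>a. h a * (disc R a - disc 1 a)) \<omega>"
    proof -
      have "I (far_tail R) \<omega> = I (\<lambda>a. h_far a - h a * (disc R a - disc 1 a)) \<omega>"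
        unfolding I_def
      proof (rule integral_cong_AE)
        show "AE a in N \<omega>. far_tail R a = h_far a - h a * (disc R a - disc 1 a)"
          using elim(1) by eventually_elim (use R in \<open>auto simp: far_tail_def h_far_def disc_def indicator_def\<close>)
      qed (auto simp: far_tail_def[abs_def])
      also have "\<dots> = I h_far \<omega> - I (\<lambda>a. h a * (disc R a - disc 1 a)) \<omega>"
        by (rule I_linear(2)[OF \<omega> ihf int[OF bh]])
      finally show ?thesis .
    qed
    \<comment> \<open>The source of the two partial sums: on 1 < |a| <= R, K equals h - mom0 / a -
      mom1 / a^2.\<close>
    have Kd: "(\<lambda>a. K a * disc R a) = (\<lambda>a. ((K a * disc 1 a + h a * (disc R a - disc 1 a)) - mom0 * inv_annulus 1 R a) - mom1 * inv_annulus 2 R a)"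
      by (rule ext) (simp add: h_def algebra_simps)
    have IK: "I (\<lambda>a. K a * disc R a) \<omega> = ((I (\<lambda>a. K a * disc 1 a) \<omega> + I (\<lambda>a. h a * (disc R a - disc 1 a)) \<omega>) - mom0 * I (inv_annulus 1 R) \<omega>) - mom1 * I (inv_annulus 2 R) \<omega>"
      unfolding Kd
      by (simp only: I_linear[OF \<omega>] I_cmult int[OF bdd_supp_K_disc] int[OF bh] int[OF bs] integrable_mult_right
          Bochner_Integration.integrable_add Bochner_Integration.integrable_diff)
    have err': "err R = (\<lambda>a. conv \<phi> (disc_kernel R) a + (K a * disc R a + (mom0 * cnj_avg R a - (momc / of_real (R\<^sup>2)) * disc R a)))"
      by (rule ext) (simp add: err_eq cnj_avg_def)
    have bca: "bdd_supp (cnj_avg R)" using nice_cnj_avg[OF R] by (simp add: nice_def)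
    have Ierr: "I (err R) \<omega> = I (conv \<phi> (disc_kernel R)) \<omega> + (I (\<lambda>a. K a * disc R a) \<omega> + (mom0 * I (cnj_avg R) \<omega> - (momc / of_real (R\<^sup>2)) * I (disc R) \<omega>))"
      unfolding err'
      by (simp only: I_linear[OF \<omega>] I_cmult int[OF bdd_supp_K_disc] int[OF bca] int[OF bc] int[OF bdd_supp_disc] integrable_mult_right
          Bochner_Integration.integrable_add Bochner_Integration.integrable_diff)
    \<comment> \<open>Here \<open>momc\<close> meets the count in |a| <= R divided by R^2, which
      supplies the density term.\<close>
    have avg: "(momc / of_real (R\<^sup>2)) * I (disc R) \<omega> = momc * of_real (density_avg R \<omega>)"
      unfolding I_disc[OF \<omega>] density_avg_def by simp
    show ?case
      unfolding gen_proc_V_eq[OF \<omega>] Ierr tail near IK avg using elim(2) by (simp add: algebra_simps)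
  qed
qed

text \<open>The statistics of the convolutions have a mean square limit X, and their sum with V is
  null in L1 by \<open>V_decomposition\<close>; subtracting leaves V + X, which is free of R and
  hence 0 almost surely. X inherits mean 0 from the vanishing integral of the kernel.\<close>

lemma V_eq_L2_limit:
  obtains X where "sq_integrable M X" "((\<lambda>R. \<integral>\<omega>. (cmod (I (conv \<phi> (disc_kernel R)) \<omega> - X \<omega>))\<^sup>2 \<partial>M) \<longlongrightarrow> 0) at_top"
    "AE \<omega> in M. gen_proc (V_Lam M \<Lambda>) \<phi> \<omega> = - X \<omega>" "(\<integral>\<omega>. X \<omega> \<partial>M) = 0"
proof -
  let ?F = "\<lambda>R. conv \<phi> (disc_kernel R)"
  have nice: "nice (?F R)" if "R \<ge> 1" for R using that by (intro nice_conv_kernel) linarith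
  have g: "negligible_error (\<lambda>R \<xi>. (\<i> * cnj (sgn \<xi>) / of_real (pi * cmod \<xi>) * fourier \<phi> \<xi>) * disc_q (R * cmod \<xi>))"
  proof (rule negligible_disc_q[where K="\<integral>z. cmod (\<phi> z) \<partial>lborel"])
    have [measurable]: "fourier \<phi> \<in> borel_measurable borel" using integrable_phi(1) by (rule borel_measurable_fourier)
    show "(\<lambda>\<xi>. \<i> * cnj (sgn \<xi>) / of_real (pi * cmod \<xi>) * fourier \<phi> \<xi>) \<in> borel_measurable borel" by measurable
    fix \<xi> :: complex assume \<xi>: "\<xi> \<noteq> 0"
    have "cmod (\<i> * cnj (sgn \<xi>) / of_real (pi * cmod \<xi>) * fourier \<phi> \<xi>) = cmod (fourier \<phi> \<xi>) * (1 / (pi * cmod \<xi>))"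
      using \<xi> by (simp add: norm_mult norm_divide norm_sgn)
    also have "\<dots> \<le> (\<integral>z. cmod (\<phi> z) \<partial>lborel) * (1 + 1 / cmod \<xi>)"
    proof (rule mult_mono[OF norm_fourier_le])
      have "1 / (pi * cmod \<xi>) \<le> 1 / (1 * cmod \<xi>)" using \<xi> pi_gt3 by (intro divide_left_mono mult_right_mono) auto
      then show "1 / (pi * cmod \<xi>) \<le> 1 + 1 / cmod \<xi>" by simp
    qed (use \<xi> in \<open>auto intro: integral_nonneg_AE\<close>)
    finally show "cmod (\<i> * cnj (sgn \<xi>) / of_real (pi * cmod \<xi>) * fourier \<phi> \<xi>) \<le> (\<integral>z. cmod (\<phi> z) \<partial>lborel) * (1 + 1 / cmod \<xi>)" .
  qed (auto intro: integral_nonneg_AE)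
  have ft: "fourier (?F R) \<xi> = (- \<i> * cnj (sgn \<xi>) / of_real (cmod \<xi>)) * fourier \<phi> \<xi> + (\<i> * cnj (sgn \<xi>) / of_real (pi * cmod \<xi>) * fourier \<phi> \<xi>) * disc_q (R * cmod \<xi>)"
    if "R \<ge> 1" "\<xi> \<noteq> 0" for R \<xi>
    by (rule fourier_conv_kernel) (use that in auto)
  have f0: "fourier (?F R) 0 = 0" if "R \<ge> 1" for R using that by (intro fourier_conv_kernel_0) linarith
  obtain X where X: "sq_integrable M X" "\<And>R. R \<ge> 1 \<Longrightarrow> integrable M (\<lambda>\<omega>. (cmod (I (?F R) \<omega> - X \<omega>))\<^sup>2)"
    "((\<lambda>R. \<integral>\<omega>. (cmod (I (?F R) \<omega> - X \<omega>))\<^sup>2 \<partial>M) \<longlongrightarrow> 0) at_top"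
    by (rule L2_limit_of_fourier[OF nice f0 ft g]) blast+
  have Xm[measurable]: "X \<in> borel_measurable M" using X(1) by (simp add: sq_integrable_def)
  have Fm[measurable]: "I (?F R) \<in> borel_measurable M" if "R \<ge> 1" for R
    using nice[OF that] by (intro measurable_I) (simp add: nice_def bdd_supp_def)
  have diff_null: "L1_null (\<lambda>R \<omega>. I (?F R) \<omega> - X \<omega>)"
    by (rule L1_null_of_L2[OF _ X(2,3)]) (auto intro!: borel_measurable_diff Fm)
  note [measurable] = measurable_gen_proc_V
  have V_null: "L1_null (\<lambda>R \<omega>. gen_proc (V_Lam M \<Lambda>) \<phi> \<omega> + I (?F R) \<omega>)"
  proof (rule L1_null_cong)
    show "L1_null (\<lambda>R \<omega>. I (far_tail R) \<omega> + mom0 * (I (inv_annulus 1 R) \<omega> - Psi_inf M 1 \<Lambda> \<omega>) + mom1 * (I (inv_annulus 2 R) \<omega> - Psi_inf M 2 \<Lambda> \<omega>)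
      + momc * of_real (density_avg R \<omega> - pi * cLam M \<Lambda> \<omega>) + (- mom0) * I (cnj_avg R) \<omega> + I (err R) \<omega>)"
      by (intro L1_null_add L1_null_cmult L1_null_far_tail L1_null_Psi L1_null_density L1_null_cnj_avg L1_null_err) auto
    show "\<forall>\<^sub>F R in at_top. (\<lambda>\<omega>. gen_proc (V_Lam M \<Lambda>) \<phi> \<omega> + I (?F R) \<omega>) \<in> borel_measurable M"
      by (rule eventually_at_top_linorderI[of 1]) (intro borel_measurable_add measurable_gen_proc_V Fm)
    show "\<forall>\<^sub>F R in at_top. AE \<omega> in M. I (far_tail R) \<omega> + mom0 * (I (inv_annulus 1 R) \<omega> - Psi_inf M 1 \<Lambda> \<omega>) + mom1 * (I (inv_annulus 2 R) \<omega> - Psi_inf M 2 \<Lambda> \<omega>)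
      + momc * of_real (density_avg R \<omega> - pi * cLam M \<Lambda> \<omega>) + (- mom0) * I (cnj_avg R) \<omega> + I (err R) \<omega> = gen_proc (V_Lam M \<Lambda>) \<phi> \<omega> + I (?F R) \<omega>"
      by (rule eventually_at_top_linorderI[of 1], drule V_decomposition, erule eventually_mono) (rule sym)
  qed
  have "L1_null (\<lambda>R \<omega>. (gen_proc (V_Lam M \<Lambda>) \<phi> \<omega> + I (?F R) \<omega>) + (- 1) * (I (?F R) \<omega> - X \<omega>))"
    by (intro L1_null_add L1_null_cmult V_null diff_null)
  then have "L1_null (\<lambda>R \<omega>. gen_proc (V_Lam M \<Lambda>) \<phi> \<omega> + X \<omega>)" by simp
  from L1_null_const[OF this] have AE: "AE \<omega> in M. gen_proc (V_Lam M \<Lambda>) \<phi> \<omega> = - X \<omega>"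
    by eventually_elim (simp add: eq_neg_iff_add_eq_0)
  have Xi: "integrable M X" by (rule covar_eq(1)[OF X(1) X(1)])
  have "(\<integral>\<omega>. X \<omega> \<partial>M) = 0"
  proof -
    have "((\<lambda>R. (\<integral>\<omega>. X \<omega> \<partial>M)) \<longlongrightarrow> 0) (at_top :: real filter)"
    proof (rule Lim_null_comparison)
      show "\<forall>\<^sub>F R in at_top. norm (\<integral>\<omega>. X \<omega> \<partial>M) \<le> (\<integral>\<omega>. cmod (I (?F R) \<omega> - X \<omega>) \<partial>M)"
      proof (rule eventually_at_top_linorderI[of 1])
        fix R :: real assume R: "R \<ge> 1"
        have iF: "integrable lborel (?F R)" using nice[OF R] by (simp add: nice_def integrable_bdd_supp)
        have "(\<integral>\<omega>. I (?F R) \<omega> - X \<omega> \<partial>M) = - (\<integral>\<omega>. X \<omega> \<partial>M)"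
          using integrable_I[OF iF] Xi f0[OF R] by (simp add: expectation_I[OF iF] fourier_0)
        then show "norm (\<integral>\<omega>. X \<omega> \<partial>M) \<le> (\<integral>\<omega>. cmod (I (?F R) \<omega> - X \<omega>) \<partial>M)"
          using integral_norm_bound[of M "\<lambda>\<omega>. I (?F R) \<omega> - X \<omega>"] by simp
      qed
      show "((\<lambda>R. \<integral>\<omega>. cmod (I (?F R) \<omega> - X \<omega>) \<partial>M) \<longlongrightarrow> 0) at_top" using diff_null by (simp add: L1_null_def)
    qed
    then show ?thesis by (simp add: tendsto_const_iff)
  qed
  with X(1,3) AE show thesis by (rule that)
qed

end

section \<open>The weighted measure and the covariances of the field\<close>

context integrable_spectral_process
begin

definition weight :: "complex \<Rightarrow> real" where "weight \<xi> = indicator (UNIV - {0}) \<xi> / (cmod \<xi>)\<^sup>2"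

lemma weight_nonneg: "weight \<xi> \<ge> 0"
  by (simp add: weight_def)

lemma measurable_weight [measurable]: "weight \<in> borel_measurable borel"
  unfolding weight_def[abs_def] by measurable

lemma weight_le: "weight \<xi> \<le> indicator {\<xi>. 0 < cmod \<xi> \<and> cmod \<xi> \<le> 1} \<xi> / (cmod \<xi>)\<^sup>2 + 1"
  by (cases "cmod \<xi> \<le> 1") (auto simp: weight_def indicator_def divide_le_eq one_le_power)

text \<open>Up to |xi| = 1 the transforms are bounded and |xi|^-2 is integrable by hypothesis;
  beyond, the weight is at most 1 and the product of transforms is itself integrable.\<close>

lemma integrable_weight_fourier:
  assumes f: "nice f" and g: "nice g"
  shows "integrable \<rho> (\<lambda>\<xi>. weight \<xi> *\<^sub>R (fourier f \<xi> * cnj (fourier g \<xi>)))"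
proof (rule Bochner_Integration.integrable_bound)
  let ?L = "\<lambda>\<xi>::complex. indicator {\<xi>. 0 < cmod \<xi> \<and> cmod \<xi> \<le> 1} \<xi> / (cmod \<xi>)\<^sup>2 :: real"
  let ?K = "(\<integral>x. cmod (f x) \<partial>lborel) * (\<integral>x. cmod (g x) \<partial>lborel)"
  have i: "integrable lborel f" "integrable lborel g" using f g by (auto simp: nice_def integrable_bdd_supp)
  have [measurable]: "fourier f \<in> borel_measurable borel" "fourier g \<in> borel_measurable borel"
    using i by (auto intro: borel_measurable_fourier)
  show "integrable \<rho> (\<lambda>\<xi>. ?K * ?L \<xi> + cmod (fourier f \<xi> * cnj (fourier g \<xi>)))"
    by (intro Bochner_Integration.integrable_add integrable_mult_right integrable_low integrable_norm integrable_fourier_nice f g)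
  show "(\<lambda>\<xi>. weight \<xi> *\<^sub>R (fourier f \<xi> * cnj (fourier g \<xi>))) \<in> borel_measurable \<rho>" by measurable
  show "AE \<xi> in \<rho>. norm (weight \<xi> *\<^sub>R (fourier f \<xi> * cnj (fourier g \<xi>))) \<le> norm (?K * ?L \<xi> + cmod (fourier f \<xi> * cnj (fourier g \<xi>)))"
  proof (rule AE_I2)
    fix \<xi>
    let ?p = "cmod (fourier f \<xi> * cnj (fourier g \<xi>))"
    have p: "?p \<le> ?K" unfolding norm_mult complex_mod_cnj by (intro mult_mono norm_fourier_le) (auto intro: integral_nonneg_AE)
    have "weight \<xi> * ?p \<le> (?L \<xi> + 1) * ?p" by (intro mult_right_mono weight_le) simp
    also have "\<dots> \<le> ?K * ?L \<xi> + ?p" using mult_right_mono[OF p, of "?L \<xi>"] by (simp only: distrib_right mult_1 mult.commute[of "?L \<xi>"]) simp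
    finally show "norm (weight \<xi> *\<^sub>R (fourier f \<xi> * cnj (fourier g \<xi>))) \<le> norm (?K * ?L \<xi> + ?p)"
      by (simp add: weight_nonneg)
  qed
qed

text \<open>The product of the transforms of the two convolutions is the weighted product of the
  transforms of \<phi> and \<psi>, damped by a bounded factor \<open>m R\<close> tending to 1 off
  the origin; at the origin both products vanish.\<close>

lemma covar_conv_kernel_limit:
  assumes P: "process_test M \<Lambda> \<rho> \<phi> A C" and Q: "process_test M \<Lambda> \<rho> \<psi> A' C'"
  shows "((\<lambda>R. covar M (I (conv \<phi> (disc_kernel R))) (I (conv \<psi> (disc_kernel R)))) \<longlongrightarrow>
    (\<integral>\<xi>. weight \<xi> *\<^sub>R (fourier \<phi> \<xi> * cnj (fourier \<psi> \<xi>)) \<partial>\<rho>)) at_top"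
proof -
  interpret P: process_test M \<Lambda> \<rho> \<phi> A C by (rule P)
  interpret Q: process_test M \<Lambda> \<rho> \<psi> A' C' by (rule Q)
  let ?f = "\<lambda>\<xi>. weight \<xi> *\<^sub>R (fourier \<phi> \<xi> * cnj (fourier \<psi> \<xi>))"
  define m where "m R \<xi> = (cmod (1 - disc_q (R * cmod \<xi>) / of_real pi))\<^sup>2" for R and \<xi> :: complex
  have [measurable]: "fourier \<phi> \<in> borel_measurable borel" "fourier \<psi> \<in> borel_measurable borel"
    using P.integrable_phi(1) Q.integrable_phi(1) by (auto intro: borel_measurable_fourier)
  have i: "integrable \<rho> ?f"
    by (intro integrable_weight_fourier nice_continuous P.phi_cont Q.phi_cont P.bdd_supp_phi Q.bdd_supp_phi)
  obtain B where B: "B > 0" "\<And>t. cmod (disc_q t) \<le> B" using disc_q_p_decay by metis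
  have bound: "m R \<xi> \<le> (1 + B)\<^sup>2" for R \<xi>
  proof -
    have "cmod (disc_q (R * cmod \<xi>) / of_real pi) \<le> B / 1"
      unfolding norm_divide using B pi_gt3 by (intro frac_le) (auto intro: less_imp_le)
    then have "cmod (1 - disc_q (R * cmod \<xi>) / of_real pi) \<le> 1 + B"
      using norm_triangle_ineq4[of 1 "disc_q (R * cmod \<xi>) / of_real pi"] by simp
    then show ?thesis unfolding m_def by (intro power_mono) auto
  qed
  have lim: "((\<lambda>R. m R \<xi>) \<longlongrightarrow> 1) at_top" if "\<xi> \<noteq> 0" for \<xi>
  proof -
    have "negligible_error (\<lambda>R \<xi>. 1 * disc_q (R * cmod \<xi>))" by (rule negligible_disc_q[where K=1]) auto
    then have "((\<lambda>R. disc_q (R * cmod \<xi>)) \<longlongrightarrow> 0) at_top" using that by (simp add: negligible_error_def)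
    then have "((\<lambda>R. m R \<xi>) \<longlongrightarrow> (cmod (1 - 0 / of_real pi))\<^sup>2) at_top" unfolding m_def by (intro tendsto_intros) auto
    then show ?thesis by simp
  qed
  have cov: "covar M (I (conv \<phi> (disc_kernel R))) (I (conv \<psi> (disc_kernel R))) = (\<integral>\<xi>. m R \<xi> *\<^sub>R ?f \<xi> \<partial>\<rho>)" if R: "R \<ge> 1" for R
  proof -
    have R0: "R > 0" using R by simp
    have "fourier (conv \<phi> (disc_kernel R)) \<xi> * cnj (fourier (conv \<psi> (disc_kernel R)) \<xi>) = m R \<xi> *\<^sub>R ?f \<xi>" for \<xi>
    proof (cases "\<xi> = 0")
      case True
      then show ?thesis using P.fourier_conv_kernel_0[OF R0] by (simp add: weight_def)
    next
      case False
      \<comment> \<open>The product of \<open>u\<close> and \<open>v\<close> is the transform of the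
        kernel, with |u|^2 = \<open>weight \<xi>\<close> and |v|^2 =
        \<open>m R \<xi>\<close>.\<close>
      define u v where "u = - \<i> * cnj (sgn \<xi>) / of_real (cmod \<xi>)" and "v = 1 - disc_q (R * cmod \<xi>) / of_real pi"
      have pi: "complex_of_real pi \<noteq> 0" by simp
      have eq: "(- \<i> * cnj (sgn \<xi>) / of_real (cmod \<xi>)) * x + (\<i> * cnj (sgn \<xi>) / of_real (pi * cmod \<xi>)) * x * disc_q (R * cmod \<xi>) = (u * v) * x" for x
        using False by (simp add: u_def v_def field_simps)
      have F: "fourier (conv \<phi> (disc_kernel R)) \<xi> = (u * v) * fourier \<phi> \<xi>" "fourier (conv \<psi> (disc_kernel R)) \<xi> = (u * v) * fourier \<psi> \<xi>"
        using P.fourier_conv_kernel[OF R0 False] Q.fourier_conv_kernel[OF R0 False] by (simp_all only: eq)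
      have "(cmod u)\<^sup>2 = weight \<xi>"
        using False by (simp add: u_def weight_def norm_mult norm_divide norm_sgn power_divide)
      then have "(cmod (u * v))\<^sup>2 = m R \<xi> * weight \<xi>" by (simp add: norm_mult power_mult_distrib m_def v_def)
      then have "(u * v) * cnj (u * v) = of_real (m R \<xi> * weight \<xi>)" by (simp only: complex_norm_square[symmetric])
      moreover have "((u * v) * fourier \<phi> \<xi>) * cnj ((u * v) * fourier \<psi> \<xi>) = ((u * v) * cnj (u * v)) * (fourier \<phi> \<xi> * cnj (fourier \<psi> \<xi>))"
        by (simp add: mult_ac)
      ultimately show ?thesis unfolding F by (simp add: scaleR_conv_of_real)
    qed
    then show ?thesis by (simp add: covar_nice[OF P.nice_conv_kernel[OF R0] Q.nice_conv_kernel[OF R0]])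
  qed
  have "((\<lambda>R. \<integral>\<xi>. m R \<xi> *\<^sub>R ?f \<xi> \<partial>\<rho>) \<longlongrightarrow> (\<integral>\<xi>. ?f \<xi> \<partial>\<rho>)) at_top"
  proof (rule dominated_convergence_at_top_real(1)[where c=1 and w="\<lambda>\<xi>. (1 + B)\<^sup>2 * norm (?f \<xi>)"])
    show "?f \<in> borel_measurable \<rho>" using i by auto
    show "(\<lambda>\<xi>. m R \<xi> *\<^sub>R ?f \<xi>) \<in> borel_measurable \<rho>" for R unfolding m_def by measurable
    show "integrable \<rho> (\<lambda>\<xi>. (1 + B)\<^sup>2 * norm (?f \<xi>))" using i by (intro integrable_mult_right integrable_norm)
    show "AE \<xi> in \<rho>. norm (m R \<xi> *\<^sub>R ?f \<xi>) \<le> (1 + B)\<^sup>2 * norm (?f \<xi>)" for R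
      by (intro AE_I2) (simp only: norm_scaleR[of "m R _"], intro mult_right_mono, use bound in \<open>auto simp: m_def\<close>)
    show "AE \<xi> in \<rho>. ((\<lambda>R. m R \<xi> *\<^sub>R ?f \<xi>) \<longlongrightarrow> ?f \<xi>) at_top"
    proof (rule AE_I2)
      fix \<xi>
      show "((\<lambda>R. m R \<xi> *\<^sub>R ?f \<xi>) \<longlongrightarrow> ?f \<xi>) at_top"
      proof (cases "\<xi> = 0")
        case False
        from tendsto_scaleR[OF lim[OF False] tendsto_const[of "?f \<xi>"]] show ?thesis by simp
      qed (simp add: weight_def)
    qed
  qed
  then show ?thesis
    by (rule Lim_transform_eventually) (auto intro!: eventually_at_top_linorderI[of 1] simp: cov)
qed

text \<open>The sign in V = -X cancels in a product of two fields, and all means are 0, so the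
  covariance is a limit of inner products of linear statistics.\<close>

lemma covar_V:
  assumes P: "process_test M \<Lambda> \<rho> \<phi> A C" and Q: "process_test M \<Lambda> \<rho> \<psi> A' C'"
  shows "covar M (gen_proc (V_Lam M \<Lambda>) \<phi>) (gen_proc (V_Lam M \<Lambda>) \<psi>) =
    (\<integral>\<xi>. weight \<xi> *\<^sub>R (fourier \<phi> \<xi> * cnj (fourier \<psi> \<xi>)) \<partial>\<rho>)"
proof -
  interpret P: process_test M \<Lambda> \<rho> \<phi> A C by (rule P)
  interpret Q: process_test M \<Lambda> \<rho> \<psi> A' C' by (rule Q)
  let ?V = "gen_proc (V_Lam M \<Lambda>)" and ?F = "\<lambda>R. I (conv \<phi> (disc_kernel R))" and ?G = "\<lambda>R. I (conv \<psi> (disc_kernel R))"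
  obtain X where X: "sq_integrable M X" "((\<lambda>R. \<integral>\<omega>. (cmod (?F R \<omega> - X \<omega>))\<^sup>2 \<partial>M) \<longlongrightarrow> 0) at_top"
    "AE \<omega> in M. ?V \<phi> \<omega> = - X \<omega>" "(\<integral>\<omega>. X \<omega> \<partial>M) = 0" by (rule P.V_eq_L2_limit)
  obtain Y where Y: "sq_integrable M Y" "((\<lambda>R. \<integral>\<omega>. (cmod (?G R \<omega> - Y \<omega>))\<^sup>2 \<partial>M) \<longlongrightarrow> 0) at_top"
    "AE \<omega> in M. ?V \<psi> \<omega> = - Y \<omega>" "(\<integral>\<omega>. Y \<omega> \<partial>M) = 0" by (rule Q.V_eq_L2_limit)
  have [measurable]: "X \<in> borel_measurable M" "Y \<in> borel_measurable M" using X Y by (auto simp: sq_integrable_def)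
  note [measurable] = P.measurable_gen_proc_V Q.measurable_gen_proc_V
  have sq: "sq_integrable M (?F R)" "sq_integrable M (?G R)" if "R \<ge> 1" for R
    using P.nice_conv_kernel[of R] Q.nice_conv_kernel[of R] that by (auto simp: nice_def intro!: sq_integrable_I)
  have "covar M (?F R) (?G R) = (\<integral>\<omega>. ?F R \<omega> * cnj (?G R \<omega>) \<partial>M)" if R: "R \<ge> 1" for R
    using R P.fourier_conv_kernel_0[of R]
    by (simp add: covar_eq(3)[OF sq[OF R]] expectation_I P.integrable_conv_kernel fourier_0)
  with covar_conv_kernel_limit[OF P Q]
  have "((\<lambda>R. \<integral>\<omega>. ?F R \<omega> * cnj (?G R \<omega>) \<partial>M) \<longlongrightarrow> (\<integral>\<xi>. weight \<xi> *\<^sub>R (fourier \<phi> \<xi> * cnj (fourier \<psi> \<xi>)) \<partial>\<rho>)) at_top"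
    by (auto elim!: Lim_transform_eventually intro!: eventually_at_top_linorderI[of 1])
  moreover have "((\<lambda>R. \<integral>\<omega>. ?F R \<omega> * cnj (?G R \<omega>) \<partial>M) \<longlongrightarrow> (\<integral>\<omega>. X \<omega> * cnj (Y \<omega>) \<partial>M)) at_top"
    by (rule L2_limit_inner[OF sq(1) X(1,2) sq(2) Y(1,2)])
  ultimately have XY: "(\<integral>\<omega>. X \<omega> * cnj (Y \<omega>) \<partial>M) = (\<integral>\<xi>. weight \<xi> *\<^sub>R (fourier \<phi> \<xi> * cnj (fourier \<psi> \<xi>)) \<partial>\<rho>)"
    by (intro tendsto_unique[OF trivial_limit_at_top_linorder])
  have "(\<integral>\<omega>. ?V \<phi> \<omega> \<partial>M) = (\<integral>\<omega>. - X \<omega> \<partial>M)" using X(3) by (intro integral_cong_AE) auto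
  then have m1: "(\<integral>\<omega>. ?V \<phi> \<omega> \<partial>M) = 0" by (simp add: X(4))
  have "(\<integral>\<omega>. ?V \<psi> \<omega> \<partial>M) = (\<integral>\<omega>. - Y \<omega> \<partial>M)" using Y(3) by (intro integral_cong_AE) auto
  then have m2: "(\<integral>\<omega>. ?V \<psi> \<omega> \<partial>M) = 0" by (simp add: Y(4))
  have "covar M (?V \<phi>) (?V \<psi>) = (\<integral>\<omega>. ?V \<phi> \<omega> * cnj (?V \<psi> \<omega>) \<partial>M)" by (simp add: covar_def m1 m2)
  also have "\<dots> = (\<integral>\<omega>. X \<omega> * cnj (Y \<omega>) \<partial>M)"
  proof (rule integral_cong_AE)
    show "AE \<omega> in M. ?V \<phi> \<omega> * cnj (?V \<psi> \<omega>) = X \<omega> * cnj (Y \<omega>)"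
      using X(3) Y(3) by eventually_elim simp
  qed measurable
  finally show ?thesis unfolding XY .
qed

lemma sq_integrable_V:
  assumes P: "process_test M \<Lambda> \<rho> \<phi> A C"
  shows "sq_integrable M (gen_proc (V_Lam M \<Lambda>) \<phi>)"
proof -
  interpret P: process_test M \<Lambda> \<rho> \<phi> A C by (rule P)
  note [measurable] = P.measurable_gen_proc_V
  obtain X where X: "sq_integrable M X" "AE \<omega> in M. gen_proc (V_Lam M \<Lambda>) \<phi> \<omega> = - X \<omega>" using P.V_eq_L2_limit by metis
  have "integrable M (\<lambda>\<omega>. (cmod (gen_proc (V_Lam M \<Lambda>) \<phi> \<omega>))\<^sup>2)"
  proof (rule integrable_cong_AE_imp)
    show "integrable M (\<lambda>\<omega>. (cmod (X \<omega>))\<^sup>2)" using X(1) by (simp add: sq_integrable_def)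
    show "AE \<omega> in M. (cmod (X \<omega>))\<^sup>2 = (cmod (gen_proc (V_Lam M \<Lambda>) \<phi> \<omega>))\<^sup>2" using X(2) by eventually_elim simp
  qed measurable
  then show ?thesis by (simp add: sq_integrable_def P.measurable_gen_proc_V)
qed

lemma process_test_of_test_fun:
  assumes "test_fun \<phi>" obtains A C where "process_test M \<Lambda> \<rho> \<phi> A C"
proof -
  obtain C A where "C > 0" "A > 0" "\<And>x. cmod (\<phi> x) \<le> C" "\<And>x. cmod x > A \<Longrightarrow> \<phi> x = 0"
    using bdd_suppE[OF bdd_supp_test_fun[OF assms]] by metis
  then have "process_test M \<Lambda> \<rho> \<phi> A C"
    using test_fun_continuous[OF assms] by unfold_locales auto
  then show thesis by (rule that)
qed

text \<open>By \<open>weight_le\<close> the mass is at most the low-frequency integral plus the mass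
  of \<open>K\<close> under \<rho>, both finite.\<close>

lemma emeasure_weight_compact:
  assumes K: "compact K" shows "emeasure (density \<rho> (\<lambda>\<xi>. ennreal (weight \<xi>))) K < \<infinity>"
proof -
  have Ks: "K \<in> sets borel" using compact_imp_closed[OF K] by (rule borel_closed)
  let ?L = "\<lambda>\<xi>::complex. indicator {\<xi>. 0 < cmod \<xi> \<and> cmod \<xi> \<le> 1} \<xi> / (cmod \<xi>)\<^sup>2 :: real"
  have fin: "emeasure \<rho> K < \<infinity>" using spectral K by (simp add: spectral_measure_def)
  have i: "integrable \<rho> (\<lambda>\<xi>. ?L \<xi> + indicator K \<xi>)"
    using integrable_low fin Ks by (intro Bochner_Integration.integrable_add integrable_real_indicator) auto
  have "emeasure (density \<rho> (\<lambda>\<xi>. ennreal (weight \<xi>))) K = (\<integral>\<^sup>+\<xi>. ennreal (weight \<xi>) * indicator K \<xi> \<partial>\<rho>)"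
    using Ks by (subst emeasure_density) auto
  also have "\<dots> \<le> (\<integral>\<^sup>+\<xi>. ennreal (?L \<xi> + indicator K \<xi>) \<partial>\<rho>)"
  proof (rule nn_integral_mono)
    fix \<xi> show "ennreal (weight \<xi>) * indicator K \<xi> \<le> ennreal (?L \<xi> + indicator K \<xi>)"
      using weight_le[of \<xi>] by (cases "\<xi> \<in> K") (auto simp del: ennreal_plus intro!: ennreal_leI)
  qed
  also have "\<dots> < \<infinity>" using i by (simp add: integrable_iff_bounded)
  finally show ?thesis .
qed

end

theorem theoremB:
  fixes M :: "'w measure" and \<Lambda> :: "'w \<Rightarrow> complex \<Rightarrow> nat" and \<rho> :: "complex measure"
  assumes "point_process M \<Lambda>"
    and "stationary_pp M \<Lambda>"
    and "finite_second_moment M \<Lambda>"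
    and "spectral_measure M (lin_stat \<Lambda>) \<rho>"
    and "(\<integral>\<^sup>+\<xi>. indicator {\<xi>. 0 < cmod \<xi> \<and> cmod \<xi> \<le> 1} \<xi> * ennreal (1 / (cmod \<xi>)\<^sup>2) \<partial>\<rho>) < \<infinity>"
  shows "spectral_measure M (gen_proc (V_Lam M \<Lambda>))
           (density \<rho> (\<lambda>\<xi>. ennreal (indicator (UNIV - {0}) \<xi> / (cmod \<xi>)\<^sup>2)))"
proof -
  interpret prob_space M using assms(1) by (simp add: point_process_def)
  interpret integrable_spectral_process M \<Lambda> \<rho>
    using assms by unfold_locales (auto simp: point_process_def)
  have "spectral_measure M (gen_proc (V_Lam M \<Lambda>)) (density \<rho> (\<lambda>\<xi>. ennreal (weight \<xi>)))"
    unfolding spectral_measure_def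
  proof (intro conjI allI impI)
    fix \<phi> \<psi> assume "test_fun \<phi>" "test_fun \<psi>"
    then obtain A C A' C' where P: "process_test M \<Lambda> \<rho> \<phi> A C" and Q: "process_test M \<Lambda> \<rho> \<psi> A' C'"
      by (metis process_test_of_test_fun)
    interpret P: process_test M \<Lambda> \<rho> \<phi> A C by (rule P)
    interpret Q: process_test M \<Lambda> \<rho> \<psi> A' C' by (rule Q)
    have [measurable]: "fourier \<phi> \<in> borel_measurable borel" "fourier \<psi> \<in> borel_measurable borel"
      using P.integrable_phi(1) Q.integrable_phi(1) by (auto intro: borel_measurable_fourier)
    show "sq_integrable M (gen_proc (V_Lam M \<Lambda>) \<phi>)" "sq_integrable M (gen_proc (V_Lam M \<Lambda>) \<psi>)"
      by (rule sq_integrable_V[OF P], rule sq_integrable_V[OF Q])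
    have i: "integrable \<rho> (\<lambda>\<xi>. weight \<xi> *\<^sub>R (fourier \<phi> \<xi> * cnj (fourier \<psi> \<xi>)))"
      by (intro integrable_weight_fourier nice_continuous P.phi_cont Q.phi_cont P.bdd_supp_phi Q.bdd_supp_phi)
    then show "integrable (density \<rho> (\<lambda>\<xi>. ennreal (weight \<xi>))) (\<lambda>\<xi>. fourier \<phi> \<xi> * cnj (fourier \<psi> \<xi>))"
      by (subst integrable_density) (auto simp: weight_nonneg)
    show "covar M (gen_proc (V_Lam M \<Lambda>) \<phi>) (gen_proc (V_Lam M \<Lambda>) \<psi>) =
      (\<integral>\<xi>. fourier \<phi> \<xi> * cnj (fourier \<psi> \<xi>) \<partial>density \<rho> (\<lambda>\<xi>. ennreal (weight \<xi>)))"
      unfolding covar_V[OF P Q] by (subst integral_density) (auto simp: weight_nonneg)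
  qed (simp_all only: sets_density sets_rho emeasure_weight_compact)
  then show ?thesis by (simp add: weight_def)
qed

end
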